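(* Let $A$ be a regular weak multiplier bialgebra over a field $k$ with left and right full comultiplication, possessing an antipode $S$, and let $L:=\sqcap^L(A)=\overline\sqcap^L(A)$. Then the functor $(-)\otimes_LA:M_L\to M^{(A)}_{(A)}$ from the category of firm right $L$-modules to the category of right-right $A$-Hopf modules, and the coinvariants functor $(-)^c:M^{(A)}_{(A)}\to M_L$, are mutually inverse equivalences.
   Context: Conventions. All vector spaces are over a field $k$; $\otimes$ is $\otimes_k$; the identity map of a space $V$ is also denoted by $V$; composition is juxtaposition; $\mathsf{Lin}(V,W)$ is the space of linear maps; $\mathsf{tw}$ is the flip; $\langle\ldots\rangle$ denotes linear span. For a linear map $f:V\otimes W\to V'\otimes W'$ put $f^{13}=(V'\otimes\mathsf{tw})(f\otimes Z)(V\otimes\mathsf{tw}):V\otimes Z\otimes W\to V'\otimes Z\otimes W'$ for any space $Z$. An associative, possibly non-unital algebra $A$ with multiplication $\mu$ is idempotent if $\mu:A\otimes A\to A$ is surjective, and non-degenerate if each of ($ab=0\ \forall b\in A$) and ($ba=0\ \forall b\in A$) implies $a=0$. For such $A$, $\mathbb M(A)$ is the multiplier algebra of pairs $(\lambda,\varrho)$ of linear maps $A\to A$ with $a\lambda(b)=\varrho(a)b$; it is unital and contains $A$ as a two-sided ideal via $(\lambda,\varrho)a=\lambda(a)$, $a(\lambda,\varrho)=\varrho(a)$. A regular weak multiplier bialgebra is an idempotent non-degenerate $k$-algebra $A$ with linear maps $E_1,E_2,T_1,T_2,T_3,T_4:A\otimes A\to A\otimes A$ and $\epsilon:A\to k$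 such that for all $a,b,c,d\in A$: (i) $(a\otimes b)E_1(c\otimes d)=E_2(a\otimes b)(c\otimes d)$; (ii) $E_1^2=E_1$; (iii) $(T_2\otimes A)(A\otimes T_1)=(A\otimes T_1)(T_2\otimes A)$; (iv) $(\epsilon\otimes A)T_1=\mu=(A\otimes\epsilon)T_2$; (v) $(\mu\otimes A)T_1^{13}(A\otimes T_1)=T_1(\mu\otimes A)$; (vi) $\langle T_1(a\otimes c)(b\otimes 1)\mid a,b,c\in A\rangle=\langle E_1(b\otimes c)\mid b,c\in A\rangle$ and $\langle(1\otimes c)T_2(b\otimes a)\mid a,b,c\in A\rangle=\langle E_2(b\otimes c)\mid b,c\in A\rangle$; (vii) $(E_1\otimes A)(A\otimes T_1)=(A\otimes T_1)(E_1\otimes A)$ and $(E_2\otimes A)(A\otimes T_2)=(A\otimes T_2)E_2^{13}$; (viii) $(\epsilon\otimes A)((1\otimes a)E_1(b\otimes c))=(\epsilon\otimes A)(T_1(a\otimes c)(b\otimes1))$ and $(\epsilon\otimes A)(E_2(a\otimes b)(1\otimes c))=(\epsilon\otimes A)((1\otimes b)T_2(a\otimes c))$; (ix) $(1\otimes a)T_1(c\otimes b)=T_3(c\otimes a)(1\otimes b)$ and $T_2(a\otimes c)(b\otimes1)=(a\otimes1)T_4(b\otimes c)$. Maps $A\to\mathbb M(A)$: $\overline\sqcap^L(a)b=(\epsilon\otimes A)T_2(a\otimes b)$, $b\overline\sqcap^L(a)=(\epsilon\otimes A)E_2(a\otimes b)$; $\sqcap^L(a)b=(\epsilon\otimes A)E_1(a\otimes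 b)$, $b\sqcap^L(a)=(\epsilon\otimes A)T_4(a\otimes b)$; $\overline\sqcap^R(a)b=(A\otimes\epsilon)E_1(b\otimes a)$, $b\overline\sqcap^R(a)=(A\otimes\epsilon)T_1(b\otimes a)$. The comultiplication is right full if $A=\langle(A\otimes\omega)T_1(a\otimes b)\mid a,b\in A,\ \omega\in\mathsf{Lin}(A,k)\rangle$ and left full if $A=\langle(\omega\otimes A)T_2(a\otimes b)\mid a,b\in A,\ \omega\in\mathsf{Lin}(A,k)\rangle$. If it is left full, the ranges of $\sqcap^L$ and $\overline\sqcap^L$ coincide; the common range $L\subseteq\mathbb M(A)$ is a (non-unital) subalgebra with local units. A right $L$-module $P$ is firm if the action induces an isomorphism $P\otimes_LL\to P$ (equivalently, since $L$ has local units, the action is surjective). Antipode. Let $G_1,G_2:A\otimes A\to A\otimes A$ be the (well-defined, idempotent) linear maps $G_1(a\otimes bc)=(a\otimes1)((\overline\sqcap^R\otimes A)\mathsf{tw}T_4(c\otimes b))$ and $G_2(ab\otimes c)=((A\otimes\overline\sqcap^L)\mathsf{tw}T_3(b\otimes a))(1\otimes c)$. $A$ possesses an antipode if there are linear maps $R_1,R_2:A\otimes A\to A\otimes A$ with $R_iT_i=G_i$, $T_iR_i=E_i$, $R_iT_iR_i=R_i$ for $i=1,2$; these are unique, and the antipode is the linear map $S:A\to\mathbb M(A)$ with $S(a)b=(\epsilon\otimes A)R_1(a\otimes b)$ and $bS(a)=(A\otimes\epsilon)R_2(b\otimes a)$. For left and right full comultiplication, $A$ is spanned by the elements $S(b)a$.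 A right $A$-comodule is a vector space $V$ with linear maps $\lambda,\varrho:V\otimes A\to V\otimes A$ such that $(1\otimes a)\lambda(v\otimes b)=\varrho(v\otimes a)(1\otimes b)$ for all $v\in V$, $a,b\in A$, $(\lambda\otimes A)\lambda^{13}(V\otimes E_1)=(\lambda\otimes A)\lambda^{13}$ and $(\lambda\otimes A)\lambda^{13}(V\otimes T_1)=(V\otimes T_1)(\lambda\otimes A)$. A morphism $f:V\to V'$ is a linear map with $\lambda'(f\otimes A)=(f\otimes A)\lambda$. The comodule is full if $V=\langle(V\otimes\omega)\lambda(v\otimes a)\mid v\in V,a\in A,\omega\in\mathsf{Lin}(A,k)\rangle$ (equivalently, the same with $\varrho$). A right-right $A$-Hopf module is a vector space $V$ which is a non-degenerate right $A$-module ($v\cdot a=0\ \forall a\in A$ implies $v=0$) with surjective action $\cdot:V\otimes A\to V$, and a full right $A$-comodule $(V,\lambda,\varrho)$, such that $\lambda(\cdot\otimes A)=(\cdot\otimes A)\lambda^{13}(V\otimes T_1)$ (equivalently $\varrho(\cdot\otimes A)=(\cdot\otimes A)(V\otimes T_3)\varrho^{13}$). Morphisms of Hopf modules are linear maps that are both module and comodule morphisms; $M^{(A)}_{(A)}$ is the resulting category and $\mathsf{Hom}^{(A)}_{(A)}(V,V')$ its hom spaces. $A$ is a Hopf module via $\mu$ and $(T_1,T_3)$. The functor $(-)\otimes_LA$: $A$ is a left $L$-module via multiplication in $\mathbb M(A)$; for a firm right $L$-module $P$, $P\otimes_LA$ is a Hopf module with action $P\otimes_L\mu$ and comodule structure $(P\otimes_LT_1,P\otimes_LT_3)$;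 a module map $f$ is sent to $f\otimes_LA$. The functor $(-)^c$: for a Hopf module $V$, let $\varpi_V:V\to\mathsf{Hom}^{(A)}_{(A)}(A,V)$ be the (well-defined) linear map with $\varpi_V(v)(S(b)a)=\sum_iv_i\cdot(S(b_i)a)$, where $\varrho(v\otimes b)=\sum_iv_i\otimes b_i$. Put $V^c:=\varpi_V(V)$, which is a firm right $L$-module via $(fl)(a)=f(la)$; a Hopf module morphism $f:V\to V'$ is sent to $f^c:\varpi_V(v)\mapsto f\varpi_V(v)=\varpi_{V'}(f(v))$. *)

theory Defs
  imports "HOL-Algebra.Module" "HOL-Algebra.AbelCoset"
begin

section \<open>Linear algebra over a field\<close>

text \<open>
  A vector space over the field \<open>K\<close> is a record \<open>V\<close> with \<open>module K V\<close>; its ring fields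
  \<open>mult\<close> and \<open>one\<close> carry no meaning unless \<open>V\<close> is an algebra (and \<open>one\<close> never does, since algebras
  need not be unital).  Linear maps are extensional functions on the carrier.
\<close>

definition lin :: "'k ring \<Rightarrow> ('k, 'v, 'x) module_scheme \<Rightarrow> ('k, 'w, 'y) module_scheme \<Rightarrow> ('v \<Rightarrow> 'w) set" where
  "lin K V W = {f \<in> carrier V \<rightarrow>\<^sub>E carrier W.
     (\<forall>x\<in>carrier V. \<forall>y\<in>carrier V. f (x \<oplus>\<^bsub>V\<^esub> y) = f x \<oplus>\<^bsub>W\<^esub> f y) \<and>
     (\<forall>c\<in>carrier K. \<forall>x\<in>carrier V. f (c \<odot>\<^bsub>V\<^esub> x) = c \<odot>\<^bsub>W\<^esub> f x)}"

definition bilinear_map :: "'k ring \<Rightarrow> ('k, 'u, 'x) module_scheme \<Rightarrow> ('k, 'v, 'y) module_scheme \<Rightarrow>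
    ('k, 'w, 'z) module_scheme \<Rightarrow> ('u \<Rightarrow> 'v \<Rightarrow> 'w) \<Rightarrow> bool" where
  "bilinear_map K U V W b \<longleftrightarrow>
     (\<forall>u\<in>carrier U. \<forall>v\<in>carrier V. b u v \<in> carrier W) \<and>
     (\<forall>u\<in>carrier U. \<forall>u'\<in>carrier U. \<forall>v\<in>carrier V. b (u \<oplus>\<^bsub>U\<^esub> u') v = b u v \<oplus>\<^bsub>W\<^esub> b u' v) \<and>
     (\<forall>u\<in>carrier U. \<forall>v\<in>carrier V. \<forall>v'\<in>carrier V. b u (v \<oplus>\<^bsub>V\<^esub> v') = b u v \<oplus>\<^bsub>W\<^esub> b u v') \<and>
     (\<forall>c\<in>carrier K. \<forall>u\<in>carrier U. \<forall>v\<in>carrier V.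
        b (c \<odot>\<^bsub>U\<^esub> u) v = c \<odot>\<^bsub>W\<^esub> b u v \<and> b u (c \<odot>\<^bsub>V\<^esub> v) = c \<odot>\<^bsub>W\<^esub> b u v)"

definition lspan :: "'k ring \<Rightarrow> ('k, 'v, 'x) module_scheme \<Rightarrow> 'v set \<Rightarrow> 'v set" where
  "lspan K V S = \<Inter> {U. submodule U K V \<and> S \<subseteq> U}"

definition scalar_space :: "'k ring \<Rightarrow> ('k, 'k) module" where
  "scalar_space K = \<lparr>carrier = carrier K, mult = mult K, one = one K, zero = zero K, add = add K, smult = mult K\<rparr>"

definition quot_space :: "('k, 'v, 'x) module_scheme \<Rightarrow> 'v set \<Rightarrow> ('k, 'v set) module" where
  "quot_space V U = \<lparr>carrier = a_rcosets\<^bsub>V\<^esub> U, mult = undefined, one = undefined,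
     zero = U, add = set_add V, smult = (\<lambda>c X. \<Union>x\<in>X. U +>\<^bsub>V\<^esub> (c \<odot>\<^bsub>V\<^esub> x))\<rparr>"

definition free_space :: "'k ring \<Rightarrow> 's set \<Rightarrow> ('k, 's \<Rightarrow> 'k) module" where
  "free_space K S = \<lparr>carrier = {f \<in> S \<rightarrow>\<^sub>E carrier K. finite {s \<in> S. f s \<noteq> \<zero>\<^bsub>K\<^esub>}},
     mult = undefined, one = undefined, zero = (\<lambda>s\<in>S. \<zero>\<^bsub>K\<^esub>),
     add = (\<lambda>f g. \<lambda>s\<in>S. f s \<oplus>\<^bsub>K\<^esub> g s), smult = (\<lambda>c f. \<lambda>s\<in>S. c \<otimes>\<^bsub>K\<^esub> f s)\<rparr>"

definition free_gen :: "'k ring \<Rightarrow> 's set \<Rightarrow> 's \<Rightarrow> 's \<Rightarrow> 'k" where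
  "free_gen K S t = (\<lambda>s\<in>S. if s = t then \<one>\<^bsub>K\<^esub> else \<zero>\<^bsub>K\<^esub>)"


subsection \<open>Tensor products over the field\<close>

type_synonym ('k, 'v, 'w) tensor = "('v \<times> 'w \<Rightarrow> 'k) set"

definition tensor_rels :: "'k ring \<Rightarrow> ('k, 'v, 'x) module_scheme \<Rightarrow> ('k, 'w, 'y) module_scheme \<Rightarrow>
    ('v \<times> 'w \<Rightarrow> 'k) set" where
  "tensor_rels K V W =
    (let S = carrier V \<times> carrier W; F = free_space K S; d = (\<lambda>v w. free_gen K S (v, w)) in
      {d (v \<oplus>\<^bsub>V\<^esub> v') w \<ominus>\<^bsub>F\<^esub> (d v w \<oplus>\<^bsub>F\<^esub> d v' w) | v v' w. v \<in> carrier V \<and> v' \<in> carrier V \<and> w \<in> carrier W} \<union>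
      {d v (w \<oplus>\<^bsub>W\<^esub> w') \<ominus>\<^bsub>F\<^esub> (d v w \<oplus>\<^bsub>F\<^esub> d v w') | v w w'. v \<in> carrier V \<and> w \<in> carrier W \<and> w' \<in> carrier W} \<union>
      {d (c \<odot>\<^bsub>V\<^esub> v) w \<ominus>\<^bsub>F\<^esub> c \<odot>\<^bsub>F\<^esub> d v w | c v w. c \<in> carrier K \<and> v \<in> carrier V \<and> w \<in> carrier W} \<union>
      {d v (c \<odot>\<^bsub>W\<^esub> w) \<ominus>\<^bsub>F\<^esub> c \<odot>\<^bsub>F\<^esub> d v w | c v w. c \<in> carrier K \<and> v \<in> carrier V \<and> w \<in> carrier W})"

definition tensor_ker :: "'k ring \<Rightarrow> ('k, 'v, 'x) module_scheme \<Rightarrow> ('k, 'w, 'y) module_scheme \<Rightarrow>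
    ('v \<times> 'w \<Rightarrow> 'k) set" where
  "tensor_ker K V W = lspan K (free_space K (carrier V \<times> carrier W)) (tensor_rels K V W)"

definition tensor_space :: "'k ring \<Rightarrow> ('k, 'v, 'x) module_scheme \<Rightarrow> ('k, 'w, 'y) module_scheme \<Rightarrow>
    ('k, ('k, 'v, 'w) tensor) module" where
  "tensor_space K V W = quot_space (free_space K (carrier V \<times> carrier W)) (tensor_ker K V W)"

definition pure_tensor :: "'k ring \<Rightarrow> ('k, 'v, 'x) module_scheme \<Rightarrow> ('k, 'w, 'y) module_scheme \<Rightarrow>
    'v \<Rightarrow> 'w \<Rightarrow> ('k, 'v, 'w) tensor" where
  "pure_tensor K V W v w = tensor_ker K V W
     +>\<^bsub>free_space K (carrier V \<times> carrier W)\<^esub> free_gen K (carrier V \<times> carrier W) (v, w)"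

text \<open>The linear map \<open>V \<otimes> W \<rightarrow> Z\<close> induced by a bilinear map \<open>b\<close>.\<close>

definition tensor_lift :: "'k ring \<Rightarrow> ('k, 'v, 'x) module_scheme \<Rightarrow> ('k, 'w, 'y) module_scheme \<Rightarrow>
    ('k, 'z, 'u) module_scheme \<Rightarrow> ('v \<Rightarrow> 'w \<Rightarrow> 'z) \<Rightarrow> ('k, 'v, 'w) tensor \<Rightarrow> 'z" where
  "tensor_lift K V W Z b = (THE f. f \<in> lin K (tensor_space K V W) Z \<and>
     (\<forall>v\<in>carrier V. \<forall>w\<in>carrier W. f (pure_tensor K V W v w) = b v w))"

text \<open>\<open>f \<otimes> g : V \<otimes> W \<rightarrow> V' \<otimes> W'\<close> for linear \<open>f : V \<rightarrow> V'\<close> and \<open>g : W \<rightarrow> W'\<close>.\<close>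

definition tensor_map :: "'k ring \<Rightarrow> ('k, 'v, 'x) module_scheme \<Rightarrow> ('k, 'w, 'y) module_scheme \<Rightarrow>
    ('k, 'v1, 'x1) module_scheme \<Rightarrow> ('k, 'w1, 'y1) module_scheme \<Rightarrow>
    ('v \<Rightarrow> 'v1) \<Rightarrow> ('w \<Rightarrow> 'w1) \<Rightarrow> ('k, 'v, 'w) tensor \<Rightarrow> ('k, 'v1, 'w1) tensor" where
  "tensor_map K V W V' W' f g =
     tensor_lift K V W (tensor_space K V' W') (\<lambda>v w. pure_tensor K V' W' (f v) (g w))"

definition tensor_flip :: "'k ring \<Rightarrow> ('k, 'v, 'x) module_scheme \<Rightarrow> ('k, 'w, 'y) module_scheme \<Rightarrow>
    ('k, 'v, 'w) tensor \<Rightarrow> ('k, 'w, 'v) tensor" where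
  "tensor_flip K V W = tensor_lift K V W (tensor_space K W V) (\<lambda>v w. pure_tensor K W V w v)"

text \<open>
  Threefold tensor products are always bracketed to the left, \<open>(U \<otimes> V) \<otimes> W\<close>; maps acting on the last two
  legs are conjugated with the associativity isomorphism.
\<close>

definition tensor_assoc :: "'k ring \<Rightarrow> ('k, 'u, 'x) module_scheme \<Rightarrow> ('k, 'v, 'y) module_scheme \<Rightarrow>
    ('k, 'w, 'z) module_scheme \<Rightarrow> ('k, ('k, 'u, 'v) tensor, 'w) tensor \<Rightarrow> ('k, 'u, ('k, 'v, 'w) tensor) tensor" where
  "tensor_assoc K U V W = (THE f.
     f \<in> lin K (tensor_space K (tensor_space K U V) W) (tensor_space K U (tensor_space K V W)) \<and>
     (\<forall>u\<in>carrier U. \<forall>v\<in>carrier V. \<forall>w\<in>carrier W.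
        f (pure_tensor K (tensor_space K U V) W (pure_tensor K U V u v) w) =
        pure_tensor K U (tensor_space K V W) u (pure_tensor K V W v w)))"

definition tensor_assoc_inv :: "'k ring \<Rightarrow> ('k, 'u, 'x) module_scheme \<Rightarrow> ('k, 'v, 'y) module_scheme \<Rightarrow>
    ('k, 'w, 'z) module_scheme \<Rightarrow> ('k, 'u, ('k, 'v, 'w) tensor) tensor \<Rightarrow> ('k, ('k, 'u, 'v) tensor, 'w) tensor" where
  "tensor_assoc_inv K U V W = (THE f.
     f \<in> lin K (tensor_space K U (tensor_space K V W)) (tensor_space K (tensor_space K U V) W) \<and>
     (\<forall>u\<in>carrier U. \<forall>v\<in>carrier V. \<forall>w\<in>carrier W.
        f (pure_tensor K U (tensor_space K V W) u (pure_tensor K V W v w)) =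
        pure_tensor K (tensor_space K U V) W (pure_tensor K U V u v) w))"

text \<open>\<open>f \<otimes> Z : V \<otimes> W \<otimes> Z \<rightarrow> V' \<otimes> W' \<otimes> Z\<close> for \<open>f : V \<otimes> W \<rightarrow> V' \<otimes> W'\<close>.\<close>

definition legs12 :: "'k ring \<Rightarrow> ('k, 'v, 'x) module_scheme \<Rightarrow> ('k, 'w, 'y) module_scheme \<Rightarrow>
    ('k, 'v1, 'x1) module_scheme \<Rightarrow> ('k, 'w1, 'y1) module_scheme \<Rightarrow> ('k, 'z, 'u) module_scheme \<Rightarrow>
    (('k, 'v, 'w) tensor \<Rightarrow> ('k, 'v1, 'w1) tensor) \<Rightarrow>
    ('k, ('k, 'v, 'w) tensor, 'z) tensor \<Rightarrow> ('k, ('k, 'v1, 'w1) tensor, 'z) tensor" where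
  "legs12 K V W V' W' Z f = tensor_map K (tensor_space K V W) Z (tensor_space K V' W') Z f (\<lambda>z. z)"

text \<open>\<open>Z \<otimes> f : Z \<otimes> V \<otimes> W \<rightarrow> Z \<otimes> V' \<otimes> W'\<close> for \<open>f : V \<otimes> W \<rightarrow> V' \<otimes> W'\<close>.\<close>

definition legs23 :: "'k ring \<Rightarrow> ('k, 'v, 'x) module_scheme \<Rightarrow> ('k, 'w, 'y) module_scheme \<Rightarrow>
    ('k, 'v1, 'x1) module_scheme \<Rightarrow> ('k, 'w1, 'y1) module_scheme \<Rightarrow> ('k, 'z, 'u) module_scheme \<Rightarrow>
    (('k, 'v, 'w) tensor \<Rightarrow> ('k, 'v1, 'w1) tensor) \<Rightarrow>
    ('k, ('k, 'z, 'v) tensor, 'w) tensor \<Rightarrow> ('k, ('k, 'z, 'v1) tensor, 'w1) tensor" where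
  "legs23 K V W V' W' Z f x = tensor_assoc_inv K Z V' W'
     (tensor_map K Z (tensor_space K V W) Z (tensor_space K V' W') (\<lambda>z. z) f (tensor_assoc K Z V W x))"

text \<open>
  \<open>f\<^sup>1\<^sup>3 = (V' \<otimes> tw) (f \<otimes> Z) (V \<otimes> tw) : V \<otimes> Z \<otimes> W \<rightarrow> V' \<otimes> Z \<otimes> W'\<close> for \<open>f : V \<otimes> W \<rightarrow> V' \<otimes> W'\<close>.
\<close>

definition legs13 :: "'k ring \<Rightarrow> ('k, 'v, 'x) module_scheme \<Rightarrow> ('k, 'w, 'y) module_scheme \<Rightarrow>
    ('k, 'v1, 'x1) module_scheme \<Rightarrow> ('k, 'w1, 'y1) module_scheme \<Rightarrow> ('k, 'z, 'u) module_scheme \<Rightarrow>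
    (('k, 'v, 'w) tensor \<Rightarrow> ('k, 'v1, 'w1) tensor) \<Rightarrow>
    ('k, ('k, 'v, 'z) tensor, 'w) tensor \<Rightarrow> ('k, ('k, 'v1, 'z) tensor, 'w1) tensor" where
  "legs13 K V W V' W' Z f x =
     legs23 K W' Z Z W' V' (tensor_flip K W' Z)
       (legs12 K V W V' W' Z f
         (legs23 K Z W W Z V (tensor_flip K Z W) x))"


section \<open>Firm modules and tensor products over a non-unital algebra\<close>

text \<open>A right module over an algebra; \<open>ract P p l\<close> is \<open>p \<cdot> l\<close>.\<close>

record ('k, 'p, 'l) rmodule = "('k, 'p) module" +
  ract :: "'p \<Rightarrow> 'l \<Rightarrow> 'p"

definition right_module :: "'k ring \<Rightarrow> ('k, 'l, 'x) module_scheme \<Rightarrow> ('k, 'p, 'l, 'y) rmodule_scheme \<Rightarrow> bool" where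
  "right_module K L P \<longleftrightarrow> module K P \<and> bilinear_map K P L P (ract P) \<and>
     (\<forall>p\<in>carrier P. \<forall>l\<in>carrier L. \<forall>m\<in>carrier L. ract P (ract P p l) m = ract P p (l \<otimes>\<^bsub>L\<^esub> m))"

text \<open>
  \<open>P \<otimes>\<^sub>L N\<close> is the quotient of \<open>P \<otimes> N\<close> by the span of all \<open>p l \<otimes> n - p \<otimes> l n\<close>; the argument \<open>lact\<close> is the
  left action of \<open>L\<close> on \<open>N\<close>.
\<close>

definition bal_ker :: "'k ring \<Rightarrow> ('k, 'l, 'x) module_scheme \<Rightarrow> ('k, 'p, 'l, 'y) rmodule_scheme \<Rightarrow>
    ('k, 'n, 'z) module_scheme \<Rightarrow> ('l \<Rightarrow> 'n \<Rightarrow> 'n) \<Rightarrow> ('k, 'p, 'n) tensor set" where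
  "bal_ker K L P N lact = lspan K (tensor_space K P N)
     {pure_tensor K P N (ract P p l) n \<ominus>\<^bsub>tensor_space K P N\<^esub> pure_tensor K P N p (lact l n) | p l n.
        p \<in> carrier P \<and> l \<in> carrier L \<and> n \<in> carrier N}"

definition bal_space :: "'k ring \<Rightarrow> ('k, 'l, 'x) module_scheme \<Rightarrow> ('k, 'p, 'l, 'y) rmodule_scheme \<Rightarrow>
    ('k, 'n, 'z) module_scheme \<Rightarrow> ('l \<Rightarrow> 'n \<Rightarrow> 'n) \<Rightarrow> ('k, ('k, 'p, 'n) tensor set) module" where
  "bal_space K L P N lact = quot_space (tensor_space K P N) (bal_ker K L P N lact)"

definition bal_tensor :: "'k ring \<Rightarrow> ('k, 'l, 'x) module_scheme \<Rightarrow> ('k, 'p, 'l, 'y) rmodule_scheme \<Rightarrow>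
    ('k, 'n, 'z) module_scheme \<Rightarrow> ('l \<Rightarrow> 'n \<Rightarrow> 'n) \<Rightarrow> 'p \<Rightarrow> 'n \<Rightarrow> ('k, 'p, 'n) tensor set" where
  "bal_tensor K L P N lact p n =
     bal_ker K L P N lact +>\<^bsub>tensor_space K P N\<^esub> pure_tensor K P N p n"

definition bal_lift :: "'k ring \<Rightarrow> ('k, 'l, 'x) module_scheme \<Rightarrow> ('k, 'p, 'l, 'y) rmodule_scheme \<Rightarrow>
    ('k, 'n, 'z) module_scheme \<Rightarrow> ('l \<Rightarrow> 'n \<Rightarrow> 'n) \<Rightarrow> ('k, 'q, 'u) module_scheme \<Rightarrow>
    ('p \<Rightarrow> 'n \<Rightarrow> 'q) \<Rightarrow> ('k, 'p, 'n) tensor set \<Rightarrow> 'q" where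
  "bal_lift K L P N lact Z b = (THE f. f \<in> lin K (bal_space K L P N lact) Z \<and>
     (\<forall>p\<in>carrier P. \<forall>n\<in>carrier N. f (bal_tensor K L P N lact p n) = b p n))"

definition firm_module :: "'k ring \<Rightarrow> ('k, 'l, 'x) module_scheme \<Rightarrow> ('k, 'p, 'l, 'y) rmodule_scheme \<Rightarrow> bool" where
  "firm_module K L P \<longleftrightarrow> right_module K L P \<and>
     bij_betw (bal_lift K L P L (mult L) P (ract P)) (carrier (bal_space K L P L (mult L))) (carrier P)"

definition rmodule_hom :: "'k ring \<Rightarrow> ('k, 'l, 'x) module_scheme \<Rightarrow> ('k, 'p, 'l, 'y) rmodule_scheme \<Rightarrow>
    ('k, 'q, 'l, 'z) rmodule_scheme \<Rightarrow> ('p \<Rightarrow> 'q) set" where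
  "rmodule_hom K L P Q = {f \<in> lin K P Q.
     \<forall>p\<in>carrier P. \<forall>l\<in>carrier L. f (ract P p l) = ract Q (f p) l}"


section \<open>Weak multiplier bialgebras\<close>

record ('k, 'a) wmb = "('k, 'a) module" +
  E1 :: "('k, 'a, 'a) tensor \<Rightarrow> ('k, 'a, 'a) tensor"
  E2 :: "('k, 'a, 'a) tensor \<Rightarrow> ('k, 'a, 'a) tensor"
  T1 :: "('k, 'a, 'a) tensor \<Rightarrow> ('k, 'a, 'a) tensor"
  T2 :: "('k, 'a, 'a) tensor \<Rightarrow> ('k, 'a, 'a) tensor"
  T3 :: "('k, 'a, 'a) tensor \<Rightarrow> ('k, 'a, 'a) tensor"
  T4 :: "('k, 'a, 'a) tensor \<Rightarrow> ('k, 'a, 'a) tensor"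
  counit :: "'a \<Rightarrow> 'k"

text \<open>
  A right-right Hopf module: \<open>ract\<close> is the \<open>A\<close>-action, and \<open>lam\<close>, \<open>rho\<close> are the two structure maps of the
  comodule.
\<close>

record ('k, 'v, 'a) hopf_module = "('k, 'v, 'a) rmodule" +
  lam :: "('k, 'v, 'a) tensor \<Rightarrow> ('k, 'v, 'a) tensor"
  rho :: "('k, 'v, 'a) tensor \<Rightarrow> ('k, 'v, 'a) tensor"

text \<open>A multiplier \<open>m = (l, r)\<close> acts by \<open>m a = fst m a\<close> and \<open>a m = snd m a\<close>.\<close>

type_synonym 'b multiplier = "('b \<Rightarrow> 'b) \<times> ('b \<Rightarrow> 'b)"

locale wmb_data =
  fixes K :: "'k ring" and A :: "('k, 'a) wmb"
begin

abbreviation times_A :: "'a \<Rightarrow> 'a \<Rightarrow> 'a" (infixl "\<cdot>" 70) where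
  "a \<cdot> b \<equiv> a \<otimes>\<^bsub>A\<^esub> b"

abbreviation tensor_A :: "'a \<Rightarrow> 'a \<Rightarrow> ('k, 'a, 'a) tensor" (infix "\<diamondop>" 65) where
  "a \<diamondop> b \<equiv> pure_tensor K A A a b"

abbreviation AA where "AA \<equiv> tensor_space K A A"
abbreviation AAA where "AAA \<equiv> tensor_space K AA A"

text \<open>\<open>f \<otimes> g\<close> on \<open>A \<otimes> A\<close>, and \<open>f \<otimes> A\<close>, \<open>A \<otimes> f\<close>, \<open>f\<^sup>1\<^sup>3\<close> on \<open>A \<otimes> A \<otimes> A\<close>.\<close>

abbreviation "map_A \<equiv> tensor_map K A A A A"
abbreviation "A12 \<equiv> legs12 K A A A A A"
abbreviation "A23 \<equiv> legs23 K A A A A A"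
abbreviation "A13 \<equiv> legs13 K A A A A A"

definition mu :: "('k, 'a, 'a) tensor \<Rightarrow> 'a" where
  "mu = tensor_lift K A A A (mult A)"

abbreviation mu_A :: "('k, ('k, 'a, 'a) tensor, 'a) tensor \<Rightarrow> ('k, 'a, 'a) tensor" where
  "mu_A \<equiv> tensor_map K AA A A A mu (\<lambda>a. a)"

text \<open>\<open>\<omega> \<otimes> A : A \<otimes> A \<rightarrow> A\<close> and \<open>V \<otimes> \<omega> : V \<otimes> A \<rightarrow> V\<close> for a functional \<open>\<omega>\<close> on \<open>A\<close>.\<close>

definition slice1 :: "('a \<Rightarrow> 'k) \<Rightarrow> ('k, 'a, 'a) tensor \<Rightarrow> 'a" where
  "slice1 w = tensor_lift K A A A (\<lambda>a b. w a \<odot>\<^bsub>A\<^esub> b)"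

definition slice2 :: "('k, 'v, 'x) module_scheme \<Rightarrow> ('a \<Rightarrow> 'k) \<Rightarrow> ('k, 'v, 'a) tensor \<Rightarrow> 'v" where
  "slice2 V w = tensor_lift K V A V (\<lambda>v a. w a \<odot>\<^bsub>V\<^esub> v)"

abbreviation "eps_A \<equiv> slice1 (counit A)"
abbreviation "A_eps \<equiv> slice2 A (counit A)"

abbreviation "functionals \<equiv> lin K A (scalar_space K)"

subsection \<open>The axioms\<close>

definition idempotent_nondegenerate_algebra :: bool where
  "idempotent_nondegenerate_algebra \<longleftrightarrow> field K \<and> module K A \<and> bilinear_map K A A A (mult A) \<and>
     (\<forall>a\<in>carrier A. \<forall>b\<in>carrier A. \<forall>c\<in>carrier A. (a \<cdot> b) \<cdot> c = a \<cdot> (b \<cdot> c)) \<and>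
     mu ` carrier AA = carrier A \<and>
     (\<forall>a\<in>carrier A. (\<forall>b\<in>carrier A. a \<cdot> b = \<zero>\<^bsub>A\<^esub>) \<longrightarrow> a = \<zero>\<^bsub>A\<^esub>) \<and>
     (\<forall>a\<in>carrier A. (\<forall>b\<in>carrier A. b \<cdot> a = \<zero>\<^bsub>A\<^esub>) \<longrightarrow> a = \<zero>\<^bsub>A\<^esub>)"

text \<open>
  A product of \<open>t \<in> A \<otimes> A\<close> with a simple tensor of multipliers is the tensor product of the
  corresponding left (or right) multiplications applied to \<open>t\<close>; for instance
  \<open>(1 \<otimes> a) t = map_A (\<lambda>x. x) (\<lambda>x. a \<cdot> x) t\<close>.
\<close>

definition regular_wmb :: bool where
  "regular_wmb \<longleftrightarrow> idempotent_nondegenerate_algebra \<and>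
     E1 A \<in> lin K AA AA \<and> E2 A \<in> lin K AA AA \<and>
     T1 A \<in> lin K AA AA \<and> T2 A \<in> lin K AA AA \<and> T3 A \<in> lin K AA AA \<and> T4 A \<in> lin K AA AA \<and>
     counit A \<in> functionals \<and>
     (\<forall>a\<in>carrier A. \<forall>b\<in>carrier A. \<forall>c\<in>carrier A. \<forall>d\<in>carrier A.
        map_A (\<lambda>x. a \<cdot> x) (\<lambda>x. b \<cdot> x) (E1 A (c \<diamondop> d)) = map_A (\<lambda>x. x \<cdot> c) (\<lambda>x. x \<cdot> d) (E2 A (a \<diamondop> b))) \<and>
     (\<forall>t\<in>carrier AA. E1 A (E1 A t) = E1 A t) \<and>
     (\<forall>t\<in>carrier AAA. A12 (T2 A) (A23 (T1 A) t) = A23 (T1 A) (A12 (T2 A) t)) \<and>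
     (\<forall>t\<in>carrier AA. eps_A (T1 A t) = mu t \<and> A_eps (T2 A t) = mu t) \<and>
     (\<forall>t\<in>carrier AAA. mu_A (A13 (T1 A) (A23 (T1 A) t)) = T1 A (mu_A t)) \<and>
     lspan K AA {map_A (\<lambda>x. x \<cdot> b) (\<lambda>x. x) (T1 A (a \<diamondop> c)) | a b c. a \<in> carrier A \<and> b \<in> carrier A \<and> c \<in> carrier A} =
       lspan K AA {E1 A (b \<diamondop> c) | b c. b \<in> carrier A \<and> c \<in> carrier A} \<and>
     lspan K AA {map_A (\<lambda>x. x) (\<lambda>x. c \<cdot> x) (T2 A (b \<diamondop> a)) | a b c. a \<in> carrier A \<and> b \<in> carrier A \<and> c \<in> carrier A} =
       lspan K AA {E2 A (b \<diamondop> c) | b c. b \<in> carrier A \<and> c \<in> carrier A} \<and>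
     (\<forall>t\<in>carrier AAA. A12 (E1 A) (A23 (T1 A) t) = A23 (T1 A) (A12 (E1 A) t)) \<and>
     (\<forall>t\<in>carrier AAA. A12 (E2 A) (A23 (T2 A) t) = A23 (T2 A) (A13 (E2 A) t)) \<and>
     (\<forall>a\<in>carrier A. \<forall>b\<in>carrier A. \<forall>c\<in>carrier A.
        eps_A (map_A (\<lambda>x. x) (\<lambda>x. a \<cdot> x) (E1 A (b \<diamondop> c))) = eps_A (map_A (\<lambda>x. x \<cdot> b) (\<lambda>x. x) (T1 A (a \<diamondop> c))) \<and>
        eps_A (map_A (\<lambda>x. x) (\<lambda>x. x \<cdot> c) (E2 A (a \<diamondop> b))) = eps_A (map_A (\<lambda>x. x) (\<lambda>x. b \<cdot> x) (T2 A (a \<diamondop> c)))) \<and>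
     (\<forall>a\<in>carrier A. \<forall>b\<in>carrier A. \<forall>c\<in>carrier A.
        map_A (\<lambda>x. x) (\<lambda>x. a \<cdot> x) (T1 A (c \<diamondop> b)) = map_A (\<lambda>x. x) (\<lambda>x. x \<cdot> b) (T3 A (c \<diamondop> a)) \<and>
        map_A (\<lambda>x. x \<cdot> b) (\<lambda>x. x) (T2 A (a \<diamondop> c)) = map_A (\<lambda>x. a \<cdot> x) (\<lambda>x. x) (T4 A (b \<diamondop> c)))"

definition right_full :: bool where
  "right_full \<longleftrightarrow> carrier A = lspan K A
     {slice2 A w (T1 A (a \<diamondop> b)) | w a b. w \<in> functionals \<and> a \<in> carrier A \<and> b \<in> carrier A}"

definition left_full :: bool where
  "left_full \<longleftrightarrow> carrier A = lspan K A
     {slice1 w (T2 A (a \<diamondop> b)) | w a b. w \<in> functionals \<and> a \<in> carrier A \<and> b \<in> carrier A}"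

subsection \<open>Multipliers and the base algebra\<close>

definition multiplier_algebra :: "('k, 'a multiplier) module" where
  "multiplier_algebra = \<lparr>
     carrier = {(l, r). l \<in> lin K A A \<and> r \<in> lin K A A \<and>
       (\<forall>a\<in>carrier A. \<forall>b\<in>carrier A. a \<cdot> l b = r a \<cdot> b)},
     mult = (\<lambda>(l, r) (l', r'). (compose (carrier A) l l', compose (carrier A) r' r)),
     one = (\<lambda>a\<in>carrier A. a, \<lambda>a\<in>carrier A. a),
     zero = (\<lambda>a\<in>carrier A. \<zero>\<^bsub>A\<^esub>, \<lambda>a\<in>carrier A. \<zero>\<^bsub>A\<^esub>),
     add = (\<lambda>(l, r) (l', r'). (\<lambda>a\<in>carrier A. l a \<oplus>\<^bsub>A\<^esub> l' a, \<lambda>a\<in>carrier A. r a \<oplus>\<^bsub>A\<^esub> r' a)),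
     smult = (\<lambda>c (l, r). (\<lambda>a\<in>carrier A. c \<odot>\<^bsub>A\<^esub> l a, \<lambda>a\<in>carrier A. c \<odot>\<^bsub>A\<^esub> r a))\<rparr>"

definition sqL :: "'a \<Rightarrow> 'a multiplier" where
  "sqL a = (\<lambda>b\<in>carrier A. eps_A (E1 A (a \<diamondop> b)), \<lambda>b\<in>carrier A. eps_A (T4 A (a \<diamondop> b)))"

definition sqL_bar :: "'a \<Rightarrow> 'a multiplier" where
  "sqL_bar a = (\<lambda>b\<in>carrier A. eps_A (T2 A (a \<diamondop> b)), \<lambda>b\<in>carrier A. eps_A (E2 A (a \<diamondop> b)))"

definition sqR_bar :: "'a \<Rightarrow> 'a multiplier" where
  "sqR_bar a = (\<lambda>b\<in>carrier A. A_eps (E1 A (b \<diamondop> a)), \<lambda>b\<in>carrier A. A_eps (T1 A (b \<diamondop> a)))"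

text \<open>
  \<open>sqL\<close>, \<open>sqL_bar\<close> and \<open>sqR_bar\<close> are \<open>\<sqinter>\<^sup>L\<close>, \<open>\<sqinter>\<^sup>L\<close> with a bar and \<open>\<sqinter>\<^sup>R\<close> with a bar.  For a left full comultiplication \<open>sqL\<close> and \<open>sqL_bar\<close> have the same range,
  which is the base algebra \<open>L\<close>.
\<close>

definition base_L :: "('k, 'a multiplier) module" where
  "base_L = multiplier_algebra\<lparr>carrier := sqL ` carrier A\<rparr>"

subsection \<open>The antipode\<close>

text \<open>
  Since \<open>A\<close> is idempotent, \<open>A \<otimes> A\<close> is spanned by the elements \<open>a \<otimes> b c\<close>, and also by the elements
  \<open>a b \<otimes> c\<close>; hence there is at most one map satisfying \<open>is_G1\<close> resp. \<open>is_G2\<close>.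
\<close>

definition is_G1 :: "(('k, 'a, 'a) tensor \<Rightarrow> ('k, 'a, 'a) tensor) \<Rightarrow> bool" where
  "is_G1 G \<longleftrightarrow> G \<in> lin K AA AA \<and>
     (\<forall>a\<in>carrier A. \<forall>b\<in>carrier A. \<forall>c\<in>carrier A.
        G (a \<diamondop> (b \<cdot> c)) = map_A (\<lambda>x. snd (sqR_bar x) a) (\<lambda>y. y) (tensor_flip K A A (T4 A (c \<diamondop> b))))"

definition is_G2 :: "(('k, 'a, 'a) tensor \<Rightarrow> ('k, 'a, 'a) tensor) \<Rightarrow> bool" where
  "is_G2 G \<longleftrightarrow> G \<in> lin K AA AA \<and>
     (\<forall>a\<in>carrier A. \<forall>b\<in>carrier A. \<forall>c\<in>carrier A.
        G ((a \<cdot> b) \<diamondop> c) = map_A (\<lambda>x. x) (\<lambda>y. fst (sqL_bar y) c) (tensor_flip K A A (T3 A (b \<diamondop> a))))"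

text \<open>\<open>R1\<close>, \<open>R2\<close> witness that \<open>A\<close> possesses an antipode; they are then unique.\<close>

definition antipode_witness ::
    "(('k, 'a, 'a) tensor \<Rightarrow> ('k, 'a, 'a) tensor) \<Rightarrow> (('k, 'a, 'a) tensor \<Rightarrow> ('k, 'a, 'a) tensor) \<Rightarrow> bool" where
  "antipode_witness R1 R2 \<longleftrightarrow> R1 \<in> lin K AA AA \<and> R2 \<in> lin K AA AA \<and>
     (\<exists>G1 G2. is_G1 G1 \<and> is_G2 G2 \<and>
       (\<forall>t\<in>carrier AA. R1 (T1 A t) = G1 t \<and> R2 (T2 A t) = G2 t)) \<and>
     (\<forall>t\<in>carrier AA. T1 A (R1 t) = E1 A t \<and> T2 A (R2 t) = E2 A t) \<and>
     (\<forall>t\<in>carrier AA. R1 (T1 A (R1 t)) = R1 t \<and> R2 (T2 A (R2 t)) = R2 t)"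

definition antipode ::
    "(('k, 'a, 'a) tensor \<Rightarrow> ('k, 'a, 'a) tensor) \<Rightarrow> (('k, 'a, 'a) tensor \<Rightarrow> ('k, 'a, 'a) tensor) \<Rightarrow>
     'a \<Rightarrow> 'a multiplier" where
  "antipode R1 R2 a = (\<lambda>b\<in>carrier A. eps_A (R1 (a \<diamondop> b)), \<lambda>b\<in>carrier A. A_eps (R2 (b \<diamondop> a)))"

subsection \<open>Comodules and Hopf modules\<close>

definition right_comodule :: "('k, 'v, 'a, 'x) hopf_module_scheme \<Rightarrow> bool" where
  "right_comodule V \<longleftrightarrow> module K V \<and>
     lam V \<in> lin K (tensor_space K V A) (tensor_space K V A) \<and>
     rho V \<in> lin K (tensor_space K V A) (tensor_space K V A) \<and>
     (\<forall>v\<in>carrier V. \<forall>a\<in>carrier A. \<forall>b\<in>carrier A.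
        tensor_map K V A V A (\<lambda>x. x) (\<lambda>x. a \<cdot> x) (lam V (pure_tensor K V A v b)) =
        tensor_map K V A V A (\<lambda>x. x) (\<lambda>x. x \<cdot> b) (rho V (pure_tensor K V A v a))) \<and>
     (\<forall>t\<in>carrier (tensor_space K (tensor_space K V A) A).
        legs12 K V A V A A (lam V) (legs13 K V A V A A (lam V) (legs23 K A A A A V (E1 A) t)) =
        legs12 K V A V A A (lam V) (legs13 K V A V A A (lam V) t)) \<and>
     (\<forall>t\<in>carrier (tensor_space K (tensor_space K V A) A).
        legs12 K V A V A A (lam V) (legs13 K V A V A A (lam V) (legs23 K A A A A V (T1 A) t)) =
        legs23 K A A A A V (T1 A) (legs12 K V A V A A (lam V) t))"

definition full_comodule :: "('k, 'v, 'a, 'x) hopf_module_scheme \<Rightarrow> bool" where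
  "full_comodule V \<longleftrightarrow> carrier V = lspan K V
     {slice2 V w (lam V (pure_tensor K V A v a)) | w v a. w \<in> functionals \<and> v \<in> carrier V \<and> a \<in> carrier A}"

definition comodule_hom :: "('k, 'v, 'a, 'x) hopf_module_scheme \<Rightarrow> ('k, 'w, 'a, 'y) hopf_module_scheme \<Rightarrow>
    ('v \<Rightarrow> 'w) set" where
  "comodule_hom V W = {f \<in> lin K V W. \<forall>t\<in>carrier (tensor_space K V A).
     lam W (tensor_map K V A W A f (\<lambda>a. a) t) = tensor_map K V A W A f (\<lambda>a. a) (lam V t)}"

definition action :: "('k, 'v, 'a, 'x) rmodule_scheme \<Rightarrow> ('k, 'v, 'a) tensor \<Rightarrow> 'v" where
  "action V = tensor_lift K V A V (ract V)"

definition hopf_module :: "('k, 'v, 'a, 'x) hopf_module_scheme \<Rightarrow> bool" where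
  "hopf_module V \<longleftrightarrow> right_module K A V \<and>
     (\<forall>v\<in>carrier V. (\<forall>a\<in>carrier A. ract V v a = \<zero>\<^bsub>V\<^esub>) \<longrightarrow> v = \<zero>\<^bsub>V\<^esub>) \<and>
     action V ` carrier (tensor_space K V A) = carrier V \<and>
     right_comodule V \<and> full_comodule V \<and>
     (\<forall>t\<in>carrier (tensor_space K (tensor_space K V A) A).
        lam V (tensor_map K (tensor_space K V A) A V A (action V) (\<lambda>a. a) t) =
        tensor_map K (tensor_space K V A) A V A (action V) (\<lambda>a. a)
          (legs13 K V A V A A (lam V) (legs23 K A A A A V (T1 A) t)))"

definition hopf_hom :: "('k, 'v, 'a, 'x) hopf_module_scheme \<Rightarrow> ('k, 'w, 'a, 'y) hopf_module_scheme \<Rightarrow>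
    ('v \<Rightarrow> 'w) set" where
  "hopf_hom V W = rmodule_hom K A V W \<inter> comodule_hom V W"

definition regular_hopf_module :: "('k, 'a, 'a) hopf_module" where
  "regular_hopf_module = \<lparr>carrier = carrier A, mult = mult A, one = one A, zero = zero A, add = add A,
     smult = smult A, ract = mult A, lam = T1 A, rho = T3 A\<rparr>"

end


section \<open>Categories and functors\<close>

record ('o, 'm) category =
  Obj :: "'o set"
  Hom :: "'o \<Rightarrow> 'o \<Rightarrow> 'm set"
  Ident :: "'o \<Rightarrow> 'm"
  Comp :: "'o \<Rightarrow> 'o \<Rightarrow> 'o \<Rightarrow> 'm \<Rightarrow> 'm \<Rightarrow> 'm" \<comment> \<open>\<open>Comp C X Y Z g f\<close> is \<open>g f\<close> for \<open>f : X \<rightarrow> Y\<close>, \<open>g : Y \<rightarrow> Z\<close>\<close>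

definition is_category :: "('o, 'm) category \<Rightarrow> bool" where
  "is_category C \<longleftrightarrow>
     (\<forall>X\<in>Obj C. Ident C X \<in> Hom C X X) \<and>
     (\<forall>X\<in>Obj C. \<forall>Y\<in>Obj C. \<forall>Z\<in>Obj C. \<forall>f\<in>Hom C X Y. \<forall>g\<in>Hom C Y Z. Comp C X Y Z g f \<in> Hom C X Z) \<and>
     (\<forall>X\<in>Obj C. \<forall>Y\<in>Obj C. \<forall>f\<in>Hom C X Y.
        Comp C X X Y f (Ident C X) = f \<and> Comp C X Y Y (Ident C Y) f = f) \<and>
     (\<forall>W\<in>Obj C. \<forall>X\<in>Obj C. \<forall>Y\<in>Obj C. \<forall>Z\<in>Obj C. \<forall>f\<in>Hom C W X. \<forall>g\<in>Hom C X Y. \<forall>h\<in>Hom C Y Z.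
        Comp C W Y Z h (Comp C W X Y g f) = Comp C W X Z (Comp C X Y Z h g) f)"

text \<open>The morphism part takes source and target explicitly, as hom sets need not be disjoint.\<close>

definition is_functor :: "('o, 'm) category \<Rightarrow> ('p, 'n) category \<Rightarrow>
    ('o \<Rightarrow> 'p) \<Rightarrow> ('o \<Rightarrow> 'o \<Rightarrow> 'm \<Rightarrow> 'n) \<Rightarrow> bool" where
  "is_functor C D F0 F1 \<longleftrightarrow> is_category C \<and> is_category D \<and>
     (\<forall>X\<in>Obj C. F0 X \<in> Obj D) \<and>
     (\<forall>X\<in>Obj C. \<forall>Y\<in>Obj C. \<forall>f\<in>Hom C X Y. F1 X Y f \<in> Hom D (F0 X) (F0 Y)) \<and>
     (\<forall>X\<in>Obj C. F1 X X (Ident C X) = Ident D (F0 X)) \<and>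
     (\<forall>X\<in>Obj C. \<forall>Y\<in>Obj C. \<forall>Z\<in>Obj C. \<forall>f\<in>Hom C X Y. \<forall>g\<in>Hom C Y Z.
        F1 X Z (Comp C X Y Z g f) = Comp D (F0 X) (F0 Y) (F0 Z) (F1 Y Z g) (F1 X Y f))"

context wmb_data
begin

text \<open>
  The category of firm right \<open>L\<close>-modules with elements in the type \<open>'p\<close>, and the category of Hopf modules
  with elements in the type \<open>'v\<close>.  All types are allowed, so a type plays the role of a universe.
\<close>

definition cat_firm :: "(('k, 'p, 'a multiplier) rmodule, 'p \<Rightarrow> 'p) category" where
  "cat_firm = \<lparr>Obj = {P. firm_module K base_L P}, Hom = rmodule_hom K base_L,
     Ident = (\<lambda>P. \<lambda>p\<in>carrier P. p), Comp = (\<lambda>P Q R g f. compose (carrier P) g f)\<rparr>"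

definition cat_hopf :: "(('k, 'v, 'a) hopf_module, 'v \<Rightarrow> 'v) category" where
  "cat_hopf = \<lparr>Obj = {V. hopf_module V}, Hom = hopf_hom,
     Ident = (\<lambda>V. \<lambda>v\<in>carrier V. v), Comp = (\<lambda>U V W g f. compose (carrier U) g f)\<rparr>"

text \<open>Isomorphisms; source and target may live in different universes.\<close>

definition firm_iso :: "('k, 'p, 'a multiplier) rmodule \<Rightarrow> ('k, 'q, 'a multiplier) rmodule \<Rightarrow> ('p \<Rightarrow> 'q) set" where
  "firm_iso P Q = {f \<in> rmodule_hom K base_L P Q. \<exists>g\<in>rmodule_hom K base_L Q P.
     (\<forall>p\<in>carrier P. g (f p) = p) \<and> (\<forall>q\<in>carrier Q. f (g q) = q)}"

definition hopf_iso :: "('k, 'v, 'a) hopf_module \<Rightarrow> ('k, 'w, 'a) hopf_module \<Rightarrow> ('v \<Rightarrow> 'w) set" where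
  "hopf_iso V W = {f \<in> hopf_hom V W. \<exists>g\<in>hopf_hom W V.
     (\<forall>v\<in>carrier V. g (f v) = v) \<and> (\<forall>w\<in>carrier W. f (g w) = w)}"

subsection \<open>The functor \<open>(-) \<otimes>\<^sub>L A\<close>\<close>

text \<open>\<open>L\<close> acts on \<open>A\<close> from the left by multiplication in the multiplier algebra: \<open>l a = fst l a\<close>.\<close>

abbreviation tensor_L_space :: "('k, 'p, 'a multiplier, 'x) rmodule_scheme \<Rightarrow> ('k, ('k, 'p, 'a) tensor set) module" where
  "tensor_L_space P \<equiv> bal_space K base_L P A fst"

abbreviation tensor_L :: "('k, 'p, 'a multiplier, 'x) rmodule_scheme \<Rightarrow> 'p \<Rightarrow> 'a \<Rightarrow> ('k, 'p, 'a) tensor set" where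
  "tensor_L P \<equiv> bal_tensor K base_L P A fst"

text \<open>
  \<open>P \<otimes>\<^sub>L T\<close> on \<open>(P \<otimes>\<^sub>L A) \<otimes> A = P \<otimes>\<^sub>L (A \<otimes> A)\<close> for \<open>T : A \<otimes> A \<rightarrow> A \<otimes> A\<close>: it sends \<open>(p \<otimes>\<^sub>L a) \<otimes> b\<close> to
  \<open>p \<otimes>\<^sub>L T (a \<otimes> b)\<close>.
\<close>

definition tensor_L_map2 :: "('k, 'p, 'a multiplier, 'x) rmodule_scheme \<Rightarrow>
    (('k, 'a, 'a) tensor \<Rightarrow> ('k, 'a, 'a) tensor) \<Rightarrow>
    ('k, ('k, 'p, 'a) tensor set, 'a) tensor \<Rightarrow> ('k, ('k, 'p, 'a) tensor set, 'a) tensor" where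
  "tensor_L_map2 P T = (THE f.
     f \<in> lin K (tensor_space K (tensor_L_space P) A) (tensor_space K (tensor_L_space P) A) \<and>
     (\<forall>p\<in>carrier P. \<forall>a\<in>carrier A. \<forall>b\<in>carrier A.
        f (pure_tensor K (tensor_L_space P) A (tensor_L P p a) b) =
        tensor_map K A A (tensor_L_space P) A (tensor_L P p) (\<lambda>x. x) (T (a \<diamondop> b))))"

definition tensor_L_obj :: "('k, 'p, 'a multiplier) rmodule \<Rightarrow> ('k, ('k, 'p, 'a) tensor set, 'a) hopf_module" where
  "tensor_L_obj P = (let Q = tensor_L_space P in
     \<lparr>carrier = carrier Q, mult = mult Q, one = one Q, zero = zero Q, add = add Q, smult = smult Q,
      ract = (\<lambda>x b. bal_lift K base_L P A fst Q (\<lambda>p a. tensor_L P p (a \<cdot> b)) x),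
      lam = tensor_L_map2 P (T1 A), rho = tensor_L_map2 P (T3 A)\<rparr>)"

definition tensor_L_mor :: "('k, 'p, 'a multiplier) rmodule \<Rightarrow> ('k, 'q, 'a multiplier) rmodule \<Rightarrow> ('p \<Rightarrow> 'q) \<Rightarrow>
    ('k, 'p, 'a) tensor set \<Rightarrow> ('k, 'q, 'a) tensor set" where
  "tensor_L_mor P Q f = bal_lift K base_L P A fst (tensor_L_space Q) (\<lambda>p a. tensor_L Q (f p) a)"

end

subsection \<open>The coinvariants functor\<close>

locale wmb_antipode_data = wmb_data K A
  for K :: "'k ring" and A :: "('k, 'a) wmb" +
  fixes R1 :: "('k, 'a, 'a) tensor \<Rightarrow> ('k, 'a, 'a) tensor"
    and R2 :: "('k, 'a, 'a) tensor \<Rightarrow> ('k, 'a, 'a) tensor"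
begin

text \<open>
  \<open>varpi V v\<close> is the morphism with \<open>S(b) a \<mapsto> \<Sum>\<^sub>i v\<^sub>i \<cdot> (S(b\<^sub>i) a)\<close>, where \<open>\<rho>(v \<otimes> b) = \<Sum>\<^sub>i v\<^sub>i \<otimes> b\<^sub>i\<close>; it is
  unique as \<open>A\<close> is spanned by the elements \<open>S(b) a\<close>.
\<close>

definition varpi :: "('k, 'v, 'a) hopf_module \<Rightarrow> 'v \<Rightarrow> 'a \<Rightarrow> 'v" where
  "varpi V v = (THE f. f \<in> hopf_hom regular_hopf_module V \<and>
     (\<forall>a\<in>carrier A. \<forall>b\<in>carrier A.
        f (fst (antipode R1 R2 b) a) =
        tensor_lift K V A V (\<lambda>v' b'. ract V v' (fst (antipode R1 R2 b') a)) (rho V (pure_tensor K V A v b))))"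

definition coinv_obj :: "('k, 'v, 'a) hopf_module \<Rightarrow> ('k, 'a \<Rightarrow> 'v, 'a multiplier) rmodule" where
  "coinv_obj V = \<lparr>carrier = varpi V ` carrier V, mult = undefined, one = undefined,
     zero = (\<lambda>a\<in>carrier A. \<zero>\<^bsub>V\<^esub>),
     add = (\<lambda>f g. \<lambda>a\<in>carrier A. f a \<oplus>\<^bsub>V\<^esub> g a),
     smult = (\<lambda>c f. \<lambda>a\<in>carrier A. c \<odot>\<^bsub>V\<^esub> f a),
     ract = (\<lambda>f l. \<lambda>a\<in>carrier A. f (fst l a))\<rparr>"

definition coinv_mor :: "('k, 'v, 'a) hopf_module \<Rightarrow> ('k, 'w, 'a) hopf_module \<Rightarrow> ('v \<Rightarrow> 'w) \<Rightarrow>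
    ('a \<Rightarrow> 'v) \<Rightarrow> 'a \<Rightarrow> 'w" where
  "coinv_mor V W f = (\<lambda>g\<in>carrier (coinv_obj V). compose (carrier A) f g)"

text \<open>
  The two functors are mutually inverse equivalences: both composites are naturally isomorphic to the identity
  functors.  As \<open>P \<otimes>\<^sub>L A\<close> and \<open>V\<^sup>c\<close> have elements in types built from those of \<open>P\<close> and \<open>V\<close>, a natural
  isomorphism between the identity and a composite has components \<open>firm_iso\<close> resp. \<open>hopf_iso\<close> across universes.
\<close>

definition unit_iso :: "(('k, 'p, 'a multiplier) rmodule \<Rightarrow> 'p \<Rightarrow> 'a \<Rightarrow> ('k, 'p, 'a) tensor set) \<Rightarrow> bool" where
  "unit_iso \<eta> \<longleftrightarrow>
     (\<forall>P\<in>Obj cat_firm. \<eta> P \<in> firm_iso P (coinv_obj (tensor_L_obj P))) \<and>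
     (\<forall>P\<in>Obj cat_firm. \<forall>Q\<in>Obj cat_firm. \<forall>f\<in>Hom cat_firm P Q. \<forall>p\<in>carrier P.
        coinv_mor (tensor_L_obj P) (tensor_L_obj Q) (tensor_L_mor P Q f) (\<eta> P p) = \<eta> Q (f p))"

definition counit_iso :: "(('k, 'v, 'a) hopf_module \<Rightarrow> ('k, 'a \<Rightarrow> 'v, 'a) tensor set \<Rightarrow> 'v) \<Rightarrow> bool" where
  "counit_iso \<epsilon> \<longleftrightarrow>
     (\<forall>V\<in>Obj cat_hopf. \<epsilon> V \<in> hopf_iso (tensor_L_obj (coinv_obj V)) V) \<and>
     (\<forall>V\<in>Obj cat_hopf. \<forall>W\<in>Obj cat_hopf. \<forall>f\<in>Hom cat_hopf V W. \<forall>x\<in>carrier (tensor_L_obj (coinv_obj V)).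
        f (\<epsilon> V x) = \<epsilon> W (tensor_L_mor (coinv_obj V) (coinv_obj W) (coinv_mor V W f) x))"

end

end

theory Submission
  imports Defs
begin

text \<open>
  The unit of the equivalence sends \<open>p\<close> to the map \<open>a \<mapsto> p \<otimes>\<^sub>L a\<close>, and its counit is evaluation
  \<open>f \<otimes>\<^sub>L a \<mapsto> f a\<close> on \<open>V\<^sup>c \<otimes>\<^sub>L A\<close>.  Naturality is immediate; the content is that these maps are well
  defined and bijective, and this rests on two constructions.  Sweedler notation \<open>\<Delta>(x) = x\<^sub>1 \<otimes> x\<^sub>2\<close> and
  \<open>\<lambda> (v \<otimes> a) = v\<^sub>0 \<otimes> v\<^sub>1 a\<close> is used in the comments only: as \<open>A\<close> has no unit, only products with \<open>\<Delta>\<close> make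
  sense, and all identities are stated for \<open>T1\<close>, \<open>T2\<close>, \<open>T3\<close>, \<open>T4\<close>, \<open>\<lambda>\<close>.  Such an identity is tested by applying
  functionals to one leg, or by multiplying a leg with arbitrary elements of \<open>A\<close>; both separate the points
  of a tensor product (\<open>sep_map1\<close>, \<open>sep_map2\<close>, \<open>cancelL1\<close>).

  The first construction is a formula for \<open>\<varpi>\<close>.  The map \<open>R1\<close> is \<open>x \<otimes> a \<mapsto> x\<^sub>1 \<otimes> S(x\<^sub>2) a\<close>.  It makes the antipode
  anti-multiplicative (\<open>S_mult\<close>), it shows that \<open>S(d) y = 0\<close> for all \<open>d\<close> only if \<open>y = 0\<close> (\<open>S_sep\<close>), and, together with
  right fullness, that the elements \<open>S(b) a\<close> span \<open>A\<close> (\<open>S_span\<close>).  Therefore \<open>V \<otimes> A\<close> contains exactly one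
  element \<open>R\<^sub>V (v \<otimes> x)\<close>, which stands for \<open>v\<^sub>0 \<otimes> S(v\<^sub>1) x\<close>, such that multiplying its second leg with any \<open>S(d)\<close> gives
  \<open>v\<^sub>0 \<otimes> S(v\<^sub>1 d) x\<close>.  Acting with the second leg on the first yields \<open>f\<^sub>v(x) = v\<^sub>0 S(v\<^sub>1) x\<close>, and \<open>f\<^sub>v\<close> is
  \<open>\<varpi>(v)\<close> (\<open>varpi_eq\<close>).  Three properties of these maps are decisive: \<open>f\<^sub>v\<close> is a morphism of comodules (\<open>lam_fv\<close>);
  the \<open>f\<close> with index \<open>v\<^sub>0\<close>, applied to \<open>v\<^sub>1 a\<close>, gives \<open>v a\<close> (\<open>fv_lam\<close>), so that the values of the \<open>f\<^sub>v\<close> span \<open>V\<close>; and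
  \<open>\<varpi>(g(a)) = g \<sqinter>\<^sup>L(a)\<close> for each morphism \<open>g\<close> of Hopf modules from \<open>A\<close> to \<open>V\<close> (\<open>fv_hom\<close>).

  The second construction is a separability structure on \<open>L\<close>: the idempotent \<open>E\<close> yields an \<open>L\<close>-bilinear map
  \<open>\<delta>\<close> from \<open>L\<close> to \<open>L \<otimes> L\<close> with \<open>\<delta> (\<sqinter>\<^sup>L(x) \<sqinter>\<^sup>L(y)) = (\<sqinter>\<^sup>L \<otimes> \<sqinter>\<^sup>L) E (x \<otimes> y)\<close>, and multiplication is a left inverse of it
  (\<open>del\<close>, \<open>del_left\<close>, \<open>del_right\<close>, \<open>mult_del\<close>).  If \<open>P\<close> is firm, then \<open>p l \<mapsto> p \<delta>(l)\<close> is therefore a well-defined section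
  of \<open>P \<otimes> L \<rightarrow> P\<close>, and it induces a section of \<open>P \<otimes> A \<rightarrow> P \<otimes>\<^sub>L A\<close> (\<open>proj_sec\<close>).  Hence \<open>P \<otimes>\<^sub>L A\<close> inherits
  non-degeneracy from \<open>P \<otimes> A\<close> (\<open>Q_nondeg\<close>), and \<open>p \<mapsto> (a \<mapsto> p \<otimes>\<^sub>L a)\<close> is injective (\<open>bt_sep\<close>).

  The theorem follows.  By \<open>fv_hom\<close> the unit sends \<open>p \<sqinter>\<^sup>L(c)\<close> to \<open>\<varpi>(p \<otimes>\<^sub>L c)\<close>, so it maps onto the coinvariants of
  \<open>P \<otimes>\<^sub>L A\<close>; it is injective by \<open>bt_sep\<close>.  In \<open>V\<^sup>c\<close> one has \<open>f \<sqinter>\<^sup>L(c) = \<varpi>(f(c))\<close>, so \<open>V\<^sup>c\<close> is an \<open>L\<close>-module, and the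
  action is surjective because values of the \<open>f\<^sub>v\<close> span \<open>V\<close>.  It is firm because \<open>\<Sum> f\<^sub>i l\<^sub>i = 0\<close> already implies
  \<open>\<Sum> f\<^sub>i \<delta>(l\<^sub>i) = 0\<close> (\<open>cdel_zero\<close>), an element that represents \<open>\<Sum> f\<^sub>i \<otimes>\<^sub>L l\<^sub>i\<close>.  The counit is surjective by \<open>fv_lam\<close>.  It is
  injective because \<open>v \<otimes> b \<mapsto> \<varpi>(v\<^sub>0) \<otimes>\<^sub>L v\<^sub>1 b\<close> recovers \<open>x b\<close> from the image of \<open>x\<close>, and \<open>V\<^sup>c \<otimes>\<^sub>L A\<close> is
  non-degenerate.
\<close>

section \<open>Linear maps and bilinear maps\<close>

abbreviation elem_of (infix ".:" 50) where "x .: V \<equiv> x \<in> carrier V"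

text \<open>
  Linearity without the extensionality that \<open>lin\<close> demands: maps are given by lambda terms, whose values off the
  carrier are irrelevant.  The lemmas of the form \<open>islin K X _ (\<lambda>x. F (f x))\<close> compose these
  properties in the style of continuity proofs.
\<close>

definition islin :: "'k ring => ('k, 'v, 'x) module_scheme => ('k, 'w, 'y) module_scheme => ('v => 'w) => bool" where
  "islin K V W f \<longleftrightarrow> (\<forall>x\<in>carrier V. f x .: W) \<and>
     (\<forall>x\<in>carrier V. \<forall>y\<in>carrier V. f (x \<oplus>\<^bsub>V\<^esub> y) = f x \<oplus>\<^bsub>W\<^esub> f y) \<and>
     (\<forall>c\<in>carrier K. \<forall>x\<in>carrier V. f (c \<odot>\<^bsub>V\<^esub> x) = c \<odot>\<^bsub>W\<^esub> f x)"

lemma islinI: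
  assumes "!!x. x .: V ==> f x .: W"
    "!!x y. x .: V ==> y .: V ==> f (x \<oplus>\<^bsub>V\<^esub> y) = f x \<oplus>\<^bsub>W\<^esub> f y"
    "!!c x. c .: K ==> x .: V ==> f (c \<odot>\<^bsub>V\<^esub> x) = c \<odot>\<^bsub>W\<^esub> f x"
  shows "islin K V W f"
  using assms by (auto simp: islin_def)

lemma islin_in: "islin K V W f ==> x .: V ==> f x .: W"
  and islin_add: "islin K V W f ==> x .: V ==> y .: V ==> f (x \<oplus>\<^bsub>V\<^esub> y) = f x \<oplus>\<^bsub>W\<^esub> f y"
  and islin_smult: "islin K V W f ==> c .: K ==> x .: V ==> f (c \<odot>\<^bsub>V\<^esub> x) = c \<odot>\<^bsub>W\<^esub> f x"
  by (auto simp: islin_def)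

lemma lin_iff: "f \<in> lin K V W \<longleftrightarrow> f \<in> extensional (carrier V) \<and> islin K V W f"
  by (auto simp: lin_def islin_def PiE_iff)

lemma lin_islin: "f \<in> lin K V W ==> islin K V W f"
  by (simp add: lin_iff)

lemma islin_cong:
  assumes "!!x. x .: V ==> f x = g x" "module K V"
  shows "islin K V W f \<longleftrightarrow> islin K V W g"
proof -
  interpret module K V by fact
  show ?thesis using assms(1) by (auto simp: islin_def)
qed

lemma restrict_lin:
  assumes "module K V" "islin K V W f" shows "restrict f (carrier V) \<in> lin K V W"
proof -
  interpret module K V by fact
  show ?thesis using assms(2) by (auto simp: lin_iff islin_def)
qed

lemma lin_eqI:
  assumes "f \<in> lin K V W" "g \<in> lin K V W" "!!x. x .: V ==> f x = g x"
  shows "f = g"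
  using assms by (auto simp: lin_iff intro!: extensionalityI)

definition bilin where
  "bilin K U V W b \<longleftrightarrow> (\<forall>u\<in>carrier U. islin K V W (b u)) \<and> (\<forall>v\<in>carrier V. islin K U W (\<lambda>u. b u v))"

lemma bilinI:
  "(!!u. u .: U ==> islin K V W (b u)) ==> (!!v. v .: V ==> islin K U W (\<lambda>u. b u v)) ==> bilin K U V W b"
  by (auto simp: bilin_def)

lemma bilinear_map_iff: "bilinear_map K U V W b \<longleftrightarrow> bilin K U V W b"
  unfolding bilinear_map_def bilin_def islin_def by blast

locale over_field = fixes K :: "'k ring" (structure) assumes field_K: "field K"
begin

abbreviation (input) tensor_of (infix "**" 75) where "V ** W == tensor_space K V W"


lemma cring_K: "cring K" using field_K by (simp add: field_def domain_def)

lemma K_closed [simp]: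
  "(zero K) .: K" "\<one>\<^bsub>K\<^esub> .: K" "a .: K ==> b .: K ==> a \<oplus>\<^bsub>K\<^esub> b .: K"
  "a .: K ==> b .: K ==> a \<otimes>\<^bsub>K\<^esub> b .: K" "a .: K ==> \<ominus>\<^bsub>K\<^esub> a .: K"
  using cring_K by (auto simp: cring.cring_simprules)

lemmas m_ag = module.axioms(2)[of K]
lemmas m_am = abelian_group.axioms(1)[OF m_ag]
lemmas m_add [simp] = abelian_monoid.a_closed[OF m_am]
  and m_zero [simp] = abelian_monoid.zero_closed[OF m_am]
  and m_smult [simp] = module.smult_closed[of K]
  and m_inv [simp] = abelian_group.a_inv_closed[OF m_ag]
  and m_l_zero [simp] = abelian_monoid.l_zero[OF m_am]
  and m_r_zero [simp] = abelian_monoid.r_zero[OF m_am]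
  and m_sub [simp] = abelian_group.minus_closed[OF m_ag]
  and m_assoc = abelian_monoid.a_assoc[OF m_am]
  and m_comm = abelian_monoid.a_comm[OF m_am]
  and m_lcomm = abelian_monoid.a_lcomm[OF m_am]
  and m_smult_l_distr = module.smult_l_distr[of K]
  and m_smult_r_distr = module.smult_r_distr[of K]
  and m_smult_assoc = module.smult_assoc1[of K]
  and m_smult_one [simp] = module.smult_one[of K]
  and m_smult_l_null [simp] = module.smult_l_null[of K]
  and m_smult_r_null [simp] = module.smult_r_null[of K]
  and m_smult_r_minus = module.smult_r_minus[of K]
  and m_r_neg [simp] = abelian_group.r_neg[OF m_ag]
  and m_l_neg [simp] = abelian_group.l_neg[OF m_ag]

lemma m_minus_smult: "module K V ==> x .: V ==> \<ominus>\<^bsub>V\<^esub> x = (\<ominus>\<^bsub>K\<^esub> \<one>\<^bsub>K\<^esub>) \<odot>\<^bsub>V\<^esub> x"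
  using module.smult_l_minus[of K V "\<one>\<^bsub>K\<^esub>" x] cring_K by (simp add: cring.cring_simprules)

lemma m_sub_eq_zero: "module K V ==> x .: V ==> y .: V ==> x \<ominus>\<^bsub>V\<^esub> y = zero V \<longleftrightarrow> x = y"
proof
  assume V: "module K V" and x: "x .: V" and y: "y .: V"
  assume "x \<ominus>\<^bsub>V\<^esub> y = zero V"
  then have "(x \<oplus>\<^bsub>V\<^esub> \<ominus>\<^bsub>V\<^esub> y) \<oplus>\<^bsub>V\<^esub> y = zero V \<oplus>\<^bsub>V\<^esub> y" by (simp add: a_minus_def)
  then show "x = y" using V x y by (simp add: m_assoc)
qed (simp add: a_minus_def)

lemma islin_zero:
  assumes "module K V" "module K W" "islin K V W f" shows "f (zero V) = zero W"
proof -
  have "f ((zero K) \<odot>\<^bsub>V\<^esub> (zero V)) = zero K \<odot>\<^bsub>W\<^esub> f (zero V)"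
    using assms cring_K by (intro islin_smult) (auto simp: cring.cring_simprules)
  then show ?thesis using assms by (simp add: islin_in)
qed

lemma islin_neg:
  assumes "module K V" "module K W" "islin K V W f" "x .: V" shows "f (\<ominus>\<^bsub>V\<^esub> x) = \<ominus>\<^bsub>W\<^esub> f x"
  using assms cring_K by (simp add: m_minus_smult islin_in islin_smult cring.cring_simprules)

lemma islin_sub:
  assumes "module K V" "module K W" "islin K V W f" "x .: V" "y .: V"
  shows "f (x \<ominus>\<^bsub>V\<^esub> y) = f x \<ominus>\<^bsub>W\<^esub> f y"
  using assms by (simp add: a_minus_def islin_in islin_add islin_neg)

section \<open>Submodules, spans\<close>

lemma submoduleI':
  assumes "module K V" "U \<subseteq> carrier V" "(zero V) \<in> U" "!!x y. x \<in> U ==> y \<in> U ==> x \<oplus>\<^bsub>V\<^esub> y \<in> U"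
    "!!c x. c .: K ==> x \<in> U ==> c \<odot>\<^bsub>V\<^esub> x \<in> U"
  shows "submodule U K V"
  using assms cring_K by (intro module.submoduleI) (auto simp: m_minus_smult cring.cring_simprules subset_iff)

lemma submoduleD:
  assumes "module K V" "submodule U K V"
  shows "U \<subseteq> carrier V" "(zero V) \<in> U" "!!x y. x \<in> U ==> y \<in> U ==> x \<oplus>\<^bsub>V\<^esub> y \<in> U"
    "!!c x. c .: K ==> x \<in> U ==> c \<odot>\<^bsub>V\<^esub> x \<in> U" "!!x. x \<in> U ==> \<ominus>\<^bsub>V\<^esub> x \<in> U"
    "!!x y. x \<in> U ==> y \<in> U ==> x \<ominus>\<^bsub>V\<^esub> y \<in> U"
  using module.submoduleE[OF assms] subgroup.one_closed[of U "add_monoid V"] assms(2)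
  by (auto simp: submodule_def a_minus_def)

lemma submodule_lspan:
  assumes "module K V" "S \<subseteq> carrier V" shows "submodule (lspan K V S) K V"
proof (rule submoduleI'[OF assms(1)])
  have 1: "submodule (carrier V) K V" using assms by (simp add: module.carrier_is_submodule)
  then show "lspan K V S \<subseteq> carrier V" using assms by (auto simp: lspan_def)
qed (use submoduleD[OF assms(1)] in "auto simp: lspan_def")

lemma lspan_superset: "S \<subseteq> lspan K V S" by (auto simp: lspan_def)

lemma lspan_subset: "submodule U K V ==> S \<subseteq> U ==> lspan K V S \<subseteq> U" by (auto simp: lspan_def)

lemma lspan_induct [consumes 3, case_names gen zero add smult]:
  assumes "module K V" "S \<subseteq> carrier V" "x \<in> lspan K V S"
    "!!x. x \<in> S ==> P x" "P (zero V)" "!!x y. x .: V ==> y .: V ==> P x ==> P y ==> P (x \<oplus>\<^bsub>V\<^esub> y)"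
    "!!c x. c .: K ==> x .: V ==> P x ==> P (c \<odot>\<^bsub>V\<^esub> x)"
  shows "P x"
proof -
  have "submodule {x\<in>carrier V. P x} K V"
    using assms by (intro submoduleI') auto
  then have "lspan K V S \<subseteq> {x\<in>carrier V. P x}" using assms by (intro lspan_subset) auto
  with assms(3) show ?thesis by auto
qed

lemma submodule_kernel:
  assumes "module K V" "module K W" "islin K V W f"
  shows "submodule {x \<in> carrier V. f x = (zero W)} K V"
  using assms by (intro submoduleI') (auto simp: islin_zero islin_add islin_smult)

lemma submodule_preimage:
  assumes "module K V" "module K W" "islin K V W f" "submodule U K W"
  shows "submodule {x \<in> carrier V. f x \<in> U} K V"
  using assms submoduleD[OF assms(2,4)] by (intro submoduleI') (auto simp: islin_zero islin_add islin_smult)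

section \<open>Quotients\<close>

lemma sub_abel: "module K V ==> submodule U K V ==> abelian_subgroup U V"
  by (auto intro!: abelian_subgroupI3 additive_subgroupI simp: submodule_def m_ag)

lemma quot_carrier: "X .: (quot_space V U) \<longleftrightarrow> (\<exists>x\<in>carrier V. X = U +>\<^bsub>V\<^esub> x)"
  by (auto simp: quot_space_def A_RCOSETS_def')

lemma quot_carrierI: "x .: V ==> U +>\<^bsub>V\<^esub> x .: (quot_space V U)"
  by (auto simp: quot_carrier)

lemma coset_eq_iff:
  assumes "module K V" "submodule U K V" "x .: V" "y .: V"
  shows "U +>\<^bsub>V\<^esub> x = U +>\<^bsub>V\<^esub> y \<longleftrightarrow> x \<ominus>\<^bsub>V\<^esub> y \<in> U"
proof -
  interpret S: abelian_subgroup U V using assms by (simp add: sub_abel)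
  show ?thesis
  proof
    assume "U +>\<^bsub>V\<^esub> x = U +>\<^bsub>V\<^esub> y"
    then have "x \<in> U +>\<^bsub>V\<^esub> y" using S.a_rcos_self[of x] assms by simp
    then show "x \<ominus>\<^bsub>V\<^esub> y \<in> U" using S.a_rcos_module_imp[of y x] assms by (simp add: a_minus_def)
  next
    assume "x \<ominus>\<^bsub>V\<^esub> y \<in> U"
    then have "x \<in> U +>\<^bsub>V\<^esub> y" using S.a_rcos_module_rev[of y x] assms by (simp add: a_minus_def)
    then show "U +>\<^bsub>V\<^esub> x = U +>\<^bsub>V\<^esub> y" using S.a_repr_independence'[of x y] assms by simp
  qed
qed

lemma coset_memD:
  assumes "module K V" "submodule U K V" "x .: V" "y \<in> U +>\<^bsub>V\<^esub> x"
  shows "y .: V" "U +>\<^bsub>V\<^esub> y = U +>\<^bsub>V\<^esub> x"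
proof -
  interpret S: abelian_subgroup U V using assms by (simp add: sub_abel)
  show 1: "y .: V" using S.a_elemrcos_carrier[OF assms(3,4)] .
  show "U +>\<^bsub>V\<^esub> y = U +>\<^bsub>V\<^esub> x"
    using S.a_repr_independence'[of y x] assms 1 by auto
qed

lemma quot_add:
  assumes "module K V" "submodule U K V" "x .: V" "y .: V"
  shows "(U +>\<^bsub>V\<^esub> x) \<oplus>\<^bsub>quot_space V U\<^esub> (U +>\<^bsub>V\<^esub> y) = U +>\<^bsub>V\<^esub> (x \<oplus>\<^bsub>V\<^esub> y)"
proof -
  interpret S: abelian_subgroup U V using assms by (simp add: sub_abel)
  show ?thesis using S.a_rcos_sum[of x y] assms by (simp add: quot_space_def)
qed

lemma quot_smult:
  assumes "module K V" "submodule U K V" "x .: V" "c .: K"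
  shows "c \<odot>\<^bsub>quot_space V U\<^esub> (U +>\<^bsub>V\<^esub> x) = U +>\<^bsub>V\<^esub> (c \<odot>\<^bsub>V\<^esub> x)"
proof -
  interpret S: abelian_subgroup U V using assms by (simp add: sub_abel)
  have 1: "U +>\<^bsub>V\<^esub> (c \<odot>\<^bsub>V\<^esub> y) = U +>\<^bsub>V\<^esub> (c \<odot>\<^bsub>V\<^esub> x)" if "y \<in> U +>\<^bsub>V\<^esub> x" for y
  proof -
    note y = coset_memD[OF assms(1-3) that]
    then have "y \<ominus>\<^bsub>V\<^esub> x \<in> U" using coset_eq_iff[OF assms(1,2), of y x] assms(3) by simp
    then have "c \<odot>\<^bsub>V\<^esub> (y \<ominus>\<^bsub>V\<^esub> x) \<in> U" using submoduleD(4)[OF assms(1,2,4)] by simp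
    moreover have "c \<odot>\<^bsub>V\<^esub> (y \<ominus>\<^bsub>V\<^esub> x) = c \<odot>\<^bsub>V\<^esub> y \<ominus>\<^bsub>V\<^esub> c \<odot>\<^bsub>V\<^esub> x"
      using assms y by (simp add: a_minus_def m_smult_r_distr m_smult_r_minus)
    ultimately show ?thesis using assms y by (subst coset_eq_iff) auto
  qed
  have 2: "x \<in> U +>\<^bsub>V\<^esub> x" using S.a_rcos_self assms by simp
  have "c \<odot>\<^bsub>quot_space V U\<^esub> (U +>\<^bsub>V\<^esub> x) = (\<Union>y\<in>U +>\<^bsub>V\<^esub> x. U +>\<^bsub>V\<^esub> (c \<odot>\<^bsub>V\<^esub> y))" by (simp add: quot_space_def)
  also have "... = (\<Union>y\<in>U +>\<^bsub>V\<^esub> x. U +>\<^bsub>V\<^esub> (c \<odot>\<^bsub>V\<^esub> x))" by (rule SUP_cong[OF refl 1])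
  also have "... = U +>\<^bsub>V\<^esub> (c \<odot>\<^bsub>V\<^esub> x)" using 2 by blast
  finally show ?thesis .
qed

lemma quot_zero: 
  assumes "module K V" "submodule U K V"
  shows "\<zero>\<^bsub>quot_space V U\<^esub> = U +>\<^bsub>V\<^esub> (zero V)"
proof -
  interpret S: abelian_subgroup U V using assms by (simp add: sub_abel)
  show ?thesis using S.a_subset by (simp add: quot_space_def)
qed

lemma module_quot:
  assumes "module K V" "submodule U K V" shows "module K (quot_space V U)"
proof (rule moduleI[OF cring_K])
  note [simp] = assms quot_add quot_smult quot_zero[OF assms] quot_carrierI
  show "abelian_group (quot_space V U)"
  proof (rule abelian_groupI)
    fix x assume "x .: (quot_space V U)"
    then obtain a where a: "a .: V" "x = U +>\<^bsub>V\<^esub> a" by (auto simp: quot_carrier)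
    then show "\<exists>y\<in>carrier (quot_space V U). y \<oplus>\<^bsub>quot_space V U\<^esub> x = \<zero>\<^bsub>quot_space V U\<^esub>"
      by (intro bexI[of _ "U +>\<^bsub>V\<^esub> (\<ominus>\<^bsub>V\<^esub> a)"]) auto
  qed (auto simp: quot_carrier m_assoc m_comm[OF assms(1)] intro: arg_cong[where f="\<lambda>x. U +>\<^bsub>V\<^esub> x"])
qed (use assms in "auto simp: quot_carrier quot_add quot_smult m_smult_l_distr m_smult_r_distr m_smult_assoc")

lemma islin_coset:
  assumes "module K V" "submodule U K V" shows "islin K V (quot_space V U) (\<lambda>x. U +>\<^bsub>V\<^esub> x)"
  using assms by (auto simp: islin_def quot_add quot_smult quot_carrierI)

lemma quot_lift:
  assumes "module K V" "submodule U K V" "module K Z" "islin K V Z f" "!!u. u \<in> U ==> f u = zero Z"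
  obtains g where "islin K (quot_space V U) Z g" "!!x. x .: V ==> g (U +>\<^bsub>V\<^esub> x) = f x"
proof -
  define g where "g X = f (SOME x. x .: V \<and> X = U +>\<^bsub>V\<^esub> x)" for X
  have g: "g (U +>\<^bsub>V\<^esub> x) = f x" if x: "x .: V" for x
  proof -
    define y where "y = (SOME y. y .: V \<and> U +>\<^bsub>V\<^esub> x = U +>\<^bsub>V\<^esub> y)"
    have "\<exists>y. y .: V \<and> U +>\<^bsub>V\<^esub> x = U +>\<^bsub>V\<^esub> y" using x by blast
    from someI_ex[OF this] have y: "y .: V \<and> U +>\<^bsub>V\<^esub> x = U +>\<^bsub>V\<^esub> y" unfolding y_def .
    then have "x \<ominus>\<^bsub>V\<^esub> y \<in> U" using coset_eq_iff[OF assms(1,2) x conjunct1[OF y]] by blast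
    then have "f (x \<ominus>\<^bsub>V\<^esub> y) = zero Z" by (rule assms)
    moreover have "f (x \<ominus>\<^bsub>V\<^esub> y) = f x \<ominus>\<^bsub>Z\<^esub> f y" using islin_sub[OF assms(1,3,4) x] y by blast
    ultimately have "f x = f y"
      using m_sub_eq_zero[OF assms(3) islin_in[OF assms(4) x] islin_in[OF assms(4) conjunct1[OF y]]] by metis
    then show ?thesis unfolding g_def y_def[symmetric] by (rule sym)
  qed
  have "islin K (quot_space V U) Z g"
  proof (rule islinI)
    fix X assume "X .: (quot_space V U)"
    then obtain x where x: "x .: V" "X = U +>\<^bsub>V\<^esub> x" by (auto simp: quot_carrier)
    then show "g X .: Z" by (simp add: g islin_in[OF assms(4)])
    show "g (c \<odot>\<^bsub>quot_space V U\<^esub> X) = c \<odot>\<^bsub>Z\<^esub> g X" if "c .: K" for c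
      using x that by (simp add: g quot_smult[OF assms(1,2)] islin_smult[OF assms(4)] assms(1))
    fix Y assume "Y .: (quot_space V U)"
    then obtain y where y: "y .: V" "Y = U +>\<^bsub>V\<^esub> y" by (auto simp: quot_carrier)
    with x show "g (X \<oplus>\<^bsub>quot_space V U\<^esub> Y) = g X \<oplus>\<^bsub>Z\<^esub> g Y"
      by (simp add: g quot_add[OF assms(1,2)] islin_add[OF assms(4)] assms(1))
  qed
  then show thesis by (rule that[OF _ g])
qed


section \<open>Free spaces\<close>

lemma free_carrier: "\<phi> .: (free_space K S) \<longleftrightarrow> \<phi> \<in> S \<rightarrow>\<^sub>E carrier K \<and> finite {s \<in> S. \<phi> s \<noteq> (zero K)}"
  and free_add: "\<phi> \<oplus>\<^bsub>free_space K S\<^esub> \<psi> = (\<lambda>s\<in>S. \<phi> s \<oplus>\<^bsub>K\<^esub> \<psi> s)"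
  and free_smult: "c \<odot>\<^bsub>free_space K S\<^esub> \<phi> = (\<lambda>s\<in>S. c \<otimes>\<^bsub>K\<^esub> \<phi> s)"
  and free_zero: "\<zero>\<^bsub>free_space K S\<^esub> = (\<lambda>s\<in>S. (zero K))"
  by (auto simp: free_space_def)

lemma free_app [simp]: "\<phi> .: (free_space K S) ==> s \<in> S ==> \<phi> s .: K"
  and free_ext: "\<phi> .: (free_space K S) ==> \<phi> \<in> extensional S"
  by (auto simp: free_carrier PiE_iff)

lemma free_op_app [simp]:
  "s \<in> S ==> (\<phi> \<oplus>\<^bsub>free_space K S\<^esub> \<psi>) s = \<phi> s \<oplus>\<^bsub>K\<^esub> \<psi> s" "s \<in> S ==> (c \<odot>\<^bsub>free_space K S\<^esub> \<phi>) s = c \<otimes>\<^bsub>K\<^esub> \<phi> s"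
  "s \<in> S ==> \<zero>\<^bsub>free_space K S\<^esub> s = zero K"
  by (auto simp: free_add free_smult free_zero)

lemma free_add_closed:
  assumes "\<phi> .: (free_space K S)" "\<psi> .: (free_space K S)"
  shows "\<phi> \<oplus>\<^bsub>free_space K S\<^esub> \<psi> .: (free_space K S)"
proof -
  have "{s \<in> S. (\<phi> \<oplus>\<^bsub>free_space K S\<^esub> \<psi>) s \<noteq> (zero K)} \<subseteq> {s \<in> S. \<phi> s \<noteq> (zero K)} \<union> {s \<in> S. \<psi> s \<noteq> (zero K)}"
    using cring_K by (auto simp: cring.cring_simprules)
  then have "finite {s \<in> S. (\<phi> \<oplus>\<^bsub>free_space K S\<^esub> \<psi>) s \<noteq> (zero K)}"
    by (rule finite_subset) (use assms in "simp add: free_carrier")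
  with assms show ?thesis unfolding free_carrier[of "_ \<oplus>\<^bsub>_\<^esub> _"] by (auto simp: free_add)
qed

lemma free_smult_closed:
  assumes "\<phi> .: (free_space K S)" "c .: K"
  shows "c \<odot>\<^bsub>free_space K S\<^esub> \<phi> .: (free_space K S)"
proof -
  have "{s \<in> S. (c \<odot>\<^bsub>free_space K S\<^esub> \<phi>) s \<noteq> (zero K)} \<subseteq> {s \<in> S. \<phi> s \<noteq> (zero K)}"
    using cring_K assms by (auto simp: cring.cring_simprules)
  then have "finite {s \<in> S. (c \<odot>\<^bsub>free_space K S\<^esub> \<phi>) s \<noteq> (zero K)}"
    by (rule finite_subset) (use assms in "simp add: free_carrier")
  with assms show ?thesis unfolding free_carrier[of "_ \<odot>\<^bsub>_\<^esub> _"] by (auto simp: free_smult)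
qed

lemma free_zero_closed: "\<zero>\<^bsub>free_space K S\<^esub> .: (free_space K S)"
  by (auto simp: free_carrier free_zero)

lemma free_eqI:
  "\<phi> .: (free_space K S) ==> \<psi> .: (free_space K S) ==> (!!s. s \<in> S ==> \<phi> s = \<psi> s) ==> \<phi> = \<psi>"
  by (auto simp: free_carrier intro: PiE_ext)

lemma module_free [simp]: "module K (free_space K S)"
proof (rule moduleI[OF cring_K])
  interpret K: cring K by (rule cring_K)
  note c = free_add_closed free_smult_closed free_zero_closed
  show "abelian_group (free_space K S)"
  proof (rule abelian_groupI)
    fix \<phi> assume \<phi>: "\<phi> .: (free_space K S)"
    show "\<exists>y\<in>carrier (free_space K S). y \<oplus>\<^bsub>free_space K S\<^esub> \<phi> = \<zero>\<^bsub>free_space K S\<^esub>"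
    proof (rule bexI)
      have 1: "(\<ominus>\<^bsub>K\<^esub> \<one>\<^bsub>K\<^esub>) \<odot>\<^bsub>free_space K S\<^esub> \<phi> .: (free_space K S)" by (rule free_smult_closed[OF \<phi>]) simp
      then show "(\<ominus>\<^bsub>K\<^esub> \<one>\<^bsub>K\<^esub>) \<odot>\<^bsub>free_space K S\<^esub> \<phi> \<oplus>\<^bsub>free_space K S\<^esub> \<phi> = \<zero>\<^bsub>free_space K S\<^esub>"
        using \<phi> by (intro free_eqI[where S=S] c) (simp_all add: K.l_minus K.l_neg)
    qed (rule free_smult_closed[OF \<phi>], simp)
  next
    fix x y z assume xyz: "x .: (free_space K S)" "y .: (free_space K S)" "z .: (free_space K S)"
    show "x \<oplus>\<^bsub>free_space K S\<^esub> y \<oplus>\<^bsub>free_space K S\<^esub> z = x \<oplus>\<^bsub>free_space K S\<^esub> (y \<oplus>\<^bsub>free_space K S\<^esub> z)"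
      using xyz by (intro free_eqI[where S=S] c) (simp_all add: K.a_assoc)
  next
    fix x y assume xy: "x .: (free_space K S)" "y .: (free_space K S)"
    show "x \<oplus>\<^bsub>free_space K S\<^esub> y = y \<oplus>\<^bsub>free_space K S\<^esub> x"
      using xy by (intro free_eqI[where S=S] c) (simp_all add: K.a_comm)
  next
    fix x assume x: "x .: (free_space K S)"
    show "\<zero>\<^bsub>free_space K S\<^esub> \<oplus>\<^bsub>free_space K S\<^esub> x = x"
      using x by (intro free_eqI[where S=S] c) simp_all
  qed (rule c; assumption)+
next
  interpret K: cring K by (rule cring_K)
  note c = free_add_closed free_smult_closed free_zero_closed
  show "c \<odot>\<^bsub>free_space K S\<^esub> x .: (free_space K S)" if "c .: K" "x .: (free_space K S)" for c x
    using that by (intro c)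
  show "(a \<oplus>\<^bsub>K\<^esub> b) \<odot>\<^bsub>free_space K S\<^esub> x = a \<odot>\<^bsub>free_space K S\<^esub> x \<oplus>\<^bsub>free_space K S\<^esub> b \<odot>\<^bsub>free_space K S\<^esub> x"
    if "a .: K" "b .: K" "x .: (free_space K S)" for a b x
    using that by (intro free_eqI[where S=S] c) (simp_all add: K.l_distr)
  show "a \<odot>\<^bsub>free_space K S\<^esub> (x \<oplus>\<^bsub>free_space K S\<^esub> y) = a \<odot>\<^bsub>free_space K S\<^esub> x \<oplus>\<^bsub>free_space K S\<^esub> a \<odot>\<^bsub>free_space K S\<^esub> y"
    if "a .: K" "x .: (free_space K S)" "y .: (free_space K S)" for a x y
    using that by (intro free_eqI[where S=S] c) (simp_all add: K.r_distr)
  show "(a \<otimes>\<^bsub>K\<^esub> b) \<odot>\<^bsub>free_space K S\<^esub> x = a \<odot>\<^bsub>free_space K S\<^esub> (b \<odot>\<^bsub>free_space K S\<^esub> x)"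
    if "a .: K" "b .: K" "x .: (free_space K S)" for a b x
    using that by (intro free_eqI[where S=S] c) (simp_all add: K.m_assoc)
  show "\<one>\<^bsub>K\<^esub> \<odot>\<^bsub>free_space K S\<^esub> x = x" if "x .: (free_space K S)" for x
    using that by (intro free_eqI[where S=S] c) simp_all
qed

lemma free_gen_in [simp]: "t \<in> S ==> free_gen K S t .: (free_space K S)"
proof -
  have "{s \<in> S. free_gen K S t s \<noteq> (zero K)} \<subseteq> {t}" by (auto simp: free_gen_def)
  then have "finite {s \<in> S. free_gen K S t s \<noteq> (zero K)}" by (rule finite_subset) simp
  then show ?thesis by (auto simp: free_carrier free_gen_def)
qed

lemma free_induct [consumes 1, case_names zero gen]:
  assumes "\<phi> .: (free_space K S)" "P \<zero>\<^bsub>free_space K S\<^esub>"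
    "!!c t \<psi>. c .: K ==> t \<in> S ==> \<psi> .: (free_space K S) ==> P \<psi> ==>
        P (c \<odot>\<^bsub>free_space K S\<^esub> free_gen K S t \<oplus>\<^bsub>free_space K S\<^esub> \<psi>)"
  shows "P \<phi>"
proof -
  interpret K: cring K by (rule cring_K)
  have *: "finite F ==> F \<subseteq> S ==> \<phi> .: (free_space K S) ==> (!!s. s \<in> S - F ==> \<phi> s = zero K) ==> P \<phi>" for F \<phi>
  proof (induction F arbitrary: \<phi> rule: finite_induct)
    case empty
    then have "\<phi> = \<zero>\<^bsub>free_space K S\<^esub>"
      by (intro free_eqI) (auto simp: free_zero_closed)
    then show ?case using assms(2) by simp
  next
    case (insert t F)
    define \<psi> where "\<psi> = (\<lambda>s\<in>S. if s = t then (zero K) else \<phi> s)"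
    have \<phi>K: "\<phi> s .: K" if "s \<in> S" for s using insert.prems that by (auto simp: free_carrier)
    have "{s \<in> S. \<psi> s \<noteq> (zero K)} \<subseteq> {s \<in> S. \<phi> s \<noteq> (zero K)}" by (auto simp: \<psi>_def)
    then have "finite {s \<in> S. \<psi> s \<noteq> (zero K)}" by (rule finite_subset) (use insert.prems in "simp add: free_carrier")
    then have \<psi>: "\<psi> .: (free_space K S)" using insert.prems by (auto simp: free_carrier \<psi>_def PiE_iff)
    have "P \<psi>" using insert.prems by (intro insert.IH[OF _ \<psi>]) (auto simp: \<psi>_def)
    then have "P (\<phi> t \<odot>\<^bsub>free_space K S\<^esub> free_gen K S t \<oplus>\<^bsub>free_space K S\<^esub> \<psi>)"
      using insert.prems \<psi> \<phi>K by (intro assms(3)) auto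
    also have "\<phi> t \<odot>\<^bsub>free_space K S\<^esub> free_gen K S t \<oplus>\<^bsub>free_space K S\<^esub> \<psi> = \<phi>"
    proof (rule free_eqI[of _ S])
      show "\<phi> t \<odot>\<^bsub>free_space K S\<^esub> free_gen K S t \<oplus>\<^bsub>free_space K S\<^esub> \<psi> .: (free_space K S)"
        using insert.prems \<phi>K \<psi> by (intro m_add m_smult module_free free_gen_in) auto
    qed (use insert.prems \<phi>K in "auto simp: free_gen_def \<psi>_def")
    finally show ?case .
  qed
  have "finite {s \<in> S. \<phi> s \<noteq> (zero K)}" using assms(1) by (simp add: free_carrier)
  then show ?thesis by (rule *[OF _ _ assms(1)]) auto
qed

lemma free_lift:
  assumes Z: "module K Z" and b: "!!s. s \<in> S ==> b s .: Z"
  obtains g where "islin K (free_space K S) Z g" "!!s. s \<in> S ==> g (free_gen K S s) = b s"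
proof -
  interpret K: cring K by (rule cring_K)
  interpret Z: module K Z by (rule Z)
  define g where "g \<phi> = (\<Oplus>\<^bsub>Z\<^esub>s\<in>{s \<in> S. \<phi> s \<noteq> (zero K)}. \<phi> s \<odot>\<^bsub>Z\<^esub> b s)" for \<phi>
  have bK: "\<phi> s \<odot>\<^bsub>Z\<^esub> b s .: Z" if "\<phi> .: (free_space K S)" "s \<in> S" for \<phi> s
    using that b by auto
  have g: "g \<phi> = (\<Oplus>\<^bsub>Z\<^esub>s\<in>T. \<phi> s \<odot>\<^bsub>Z\<^esub> b s)"
    if "finite T" "T \<subseteq> S" "{s \<in> S. \<phi> s \<noteq> (zero K)} \<subseteq> T" "\<phi> .: (free_space K S)" for \<phi> T
    unfolding g_def using that b bK
    by (intro Z.add.finprod_mono_neutral_cong_left) auto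
  have fin: "finite {s \<in> S. \<phi> s \<noteq> (zero K)}" if "\<phi> .: (free_space K S)" for \<phi>
    using that by (simp add: free_carrier)
  have "islin K (free_space K S) Z g"
  proof (rule islinI)
    fix \<phi> assume \<phi>: "\<phi> .: (free_space K S)"
    show "g \<phi> .: Z" unfolding g_def using bK[OF \<phi>] by (intro Z.finsum_closed) auto
    show "g (c \<odot>\<^bsub>free_space K S\<^esub> \<phi>) = c \<odot>\<^bsub>Z\<^esub> g \<phi>" if c: "c .: K" for c
    proof -
      let ?T = "{s \<in> S. \<phi> s \<noteq> (zero K)}"
      have "g (c \<odot>\<^bsub>free_space K S\<^esub> \<phi>) = (\<Oplus>\<^bsub>Z\<^esub>s\<in>?T. (c \<odot>\<^bsub>free_space K S\<^esub> \<phi>) s \<odot>\<^bsub>Z\<^esub> b s)"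
        using c \<phi> by (intro g) (auto simp: fin)
      also have "... = (\<Oplus>\<^bsub>Z\<^esub>s\<in>?T. c \<odot>\<^bsub>Z\<^esub> (\<phi> s \<odot>\<^bsub>Z\<^esub> b s))"
        using c \<phi> b bK[OF \<phi>] by (intro Z.finsum_cong') (auto simp: Z.smult_assoc1)
      also have "... = c \<odot>\<^bsub>Z\<^esub> g \<phi>"
        unfolding g_def using bK[OF \<phi>] c fin[OF \<phi>] by (intro Z.finsum_smult_ldistr[symmetric]) auto
      finally show ?thesis .
    qed
    fix \<psi> assume \<psi>: "\<psi> .: (free_space K S)"
    let ?T = "{s \<in> S. \<phi> s \<noteq> (zero K)} \<union> {s \<in> S. \<psi> s \<noteq> (zero K)}"
    have "g (\<phi> \<oplus>\<^bsub>free_space K S\<^esub> \<psi>) = (\<Oplus>\<^bsub>Z\<^esub>s\<in>?T. (\<phi> \<oplus>\<^bsub>free_space K S\<^esub> \<psi>) s \<odot>\<^bsub>Z\<^esub> b s)"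
      using \<phi> \<psi> by (intro g) (auto simp: fin)
    also have "... = (\<Oplus>\<^bsub>Z\<^esub>s\<in>?T. \<phi> s \<odot>\<^bsub>Z\<^esub> b s \<oplus>\<^bsub>Z\<^esub> \<psi> s \<odot>\<^bsub>Z\<^esub> b s)"
      using \<phi> \<psi> b bK[OF \<phi>] bK[OF \<psi>] by (intro Z.finsum_cong') (auto simp: Z.smult_l_distr)
    also have "... = (\<Oplus>\<^bsub>Z\<^esub>s\<in>?T. \<phi> s \<odot>\<^bsub>Z\<^esub> b s) \<oplus>\<^bsub>Z\<^esub> (\<Oplus>\<^bsub>Z\<^esub>s\<in>?T. \<psi> s \<odot>\<^bsub>Z\<^esub> b s)"
      using bK[OF \<phi>] bK[OF \<psi>] by (intro Z.finsum_addf) auto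
    also have "(\<Oplus>\<^bsub>Z\<^esub>s\<in>?T. \<phi> s \<odot>\<^bsub>Z\<^esub> b s) = g \<phi>" using \<phi> \<psi> by (intro g[symmetric]) (auto simp: fin)
    also have "(\<Oplus>\<^bsub>Z\<^esub>s\<in>?T. \<psi> s \<odot>\<^bsub>Z\<^esub> b s) = g \<psi>" using \<phi> \<psi> by (intro g[symmetric]) (auto simp: fin)
    finally show "g (\<phi> \<oplus>\<^bsub>free_space K S\<^esub> \<psi>) = g \<phi> \<oplus>\<^bsub>Z\<^esub> g \<psi>" .
  qed
  moreover have "g (free_gen K S t) = b t" if t: "t \<in> S" for t
  proof -
    have "g (free_gen K S t) = (\<Oplus>\<^bsub>Z\<^esub>s\<in>{t}. free_gen K S t s \<odot>\<^bsub>Z\<^esub> b s)"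
      using t by (intro g free_gen_in) (auto simp: free_gen_def split: if_splits)
    also have "... = b t" using t b by (simp add: free_gen_def)
    finally show ?thesis .
  qed
  ultimately show thesis by (rule that)
qed

section \<open>Tensor products\<close>

lemma tensor_rels_sub: "module K V ==> module K W ==> tensor_rels K V W \<subseteq> carrier (free_space K (carrier V \<times> carrier W))"
  by (auto simp: tensor_rels_def Let_def)

lemma tensor_ker_sub: "module K V ==> module K W ==> submodule (tensor_ker K V W) K (free_space K (carrier V \<times> carrier W))"
  unfolding tensor_ker_def by (intro submodule_lspan tensor_rels_sub) auto

lemma module_tensor [simp]: "module K V ==> module K W ==> module K (V ** W)"
  unfolding tensor_space_def by (intro module_quot tensor_ker_sub) auto

lemma pure_in [simp]:
  "module K V ==> module K W ==> v .: V ==> w .: W ==> pure_tensor K V W v w .: (V ** W)"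
  unfolding tensor_space_def pure_tensor_def by (intro quot_carrierI) auto

lemma pure_bilin:
  assumes V: "module K V" and W: "module K W"
  shows "bilin K V W (V ** W) (pure_tensor K V W)"
proof -
  let ?S = "carrier V \<times> carrier W"
  let ?F = "free_space K ?S"
  let ?d = "\<lambda>v w. free_gen K ?S (v, w)"
  let ?k = "tensor_ker K V W"
  note sub = tensor_ker_sub[OF V W]
  have eq: "?k +>\<^bsub>?F\<^esub> x = ?k +>\<^bsub>?F\<^esub> y" if "x \<ominus>\<^bsub>?F\<^esub> y \<in> tensor_rels K V W" "x .: ?F" "y .: ?F" for x y
    using that coset_eq_iff[OF module_free sub that(2,3)] lspan_superset[of "tensor_rels K V W" ?F]
    unfolding tensor_ker_def by blast
  note add = quot_add[OF module_free sub] and smult = quot_smult[OF module_free sub]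
  show ?thesis
  proof (intro bilinI islinI)
    fix v v' w assume h: "v .: V" "v' .: V" "w .: W"
    have "?d (v \<oplus>\<^bsub>V\<^esub> v') w \<ominus>\<^bsub>?F\<^esub> (?d v w \<oplus>\<^bsub>?F\<^esub> ?d v' w) \<in> tensor_rels K V W"
      unfolding tensor_rels_def Let_def using h by blast
    then have "?k +>\<^bsub>?F\<^esub> ?d (v \<oplus>\<^bsub>V\<^esub> v') w = ?k +>\<^bsub>?F\<^esub> (?d v w \<oplus>\<^bsub>?F\<^esub> ?d v' w)"
      by (rule eq) (use h V W in auto)
    then show "pure_tensor K V W (v \<oplus>\<^bsub>V\<^esub> v') w = pure_tensor K V W v w \<oplus>\<^bsub>V ** W\<^esub> pure_tensor K V W v' w"
      using h by (simp add: pure_tensor_def tensor_space_def add)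
  next
    fix v w w' assume h: "v .: V" "w' .: W" "w .: W"
    have "?d v (w \<oplus>\<^bsub>W\<^esub> w') \<ominus>\<^bsub>?F\<^esub> (?d v w \<oplus>\<^bsub>?F\<^esub> ?d v w') \<in> tensor_rels K V W"
      unfolding tensor_rels_def Let_def using h by blast
    then have "?k +>\<^bsub>?F\<^esub> ?d v (w \<oplus>\<^bsub>W\<^esub> w') = ?k +>\<^bsub>?F\<^esub> (?d v w \<oplus>\<^bsub>?F\<^esub> ?d v w')"
      by (rule eq) (use h V W in auto)
    then show "pure_tensor K V W v (w \<oplus>\<^bsub>W\<^esub> w') = pure_tensor K V W v w \<oplus>\<^bsub>V ** W\<^esub> pure_tensor K V W v w'"
      using h by (simp add: pure_tensor_def tensor_space_def add)
  next
    fix v w c assume h: "v .: V" "c .: K" "w .: W"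
    have "?d (c \<odot>\<^bsub>V\<^esub> v) w \<ominus>\<^bsub>?F\<^esub> c \<odot>\<^bsub>?F\<^esub> ?d v w \<in> tensor_rels K V W"
      unfolding tensor_rels_def Let_def using h by blast
    then have "?k +>\<^bsub>?F\<^esub> ?d (c \<odot>\<^bsub>V\<^esub> v) w = ?k +>\<^bsub>?F\<^esub> (c \<odot>\<^bsub>?F\<^esub> ?d v w)"
      by (rule eq) (use h V W in auto)
    then show "pure_tensor K V W (c \<odot>\<^bsub>V\<^esub> v) w = c \<odot>\<^bsub>V ** W\<^esub> pure_tensor K V W v w"
      using h by (simp add: pure_tensor_def tensor_space_def smult)
    have "?d v (c \<odot>\<^bsub>W\<^esub> w) \<ominus>\<^bsub>?F\<^esub> c \<odot>\<^bsub>?F\<^esub> ?d v w \<in> tensor_rels K V W"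
      unfolding tensor_rels_def Let_def using h by blast
    then have "?k +>\<^bsub>?F\<^esub> ?d v (c \<odot>\<^bsub>W\<^esub> w) = ?k +>\<^bsub>?F\<^esub> (c \<odot>\<^bsub>?F\<^esub> ?d v w)"
      by (rule eq) (use h V W in auto)
    then show "pure_tensor K V W v (c \<odot>\<^bsub>W\<^esub> w) = c \<odot>\<^bsub>V ** W\<^esub> pure_tensor K V W v w"
      using h by (simp add: pure_tensor_def tensor_space_def smult)
  qed (use V W in simp_all)
qed

lemma tensor_induct [consumes 3, case_names pure add]:
  assumes V: "module K V" and W: "module K W" and t: "t .: (V ** W)"
    and pure: "!!v w. v .: V ==> w .: W ==> P (pure_tensor K V W v w)"
    and add: "!!s t. s .: (V ** W) ==> t .: (V ** W) ==> P s ==> P t ==> P (s \<oplus>\<^bsub>V ** W\<^esub> t)"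
  shows "P t"
proof -
  let ?S = "carrier V \<times> carrier W"
  let ?F = "free_space K ?S"
  note sub = tensor_ker_sub[OF V W]
  have q: "islin K ?F (V ** W) (\<lambda>x. tensor_ker K V W +>\<^bsub>?F\<^esub> x)"
    unfolding tensor_space_def by (rule islin_coset[OF module_free sub])
  obtain x where x: "x .: ?F" "t = tensor_ker K V W +>\<^bsub>?F\<^esub> x"
    using t by (auto simp: tensor_space_def quot_carrier)
  have "P (tensor_ker K V W +>\<^bsub>?F\<^esub> x)" using x(1)
  proof (induction rule: free_induct)
    case zero
    have "tensor_ker K V W +>\<^bsub>?F\<^esub> (zero ?F) = \<zero>\<^bsub>V ** W\<^esub>" using islin_zero[OF module_free module_tensor[OF V W] q] .
    also have "... = pure_tensor K V W (zero V) (zero W)"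
    proof -
      have "islin K W (V ** W) (pure_tensor K V W (zero V))" using pure_bilin[OF V W] V by (auto simp: bilin_def)
      from islin_zero[OF W module_tensor[OF V W] this] show ?thesis by (rule sym)
    qed
    finally show ?case using pure V W by simp
  next
    case (gen c s \<psi>)
    obtain v w where s: "s = (v, w)" "v .: V" "w .: W" using gen by auto
    have "tensor_ker K V W +>\<^bsub>?F\<^esub> (c \<odot>\<^bsub>?F\<^esub> free_gen K ?S s \<oplus>\<^bsub>?F\<^esub> \<psi>) =
       c \<odot>\<^bsub>V ** W\<^esub> pure_tensor K V W v w \<oplus>\<^bsub>V ** W\<^esub> (tensor_ker K V W +>\<^bsub>?F\<^esub> \<psi>)"
      using gen s by (simp add: islin_add[OF q] islin_smult[OF q] pure_tensor_def)
    also have "c \<odot>\<^bsub>V ** W\<^esub> pure_tensor K V W v w = pure_tensor K V W (c \<odot>\<^bsub>V\<^esub> v) w"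
      using pure_bilin[OF V W] gen s by (simp add: bilin_def islin_def)
    finally show ?case using gen s V W islin_in[OF q] by (auto intro!: add pure)
  qed
  then show ?thesis using x by simp
qed

lemma tensor_eqI:
  assumes "module K V" "module K W" "islin K (V ** W) Z f" "islin K (V ** W) Z g"
    "!!v w. v .: V ==> w .: W ==> f (pure_tensor K V W v w) = g (pure_tensor K V W v w)"
    "t .: (V ** W)"
  shows "f t = g t"
  using assms(1,2,6) by (induction rule: tensor_induct) (simp_all add: assms(5) islin_add[OF assms(3)] islin_add[OF assms(4)])

lemma tensor_lift_ex:
  assumes V: "module K V" and W: "module K W" and Z: "module K Z" and b: "bilin K V W Z b"
  shows "\<exists>g. islin K (V ** W) Z g \<and> (\<forall>v\<in>carrier V. \<forall>w\<in>carrier W. g (pure_tensor K V W v w) = b v w)"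
proof -
  let ?S = "carrier V \<times> carrier W"
  let ?F = "free_space K ?S"
  note sub = tensor_ker_sub[OF V W]
  have bin: "case_prod b s .: Z" if "s \<in> ?S" for s using b that by (auto simp: bilin_def islin_def)
  have "\<exists>f. islin K ?F Z f \<and> (\<forall>s\<in>?S. f (free_gen K ?S s) = case_prod b s)"
    by (rule free_lift[of Z ?S "case_prod b", OF Z bin]) (assumption | blast)+
  then obtain f where f: "islin K ?F Z f" "!!s. s \<in> ?S ==> f (free_gen K ?S s) = case_prod b s" by blast
  have ker: "f u = zero Z" if "u \<in> tensor_ker K V W" for u
  proof -
    have "tensor_rels K V W \<subseteq> {x \<in> carrier ?F. f x = (zero Z)}"
      using b V W Z
      by (auto simp: tensor_rels_def Let_def islin_sub[OF module_free Z f(1)] islin_add[OF f(1)] islin_smult[OF f(1)] f(2)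
          m_sub_eq_zero bilin_def islin_def)
    then have "tensor_ker K V W \<subseteq> {x \<in> carrier ?F. f x = (zero Z)}"
      unfolding tensor_ker_def by (intro lspan_subset submodule_kernel Z f) simp
    with that show ?thesis by auto
  qed
  have "\<exists>g. islin K (quot_space ?F (tensor_ker K V W)) Z g \<and> (\<forall>x\<in>carrier ?F. g (tensor_ker K V W +>\<^bsub>?F\<^esub> x) = f x)"
    by (rule quot_lift[OF module_free sub Z f(1) ker]) (assumption | blast)+
  then obtain g where g: "islin K (quot_space ?F (tensor_ker K V W)) Z g" "!!x. x .: ?F ==> g (tensor_ker K V W +>\<^bsub>?F\<^esub> x) = f x" by blast
  show ?thesis
    by (rule exI[of _ g]) (use g f in "auto simp: tensor_space_def pure_tensor_def")
qed

lemma tensor_lift: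
  assumes V: "module K V" and W: "module K W" and Z: "module K Z" and b: "bilin K V W Z b"
  shows tensor_lift_lin: "tensor_lift K V W Z b \<in> lin K (V ** W) Z"
    and tensor_lift_pure [simp]: "v .: V ==> w .: W ==> tensor_lift K V W Z b (pure_tensor K V W v w) = b v w"
proof -
  let ?P = "\<lambda>f. f \<in> lin K (V ** W) Z \<and> (\<forall>v\<in>carrier V. \<forall>w\<in>carrier W. f (pure_tensor K V W v w) = b v w)"
  obtain g where g: "islin K (V ** W) Z g" "\<forall>v\<in>carrier V. \<forall>w\<in>carrier W. g (pure_tensor K V W v w) = b v w"
    using tensor_lift_ex[OF assms] by blast
  have ex: "?P (restrict g (carrier (V ** W)))"
    using g V W by (auto intro!: restrict_lin)
  have un: "f = f'" if "?P f" "?P f'" for f f'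
  proof (rule lin_eqI)
    show "f x = f' x" if "x .: (V ** W)" for x
      by (rule tensor_eqI[OF V W _ _ _ that]) (use \<open>?P f\<close> \<open>?P f'\<close> in "auto intro: lin_islin")
  qed (use that in auto)
  have "\<exists>!f. ?P f" by (rule ex1I[of ?P, OF ex]) (rule un[OF _ ex])
  from theI'[OF this] have "?P (tensor_lift K V W Z b)" unfolding tensor_lift_def .
  then show "tensor_lift K V W Z b \<in> lin K (V ** W) Z"
    "v .: V ==> w .: W ==> tensor_lift K V W Z b (pure_tensor K V W v w) = b v w" by auto
qed

lemmas tensor_lift_islin = lin_islin[OF tensor_lift_lin]

lemma islin_comp: "islin K W Z g ==> islin K V W f ==> islin K V Z (\<lambda>x. g (f x))"
  by (auto simp: islin_def)

abbreviation (input) "idm \<equiv> \<lambda>x. x"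

lemma islin_id [simp]: "islin K V V idm" by (auto simp: islin_def)

lemma islin_zero_map: "module K V ==> module K W ==> islin K V W (\<lambda>x. (zero W))"
  by (auto simp: islin_def)

lemma islin_add_map: "module K W ==> islin K V W f ==> islin K V W g ==> islin K V W (\<lambda>x. f x \<oplus>\<^bsub>W\<^esub> g x)"
  by (auto simp: islin_def m_smult_r_distr m_assoc m_lcomm)

lemma islin_smult_map: "module K W ==> c .: K ==> islin K V W f ==> islin K V W (\<lambda>x. c \<odot>\<^bsub>W\<^esub> f x)"
proof -
  interpret cring K by (rule cring_K)
  show "module K W ==> c .: K ==> islin K V W f ==> islin K V W (\<lambda>x. c \<odot>\<^bsub>W\<^esub> f x)"
    by (auto simp: islin_def m_smult_r_distr m_comm simp flip: m_smult_assoc)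
qed

lemma islin_pure1: "module K V ==> module K W ==> w .: W ==> islin K X V f ==> islin K X (V ** W) (\<lambda>x. pure_tensor K V W (f x) w)"
  using islin_comp[of V "V ** W" "\<lambda>v. pure_tensor K V W v w" X f] pure_bilin[of V W] by (auto simp: bilin_def)

lemma islin_pure2: "module K V ==> module K W ==> v .: V ==> islin K X W f ==> islin K X (V ** W) (\<lambda>x. pure_tensor K V W v (f x))"
  using islin_comp[of W "V ** W" "pure_tensor K V W v" X f] pure_bilin[of V W] by (auto simp: bilin_def)

lemma islin_tensor_lift:
  "module K V ==> module K W ==> module K Z ==> bilin K V W Z b ==> islin K X (V ** W) f ==>
    islin K X Z (\<lambda>x. tensor_lift K V W Z b (f x))"
  by (rule islin_comp[OF tensor_lift_islin])

lemma tensor_lift_in: "module K V ==> module K W ==> module K Z ==> bilin K V W Z b ==> t .: (V ** W) ==>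
    tensor_lift K V W Z b t .: Z"
  by (rule islin_in[OF tensor_lift_islin])

lemma islin_tensor_lift_param:
  assumes "module K V" "module K W" "module K Z" "module K X" "t .: (V ** W)"
    "!!x. x .: X ==> bilin K V W Z (b x)"
    "!!v w. v .: V ==> w .: W ==> islin K X Z (\<lambda>x. b x v w)"
  shows "islin K X Z (\<lambda>x. tensor_lift K V W Z (b x) t)"
  using assms(1,2,5)
proof (induction rule: tensor_induct)
  case (pure v w)
  show ?case by (rule iffD1[OF islin_cong assms(7)[OF pure]]) (use assms pure in auto)
next
  case (add s t)
  show ?case
    by (rule iffD1[OF islin_cong islin_add_map[OF assms(3) add(3,4)]])
       (use assms add in "auto simp: islin_add[OF tensor_lift_islin]")
qed

lemma tensor_lift_unique:
  assumes "module K V" "module K W" "module K Z" "islin K (V ** W) Z f" "t .: (V ** W)"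
     "!!v w. v .: V ==> w .: W ==> b v w = f (pure_tensor K V W v w)"
  shows "tensor_lift K V W Z b t = f t"
proof -
  have b: "bilin K V W Z b"
  proof (rule bilinI)
    show "islin K W Z (b u)" if "u .: V" for u
      by (rule iffD1[OF islin_cong islin_comp[OF assms(4) islin_pure2[OF assms(1,2) that islin_id]]]) (use assms that in auto)
    show "islin K V Z (\<lambda>u. b u v)" if "v .: W" for v
      by (rule iffD1[OF islin_cong islin_comp[OF assms(4) islin_pure1[OF assms(1,2) that islin_id]]]) (use assms that in auto)
  qed
  show ?thesis
    by (rule tensor_eqI[OF assms(1,2) tensor_lift_islin[OF assms(1-3) b] assms(4) _ assms(5)])
       (use assms b in auto)
qed


section \<open>Functionals separate the points of a tensor product\<close>

lemma module_scalar [simp]: "module K (scalar_space K)"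
proof -
  interpret cring K by (rule cring_K)
  show ?thesis
  proof (rule moduleI[OF cring_K])
    show "abelian_group (scalar_space K)"
      by (rule abelian_groupI) (auto simp: scalar_space_def a_assoc a_comm a_lcomm intro: bexI[of _ "\<ominus>_"] l_neg)
  qed (auto simp: scalar_space_def l_distr r_distr m_assoc)
qed

lemma scalar_simps [simp]: "carrier (scalar_space K) = carrier K" "c \<odot>\<^bsub>scalar_space K\<^esub> d = c \<otimes>\<^bsub>K\<^esub> d"
   "c \<oplus>\<^bsub>scalar_space K\<^esub> d = c \<oplus>\<^bsub>K\<^esub> d" "\<zero>\<^bsub>scalar_space K\<^esub> = zero K"
  by (auto simp: scalar_space_def)

abbreviation dual where "dual V \<equiv> {w. islin K V (scalar_space K) w}"

text \<open>Zorn's lemma: the union of a chain of submodules that avoid \<open>x\<close> is again one.\<close>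

lemma maximal_avoiding:
  assumes V: "module K V" and U: "submodule U K V" and x: "x .: V" "x \<notin> U"
  obtains M where "submodule M K V" "U \<subseteq> M" "x \<notin> M" "!!N. submodule N K V ==> M \<subseteq> N ==> x \<notin> N ==> N = M"
proof -
  let ?A = "{N. submodule N K V \<and> U \<subseteq> N \<and> x \<notin> N}"
  have "\<exists>M\<in>?A. \<forall>X\<in>?A. M \<subseteq> X \<longrightarrow> X = M"
  proof (rule subset_Zorn_nonempty)
    show "?A \<noteq> {}" using U x by auto
    fix C assume C: "C \<noteq> {}" "subset.chain ?A C"
    have CA: "C \<subseteq> ?A" using C(2) by (auto simp: subset.chain_def)
    have sub: "submodule N K V" if "N \<in> C" for N using CA that by auto
    have "submodule (\<Union>C) K V"
    proof (rule submoduleI'[OF V])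
      show "\<Union>C \<subseteq> carrier V" using submoduleD(1)[OF V sub] by blast
      show "(zero V) \<in> \<Union>C" using submoduleD(2)[OF V sub] C(1) by blast
      show "c \<odot>\<^bsub>V\<^esub> y \<in> \<Union>C" if "c .: K" "y \<in> \<Union>C" for c y
        using submoduleD(4)[OF V sub] that by blast
      show "y \<oplus>\<^bsub>V\<^esub> z \<in> \<Union>C" if yz: "y \<in> \<Union>C" "z \<in> \<Union>C" for y z
      proof -
        from yz obtain N N' where N: "N \<in> C" "N' \<in> C" "y \<in> N" "z \<in> N'" by auto
        then have "N \<subseteq> N' \<or> N' \<subseteq> N" using C(2) by (auto simp: subset.chain_def)
        then show ?thesis
        proof
          assume "N \<subseteq> N'" then show ?thesis using submoduleD(3)[OF V sub[OF N(2)], of y z] N by blast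
        next
          assume "N' \<subseteq> N" then show ?thesis using submoduleD(3)[OF V sub[OF N(1)], of y z] N by blast
        qed
      qed
    qed
    then show "\<Union>C \<in> ?A" using CA C(1) by blast
  qed
  then obtain M where "M \<in> ?A" "\<forall>X\<in>?A. M \<subseteq> X \<longrightarrow> X = M" by blast
  then show thesis by (intro that[of M]) auto
qed

text \<open>
  A submodule \<open>M\<close> that contains \<open>U\<close> and is maximal among those avoiding \<open>x\<close> is a complement of the line through \<open>x\<close>:
  adjoining any \<open>y\<close> outside \<open>M\<close> yields \<open>x\<close>, so \<open>y\<close> is a multiple of \<open>x\<close> modulo \<open>M\<close>.  The functional is the coefficient of
  \<open>x\<close> along \<open>M\<close>.
\<close>

lemma functional_ex:
  assumes V: "module K V" and U: "submodule U K V" and x: "x .: V" "x \<notin> U"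
  obtains w where "w \<in> dual V" "!!u. u \<in> U ==> w u = zero K" "w x = \<one>\<^bsub>K\<^esub>"
proof -
  interpret field K by (rule field_K)
  obtain M where M: "submodule M K V" "U \<subseteq> M" "x \<notin> M"
    and max: "!!N. submodule N K V ==> M \<subseteq> N ==> x \<notin> N ==> N = M"
    by (rule maximal_avoiding[OF assms]) (rule that)
  note MD = submoduleD[OF V M(1)]
  have MC: "m .: V" if "m \<in> M" for m using MD(1) that by auto
  \<comment> \<open>The submodule generated by \<open>M\<close> and \<open>y\<close>.\<close>
  let ?comb = "\<lambda>y. {c \<odot>\<^bsub>V\<^esub> y \<oplus>\<^bsub>V\<^esub> m | c m. c .: K \<and> m \<in> M}"
  have sub: "submodule (?comb y) K V" if y: "y .: V" for y
  proof (rule submoduleI'[OF V])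
    show "?comb y \<subseteq> carrier V" using V y MC by auto
    have "(zero V) = \<zero> \<odot>\<^bsub>V\<^esub> y \<oplus>\<^bsub>V\<^esub> (zero V)" using V y by simp
    then show "(zero V) \<in> ?comb y" using MD(2) by blast
    show "p \<oplus>\<^bsub>V\<^esub> q \<in> ?comb y" if pq: "p \<in> ?comb y" "q \<in> ?comb y" for p q
    proof -
      from pq obtain c m d n where h: "p = c \<odot>\<^bsub>V\<^esub> y \<oplus>\<^bsub>V\<^esub> m" "q = d \<odot>\<^bsub>V\<^esub> y \<oplus>\<^bsub>V\<^esub> n" "c .: K" "d .: K" "m \<in> M" "n \<in> M" by blast
      then have "p \<oplus>\<^bsub>V\<^esub> q = (c \<oplus> d) \<odot>\<^bsub>V\<^esub> y \<oplus>\<^bsub>V\<^esub> (m \<oplus>\<^bsub>V\<^esub> n)"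
      proof -
        interpret W: abelian_group V using V by (rule m_ag)
        have "m .: V" "n .: V" "c \<odot>\<^bsub>V\<^esub> y .: V" "d \<odot>\<^bsub>V\<^esub> y .: V" using h V y MC by auto
        then show ?thesis using h V y by (simp add: m_smult_l_distr W.a_ac)
      qed
      then show ?thesis using h MD(3) by blast
    qed
    show "e \<odot>\<^bsub>V\<^esub> p \<in> ?comb y" if e: "e .: K" and p: "p \<in> ?comb y" for e p
    proof -
      from p obtain c m where h: "p = c \<odot>\<^bsub>V\<^esub> y \<oplus>\<^bsub>V\<^esub> m" "c .: K" "m \<in> M" by blast
      then have "e \<odot>\<^bsub>V\<^esub> p = (e \<otimes> c) \<odot>\<^bsub>V\<^esub> y \<oplus>\<^bsub>V\<^esub> (e \<odot>\<^bsub>V\<^esub> m)"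
        using V y MC e by (simp add: m_smult_r_distr m_smult_assoc)
      then show ?thesis using h MD(4) e by blast
    qed
  qed
  have Msub: "M \<subseteq> ?comb y" if y: "y .: V" for y
  proof
    fix m assume m: "m \<in> M"
    then have "m = \<zero> \<odot>\<^bsub>V\<^esub> y \<oplus>\<^bsub>V\<^esub> m" using V y MC by simp
    then show "m \<in> ?comb y" using m by blast
  qed
  have ex: "\<exists>c. c .: K \<and> y \<ominus>\<^bsub>V\<^esub> c \<odot>\<^bsub>V\<^esub> x \<in> M" if y: "y .: V" for y
  proof (cases "y \<in> M")
    case True
    then have "y \<ominus>\<^bsub>V\<^esub> \<zero> \<odot>\<^bsub>V\<^esub> x = y" using V x y by (simp add: a_minus_def m_minus_smult)
    with True show ?thesis by (intro exI[of _ "\<zero>"]) simp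
  next
    case False
    have "y = \<one> \<odot>\<^bsub>V\<^esub> y \<oplus>\<^bsub>V\<^esub> (zero V)" using V y by simp
    then have "y \<in> ?comb y" using MD(2) by blast
    with False have "?comb y \<noteq> M" by blast
    with max[OF sub[OF y] Msub[OF y]] have "x \<in> ?comb y" by blast
    then obtain c m where h: "x = c \<odot>\<^bsub>V\<^esub> y \<oplus>\<^bsub>V\<^esub> m" "c .: K" "m \<in> M" by blast
    have "c \<noteq> \<zero>" using h x(2) M(3) V y MC by auto
    then have inv: "inv c .: K" "inv c \<otimes> c = \<one>" using h(2) field_Units by auto
    have "inv c \<odot>\<^bsub>V\<^esub> x = y \<oplus>\<^bsub>V\<^esub> inv c \<odot>\<^bsub>V\<^esub> m"
      unfolding h(1) using h inv V y MC by (simp add: m_smult_r_distr flip: m_smult_assoc)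
    then have "y \<ominus>\<^bsub>V\<^esub> inv c \<odot>\<^bsub>V\<^esub> x = y \<ominus>\<^bsub>V\<^esub> (y \<oplus>\<^bsub>V\<^esub> inv c \<odot>\<^bsub>V\<^esub> m)" by simp
    also have "... = \<ominus>\<^bsub>V\<^esub> (inv c \<odot>\<^bsub>V\<^esub> m)"
      using h inv V y MC by (simp add: a_minus_def abelian_group.minus_add[OF m_ag] abelian_group.r_neg2[OF m_ag])
    finally show ?thesis using MD(4,5) inv h by auto
  qed
  have un: "c = d" if h: "c .: K" "d .: K" "y \<ominus>\<^bsub>V\<^esub> c \<odot>\<^bsub>V\<^esub> x \<in> M" "y \<ominus>\<^bsub>V\<^esub> d \<odot>\<^bsub>V\<^esub> x \<in> M" "y .: V" for c d y
  proof (rule ccontr)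
    assume "c \<noteq> d"
    then have ne: "c \<ominus> d \<noteq> \<zero>" using h by (metis a_minus_def add.inv_equality add.inv_inv a_inv_closed)
    have "(y \<ominus>\<^bsub>V\<^esub> d \<odot>\<^bsub>V\<^esub> x) \<ominus>\<^bsub>V\<^esub> (y \<ominus>\<^bsub>V\<^esub> c \<odot>\<^bsub>V\<^esub> x) \<in> M" using h MD(6) by blast
    moreover have "(y \<ominus>\<^bsub>V\<^esub> d \<odot>\<^bsub>V\<^esub> x) \<ominus>\<^bsub>V\<^esub> (y \<ominus>\<^bsub>V\<^esub> c \<odot>\<^bsub>V\<^esub> x) = (c \<ominus> d) \<odot>\<^bsub>V\<^esub> x"
    proof -
      have "(c \<ominus> d) \<odot>\<^bsub>V\<^esub> x = c \<odot>\<^bsub>V\<^esub> x \<oplus>\<^bsub>V\<^esub> \<ominus>\<^bsub>V\<^esub> (d \<odot>\<^bsub>V\<^esub> x)"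
        using h V x by (simp add: a_minus_def m_smult_l_distr module.smult_l_minus[of K])
      moreover have "(y \<ominus>\<^bsub>V\<^esub> d \<odot>\<^bsub>V\<^esub> x) \<ominus>\<^bsub>V\<^esub> (y \<ominus>\<^bsub>V\<^esub> c \<odot>\<^bsub>V\<^esub> x) = c \<odot>\<^bsub>V\<^esub> x \<oplus>\<^bsub>V\<^esub> \<ominus>\<^bsub>V\<^esub> (d \<odot>\<^bsub>V\<^esub> x)"
      proof -
        interpret W: abelian_group V using V by (rule m_ag)
        have s: "c \<odot>\<^bsub>V\<^esub> x .: V" "d \<odot>\<^bsub>V\<^esub> x .: V" using h V x by auto
        then show ?thesis using h(5)
          by (simp add: a_minus_def W.minus_add W.minus_minus W.a_ac) (simp add: W.r_neg W.r_neg1 W.r_neg2)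
      qed
      ultimately show ?thesis by simp
    qed
    ultimately have "(c \<ominus> d) \<odot>\<^bsub>V\<^esub> x \<in> M" by simp
    then have "inv (c \<ominus> d) \<odot>\<^bsub>V\<^esub> ((c \<ominus> d) \<odot>\<^bsub>V\<^esub> x) \<in> M" using ne h field_Units MD(4) by auto
    then have "x \<in> M" using ne h field_Units V x by (simp flip: m_smult_assoc)
    with M(3) show False by simp
  qed
  define w where "w y = (THE c. c .: K \<and> y \<ominus>\<^bsub>V\<^esub> c \<odot>\<^bsub>V\<^esub> x \<in> M)" for y
  have w: "w y .: K" "y \<ominus>\<^bsub>V\<^esub> w y \<odot>\<^bsub>V\<^esub> x \<in> M" if "y .: V" for y
  proof -
    have "\<exists>!c. c .: K \<and> y \<ominus>\<^bsub>V\<^esub> c \<odot>\<^bsub>V\<^esub> x \<in> M" using ex[OF that] un that by blast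
    from theI'[OF this] show "w y .: K" "y \<ominus>\<^bsub>V\<^esub> w y \<odot>\<^bsub>V\<^esub> x \<in> M" unfolding w_def by auto
  qed
  have weq: "w y = c" if "y .: V" "c .: K" "y \<ominus>\<^bsub>V\<^esub> c \<odot>\<^bsub>V\<^esub> x \<in> M" for y c
    using un[OF w(1)[OF that(1)] that(2) w(2)[OF that(1)] that(3,1)] .
  have "islin K V (scalar_space K) w"
  proof (rule islinI)
    interpret W: abelian_group V using V by (rule m_ag)
    show "w y .: (scalar_space K)" if "y .: V" for y using w that by simp
    show "w (y \<oplus>\<^bsub>V\<^esub> z) = w y \<oplus>\<^bsub>scalar_space K\<^esub> w z" if yz: "y .: V" "z .: V" for y z
    proof -
      have s: "w y \<odot>\<^bsub>V\<^esub> x .: V" "w z \<odot>\<^bsub>V\<^esub> x .: V" using w yz V x by auto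
      have "(y \<oplus>\<^bsub>V\<^esub> z) \<ominus>\<^bsub>V\<^esub> (w y \<oplus> w z) \<odot>\<^bsub>V\<^esub> x = (y \<ominus>\<^bsub>V\<^esub> w y \<odot>\<^bsub>V\<^esub> x) \<oplus>\<^bsub>V\<^esub> (z \<ominus>\<^bsub>V\<^esub> w z \<odot>\<^bsub>V\<^esub> x)"
        using w[OF yz(1)] w[OF yz(2)] yz V x s by (simp add: m_smult_l_distr a_minus_def W.minus_add W.a_ac)
      also have "... \<in> M" using w yz MD(3) by blast
      finally show ?thesis using w yz V by (simp add: weq)
    qed
    show "w (e \<odot>\<^bsub>V\<^esub> y) = e \<odot>\<^bsub>scalar_space K\<^esub> w y" if e: "e .: K" and y: "y .: V" for e y
    proof -
      have "(e \<odot>\<^bsub>V\<^esub> y) \<ominus>\<^bsub>V\<^esub> (e \<otimes> w y) \<odot>\<^bsub>V\<^esub> x = e \<odot>\<^bsub>V\<^esub> (y \<ominus>\<^bsub>V\<^esub> w y \<odot>\<^bsub>V\<^esub> x)"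
        using w[OF y] y e V x by (simp add: m_smult_r_distr m_smult_assoc a_minus_def m_smult_r_minus)
      also have "... \<in> M" using w y e MD(4) by blast
      finally show ?thesis using w y e V by (simp add: weq)
    qed
  qed
  moreover have "w u = \<zero>" if u: "u \<in> U" for u
  proof (rule weq)
    show "u .: V" using u M(2) MC by auto
    then show "u \<ominus>\<^bsub>V\<^esub> \<zero> \<odot>\<^bsub>V\<^esub> x \<in> M" using u M(2) V x by (auto simp: a_minus_def m_minus_smult)
  qed simp
  moreover have "w x = \<one>"
    using V x MD(2) by (intro weq) (simp_all add: a_minus_def)
  ultimately show thesis by (intro that[of w]) auto
qed

lemma lspanI: "x \<in> S ==> x \<in> lspan K V S" by (auto simp: lspan_def)

lemma pure_zero1: "module K V ==> module K W ==> w .: W ==> pure_tensor K V W (zero V) w = \<zero>\<^bsub>V ** W\<^esub>"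
  using islin_zero[OF _ _ islin_pure1[OF _ _ _ islin_id], of V W w] by simp

lemma pure_zero2: "module K V ==> module K W ==> v .: V ==> pure_tensor K V W v (zero W) = \<zero>\<^bsub>V ** W\<^esub>"
  using islin_zero[OF _ _ islin_pure2[OF _ _ _ islin_id], of W V v] by simp

lemma islin_scaled: "module K W ==> w .: W ==> islin K X (scalar_space K) f ==> islin K X W (\<lambda>x. f x \<odot>\<^bsub>W\<^esub> w)"
  by (auto simp: islin_def m_smult_l_distr m_smult_assoc)

text \<open>The slices \<open>\<omega> \<otimes> W\<close> and \<open>V \<otimes> \<omega>\<close>, with values in \<open>W\<close> and \<open>V\<close>.\<close>

definition sl1 where "sl1 V W w = tensor_lift K V W W (\<lambda>v x. w v \<odot>\<^bsub>W\<^esub> x)"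
definition sl2 where "sl2 V W w = tensor_lift K V W V (\<lambda>v x. w x \<odot>\<^bsub>V\<^esub> v)"

lemma dual_in: "w \<in> dual V ==> x .: V ==> w x .: K"
  by (auto dest: islin_in)

lemma sl1_bilin: "module K V ==> module K W ==> w \<in> dual V ==> bilin K V W W (\<lambda>v x. w v \<odot>\<^bsub>W\<^esub> x)"
  by (intro bilinI islin_scaled islin_smult_map islin_id) (auto simp: dual_in)

lemma sl2_bilin: "module K V ==> module K W ==> w \<in> dual W ==> bilin K V W V (\<lambda>v x. w x \<odot>\<^bsub>V\<^esub> v)"
  by (intro bilinI islin_scaled islin_smult_map islin_id) (auto simp: dual_in)

lemma islin_sl1: "module K V ==> module K W ==> w \<in> dual V ==> islin K X (V ** W) f ==> islin K X W (\<lambda>x. sl1 V W w (f x))"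
  unfolding sl1_def by (rule islin_tensor_lift) (auto intro!: sl1_bilin)

lemma islin_sl2: "module K V ==> module K W ==> w \<in> dual W ==> islin K X (V ** W) f ==> islin K X V (\<lambda>x. sl2 V W w (f x))"
  unfolding sl2_def by (rule islin_tensor_lift) (auto intro!: sl2_bilin)

lemma sl1_pure [simp]: "module K V ==> module K W ==> islin K V (scalar_space K) w ==> v .: V ==> x .: W ==>
    sl1 V W w (pure_tensor K V W v x) = w v \<odot>\<^bsub>W\<^esub> x"
  unfolding sl1_def using sl1_bilin[of V W w] by (subst tensor_lift_pure) auto

lemma sl2_pure [simp]: "module K V ==> module K W ==> islin K W (scalar_space K) w ==> v .: V ==> x .: W ==>
    sl2 V W w (pure_tensor K V W v x) = w x \<odot>\<^bsub>V\<^esub> v"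
  unfolding sl2_def using sl2_bilin[of V W w] by (subst tensor_lift_pure) auto

lemma sl1_in [simp]: "module K V ==> module K W ==> islin K V (scalar_space K) w ==> t .: (V ** W) ==> sl1 V W w t .: W"
  using islin_in[OF islin_sl1[OF _ _ _ islin_id]] by auto

lemma sl2_in [simp]: "module K V ==> module K W ==> islin K W (scalar_space K) w ==> t .: (V ** W) ==> sl2 V W w t .: V"
  using islin_in[OF islin_sl2[OF _ _ _ islin_id]] by auto

text \<open>
  Induction on the finite set \<open>F\<close> of second legs.  If the new leg \<open>w\<close> depends on the old ones, it can be dropped;
  otherwise a functional that vanishes on \<open>F\<close> and is \<open>1\<close> at \<open>w\<close> shows that the coefficient of \<open>w\<close> is zero.
\<close>

lemma sep2_zero_span:
  assumes V: "module K V" and W: "module K W"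
  shows "finite F ==> F \<subseteq> carrier W ==> t \<in> lspan K (V ** W) {pure_tensor K V W v u | v u. v .: V \<and> u \<in> F} ==>
    (!!w. w \<in> dual W ==> sl2 V W w t = zero V) ==> t = \<zero>\<^bsub>V ** W\<^esub>"
proof (induction F arbitrary: t rule: finite_induct)
  case empty
  let ?T = "V ** W"
  note T = module_tensor[OF V W]
  have "submodule {(zero ?T)} K ?T" using T by (intro submoduleI') auto
  then have "lspan K ?T {} \<subseteq> {(zero ?T)}" by (intro lspan_subset) auto
  then show ?case using empty by auto
next
  case (insert w F)
  let ?T = "V ** W"
  note T = module_tensor[OF V W]
  let ?G = "\<lambda>F. {pure_tensor K V W v u | v u. v .: V \<and> u \<in> F}"
  have F: "F \<subseteq> carrier W" and w: "w .: W" using insert.prems by auto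
  have GF: "?G F \<subseteq> carrier ?T" using V W F by auto
  have Gw: "?G (insert w F) \<subseteq> carrier ?T" using V W F w by auto
  note S = submodule_lspan[OF T GF]
  note SD = submoduleD[OF T S]
  have SC: "s .: ?T" if "s \<in> lspan K ?T (?G F)" for s using SD(1) that by auto
  note add = islin_add[OF islin_pure1[OF V W w islin_id]] and smult = islin_smult[OF islin_pure1[OF V W w islin_id]]
  have dec: "\<exists>v s. v .: V \<and> s \<in> lspan K ?T (?G F) \<and> t = pure_tensor K V W v w \<oplus>\<^bsub>?T\<^esub> s"
    using T Gw insert.prems(2)
  proof (induction rule: lspan_induct)
    case (gen x)
    then obtain v u where x: "x = pure_tensor K V W v u" "v .: V" "u = w \<or> u \<in> F" by auto
    show ?case
    proof (cases "u = w")
      case True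
      then show ?thesis using x SD(2) V W w by (intro exI[of _ v] exI[of _ "(zero ?T)"]) auto
    next
      case False
      then have "x \<in> ?G F" using x by auto
      then have 1: "x \<in> lspan K ?T (?G F)" by (rule lspanI)
      then have "x .: ?T" by (rule SC)
      then have "x = pure_tensor K V W (zero V) w \<oplus>\<^bsub>?T\<^esub> x" using V W w by (simp add: pure_zero1)
      with 1 show ?thesis using V by (meson m_zero)
    qed
  next
    case zero
    have "(zero ?T) = pure_tensor K V W (zero V) w \<oplus>\<^bsub>?T\<^esub> (zero ?T)" using V W w by (simp add: pure_zero1)
    then show ?case using SD(2) V by (meson m_zero)
  next
    case (add x y)
    from add(3,4) obtain v s v' s' where h: "v .: V" "s \<in> lspan K ?T (?G F)" "x = pure_tensor K V W v w \<oplus>\<^bsub>?T\<^esub> s"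
       "v' .: V" "s' \<in> lspan K ?T (?G F)" "y = pure_tensor K V W v' w \<oplus>\<^bsub>?T\<^esub> s'" by blast
    have "x \<oplus>\<^bsub>?T\<^esub> y = pure_tensor K V W (v \<oplus>\<^bsub>V\<^esub> v') w \<oplus>\<^bsub>?T\<^esub> (s \<oplus>\<^bsub>?T\<^esub> s')"
    proof -
      interpret TT: abelian_group ?T using T by (rule m_ag)
      have c: "pure_tensor K V W v w .: ?T" "pure_tensor K V W v' w .: ?T" "s .: ?T" "s' .: ?T"
        using h SC V W w by auto
      show ?thesis unfolding h(3,6) using h c by (simp add: islin_add[OF islin_pure1[OF V W w islin_id]] TT.a_ac)
    qed
    then show ?case using h(1,4) SD(3)[OF h(2,5)] V by (meson m_add)
  next
    case (smult c x)
    from smult(3) obtain v s where h: "v .: V" "s \<in> lspan K ?T (?G F)" "x = pure_tensor K V W v w \<oplus>\<^bsub>?T\<^esub> s" by blast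
    have "c \<odot>\<^bsub>?T\<^esub> x = pure_tensor K V W (c \<odot>\<^bsub>V\<^esub> v) w \<oplus>\<^bsub>?T\<^esub> (c \<odot>\<^bsub>?T\<^esub> s)"
      unfolding h(3) using h(1,2) smult(1) SC V W w T
      by (subst m_smult_r_distr) (auto simp: islin_smult[OF islin_pure1[OF V W w islin_id]])
    then show ?case using h(1) V SD(4)[OF smult(1) h(2)] smult(1) by (meson m_smult)
  qed
  from dec obtain v s where h: "v .: V" "s \<in> lspan K ?T (?G F)" "t = pure_tensor K V W v w \<oplus>\<^bsub>?T\<^esub> s" by blast
  have tF: "t \<in> lspan K ?T (?G F)"
  proof (cases "w \<in> lspan K W F")
    case True
    have "lspan K W F \<subseteq> {x \<in> carrier W. pure_tensor K V W v x \<in> lspan K ?T (?G F)}"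
    proof (rule lspan_subset)
      show "submodule {x \<in> carrier W. pure_tensor K V W v x \<in> lspan K ?T (?G F)} K W"
        using submodule_preimage[OF W T islin_pure2[OF V W h(1) islin_id] S] .
      show "F \<subseteq> {x \<in> carrier W. pure_tensor K V W v x \<in> lspan K ?T (?G F)}"
        using F h(1) by (auto intro!: lspanI)
    qed
    with True have "pure_tensor K V W v w \<in> lspan K ?T (?G F)" by auto
    then show ?thesis unfolding h(3) using h(2) by (rule SD(3))
  next
    case False
    obtain f where f: "f \<in> dual W" "!!u. u \<in> lspan K W F ==> f u = \<zero>" "f w = \<one>"
      by (rule functional_ex[OF W submodule_lspan[OF W F] w False]) (rule that)
    have "lspan K ?T (?G F) \<subseteq> {x \<in> carrier ?T. sl2 V W f x = (zero V)}"
    proof (rule lspan_subset)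
      show "submodule {x \<in> carrier ?T. sl2 V W f x = (zero V)} K ?T"
        using submodule_kernel[OF T V islin_sl2[OF V W f(1) islin_id]] .
      show "?G F \<subseteq> {x \<in> carrier ?T. sl2 V W f x = (zero V)}"
        using GF f(1) f(2)[OF lspanI] V W F by (auto simp: subset_iff)
    qed
    then have "sl2 V W f s = zero V" using h(2) by auto
    then have "sl2 V W f t = v" unfolding h(3)
      using islin_add[OF islin_sl2[OF V W f(1) islin_id]] h SC V W w f by simp
    then have "v = zero V" using insert.prems(3)[OF f(1)] by simp
    then show ?thesis using h SC V W w T by (simp add: pure_zero1)
  qed
  show ?case using insert.IH[OF F tF] insert.prems(3) by blast
qed

lemma sep2_zero:
  assumes V: "module K V" and W: "module K W" and t: "t .: (V ** W)"
    and z: "!!w. w \<in> dual W ==> sl2 V W w t = zero V"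
  shows "t = \<zero>\<^bsub>V ** W\<^esub>"
proof -
  let ?T = "V ** W"
  note T = module_tensor[OF V W]
  let ?G = "\<lambda>F. {pure_tensor K V W v u | v u. v .: V \<and> u \<in> F}"
  have "\<exists>F. finite F \<and> F \<subseteq> carrier W \<and> t \<in> lspan K ?T (?G F)"
    using V W t
  proof (induction rule: tensor_induct)
    case (pure v w)
    then have "pure_tensor K V W v w \<in> lspan K ?T (?G {w})" by (intro lspanI) auto
    then show ?case using pure by (intro exI[of _ "{w}"]) auto
  next
    case (add s t)
    from add(3,4) obtain F F' where F: "finite F" "F \<subseteq> carrier W" "s \<in> lspan K ?T (?G F)" "finite F'" "F' \<subseteq> carrier W" "t \<in> lspan K ?T (?G F')"
      by blast
    have sub: "submodule (lspan K ?T (?G (F \<union> F'))) K ?T" using T F V W by (intro submodule_lspan) auto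
    have "lspan K ?T (?G F) \<subseteq> lspan K ?T (?G (F \<union> F'))" "lspan K ?T (?G F') \<subseteq> lspan K ?T (?G (F \<union> F'))"
      by (intro lspan_subset[OF sub] subsetI lspanI; auto)+
    then have "s \<oplus>\<^bsub>?T\<^esub> t \<in> lspan K ?T (?G (F \<union> F'))" using F(3,6) submoduleD(3)[OF T sub, of s t] by auto
    then show ?case using F by (intro exI[of _ "F \<union> F'"]) auto
  qed
  then obtain F where "finite F" "F \<subseteq> carrier W" "t \<in> lspan K ?T (?G F)" by blast
  then show ?thesis by (rule sep2_zero_span[OF V W _ _ _ z])
qed

section \<open>Flips and tensor products of linear maps\<close>

lemma flip_bilin: "module K V ==> module K W ==> bilin K V W (W ** V) (\<lambda>v w. pure_tensor K W V w v)"
  by (intro bilinI islin_pure1 islin_pure2 islin_id)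

lemma islin_flip: "module K V ==> module K W ==> islin K X (V ** W) f ==> islin K X (W ** V) (\<lambda>x. tensor_flip K V W (f x))"
  unfolding tensor_flip_def by (rule islin_tensor_lift) (auto intro!: flip_bilin)

lemma flip_pure [simp]: "module K V ==> module K W ==> v .: V ==> w .: W ==>
    tensor_flip K V W (pure_tensor K V W v w) = pure_tensor K W V w v"
  unfolding tensor_flip_def using flip_bilin[of V W] by (subst tensor_lift_pure) auto

lemma flip_in [simp]: "module K V ==> module K W ==> t .: (V ** W) ==> tensor_flip K V W t .: (W ** V)"
  using islin_in[OF islin_flip[OF _ _ islin_id]] by auto

lemma flip_flip [simp]: "module K V ==> module K W ==> t .: (V ** W) ==> tensor_flip K W V (tensor_flip K V W t) = t"
  by (rule tensor_eqI[of V W "V ** W"]) (auto intro!: islin_flip islin_id)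

lemma sl2_flip: "module K V ==> module K W ==> islin K V (scalar_space K) w ==> t .: (V ** W) ==>
    sl2 W V w (tensor_flip K V W t) = sl1 V W w t"
  by (rule tensor_eqI[of V W W]) (auto intro!: islin_flip islin_sl1 islin_sl2 islin_id)

lemma sep1_zero:
  assumes V: "module K V" and W: "module K W" and t: "t .: (V ** W)"
    and z: "!!w. w \<in> dual V ==> sl1 V W w t = zero W"
  shows "t = \<zero>\<^bsub>V ** W\<^esub>"
proof -
  have "tensor_flip K V W t = \<zero>\<^bsub>W ** V\<^esub>"
    by (rule sep2_zero) (use assms in "auto simp: sl2_flip")
  then have "tensor_flip K W V (tensor_flip K V W t) = \<zero>\<^bsub>V ** W\<^esub>"
    using islin_zero[OF module_tensor[OF W V] module_tensor[OF V W] islin_flip[OF W V islin_id]] by simp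
  then show ?thesis using V W t by simp
qed

lemma map_bilin: "module K V' ==> module K W' ==> islin K V V' f ==> islin K W W' g ==>
    bilin K V W (V' ** W') (\<lambda>v w. pure_tensor K V' W' (f v) (g w))"
  by (intro bilinI islin_pure1 islin_pure2) (auto dest: islin_in)

lemma islin_map:
  "module K V ==> module K W ==> module K V' ==> module K W' ==> islin K V V' f ==> islin K W W' g ==>
    islin K X (V ** W) h ==> islin K X (V' ** W') (\<lambda>x. tensor_map K V W V' W' f g (h x))"
  unfolding tensor_map_def by (rule islin_tensor_lift) (auto intro!: map_bilin)

lemma map_pure [simp]:
  "module K V ==> module K W ==> module K V' ==> module K W' ==> islin K V V' f ==> islin K W W' g ==> v .: V ==> w .: W ==>
    tensor_map K V W V' W' f g (pure_tensor K V W v w) = pure_tensor K V' W' (f v) (g w)"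
  unfolding tensor_map_def using map_bilin[of V' W' V f W g] by (subst tensor_lift_pure) auto

lemma map_in:
  "module K V ==> module K W ==> module K V' ==> module K W' ==> islin K V V' f ==> islin K W W' g ==>
    t .: (V ** W) ==> tensor_map K V W V' W' f g t .: (V' ** W')"
  by (rule islin_in[OF islin_map[OF _ _ _ _ _ _ islin_id]])

lemma map_map:
  assumes "module K V" "module K W" "module K V'" "module K W'" "module K V''" "module K W''"
    "islin K V V' f" "islin K W W' g" "islin K V' V'' f'" "islin K W' W'' g'" "t .: (V ** W)"
  shows "tensor_map K V' W' V'' W'' f' g' (tensor_map K V W V' W' f g t) = tensor_map K V W V'' W'' (\<lambda>x. f' (f x)) (\<lambda>x. g' (g x)) t"
proof -
  have 1: "islin K V V'' (\<lambda>x. f' (f x))" "islin K W W'' (\<lambda>x. g' (g x))" using assms by (auto intro: islin_comp)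
  show ?thesis
    by (rule tensor_eqI[of V W "(V'' ** W'')"])
       (simp_all add: assms 1 islin_map islin_in[OF assms(7)] islin_in[OF assms(8)])
qed

lemma map_id: "module K V ==> module K W ==> t .: (V ** W) ==> tensor_map K V W V W idm idm t = t"
  by (rule tensor_eqI[of V W "V ** W"]) (simp_all add: islin_map)

lemma map_cong:
  assumes "module K V" "module K W" "module K V'" "module K W'" "islin K V V' f" "islin K W W' g"
    "!!x. x .: V ==> f x = f' x" "!!x. x .: W ==> g x = g' x" "t .: (V ** W)"
  shows "tensor_map K V W V' W' f g t = tensor_map K V W V' W' f' g' t"
proof -
  have f': "islin K V V' f'" and g': "islin K W W' g'"
    using islin_cong[of V f f'] islin_cong[of W g g'] assms by auto
  show ?thesis
  proof (rule tensor_eqI[OF assms(1,2) _ _ _ assms(9), where Z="(V' ** W')"])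
    show "islin K (V ** W) (V' ** W') (tensor_map K V W V' W' f g)"
      by (rule islin_map[OF assms(1-6) islin_id])
    show "islin K (V ** W) (V' ** W') (tensor_map K V W V' W' f' g')"
      by (rule islin_map[OF assms(1-4) f' g' islin_id])
    fix v w assume "v .: V" "w .: W"
    then show "tensor_map K V W V' W' f g (pure_tensor K V W v w) = tensor_map K V W V' W' f' g' (pure_tensor K V W v w)"
      by (simp only: map_pure[OF assms(1-6)] map_pure[OF assms(1-4) f' g'] assms(7,8))
  qed
qed

lemma sl1_map:
  assumes "module K V" "module K W" "module K V'" "module K W'" "islin K V V' f" "islin K W W' g" "islin K V' (scalar_space K) w" "t .: (V ** W)"
  shows "sl1 V' W' w (tensor_map K V W V' W' f g t) = g (sl1 V W (\<lambda>x. w (f x)) t)"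
proof -
  have 1: "islin K V (scalar_space K) (\<lambda>x. w (f x))" using assms by (auto intro: islin_comp)
  show ?thesis
    by (rule tensor_eqI[of V W W'])
       (simp_all add: assms 1 islin_map islin_sl1 islin_comp[OF assms(6)] islin_in[OF assms(5)] islin_in[OF assms(6)]
          islin_smult[OF assms(6)] islin_in[OF 1, simplified])
qed

lemma sl2_map:
  assumes "module K V" "module K W" "module K V'" "module K W'" "islin K V V' f" "islin K W W' g" "islin K W' (scalar_space K) w" "t .: (V ** W)"
  shows "sl2 V' W' w (tensor_map K V W V' W' f g t) = f (sl2 V W (\<lambda>x. w (g x)) t)"
proof -
  have 1: "islin K W (scalar_space K) (\<lambda>x. w (g x))" using assms by (auto intro: islin_comp)
  show ?thesis
    by (rule tensor_eqI[of V W V'])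
       (simp_all add: assms 1 islin_map islin_sl2 islin_comp[OF assms(5)] islin_in[OF assms(5)] islin_in[OF assms(6)]
          islin_smult[OF assms(5)] islin_in[OF 1, simplified])
qed

lemma eq_from_sub: "module K V ==> x .: V ==> y .: V ==> x \<ominus>\<^bsub>V\<^esub> y = zero V ==> x = y"
  by (simp add: m_sub_eq_zero)

text \<open>
  Slicing reduces this to injectivity of the family itself, since slices of one leg commute with maps on the other.
  This is how an identity of tensors is checked after multiplying one leg with all elements of \<open>A\<close>.
\<close>

lemma sep_map1:
  assumes V: "module K V" and W: "module K W" and V': "!!i. i \<in> I ==> module K (V' i)"
    and f: "!!i. i \<in> I ==> islin K V (V' i) (f i)"
    and inj: "!!v. v .: V ==> (!!i. i \<in> I ==> f i v = \<zero>\<^bsub>V' i\<^esub>) ==> v = zero V"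
    and s: "s .: (V ** W)" and t: "t .: (V ** W)"
    and eq: "!!i. i \<in> I ==> tensor_map K V W (V' i) W (f i) idm s = tensor_map K V W (V' i) W (f i) idm t"
  shows "s = t"
proof (rule eq_from_sub[OF module_tensor[OF V W] s t], rule sep2_zero[OF V W])
  fix w assume w: "w \<in> dual W"
  let ?T = "V ** W"
  show "sl2 V W w (s \<ominus>\<^bsub>?T\<^esub> t) = zero V"
  proof (rule inj)
    fix i assume i: "i \<in> I"
    have eqi: "f i (sl2 V W w s) = f i (sl2 V W w t)"
      using sl2_map[OF V W V'[OF i] W f[OF i] islin_id, of w s] sl2_map[OF V W V'[OF i] W f[OF i] islin_id, of w t] eq[OF i] w s t by simp
    have "f i (sl2 V W w (s \<ominus>\<^bsub>?T\<^esub> t)) = f i (sl2 V W w s \<ominus>\<^bsub>V\<^esub> sl2 V W w t)" (is "?lhs = _")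
      by (simp only: islin_sub[OF module_tensor[OF V W] V islin_sl2[OF V W w islin_id] s t])
    also have "... = f i (sl2 V W w s) \<ominus>\<^bsub>V' i\<^esub> f i (sl2 V W w t)"
      by (rule islin_sub[OF V V'[OF i] f[OF i]]) (use V W w s t in auto)
    also have "... = \<zero>\<^bsub>V' i\<^esub>" (is "_ = ?rhs")
      using eqi by (subst m_sub_eq_zero[OF V'[OF i]]) (use V W w s t in "auto intro!: islin_in[OF f[OF i]]")
    finally show "?lhs = ?rhs" .
  qed (use V W w s t in auto)
qed (use V W s t in auto)

lemma sep_map2:
  assumes V: "module K V" and W: "module K W" and W': "!!i. i \<in> I ==> module K (W' i)"
    and f: "!!i. i \<in> I ==> islin K W (W' i) (f i)"
    and inj: "!!v. v .: W ==> (!!i. i \<in> I ==> f i v = \<zero>\<^bsub>W' i\<^esub>) ==> v = zero W"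
    and s: "s .: (V ** W)" and t: "t .: (V ** W)"
    and eq: "!!i. i \<in> I ==> tensor_map K V W V (W' i) idm (f i) s = tensor_map K V W V (W' i) idm (f i) t"
  shows "s = t"
proof (rule eq_from_sub[OF module_tensor[OF V W] s t], rule sep1_zero[OF V W])
  fix w assume w: "w \<in> dual V"
  let ?T = "V ** W"
  show "sl1 V W w (s \<ominus>\<^bsub>?T\<^esub> t) = zero W"
  proof (rule inj)
    fix i assume i: "i \<in> I"
    have eqi: "f i (sl1 V W w s) = f i (sl1 V W w t)"
      using sl1_map[OF V W V W'[OF i] islin_id f[OF i], of w s] sl1_map[OF V W V W'[OF i] islin_id f[OF i], of w t] eq[OF i] w s t by simp
    have "f i (sl1 V W w (s \<ominus>\<^bsub>?T\<^esub> t)) = f i (sl1 V W w s \<ominus>\<^bsub>W\<^esub> sl1 V W w t)" (is "?lhs = _")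
      by (simp only: islin_sub[OF module_tensor[OF V W] W islin_sl1[OF V W w islin_id] s t])
    also have "... = f i (sl1 V W w s) \<ominus>\<^bsub>W' i\<^esub> f i (sl1 V W w t)"
      by (rule islin_sub[OF W W'[OF i] f[OF i]]) (use V W w s t in auto)
    also have "... = \<zero>\<^bsub>W' i\<^esub>" (is "_ = ?rhs")
      using eqi by (subst m_sub_eq_zero[OF W'[OF i]]) (use V W w s t in "auto intro!: islin_in[OF f[OF i]]")
    finally show "?lhs = ?rhs" .
  qed (use V W w s t in auto)
qed (use V W s t in auto)

lemma sep1: 
  assumes "module K V" "module K W" "s .: (V ** W)" "t .: (V ** W)"
    "!!w. w \<in> dual V ==> sl1 V W w s = sl1 V W w t"
  shows "s = t"
proof (rule eq_from_sub[OF module_tensor[OF assms(1,2)] assms(3,4)], rule sep1_zero[OF assms(1,2)])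
  show "sl1 V W w (s \<ominus>\<^bsub>V ** W\<^esub> t) = zero W" if "w \<in> dual V" for w
    using islin_sub[OF module_tensor[OF assms(1,2)] assms(2) islin_sl1[OF assms(1,2) that islin_id] assms(3,4)] assms that
    by (simp add: m_sub_eq_zero)
qed (use assms in auto)

lemma sep2: 
  assumes "module K V" "module K W" "s .: (V ** W)" "t .: (V ** W)"
    "!!w. w \<in> dual W ==> sl2 V W w s = sl2 V W w t"
  shows "s = t"
proof (rule eq_from_sub[OF module_tensor[OF assms(1,2)] assms(3,4)], rule sep2_zero[OF assms(1,2)])
  show "sl2 V W w (s \<ominus>\<^bsub>V ** W\<^esub> t) = zero V" if "w \<in> dual W" for w
    using islin_sub[OF module_tensor[OF assms(1,2)] assms(1) islin_sl2[OF assms(1,2) that islin_id] assms(3,4)] assms that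
    by (simp add: m_sub_eq_zero)
qed (use assms in auto)

text \<open>
  A functional on \<open>V\<close> that vanishes on \<open>U\<close> but not at the slice gives a slice of the other leg which all functionals in
  the separating family kill.  It serves to pass from slices that a formula computes, such as those by
  \<open>y \<mapsto> w (a y)\<close>, to all slices.
\<close>

lemma slice_in_submodule:
  assumes V: "module K V" and W: "module K W" and U: "submodule U K V" and t: "t .: (V ** W)"
    and \<Phi>: "\<Phi> \<subseteq> dual W" and sep: "!!x. x .: W ==> (!!w. w \<in> \<Phi> ==> w x = \<zero>) ==> x = zero W"
    and sl: "!!w. w \<in> \<Phi> ==> sl2 V W w t \<in> U" and w: "w \<in> dual W"
  shows "sl2 V W w t \<in> U"
proof (rule ccontr)
  assume n: "sl2 V W w t \<notin> U"
  have c: "sl2 V W w t .: V" using V W t w by simp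
  obtain f where f: "f \<in> dual V" "!!u. u \<in> U ==> f u = \<zero>" "f (sl2 V W w t) = \<one>"
    by (rule functional_ex[OF V U c n]) (rule that)
  have swap: "f (sl2 V W g t) = g (sl1 V W f t)" if g: "g \<in> dual W" for g
    by (rule tensor_eqI[OF V W _ _ _ t, where Z="scalar_space K"])
       (use V W f g cring_K in \<open>auto intro!: islin_comp[of V "scalar_space K" f] islin_comp[of W "scalar_space K" g] islin_sl1 islin_sl2 islin_id
          simp: islin_smult dual_in islin_in cring.cring_simprules dest: islin_in\<close>)
  have "sl1 V W f t = zero W"
  proof (rule sep)
    show "g (sl1 V W f t) = \<zero>" if "g \<in> \<Phi>" for g using swap[of g] f(2) sl that \<Phi> by auto
  qed (use V W f t in auto)
  then have "f (sl2 V W w t) = \<zero>" using swap[OF w] islin_zero[OF W module_scalar, of w] w by simp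
  then show False using f(3) field_K by (simp add: field_def domain_def domain_axioms_def)
qed

lemma slice_swap:
  assumes V: "module K V" and W: "module K W" and f: "islin K V (scalar_space K) f" and g: "islin K W (scalar_space K) g"
    and t: "t .: (V ** W)"
  shows "f (sl2 V W g t) = g (sl1 V W f t)"
  by (rule tensor_eqI[OF V W _ _ _ t, where Z="scalar_space K"])
     (use V W f g cring_K in \<open>auto intro!: islin_comp[of V "scalar_space K" f] islin_comp[of W "scalar_space K" g] islin_sl1 islin_sl2
        simp: islin_smult dual_in islin_in cring.cring_simprules dest: islin_in\<close>)

lemma tensor3_eqI:
  assumes U: "module K U" and V: "module K V" and W: "module K W"
    and f: "islin K ((U ** V) ** W) Z f" and g: "islin K ((U ** V) ** W) Z g"
    and eq: "!!u v w. u .: U ==> v .: V ==> w .: W ==>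
      f (pure_tensor K (U ** V) W (pure_tensor K U V u v) w) = g (pure_tensor K (U ** V) W (pure_tensor K U V u v) w)"
    and t: "t .: ((U ** V) ** W)"
  shows "f t = g t"
proof (rule tensor_eqI[OF module_tensor[OF U V] W f g _ t])
  fix s w assume s: "s .: (U ** V)" and w: "w .: W"
  note p = islin_pure1[OF module_tensor[OF U V] W w islin_id]
  show "f (pure_tensor K (U ** V) W s w) = g (pure_tensor K (U ** V) W s w)"
    by (rule tensor_eqI[OF U V islin_comp[OF f p] islin_comp[OF g p] _ s]) (rule eq[OF _ _ w])
qed

lemma tensor3_eqI':
  assumes U: "module K U" and V: "module K V" and W: "module K W"
    and f: "islin K (U ** (V ** W)) Z f" and g: "islin K (U ** (V ** W)) Z g"
    and eq: "!!u v w. u .: U ==> v .: V ==> w .: W ==>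
      f (pure_tensor K U (V ** W) u (pure_tensor K V W v w)) = g (pure_tensor K U (V ** W) u (pure_tensor K V W v w))"
    and t: "t .: (U ** (V ** W))"
  shows "f t = g t"
proof (rule tensor_eqI[OF U module_tensor[OF V W] f g _ t])
  fix s w assume s: "s .: (V ** W)" and w: "w .: U"
  note p = islin_pure2[OF U module_tensor[OF V W] w islin_id]
  show "f (pure_tensor K U (V ** W) w s) = g (pure_tensor K U (V ** W) w s)"
    by (rule tensor_eqI[OF V W islin_comp[OF f p] islin_comp[OF g p] _ s]) (rule eq[OF w])
qed

text \<open>
  The definite descriptions that define maps on tensor products (\<open>tensor_lift\<close>, \<open>tensor_assoc\<close>, \<open>varpi\<close>) all have this
  shape; a linear map with property \<open>P\<close> that is unique on the carrier identifies the described map.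
\<close>

lemma the_lin:
  assumes M: "module K M" and f: "islin K M Z f" and P: "!!g. (!!x. x .: M ==> g x = f x) ==> P g"
    and un: "!!g. islin K M Z g ==> P g ==> (!!x. x .: M ==> g x = f x)"
  shows "(THE f. f \<in> lin K M Z \<and> P f) = restrict f (carrier M)"
proof (rule the_equality)
  show "restrict f (carrier M) \<in> lin K M Z \<and> P (restrict f (carrier M))"
    by (rule conjI[OF restrict_lin[OF M f]]) (rule P, simp)
  fix g assume g: "g \<in> lin K M Z \<and> P g"
  show "g = restrict f (carrier M)"
    by (rule lin_eqI[OF conjunct1[OF g] restrict_lin[OF M f]]) (simp add: un[OF lin_islin[OF conjunct1[OF g]] conjunct2[OF g]])
qed

lemma assoc:
  assumes U: "module K U" and V: "module K V" and W: "module K W"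
  shows islin_assoc: "islin K ((U ** V) ** W) (U ** (V ** W)) (tensor_assoc K U V W)"
    and assoc_pure: "u .: U ==> v .: V ==> w .: W ==>
      tensor_assoc K U V W (pure_tensor K (U ** V) W (pure_tensor K U V u v) w) = pure_tensor K U (V ** W) u (pure_tensor K V W v w)"
proof -
  let ?UV = "U ** V" and ?VW = "V ** W"
  let ?M = "?UV ** W" and ?N = "U ** ?VW"
  let ?b = "\<lambda>x w. tensor_map K U V U ?VW idm (\<lambda>v. pure_tensor K V W v w) x"
  define f where "f = tensor_lift K ?UV W ?N ?b"
  note m [simp] = U V W module_tensor[OF U V] module_tensor[OF V W] module_tensor[OF module_tensor[OF U V] W] module_tensor[OF U module_tensor[OF V W]]
  have par: "islin K W ?N (\<lambda>w. ?b x w)" if x: "x .: ?UV" for x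
    unfolding tensor_map_def
    by (rule islin_tensor_lift_param[OF m(1,2,7,3) x])
       (simp_all add: bilin_def islin_pure1 islin_pure2)
  have b: "bilin K ?UV W ?N ?b"
    by (intro bilinI par) (simp_all add: islin_map islin_pure1)
  have f: "islin K ?M ?N f" unfolding f_def by (rule tensor_lift_islin[OF m(4,3,7) b])
  have fp: "f (pure_tensor K ?UV W (pure_tensor K U V u v) w) = pure_tensor K U ?VW u (pure_tensor K V W v w)"
    if "u .: U" "v .: V" "w .: W" for u v w
    unfolding f_def using that b by (simp add: islin_pure1)
  have eq: "tensor_assoc K U V W = restrict f (carrier ?M)"
    unfolding tensor_assoc_def
  proof (rule the_lin[OF m(6) f])
    fix g x assume "islin K ?M ?N g" "\<forall>u\<in>carrier U. \<forall>v\<in>carrier V. \<forall>w\<in>carrier W.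
        g (pure_tensor K ?UV W (pure_tensor K U V u v) w) = pure_tensor K U ?VW u (pure_tensor K V W v w)" "x .: ?M"
    then show "g x = f x" by (intro tensor3_eqI[OF U V W _ f, where f=g and t=x]) (simp_all add: fp)
  qed (simp add: fp)
  show "islin K ?M ?N (tensor_assoc K U V W)" unfolding eq by (rule lin_islin[OF restrict_lin[OF m(6) f]])
  show "u .: U ==> v .: V ==> w .: W ==>
      tensor_assoc K U V W (pure_tensor K ?UV W (pure_tensor K U V u v) w) = pure_tensor K U ?VW u (pure_tensor K V W v w)"
    unfolding eq by (simp add: fp)
qed

lemma assoc_inv:
  assumes U: "module K U" and V: "module K V" and W: "module K W"
  shows islin_assoc_inv: "islin K (U ** (V ** W)) ((U ** V) ** W) (tensor_assoc_inv K U V W)"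
    and assoc_inv_pure: "u .: U ==> v .: V ==> w .: W ==>
      tensor_assoc_inv K U V W (pure_tensor K U (V ** W) u (pure_tensor K V W v w)) = pure_tensor K (U ** V) W (pure_tensor K U V u v) w"
proof -
  let ?UV = "U ** V" and ?VW = "V ** W"
  let ?M = "?UV ** W" and ?N = "U ** ?VW"
  let ?b = "\<lambda>u x. tensor_map K V W ?UV W (\<lambda>v. pure_tensor K U V u v) idm x"
  define f where "f = tensor_lift K U ?VW ?M ?b"
  note m [simp] = U V W module_tensor[OF U V] module_tensor[OF V W] module_tensor[OF module_tensor[OF U V] W] module_tensor[OF U module_tensor[OF V W]]
  have par: "islin K U ?M (\<lambda>u. ?b u x)" if x: "x .: ?VW" for x
    unfolding tensor_map_def
    by (rule islin_tensor_lift_param[OF m(2,3,6,1) x])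
       (simp_all add: bilin_def islin_pure1 islin_pure2)
  have b: "bilin K U ?VW ?M ?b"
    by (intro bilinI par) (simp_all add: islin_map islin_pure2)
  have f: "islin K ?N ?M f" unfolding f_def by (rule tensor_lift_islin[OF m(1,5,6) b])
  have fp: "f (pure_tensor K U ?VW u (pure_tensor K V W v w)) = pure_tensor K ?UV W (pure_tensor K U V u v) w"
    if "u .: U" "v .: V" "w .: W" for u v w
    unfolding f_def using that b by (simp add: islin_pure2)
  have eq: "tensor_assoc_inv K U V W = restrict f (carrier ?N)"
    unfolding tensor_assoc_inv_def
  proof (rule the_lin[OF m(7) f])
    fix g x assume "islin K ?N ?M g" "\<forall>u\<in>carrier U. \<forall>v\<in>carrier V. \<forall>w\<in>carrier W.
        g (pure_tensor K U ?VW u (pure_tensor K V W v w)) = pure_tensor K ?UV W (pure_tensor K U V u v) w" "x .: ?N"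
    then show "g x = f x" by (intro tensor3_eqI'[OF U V W _ f, where f=g and t=x]) (simp_all add: fp)
  qed (simp add: fp)
  show "islin K ?N ?M (tensor_assoc_inv K U V W)" unfolding eq by (rule lin_islin[OF restrict_lin[OF m(7) f]])
  show "u .: U ==> v .: V ==> w .: W ==>
      tensor_assoc_inv K U V W (pure_tensor K U ?VW u (pure_tensor K V W v w)) = pure_tensor K ?UV W (pure_tensor K U V u v) w"
    unfolding eq by (simp add: fp)
qed

text \<open>With a pure first leg, rebracketing just attaches the first leg to the second.\<close>

lemma assoc_inv_pure_right:
  assumes U: "module K U" and V: "module K V" and W: "module K W" and u: "u .: U" and t: "t .: (V ** W)"
  shows "tensor_assoc_inv K U V W (pure_tensor K U (V ** W) u t) =
     tensor_map K V W (U ** V) W (\<lambda>v. pure_tensor K U V u v) idm t"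
  by (rule tensor_eqI[OF V W _ _ _ t, where Z="((U ** V) ** W)"])
     (simp_all add: U V W u assoc_inv_pure islin_map islin_pure2 islin_comp[OF islin_assoc_inv[OF U V W]])

lemma legs12_pure:
  assumes "module K V" "module K W" "module K V'" "module K W'" "module K Z"
    "islin K (V ** W) (V' ** W') f" "t .: (V ** W)" "z .: Z"
  shows "legs12 K V W V' W' Z f (pure_tensor K (V ** W) Z t z) = pure_tensor K (V' ** W') Z (f t) z"
  unfolding legs12_def by (subst map_pure) (simp_all add: assms)

lemma islin_legs12:
  assumes "module K V" "module K W" "module K V'" "module K W'" "module K Z"
    "islin K (V ** W) (V' ** W') f" "islin K X ((V ** W) ** Z) h"
  shows "islin K X ((V' ** W') ** Z) (\<lambda>x. legs12 K V W V' W' Z f (h x))"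
  unfolding legs12_def by (rule islin_map) (simp_all add: assms)

lemma legs23_pure:
  assumes "module K V" "module K W" "module K V'" "module K W'" "module K Z"
    "islin K (V ** W) (V' ** W') f" "v .: V" "w .: W" "z .: Z"
  shows "legs23 K V W V' W' Z f (pure_tensor K (Z ** V) W (pure_tensor K Z V z v) w) =
     tensor_map K V' W' (Z ** V') W' (\<lambda>p. pure_tensor K Z V' z p) idm (f (pure_tensor K V W v w))"
proof -
  have "f (pure_tensor K V W v w) .: (V' ** W')" using islin_in[OF assms(6)] assms by simp
  then show ?thesis unfolding legs23_def by (simp add: assms assoc_pure assoc_inv_pure_right)
qed

lemma islin_legs23:
  assumes "module K V" "module K W" "module K V'" "module K W'" "module K Z"
    "islin K (V ** W) (V' ** W') f" "islin K X ((Z ** V) ** W) h"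
  shows "islin K X ((Z ** V') ** W') (\<lambda>x. legs23 K V W V' W' Z f (h x))"
  unfolding legs23_def
  by (intro islin_comp[OF islin_assoc_inv] islin_map islin_comp[OF islin_assoc] module_tensor islin_id assms)

lemma legs13_pure:
  assumes "module K V" "module K W" "module K V'" "module K W'" "module K Z"
    "islin K (V ** W) (V' ** W') f" "v .: V" "w .: W" "z .: Z"
  shows "legs13 K V W V' W' Z f (pure_tensor K (V ** Z) W (pure_tensor K V Z v z) w) =
     tensor_map K V' W' (V' ** Z) W' (\<lambda>p. pure_tensor K V' Z p z) idm (f (pure_tensor K V W v w))"
proof -
  have t: "f (pure_tensor K V W v w) .: (V' ** W')" using islin_in[OF assms(6)] assms by simp
  have fl: "islin K (X ** Y) (Y ** X) (tensor_flip K X Y)" if "module K X" "module K Y" for X :: "('k, 'aa, 'bb) module_scheme" and Y :: "('k, 'cc, 'dd) module_scheme"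
    by (rule islin_flip[OF that islin_id])
  have "legs23 K Z W W Z V (tensor_flip K Z W) (pure_tensor K (V ** Z) W (pure_tensor K V Z v z) w) =
     pure_tensor K (V ** W) Z (pure_tensor K V W v w) z"
    by (subst legs23_pure) (simp_all add: assms fl islin_pure2)
  moreover have "legs23 K W' Z Z W' V' (tensor_flip K W' Z) (pure_tensor K (V' ** W') Z s z) =
     tensor_map K V' W' (V' ** Z) W' (\<lambda>p. pure_tensor K V' Z p z) idm s" if s: "s .: (V' ** W')" for s
    by (rule tensor_eqI[OF assms(3,4) _ _ _ s, where Z="((V' ** Z) ** W')"])
       (simp_all add: assms fl islin_legs23 islin_map islin_pure1 islin_pure2 legs23_pure)
  ultimately show ?thesis unfolding legs13_def using t by (simp add: assms legs12_pure)
qed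

lemma islin_legs13:
  assumes "module K V" "module K W" "module K V'" "module K W'" "module K Z"
    "islin K (V ** W) (V' ** W') f" "islin K X ((V ** Z) ** W) h"
  shows "islin K X ((V' ** Z) ** W') (\<lambda>x. legs13 K V W V' W' Z f (h x))"
proof -
  have fl: "islin K (X ** Y) (Y ** X) (tensor_flip K X Y)" if "module K X" "module K Y" for X :: "('k, 'aa, 'bb) module_scheme" and Y :: "('k, 'cc, 'dd) module_scheme"
    by (rule islin_flip[OF that islin_id])
  show ?thesis unfolding legs13_def
    by (intro islin_legs23 islin_legs12 fl assms)
qed

end

locale wmb = wmb_data K A + over_field K for K :: "'k ring" (structure) and A :: "('k, 'a) wmb" +
  assumes regular: regular_wmb
begin

lemma alg: idempotent_nondegenerate_algebra using regular by (simp add: regular_wmb_def)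

lemma A_module [simp]: "module K A"
  and mult_bilin: "bilin K A A A (mult A)"
  and m_ass: "a .: A ==> b .: A ==> c .: A ==> (a \<cdot> b) \<cdot> c = a \<cdot> (b \<cdot> c)"
  and mu_surj: "mu ` carrier AA = carrier A"
  and nd_r: "a .: A ==> (!!b. b .: A ==> a \<cdot> b = zero A) ==> a = zero A"
  and nd_l: "a .: A ==> (!!b. b .: A ==> b \<cdot> a = zero A) ==> a = zero A"
  using alg by (auto simp: idempotent_nondegenerate_algebra_def bilinear_map_iff)

lemma m_in [simp]: "a .: A ==> b .: A ==> a \<cdot> b .: A"
  using mult_bilin by (auto simp: bilin_def islin_def)

lemma islin_mult1 [simp]: "c .: A ==> islin K X A f ==> islin K X A (\<lambda>x. c \<cdot> f x)"
  and islin_mult2 [simp]: "c .: A ==> islin K X A f ==> islin K X A (\<lambda>x. f x \<cdot> c)"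
  using mult_bilin by (auto simp: bilin_def intro: islin_comp)

lemma islin_mult1' [simp]: "c .: A ==> islin K A A ((\<cdot>) c)"
  using islin_mult1[OF _ islin_id] .

lemma AA_module [simp]: "module K AA" by simp
lemma AAA_module [simp]: "module K AAA" by simp

lemma ops_lin: "E1 A \<in> lin K AA AA" "E2 A \<in> lin K AA AA" "T1 A \<in> lin K AA AA" "T2 A \<in> lin K AA AA" "T3 A \<in> lin K AA AA" "T4 A \<in> lin K AA AA"
  and eps_fun: "counit A \<in> functionals"
  using regular by (auto simp: regular_wmb_def)

lemmas ops_islin [simp] = ops_lin[THEN lin_islin]

lemma islin_ops [simp]: "islin K X AA f ==> islin K X AA (\<lambda>x. E1 A (f x))" "islin K X AA f ==> islin K X AA (\<lambda>x. E2 A (f x))"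
  "islin K X AA f ==> islin K X AA (\<lambda>x. T1 A (f x))" "islin K X AA f ==> islin K X AA (\<lambda>x. T2 A (f x))"
  "islin K X AA f ==> islin K X AA (\<lambda>x. T3 A (f x))" "islin K X AA f ==> islin K X AA (\<lambda>x. T4 A (f x))"
  by (rule islin_comp[OF ops_lin(1)[THEN lin_islin]] islin_comp[OF ops_lin(2)[THEN lin_islin]]
    islin_comp[OF ops_lin(3)[THEN lin_islin]] islin_comp[OF ops_lin(4)[THEN lin_islin]]
    islin_comp[OF ops_lin(5)[THEN lin_islin]] islin_comp[OF ops_lin(6)[THEN lin_islin]]; assumption)+

lemma ops_in [simp]: "t .: AA ==> E1 A t .: AA" "t .: AA ==> E2 A t .: AA"
  "t .: AA ==> T1 A t .: AA" "t .: AA ==> T2 A t .: AA"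
  "t .: AA ==> T3 A t .: AA" "t .: AA ==> T4 A t .: AA"
  using ops_islin[THEN islin_in] by auto

abbreviation "eps \<equiv> counit A"

lemma eps_dual [simp]: "islin K A (scalar_space K) eps" using eps_fun by (rule lin_islin)

lemma islin_eps [simp]: "islin K X A f ==> islin K X (scalar_space K) (\<lambda>x. eps (f x))"
  by (rule islin_comp[OF eps_dual])

abbreviation s1 where "s1 \<equiv> sl1 A A"
abbreviation s2 where "s2 \<equiv> sl2 A A"

lemma slice_eq: "slice1 w = s1 w" "slice2 A w = s2 w" "slice2 V w = sl2 V A w"
  by (simp_all add: slice1_def slice2_def sl1_def sl2_def)

lemmas [simp] = islin_pure1 islin_pure2 islin_map map_in map_map map_id

lemmas islin_s1 [simp] = islin_sl1[unfolded mem_Collect_eq]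
lemmas islin_s2 [simp] = islin_sl2[unfolded mem_Collect_eq]
lemmas islin_s1' [simp] = islin_s1[OF _ _ _ islin_id]
lemmas islin_s2' [simp] = islin_s2[OF _ _ _ islin_id]

section \<open>The axioms on \<open>A \<otimes> A\<close>\<close>

abbreviation PAA where "PAA \<equiv> pure_tensor K AA A"

lemma A23_PAA: "islin K AA AA X ==> a .: A ==> b .: A ==> c .: A ==>
    A23 X (PAA (a \<diamondop> b) c) = tensor_map K A A AA A (\<lambda>p. a \<diamondop> p) idm (X (b \<diamondop> c))"
  by (rule legs23_pure) simp_all

lemma A13_PAA: "islin K AA AA X ==> a .: A ==> b .: A ==> c .: A ==>
    A13 X (PAA (a \<diamondop> b) c) = tensor_map K A A AA A (\<lambda>p. p \<diamondop> b) idm (X (a \<diamondop> c))"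
  by (rule legs13_pure) simp_all

lemma A12_PAA: "islin K AA AA X ==> t .: AA ==> c .: A ==> A12 X (PAA t c) = PAA (X t) c"
  by (rule legs12_pure) simp_all

lemma A12_map: 
  assumes "islin K AA AA X" "islin K A AA h" "t .: AA"
  shows "A12 X (tensor_map K A A AA A h idm t) = tensor_map K A A AA A (\<lambda>p. X (h p)) idm t"
  unfolding legs12_def using assms islin_comp[OF assms(1,2)] by simp

lemma slice1_A23:
  assumes X: "islin K AA AA X" and w: "w \<in> dual A" and s: "s .: AA" and b: "b .: A"
  shows "tensor_map K AA A A A (s1 w) idm (A23 X (PAA s b)) = X (s1 w s \<diamondop> b)"
proof (rule tensor_eqI[OF A_module A_module _ _ _ s, where Z=AA])
  note X' = islin_comp[OF X]
  show "islin K AA AA (\<lambda>s. tensor_map K AA A A A (s1 w) idm (A23 X (PAA s b)))"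
    using w b X by (simp add: islin_legs23)
  show "islin K AA AA (\<lambda>s. X (s1 w s \<diamondop> b))" using w b by (intro X') simp
  fix u p assume u: "u .: A" and p: "p .: A"
  have t: "X (p \<diamondop> b) .: AA" using islin_in[OF X] p b by simp
  have "tensor_map K AA A A A (s1 w) idm (A23 X (PAA (u \<diamondop> p) b)) = map_A (\<lambda>q. w u \<odot>\<^bsub>A\<^esub> q) idm (X (p \<diamondop> b))" (is "?lhs = _")
  proof -
    have "tensor_map K AA A A A (s1 w) idm (A23 X (PAA (u \<diamondop> p) b)) = map_A (\<lambda>q. s1 w (u \<diamondop> q)) idm (X (p \<diamondop> b))"
      using w u p b X t by (simp add: A23_PAA)
    also have "... = map_A (\<lambda>q. w u \<odot>\<^bsub>A\<^esub> q) idm (X (p \<diamondop> b))"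
      by (rule map_cong) (use w u t in simp_all)
    finally show ?thesis .
  qed
  also have "... = w u \<odot>\<^bsub>AA\<^esub> X (p \<diamondop> b)"
    by (rule tensor_eqI[OF A_module A_module _ _ _ t, where Z=AA])
       (use w u in "simp_all add: islin_smult_map dual_in islin_smult[OF islin_pure1[OF A_module A_module _ islin_id]]")
  also have "... = X (s1 w (u \<diamondop> p) \<diamondop> b)" (is "_ = ?rhs")
    using w u p b by (simp add: dual_in islin_smult[OF X] islin_smult[OF islin_pure1[OF A_module A_module b islin_id]])
  finally show "?lhs = ?rhs" .
qed

lemma slice3_A23:
  assumes X: "islin K AA AA X" and w: "w \<in> dual A" and s: "s .: AA" and b: "b .: A"
  shows "sl2 AA A w (A23 X (PAA s b)) = map_A idm (\<lambda>p. s2 w (X (p \<diamondop> b))) s"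
proof (rule tensor_eqI[OF A_module A_module _ _ _ s, where Z=AA])
  have l: "islin K A AA (\<lambda>p. X (p \<diamondop> b))" by (rule islin_comp[OF X]) (simp add: b)
  show "islin K AA AA (\<lambda>s. sl2 AA A w (A23 X (PAA s b)))" using w b X by (intro islin_s2 islin_legs23 islin_pure1) simp_all
  show "islin K AA AA (map_A idm (\<lambda>p. s2 w (X (p \<diamondop> b))))" using w l by simp
  fix u p assume u: "u .: A" and p: "p .: A"
  have t: "X (p \<diamondop> b) .: AA" using islin_in[OF X] p b by simp
  then show "sl2 AA A w (A23 X (PAA (u \<diamondop> p) b)) = map_A idm (\<lambda>p. s2 w (X (p \<diamondop> b))) (u \<diamondop> p)"
    using w u p b X l by (simp add: A23_PAA sl2_map)
qed

text \<open>
  If \<open>X \<otimes> A\<close> and \<open>A \<otimes> Y\<close> commute, then so do the slices of \<open>X\<close> and \<open>Y\<close>.  This replaces identities in threefold tensor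
  products, such as coassociativity, by identities in \<open>A \<otimes> A\<close>.
\<close>

lemma commuting_slices:
  assumes X: "islin K AA AA X" and Y: "islin K AA AA Y" and comm: "!!t. t .: AAA ==> A12 X (A23 Y t) = A23 Y (A12 X t)"
    and w: "w \<in> dual A" and c: "c .: A" and x: "x .: A" and b: "b .: A"
  shows "Y (s1 w (X (c \<diamondop> x)) \<diamondop> b) = map_A (\<lambda>p. s1 w (X (c \<diamondop> p))) idm (Y (x \<diamondop> b))" (is ?A)
    and "X (c \<diamondop> s2 w (Y (x \<diamondop> b))) = map_A idm (\<lambda>p. s2 w (Y (p \<diamondop> b))) (X (c \<diamondop> x))" (is ?B)
proof -
  have Xcx: "X (c \<diamondop> x) .: AA" and Yxb: "Y (x \<diamondop> b) .: AA" using islin_in[OF X] islin_in[OF Y] c x b by simp_all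
  have l: "islin K A AA (\<lambda>p. X (c \<diamondop> p))" by (rule islin_comp[OF X]) (simp add: c)
  have "A12 X (A23 Y (PAA (c \<diamondop> x) b)) = A23 Y (A12 X (PAA (c \<diamondop> x) b))" using comm c x b by simp
  then have *: "tensor_map K A A AA A (\<lambda>p. X (c \<diamondop> p)) idm (Y (x \<diamondop> b)) = A23 Y (PAA (X (c \<diamondop> x)) b)"
    using X Y c x b Yxb by (simp add: A23_PAA A12_PAA A12_map)
  show ?A using arg_cong[OF *, of "tensor_map K AA A A A (s1 w) idm"] l Yxb Xcx w b Y by (simp add: slice1_A23)
  show ?B using arg_cong[OF *, of "sl2 AA A w"] l Yxb Xcx w b Y by (simp add: slice3_A23 sl2_map)
qed

lemma ax: 
  "a .: A ==> b .: A ==> c .: A ==> d .: A ==>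
     map_A (\<lambda>x. a \<cdot> x) (\<lambda>x. b \<cdot> x) (E1 A (c \<diamondop> d)) = map_A (\<lambda>x. x \<cdot> c) (\<lambda>x. x \<cdot> d) (E2 A (a \<diamondop> b))"
  "t .: AA ==> E1 A (E1 A t) = E1 A t"
  "u .: AAA ==> A12 (T2 A) (A23 (T1 A) u) = A23 (T1 A) (A12 (T2 A) u)"
  "t .: AA ==> s1 eps (T1 A t) = mu t" "t .: AA ==> s2 eps (T2 A t) = mu t"
  "u .: AAA ==> mu_A (A13 (T1 A) (A23 (T1 A) u)) = T1 A (mu_A u)"
  "lspan K AA {map_A (\<lambda>x. x \<cdot> b) idm (T1 A (a \<diamondop> c)) | a b c. a .: A \<and> b .: A \<and> c .: A} =
       lspan K AA {E1 A (b \<diamondop> c) | b c. b .: A \<and> c .: A}"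
  "lspan K AA {map_A idm (\<lambda>x. c \<cdot> x) (T2 A (b \<diamondop> a)) | a b c. a .: A \<and> b .: A \<and> c .: A} =
       lspan K AA {E2 A (b \<diamondop> c) | b c. b .: A \<and> c .: A}"
  "u .: AAA ==> A12 (E1 A) (A23 (T1 A) u) = A23 (T1 A) (A12 (E1 A) u)"
  "u .: AAA ==> A12 (E2 A) (A23 (T2 A) u) = A23 (T2 A) (A13 (E2 A) u)"
  "a .: A ==> b .: A ==> c .: A ==>
        s1 eps (map_A idm (\<lambda>x. a \<cdot> x) (E1 A (b \<diamondop> c))) = s1 eps (map_A (\<lambda>x. x \<cdot> b) idm (T1 A (a \<diamondop> c)))"
  "a .: A ==> b .: A ==> c .: A ==>
        s1 eps (map_A idm (\<lambda>x. x \<cdot> c) (E2 A (a \<diamondop> b))) = s1 eps (map_A idm (\<lambda>x. b \<cdot> x) (T2 A (a \<diamondop> c)))"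
  "a .: A ==> b .: A ==> c .: A ==>
        map_A idm (\<lambda>x. a \<cdot> x) (T1 A (c \<diamondop> b)) = map_A idm (\<lambda>x. x \<cdot> b) (T3 A (c \<diamondop> a))"
  "a .: A ==> b .: A ==> c .: A ==>
        map_A (\<lambda>x. x \<cdot> b) idm (T2 A (a \<diamondop> c)) = map_A (\<lambda>x. a \<cdot> x) idm (T4 A (b \<diamondop> c))"
  using regular unfolding regular_wmb_def slice_eq by (elim conjE, simp)+

lemmas T1_rcol = commuting_slices(1)[OF ops_islin(4,3) ax(3)]
lemmas T2_lcol = commuting_slices(2)[OF ops_islin(4,3) ax(3)]
lemmas T1_E1_rcol = commuting_slices(1)[OF ops_islin(1,3) ax(9)]
text \<open>The compatibility of \<open>E2\<close> and \<open>T2\<close> lets \<open>E2\<close> act on the outer legs, past \<open>b\<close> in the middle leg; slice the third leg.\<close>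

lemma E2_T2_lcol:
  assumes w: "w \<in> dual A" and b: "b .: A" and c: "c .: A" and d: "d .: A"
  shows "E2 A (d \<diamondop> s2 w (T2 A (b \<diamondop> c))) = map_A idm (\<lambda>c. s2 w (T2 A (b \<diamondop> c))) (E2 A (d \<diamondop> c))"
proof -
  have *: "tensor_map K A A AA A (\<lambda>p. E2 A (d \<diamondop> p)) idm (T2 A (b \<diamondop> c)) =
     A23 (T2 A) (tensor_map K A A AA A (\<lambda>p. p \<diamondop> b) idm (E2 A (d \<diamondop> c)))"
    using ax(10)[of "PAA (d \<diamondop> b) c"] b c d by (simp add: A23_PAA A13_PAA A12_map)
  have "sl2 AA A w (A23 (T2 A) (tensor_map K A A AA A (\<lambda>p. p \<diamondop> b) idm s)) = map_A idm (\<lambda>c. s2 w (T2 A (b \<diamondop> c))) s"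
    if s: "s .: AA" for s
  proof (rule tensor_eqI[OF A_module A_module _ _ _ s, where Z=AA])
    show "islin K AA AA (\<lambda>s. sl2 AA A w (A23 (T2 A) (tensor_map K A A AA A (\<lambda>p. p \<diamondop> b) idm s)))"
      using w b by (intro islin_s2 islin_legs23 islin_map) simp_all
  qed (use w b in "simp_all add: A23_PAA sl2_map")
  then show ?thesis using arg_cong[OF *, of "sl2 AA A w"] b c d w by (simp add: sl2_map)
qed

lemma mu_pure [simp]: "a .: A ==> b .: A ==> mu (a \<diamondop> b) = a \<cdot> b"
  unfolding mu_def using mult_bilin by simp

lemma islin_mu [simp]: "islin K X AA f ==> islin K X A (\<lambda>x. mu (f x))"
  unfolding mu_def using mult_bilin by (simp add: islin_tensor_lift)

lemma islin_mu' [simp]: "islin K AA A mu" using islin_mu[OF islin_id] .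

lemma mu_in [simp]: "t .: AA ==> mu t .: A" using islin_in[OF islin_mu'] .

text \<open>\<open>A\<close> is idempotent, so a statement closed under sums has to be checked for products only.\<close>

lemma A_induct [consumes 1, case_names mult add]:
  assumes "x .: A" "!!a b. a .: A ==> b .: A ==> P (a \<cdot> b)"
    "!!x y. x .: A ==> y .: A ==> P x ==> P y ==> P (x \<oplus>\<^bsub>A\<^esub> y)"
  shows "P x"
proof -
  have "P (mu t)" if t: "t .: AA" for t
    using A_module A_module t
    by (induction rule: tensor_induct) (simp_all add: assms(2,3) islin_add[OF islin_mu'])
  moreover obtain t where "t .: AA" "x = mu t" using assms(1) mu_surj by (metis imageE)
  ultimately show ?thesis by simp
qed

end

context over_field begin

lemma sl1_cong:
  assumes V: "module K V" and W: "module K W" and w: "islin K V (scalar_space K) w" and eq: "!!x. x .: V ==> w x = w' x"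
    and t: "t .: (V ** W)"
  shows "sl1 V W w t = sl1 V W w' t"
proof -
  have w': "islin K V (scalar_space K) w'" using iffD1[OF islin_cong[OF eq V] w] .
  show ?thesis
    by (rule tensor_eqI[OF V W _ _ _ t, where f="sl1 V W w" and g="sl1 V W w'" and Z=W])
       (simp_all add: V W w w' eq islin_sl1)
qed

lemma sl2_cong:
  assumes V: "module K V" and W: "module K W" and w: "islin K W (scalar_space K) w" and eq: "!!x. x .: W ==> w x = w' x"
    and t: "t .: (V ** W)"
  shows "sl2 V W w t = sl2 V W w' t"
proof -
  have w': "islin K W (scalar_space K) w'" using iffD1[OF islin_cong[OF eq W] w] .
  show ?thesis
    by (rule tensor_eqI[OF V W _ _ _ t, where f="sl2 V W w" and g="sl2 V W w'" and Z=V])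
       (simp_all add: V W w w' eq islin_sl2)
qed

lemma islin_map_param1:
  assumes "module K V" "module K W" "module K V'" "module K W'" "module K X" "!!x. x .: X ==> islin K V V' (f x)"
    "!!v. v .: V ==> islin K X V' (\<lambda>x. f x v)" "islin K W W' g" "t .: (V ** W)"
  shows "islin K X (V' ** W') (\<lambda>x. tensor_map K V W V' W' (f x) g t)"
  unfolding tensor_map_def
  by (rule islin_tensor_lift_param)
     (simp_all add: assms bilin_def islin_pure1 islin_pure2 islin_in[OF assms(8)] islin_in[OF assms(6)])

lemma islin_map_param2:
  assumes "module K V" "module K W" "module K V'" "module K W'" "module K X" "!!x. x .: X ==> islin K W W' (g x)"
    "!!v. v .: W ==> islin K X W' (\<lambda>x. g x v)" "islin K V V' f" "t .: (V ** W)"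
  shows "islin K X (V' ** W') (\<lambda>x. tensor_map K V W V' W' f (g x) t)"
  unfolding tensor_map_def
  by (rule islin_tensor_lift_param)
     (simp_all add: assms bilin_def islin_pure1 islin_pure2 islin_in[OF assms(8)] islin_in[OF assms(6)])

end

context wmb begin

text \<open>\<open>on1 f\<close> and \<open>on2 f\<close> apply \<open>f\<close> to one leg of \<open>A \<otimes> A\<close>; \<open>lm\<close> and \<open>rm\<close> multiply a leg from the left and from the right.\<close>

abbreviation "tA V W f \<equiv> tensor_map K V A W A f (\<lambda>a. a)"
abbreviation "on1 f \<equiv> map_A f idm"
abbreviation "on2 f \<equiv> map_A idm f"
abbreviation "lm1 a \<equiv> on1 (\<lambda>x. a \<cdot> x)"
abbreviation "rm1 a \<equiv> on1 (\<lambda>x. x \<cdot> a)"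
abbreviation "lm2 a \<equiv> on2 (\<lambda>x. a \<cdot> x)"
abbreviation "rm2 a \<equiv> on2 (\<lambda>x. x \<cdot> a)"

lemmas mcong = map_cong[OF A_module A_module A_module A_module]
lemmas AA_eqI = tensor_eqI[OF A_module A_module]

text \<open>Non-degeneracy of \<open>A\<close>, carried over to one leg of a tensor product.\<close>

lemma cancelL1: 
  assumes "module K W" "s .: (A ** W)" "t .: (A ** W)"
    "!!a. a .: A ==> tensor_map K A W A W (\<lambda>x. a \<cdot> x) idm s = tensor_map K A W A W (\<lambda>x. a \<cdot> x) idm t"
  shows "s = t"
  by (rule sep_map1[where I="carrier A" and V'="\<lambda>_. A" and f="\<lambda>a x. a \<cdot> x", OF A_module assms(1) _ _ _ assms(2,3)])
     (simp_all add: nd_l assms(4))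

lemma cancelR1: 
  assumes "module K W" "s .: (A ** W)" "t .: (A ** W)"
    "!!a. a .: A ==> tensor_map K A W A W (\<lambda>x. x \<cdot> a) idm s = tensor_map K A W A W (\<lambda>x. x \<cdot> a) idm t"
  shows "s = t"
  by (rule sep_map1[where I="carrier A" and V'="\<lambda>_. A" and f="\<lambda>a x. x \<cdot> a", OF A_module assms(1) _ _ _ assms(2,3)])
     (simp_all add: nd_r assms(4))

lemma cancelL2: 
  assumes "module K V" "s .: (V ** A)" "t .: (V ** A)"
    "!!a. a .: A ==> tensor_map K V A V A idm (\<lambda>x. a \<cdot> x) s = tensor_map K V A V A idm (\<lambda>x. a \<cdot> x) t"
  shows "s = t"
  by (rule sep_map2[where I="carrier A" and W'="\<lambda>_. A" and f="\<lambda>a x. a \<cdot> x", OF assms(1) A_module _ _ _ assms(2,3)])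
     (simp_all add: nd_l assms(4))

lemma cancelR2: 
  assumes "module K V" "s .: (V ** A)" "t .: (V ** A)"
    "!!a. a .: A ==> tensor_map K V A V A idm (\<lambda>x. x \<cdot> a) s = tensor_map K V A V A idm (\<lambda>x. x \<cdot> a) t"
  shows "s = t"
  by (rule sep_map2[where I="carrier A" and W'="\<lambda>_. A" and f="\<lambda>a x. x \<cdot> a", OF assms(1) A_module _ _ _ assms(2,3)])
     (simp_all add: nd_r assms(4))

lemmas cL1 = cancelL1[OF A_module] and cR1 = cancelR1[OF A_module] and cL2 = cancelL2[OF A_module] and cR2 = cancelR2[OF A_module]

lemma cancel_A: "a .: A ==> b .: A ==> (!!d. d .: A ==> d \<cdot> a = d \<cdot> b) ==> a = b"
  and cancel_A': "a .: A ==> b .: A ==> (!!d. d .: A ==> a \<cdot> d = b \<cdot> d) ==> a = b"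
proof -
  assume ab: "a .: A" "b .: A"
  show "a = b" if "!!d. d .: A ==> d \<cdot> a = d \<cdot> b"
    by (rule eq_from_sub[OF A_module ab], rule nd_l)
       (use ab that in "simp_all add: islin_sub[OF A_module A_module islin_mult1[OF _ islin_id]] m_sub_eq_zero")
  show "a = b" if "!!d. d .: A ==> a \<cdot> d = b \<cdot> d"
    by (rule eq_from_sub[OF A_module ab], rule nd_r)
       (use ab that in "simp_all add: islin_sub[OF A_module A_module islin_mult2[OF _ islin_id]] m_sub_eq_zero")
qed

lemmas s1_map [simp] = sl1_map[OF A_module A_module A_module A_module]
lemmas s2_map [simp] = sl2_map[OF A_module A_module A_module A_module]

lemma s1_eps_T1 [simp]: "a .: A ==> b .: A ==> s1 eps (T1 A (a \<diamondop> b)) = a \<cdot> b"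
  and s2_eps_T2 [simp]: "a .: A ==> b .: A ==> s2 eps (T2 A (a \<diamondop> b)) = a \<cdot> b"
  by (simp_all add: ax)

text \<open>
  Both sides are \<open>(a \<otimes> 1) \<Delta>(b) (1 \<otimes> c)\<close>.  For each slice \<open>w\<close> of the first leg, coassociativity moves
  \<open>p \<mapsto> (w \<otimes> A) T2 (a \<otimes> p)\<close> through \<open>T1\<close>, and \<open>\<epsilon>\<close> after this map is the functional \<open>p \<mapsto> w (a p)\<close>.
\<close>

lemma T1_T2: 
  assumes a: "a .: A" and b: "b .: A" and c: "c .: A"
  shows "lm1 a (T1 A (b \<diamondop> c)) = rm2 c (T2 A (a \<diamondop> b))"
proof (rule sep1[OF A_module A_module])
  fix w assume w: "w \<in> dual A"
  let ?L = "\<lambda>p. s1 w (T2 A (a \<diamondop> p))"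
  have L: "islin K A A ?L" using w a by simp
  have "s1 w (T2 A (a \<diamondop> b)) \<cdot> c = s1 eps (T1 A (?L b \<diamondop> c))" using w a b c by simp
  also have "... = s1 eps (on1 ?L (T1 A (b \<diamondop> c)))" using T1_rcol[OF _ w a b c] by simp
  also have "... = s1 (\<lambda>p. eps (?L p)) (T1 A (b \<diamondop> c))" using L b c by simp
  also have "... = s1 (\<lambda>p. w (a \<cdot> p)) (T1 A (b \<diamondop> c))"
  proof -
    have e: "eps (?L p) = w (a \<cdot> p)" if "p .: A" for p
      using slice_swap[OF A_module A_module _ eps_dual, of w "T2 A (a \<diamondop> p)"] w a that by simp
    show ?thesis by (rule sl1_cong) (use e b c L in simp_all)
  qed
  finally show "s1 w (lm1 a (T1 A (b \<diamondop> c))) = s1 w (rm2 c (T2 A (a \<diamondop> b)))"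
    using w a b c by simp
qed (use a b c in simp_all)

lemma T1_right:
  assumes a: "a .: A" and b: "b .: A" and c: "c .: A"
  shows "T1 A (a \<diamondop> (b \<cdot> c)) = rm2 c (T1 A (a \<diamondop> b))"
proof (rule cL2)
  fix d assume d: "d .: A"
  have "lm2 d (T1 A (a \<diamondop> (b \<cdot> c))) = rm2 (b \<cdot> c) (T3 A (a \<diamondop> d))"
    using a b c d by (simp add: ax)
  also have "... = rm2 c (rm2 b (T3 A (a \<diamondop> d)))"
    using a b c d by simp (rule mcong, simp_all add: m_ass)
  also have "rm2 b (T3 A (a \<diamondop> d)) = lm2 d (T1 A (a \<diamondop> b))"
    using a b d by (simp add: ax)
  also have "rm2 c ... = lm2 d (rm2 c (T1 A (a \<diamondop> b)))"
    using a b c d by simp (rule mcong, simp_all add: m_ass)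
  finally show "lm2 d (T1 A (a \<diamondop> (b \<cdot> c))) = lm2 d (rm2 c (T1 A (a \<diamondop> b)))" .
qed (use a b c in simp_all)

text \<open>
  \<open>T4 (a \<otimes> b)\<close> is \<open>\<Delta>(b) (a \<otimes> 1)\<close>, \<open>T3 (b \<otimes> a)\<close> is \<open>(1 \<otimes> a) \<Delta>(b)\<close>.  The next lemmas express that the four maps come from one
  comultiplication: covering \<open>\<Delta>\<close> by factors on different sides and legs gives the same result.
\<close>

lemma T4_T1:
  assumes a: "a .: A" and b: "b .: A" and c: "c .: A"
  shows "rm2 c (T4 A (a \<diamondop> b)) = rm1 a (T1 A (b \<diamondop> c))"
proof (rule cL1)
  fix d assume d: "d .: A"
  have "lm1 d (rm2 c (T4 A (a \<diamondop> b))) =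
     rm2 c (lm1 d (T4 A (a \<diamondop> b)))" using a b c d by simp
  also have "... = rm2 c (rm1 a (T2 A (d \<diamondop> b)))" using a b d by (simp only: ax)
  also have "... = rm1 a (rm2 c (T2 A (d \<diamondop> b)))" using a b c d by simp
  also have "... = rm1 a (lm1 d (T1 A (b \<diamondop> c)))" using b c d by (simp only: T1_T2)
  also have "... = lm1 d (rm1 a (T1 A (b \<diamondop> c)))"
    using a b c d by simp (rule mcong, simp_all add: m_ass)
  finally show "lm1 d (rm2 c (T4 A (a \<diamondop> b))) =
    lm1 d (rm1 a (T1 A (b \<diamondop> c)))" .
qed (use a b c in simp_all)

lemma T3_T4:
  assumes a: "a .: A" and b: "b .: A" and c: "c .: A"
  shows "rm1 c (T3 A (b \<diamondop> a)) = lm2 a (T4 A (c \<diamondop> b))"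
proof (rule cR2)
  fix d assume d: "d .: A"
  have "rm2 d (rm1 c (T3 A (b \<diamondop> a))) =
     rm1 c (rm2 d (T3 A (b \<diamondop> a)))" using a b c d by simp
  also have "... = rm1 c (lm2 a (T1 A (b \<diamondop> d)))" using a b d by (simp only: ax)
  also have "... = lm2 a (rm1 c (T1 A (b \<diamondop> d)))" using a b c d by simp
  also have "... = lm2 a (rm2 d (T4 A (c \<diamondop> b)))" using b c d by (simp only: T4_T1)
  also have "... = rm2 d (lm2 a (T4 A (c \<diamondop> b)))"
    using a b c d by simp (rule mcong, simp_all add: m_ass)
  finally show "rm2 d (rm1 c (T3 A (b \<diamondop> a))) =
    rm2 d (lm2 a (T4 A (c \<diamondop> b)))" .
qed (use a b c in simp_all)

lemma T2_T3:
  assumes a: "a .: A" and b: "b .: A" and c: "c .: A"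
  shows "lm2 c (T2 A (a \<diamondop> b)) = lm1 a (T3 A (b \<diamondop> c))"
proof (rule cR2)
  fix d assume d: "d .: A"
  have "rm2 d (lm2 c (T2 A (a \<diamondop> b))) =
     lm2 c (rm2 d (T2 A (a \<diamondop> b)))"
    using a b c d by simp (rule mcong, simp_all add: m_ass)
  also have "... = lm2 c (lm1 a (T1 A (b \<diamondop> d)))" using a b d by (simp only: T1_T2)
  also have "... = lm1 a (lm2 c (T1 A (b \<diamondop> d)))" using a b c d by simp
  also have "... = lm1 a (rm2 d (T3 A (b \<diamondop> c)))" using b c d by (simp only: ax)
  also have "... = rm2 d (lm1 a (T3 A (b \<diamondop> c)))" using a b c d by simp
  finally show "rm2 d (lm2 c (T2 A (a \<diamondop> b))) =
    rm2 d (lm1 a (T3 A (b \<diamondop> c)))" .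
qed (use a b c in simp_all)

lemma s2_eps_T4 [simp]:
  assumes a: "a .: A" and b: "b .: A" shows "s2 eps (T4 A (b \<diamondop> a)) = a \<cdot> b"
proof (rule cancel_A)
  fix d assume d: "d .: A"
  have "d \<cdot> s2 eps (T4 A (b \<diamondop> a)) = s2 eps (lm1 d (T4 A (b \<diamondop> a)))" (is "?lhs = _") using a b d by simp
  also have "... = s2 eps (rm1 b (T2 A (d \<diamondop> a)))" using a b d by (simp only: ax)
  also have "... = d \<cdot> (a \<cdot> b)" (is "_ = ?rhs") using a b d by (simp add: m_ass)
  finally show "?lhs = ?rhs" .
qed (use a b in simp_all)

lemma s1_eps_T3 [simp]:
  assumes a: "a .: A" and b: "b .: A" shows "s1 eps (T3 A (a \<diamondop> b)) = b \<cdot> a"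
proof (rule cancel_A')
  fix d assume d: "d .: A"
  have "s1 eps (T3 A (a \<diamondop> b)) \<cdot> d = s1 eps (rm2 d (T3 A (a \<diamondop> b)))" (is "?lhs = _") using a b d by simp
  also have "... = s1 eps (lm2 b (T1 A (a \<diamondop> d)))" using a b d by (simp only: ax)
  also have "... = b \<cdot> a \<cdot> d" (is "_ = ?rhs") using a b d by (simp add: m_ass)
  finally show "?lhs = ?rhs" .
qed (use a b in simp_all)

section \<open>The product of \<open>A \<otimes> A\<close> and products with \<open>\<Delta>\<close>\<close>

text \<open>The product of the algebra \<open>A \<otimes> A\<close>.\<close>

definition star :: "('k, 'a, 'a) tensor => ('k, 'a, 'a) tensor => ('k, 'a, 'a) tensor" (infixl "\<star>" 70) where
  "u \<star> t = tensor_lift K A A AA (\<lambda>c d. map_A (\<lambda>x. x \<cdot> c) (\<lambda>x. x \<cdot> d) u) t"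

lemma star_bilin: "u .: AA ==> bilin K A A AA (\<lambda>c d. map_A (\<lambda>x. x \<cdot> c) (\<lambda>x. x \<cdot> d) u)"
  by (intro bilinI islin_map_param1 islin_map_param2) simp_all

lemma star_pure2 [simp]: "u .: AA ==> c .: A ==> d .: A ==> u \<star> (c \<diamondop> d) = map_A (\<lambda>x. x \<cdot> c) (\<lambda>x. x \<cdot> d) u"
  unfolding star_def by (simp add: star_bilin)

lemma islin_star2 [simp]: "u .: AA ==> islin K X AA f ==> islin K X AA (\<lambda>x. u \<star> f x)"
  unfolding star_def by (simp add: islin_tensor_lift star_bilin)

lemma star_in [simp]: "u .: AA ==> t .: AA ==> u \<star> t .: AA"
  using islin_in[OF islin_star2[OF _ islin_id]] .

lemma islin_star1 [simp]:
  assumes t: "t .: AA" and f: "islin K X AA f" shows "islin K X AA (\<lambda>x. f x \<star> t)"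
proof -
  have "islin K AA AA (\<lambda>u. u \<star> t)" unfolding star_def
    by (rule islin_tensor_lift_param) (simp_all add: t star_bilin)
  from islin_comp[OF this f] show ?thesis .
qed

lemma star_pure1 [simp]: "a .: A ==> b .: A ==> t .: AA ==> (a \<diamondop> b) \<star> t = map_A (\<lambda>x. a \<cdot> x) (\<lambda>x. b \<cdot> x) t"
  by (rule AA_eqI[where Z=AA]) simp_all

text \<open>\<open>E2\<close> is right and \<open>E1\<close> left multiplication by the same multiplier \<open>E\<close>.\<close>

lemma E2_star: 
  assumes u: "u .: AA" and t: "t .: AA" shows "E2 A u \<star> t = u \<star> E1 A t"
proof (rule AA_eqI[where Z=AA, OF _ _ _ u])
  fix a b assume ab: "a .: A" "b .: A"
  show "E2 A (a \<diamondop> b) \<star> t = (a \<diamondop> b) \<star> E1 A t"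
    by (rule AA_eqI[where Z=AA, OF _ _ _ t]) (use ab in "simp_all add: ax(1)")
qed (use t in simp_all)

lemma star_cancelL:
  assumes s: "s .: AA" and t: "t .: AA" and eq: "!!u. u .: AA ==> u \<star> s = u \<star> t" shows "s = t"
proof (rule cL1[OF s t], rule cL2)
  fix a b assume ab: "a .: A" "b .: A"
  show "lm2 b (lm1 a s) = lm2 b (lm1 a t)"
    using eq[of "a \<diamondop> b"] ab s t by simp
qed (use s t in simp_all)

lemma star_cancelR:
  assumes s: "s .: AA" and t: "t .: AA" and eq: "!!u. u .: AA ==> s \<star> u = t \<star> u" shows "s = t"
proof (rule cR1[OF s t], rule cR2)
  fix a b assume ab: "a .: A" "b .: A"
  show "rm2 b (rm1 a s) = rm2 b (rm1 a t)"
    using eq[of "a \<diamondop> b"] ab s t by simp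
qed (use s t in simp_all)

text \<open>Left multiplication by \<open>\<Delta>(x)\<close> on \<open>A \<otimes> A\<close>, extended from \<open>b \<otimes> c \<mapsto> T1 (x \<otimes> c) (b \<otimes> 1)\<close>.\<close>

definition D :: "'a => ('k, 'a, 'a) tensor => ('k, 'a, 'a) tensor" where
  "D x t = tensor_lift K A A AA (\<lambda>b c. rm1 b (T1 A (x \<diamondop> c))) t"

text \<open>Right multiplication by \<open>\<Delta>(x)\<close> on \<open>A \<otimes> A\<close>.\<close>

definition DL :: "'a => ('k, 'a, 'a) tensor => ('k, 'a, 'a) tensor" where
  "DL x s = tensor_lift K A A AA (\<lambda>c z. lm2 z (T2 A (c \<diamondop> x))) s"

lemma D_bilin: "x .: A ==> bilin K A A AA (\<lambda>b c. rm1 b (T1 A (x \<diamondop> c)))"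
  by (intro bilinI islin_map_param1) simp_all

lemma DL_bilin: "x .: A ==> bilin K A A AA (\<lambda>c z. lm2 z (T2 A (c \<diamondop> x)))"
  by (intro bilinI islin_map_param2) simp_all

lemma D_pure [simp]: "x .: A ==> b .: A ==> c .: A ==> D x (b \<diamondop> c) = rm1 b (T1 A (x \<diamondop> c))"
  unfolding D_def by (simp add: D_bilin)

lemma DL_pure [simp]: "x .: A ==> c .: A ==> z .: A ==> DL x (c \<diamondop> z) = lm2 z (T2 A (c \<diamondop> x))"
  unfolding DL_def by (simp add: DL_bilin)

lemma islin_D [simp]: "x .: A ==> islin K X AA f ==> islin K X AA (\<lambda>y. D x (f y))"
  unfolding D_def by (simp add: islin_tensor_lift D_bilin)

lemma islin_DL [simp]: "x .: A ==> islin K X AA f ==> islin K X AA (\<lambda>y. DL x (f y))"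
  unfolding DL_def by (simp add: islin_tensor_lift DL_bilin)

lemma islin_D_arg [simp]: 
  assumes t: "t .: AA" and f: "islin K X A f" shows "islin K X AA (\<lambda>y. D (f y) t)"
proof -
  have "islin K A AA (\<lambda>u. D u t)" unfolding D_def
    by (rule islin_tensor_lift_param) (simp_all add: t D_bilin)
  from islin_comp[OF this f] show ?thesis .
qed

lemma islin_DL_arg [simp]: 
  assumes t: "t .: AA" and f: "islin K X A f" shows "islin K X AA (\<lambda>y. DL (f y) t)"
proof -
  have "islin K A AA (\<lambda>u. DL u t)" unfolding DL_def
    by (rule islin_tensor_lift_param) (simp_all add: t DL_bilin)
  from islin_comp[OF this f] show ?thesis .
qed

lemma D_in [simp]: "x .: A ==> t .: AA ==> D x t .: AA"
  and DL_in [simp]: "x .: A ==> t .: AA ==> DL x t .: AA"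
  using islin_in[OF islin_D[OF _ islin_id]] islin_in[OF islin_DL[OF _ islin_id]] by blast+

text \<open>Associativity \<open>(s \<Delta>(x)) t = s (\<Delta>(x) t)\<close>, which amounts to \<open>T1_T2\<close>.\<close>

lemma DL_star: 
  assumes x: "x .: A" and s: "s .: AA" and t: "t .: AA" shows "DL x s \<star> t = s \<star> D x t"
proof (rule AA_eqI[where Z=AA, OF _ _ _ s])
  fix c z assume cz: "c .: A" "z .: A"
  show "DL x (c \<diamondop> z) \<star> t = (c \<diamondop> z) \<star> D x t"
  proof (rule AA_eqI[where Z=AA, OF _ _ _ t])
    fix b d assume bd: "b .: A" "d .: A"
    have "DL x (c \<diamondop> z) \<star> (b \<diamondop> d) = map_A (\<lambda>u. u \<cdot> b) (\<lambda>u. z \<cdot> u) (rm2 d (T2 A (c \<diamondop> x)))" (is "?lhs = _")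
      using x cz bd by simp (rule mcong, simp_all add: m_ass)
    also have "... = map_A (\<lambda>u. u \<cdot> b) (\<lambda>u. z \<cdot> u) (lm1 c (T1 A (x \<diamondop> d)))" using x cz bd by (simp only: T1_T2)
    also have "... = (c \<diamondop> z) \<star> D x (b \<diamondop> d)" (is "_ = ?rhs") using x cz bd by simp (rule mcong, simp_all add: m_ass)
    finally show "?lhs = ?rhs" .
  qed (use x cz in simp_all)
qed (use x t in simp_all)

lemma T2_star:
  assumes d: "d .: A" and y: "y .: A" and t: "t .: AA"
  shows "T2 A (d \<diamondop> y) \<star> t = lm1 d (D y t)"
proof (rule AA_eqI[where Z=AA, OF _ _ _ t])
  fix b c assume bc: "b .: A" "c .: A"
  have "T2 A (d \<diamondop> y) \<star> (b \<diamondop> c) = rm1 b (rm2 c (T2 A (d \<diamondop> y)))" (is "?lhs = _") using d y bc by simp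
  also have "... = rm1 b (lm1 d (T1 A (y \<diamondop> c)))" using d y bc by (simp only: T1_T2)
  also have "... = lm1 d (D y (b \<diamondop> c))" (is "_ = ?rhs") using d y bc by simp (rule mcong, simp_all add: m_ass)
  finally show "?lhs = ?rhs" .
qed (use d y in simp_all)

lemma T1_mult: 
  assumes a: "a .: A" and b: "b .: A" and c: "c .: A" shows "T1 A (a \<cdot> b \<diamondop> c) = D a (T1 A (b \<diamondop> c))"
proof -
  have "mu_A (A13 (T1 A) (tA A AA (\<lambda>p. a \<diamondop> p) t)) = D a t" if t: "t .: AA" for t
  proof (rule AA_eqI[where Z=AA, OF _ _ _ t])
    show "islin K AA AA (\<lambda>t. mu_A (A13 (T1 A) (tA A AA (\<lambda>p. a \<diamondop> p) t)))"
      using a by (intro islin_map islin_legs13) simp_all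
    fix p q assume pq: "p .: A" "q .: A"
    have "mu_A (A13 (T1 A) (tA A AA (\<lambda>p. a \<diamondop> p) (p \<diamondop> q))) = on1 (\<lambda>u. mu (u \<diamondop> p)) (T1 A (a \<diamondop> q))" (is "?lhs = _")
      using a pq by (simp add: A13_PAA)
    also have "... = D a (p \<diamondop> q)" (is "_ = ?rhs") using a pq by simp (rule mcong, simp_all)
    finally show "?lhs = ?rhs" .
  qed (use a in simp_all)
  moreover have "mu_A (A13 (T1 A) (A23 (T1 A) (PAA (a \<diamondop> b) c))) = T1 A (mu_A (PAA (a \<diamondop> b) c))" using a b c by (intro ax) simp
  ultimately show ?thesis using a b c by (simp add: A23_PAA)
qed

lemma T2_mult:
  assumes d: "d .: A" and y: "y .: A" and c: "c .: A" shows "T2 A (d \<diamondop> (y \<cdot> c)) = DL c (T2 A (d \<diamondop> y))"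
proof (rule cR2)
  fix w assume w: "w .: A"
  have l: "rm2 w (DL c s) = s \<star> T1 A (c \<diamondop> w)" if s: "s .: AA" for s
  proof (rule AA_eqI[where Z=AA, OF _ _ _ s])
    fix p q assume pq: "p .: A" "q .: A"
    have "rm2 w (DL c (p \<diamondop> q)) = lm2 q (rm2 w (T2 A (p \<diamondop> c)))"
      using pq w c by simp (rule mcong, simp_all add: m_ass)
    also have "... = lm2 q (lm1 p (T1 A (c \<diamondop> w)))" using pq w c by (simp only: T1_T2)
    finally show "rm2 w (DL c (p \<diamondop> q)) = (p \<diamondop> q) \<star> T1 A (c \<diamondop> w)" using pq w c by simp
  qed (use w c in simp_all)
  have "rm2 w (T2 A (d \<diamondop> (y \<cdot> c))) = lm1 d (T1 A (y \<cdot> c \<diamondop> w))" using d y c w by (simp add: T1_T2)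
  also have "... = T2 A (d \<diamondop> y) \<star> T1 A (c \<diamondop> w)" using d y c w by (simp add: T1_mult T2_star)
  finally show "rm2 w (T2 A (d \<diamondop> (y \<cdot> c))) = rm2 w (DL c (T2 A (d \<diamondop> y)))" using l d y by simp
qed (use d y c in simp_all)

section \<open>The idempotent \<open>E\<close>\<close>

lemma E1_R: 
  assumes c: "c .: A" and t: "t .: AA"
  shows "E1 A (rm1 c t) = rm1 c (E1 A t)"
    "E1 A (rm2 c t) = rm2 c (E1 A t)"
proof -
  have star_R: "u \<star> rm1 c t = rm1 c (u \<star> t)"
    "u \<star> rm2 c t = rm2 c (u \<star> t)" if u: "u .: AA" and t: "t .: AA" for u t
  proof -
    show "u \<star> rm1 c t = rm1 c (u \<star> t)"
    proof (rule AA_eqI[where Z=AA, OF _ _ _ t])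
      show "u \<star> rm1 c (v \<diamondop> w) = rm1 c (u \<star> (v \<diamondop> w))" if "v .: A" "w .: A" for v w
        using u c that by simp (rule mcong, simp_all add: m_ass)
    qed (use u c in simp_all)
    show "u \<star> rm2 c t = rm2 c (u \<star> t)"
    proof (rule AA_eqI[where Z=AA, OF _ _ _ t])
      show "u \<star> rm2 c (v \<diamondop> w) = rm2 c (u \<star> (v \<diamondop> w))" if "v .: A" "w .: A" for v w
        using u c that by simp (rule mcong, simp_all add: m_ass)
    qed (use u c in simp_all)
  qed
  show "E1 A (rm1 c t) = rm1 c (E1 A t)"
    by (rule star_cancelL) (use c t in "simp_all add: star_R flip: E2_star")
  show "E1 A (rm2 c t) = rm2 c (E1 A t)"
    by (rule star_cancelL) (use c t in "simp_all add: star_R flip: E2_star")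
qed

lemma E2_L: 
  assumes c: "c .: A" and t: "t .: AA"
  shows "E2 A (lm2 c t) = lm2 c (E2 A t)"
proof -
  have star_L: "lm2 c t \<star> u = lm2 c (t \<star> u)" if u: "u .: AA" and t: "t .: AA" for u t
  proof (rule AA_eqI[where Z=AA, OF _ _ _ t])
    show "lm2 c (v \<diamondop> w) \<star> u = lm2 c ((v \<diamondop> w) \<star> u)" if "v .: A" "w .: A" for v w
      using u c that by simp (rule mcong, simp_all add: m_ass)
  qed (use u c in simp_all)
  show ?thesis
    by (rule star_cancelR) (use c t in "simp_all add: star_L E2_star")
qed

lemma E2_idem: "t .: AA ==> E2 A (E2 A t) = E2 A t"
  by (rule star_cancelR) (simp_all add: E2_star ax(2))

text \<open>\<open>\<Delta>(a) (b \<otimes> c)\<close> lies in the range of the idempotent \<open>E1\<close>; cancel the factor \<open>b\<close>.\<close>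

lemma E1_T1 [simp]: 
  assumes t: "t .: AA" shows "E1 A (T1 A t) = T1 A t"
proof (rule AA_eqI[where Z=AA, OF _ _ _ t])
  fix a c assume a: "a .: A" and c: "c .: A"
  show "E1 A (T1 A (a \<diamondop> c)) = T1 A (a \<diamondop> c)"
  proof (rule cR1)
    fix b assume b: "b .: A"
    let ?U = "{t \<in> carrier AA. E1 A t = t}"
    have "submodule ?U K AA"
      by (rule submoduleI') (auto simp: islin_zero[OF AA_module AA_module ops_islin(1)] islin_add[OF ops_islin(1)] islin_smult[OF ops_islin(1)])
    then have "lspan K AA {E1 A (b \<diamondop> c) | b c. b .: A \<and> c .: A} \<subseteq> ?U"
      by (rule lspan_subset) (auto simp: ax(2))
    moreover have "rm1 b (T1 A (a \<diamondop> c)) \<in> lspan K AA {E1 A (b \<diamondop> c) | b c. b .: A \<and> c .: A}"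
      unfolding ax(7)[symmetric] using a b c by (intro lspanI) blast
    ultimately show "rm1 b (E1 A (T1 A (a \<diamondop> c))) = rm1 b (T1 A (a \<diamondop> c))"
      using a b c by (simp add: E1_R(1)[symmetric] subset_iff)
  qed (use a c in simp_all)
qed simp_all

lemma E2_T2 [simp]: 
  assumes t: "t .: AA" shows "E2 A (T2 A t) = T2 A t"
proof (rule AA_eqI[where Z=AA, OF _ _ _ t])
  fix a c assume a: "a .: A" and c: "c .: A"
  show "E2 A (T2 A (a \<diamondop> c)) = T2 A (a \<diamondop> c)"
  proof (rule cL2)
    fix b assume b: "b .: A"
    let ?U = "{t \<in> carrier AA. E2 A t = t}"
    have "submodule ?U K AA"
      by (rule submoduleI') (auto simp: islin_zero[OF AA_module AA_module ops_islin(2)] islin_add[OF ops_islin(2)] islin_smult[OF ops_islin(2)])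
    then have "lspan K AA {E2 A (b \<diamondop> c) | b c. b .: A \<and> c .: A} \<subseteq> ?U"
      by (rule lspan_subset) (auto simp: E2_idem)
    moreover have "lm2 b (T2 A (a \<diamondop> c)) \<in> lspan K AA {E2 A (b \<diamondop> c) | b c. b .: A \<and> c .: A}"
      unfolding ax(8)[symmetric] using a b c by (intro lspanI) blast
    ultimately show "lm2 b (E2 A (T2 A (a \<diamondop> c))) = lm2 b (T2 A (a \<diamondop> c))"
      using a b c by (simp add: E2_L[symmetric] subset_iff)
  qed (use a c in simp_all)
qed simp_all

lemma E1_D [simp]: "x .: A ==> t .: AA ==> E1 A (D x t) = D x t"
  by (rule AA_eqI[where Z=AA]) (simp_all add: E1_R)

lemma E2_DL [simp]: "x .: A ==> t .: AA ==> E2 A (DL x t) = DL x t"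
  by (rule AA_eqI[where Z=AA]) (simp_all add: E2_L)

text \<open>\<open>\<Delta>(x) E = \<Delta>(x)\<close>, transposed from \<open>E \<Delta>(x) = \<Delta>(x)\<close> along the product of \<open>A \<otimes> A\<close>.\<close>

lemma D_E1 [simp]: "x .: A ==> t .: AA ==> D x (E1 A t) = D x t"
  by (rule star_cancelL) (simp_all flip: DL_star E2_star)

lemma DL_E2 [simp]: "x .: A ==> t .: AA ==> DL x (E2 A t) = DL x t"
  by (rule star_cancelR) (simp_all add: DL_star E2_star)

lemma E1_T4 [simp]: 
  assumes a: "a .: A" and b: "b .: A" shows "E1 A (T4 A (a \<diamondop> b)) = T4 A (a \<diamondop> b)"
proof (rule cR2)
  fix c assume c: "c .: A"
  show "rm2 c (E1 A (T4 A (a \<diamondop> b))) = rm2 c (T4 A (a \<diamondop> b))"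
    using a b c by (simp add: T4_T1 E1_R flip: E1_R(2))
qed (use a b in simp_all)

end

locale hopf_wmb = wmb K A + wmb_antipode_data K A R1 R2
  for K :: "'k ring" (structure) and A :: "('k, 'a) wmb" and R1 R2 +
  assumes right_full: right_full and witness: "antipode_witness R1 R2"
begin

lemma R_lin: "R1 \<in> lin K AA AA" "R2 \<in> lin K AA AA"
  and T1_R1 [simp]: "t .: AA ==> T1 A (R1 t) = E1 A t"
  and T2_R2 [simp]: "t .: AA ==> T2 A (R2 t) = E2 A t"
  using witness by (simp_all add: antipode_witness_def)

text \<open>Since \<open>T1 R1 = E1\<close>, this is the condition \<open>R1 T1 R1 = R1\<close>.\<close>

lemma R1_E1 [simp]: "t .: AA ==> R1 (E1 A t) = R1 t"
  using witness unfolding antipode_witness_def by metis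

lemma R_islin [simp]: "islin K AA AA R1" "islin K AA AA R2"
  using R_lin by (auto intro: lin_islin)

lemma islin_R [simp]: "islin K X AA f ==> islin K X AA (\<lambda>x. R1 (f x))" "islin K X AA f ==> islin K X AA (\<lambda>x. R2 (f x))"
  by (rule islin_comp[OF R_islin(1)] islin_comp[OF R_islin(2)]; assumption)+

lemma R_in [simp]: "t .: AA ==> R1 t .: AA" "t .: AA ==> R2 t .: AA"
  using islin_in[OF R_islin(1)] islin_in[OF R_islin(2)] by auto

text \<open>The explicit form of \<open>R1 T1\<close>, on the products that span \<open>A\<close>.\<close>

lemma R1_T1_mult:
  assumes a: "a .: A" and b: "b .: A" and c: "c .: A"
  shows "R1 (T1 A (a \<diamondop> (b \<cdot> c))) = on1 (\<lambda>x. s2 eps (T1 A (a \<diamondop> x))) (tensor_flip K A A (T4 A (c \<diamondop> b)))"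
proof -
  obtain G1 where G1: "is_G1 G1" "!!t. t .: AA ==> R1 (T1 A t) = G1 t"
    using witness by (auto simp: antipode_witness_def)
  have "R1 (T1 A (a \<diamondop> (b \<cdot> c))) = on1 (\<lambda>x. snd (sqR_bar x) a) (tensor_flip K A A (T4 A (c \<diamondop> b)))"
    using G1 a b c by (simp add: is_G1_def)
  also have "... = on1 (\<lambda>x. s2 eps (T1 A (a \<diamondop> x))) (tensor_flip K A A (T4 A (c \<diamondop> b)))"
    by (rule mcong[symmetric]) (use a b c in "simp_all add: sqR_bar_def slice_eq")
  finally show ?thesis .
qed

text \<open>
  By \<open>T2 R2 = E2\<close>, every element of \<open>(A \<otimes> A) E\<close> is a value of \<open>T2\<close>; so \<open>E s\<close> is determined by the products of these
  values with \<open>s\<close>.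
\<close>

lemma E1_eqI:
  assumes s: "s .: AA" and t: "t .: AA"
    and eq: "!!q r. q .: A ==> r .: A ==> T2 A (q \<diamondop> r) \<star> s = T2 A (q \<diamondop> r) \<star> t"
  shows "E1 A s = E1 A t"
proof (rule star_cancelL)
  have *: "T2 A v \<star> s = T2 A v \<star> t" if v: "v .: AA" for v
    by (rule AA_eqI[where Z=AA, OF _ _ _ v]) (simp_all add: s t eq)
  show "u \<star> E1 A s = u \<star> E1 A t" if u: "u .: AA" for u
    using *[of "R2 u"] u s t by (simp add: E2_star)
qed (simp_all add: s t)

text \<open>The slice \<open>x \<mapsto> (w \<otimes> A) ((c \<otimes> 1) \<Delta>(x))\<close>.\<close>

abbreviation L2 where "L2 c w \<equiv> \<lambda>x. s1 w (T2 A (c \<diamondop> x))"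

lemma T1_L2:
  assumes w: "w \<in> dual A" and c: "c .: A" and t: "t .: AA"
  shows "T1 A (on1 (L2 c w) t) = on1 (L2 c w) (T1 A t)"
  by (rule AA_eqI[where Z=AA, OF _ _ _ t]) (use w c T1_rcol[OF _ w c] in simp_all)

text \<open>
  The first leg of \<open>E\<close> commutes with left slices of \<open>\<Delta>\<close>.  One inclusion holds on the range of \<open>E1\<close>, where \<open>E1 = T1 R1\<close> reduces
  it to \<open>T1_L2\<close>.  For the other, \<open>R2\<close> is needed: after multiplication with \<open>(q \<otimes> 1) \<Delta>(r)\<close> one may replace
  \<open>c \<otimes> r\<close> by \<open>(c \<otimes> r) E = T2 (R2 (c \<otimes> r))\<close>, and multiplication by the \<open>\<Delta>\<close> which this produces absorbs \<open>E\<close>.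
\<close>

lemma E1_L2:
  assumes w: "w \<in> dual A" and c: "c .: A" and t: "t .: AA"
  shows "E1 A (on1 (L2 c w) t) = on1 (L2 c w) (E1 A t)"
proof -
  have L: "islin K A A (L2 c w)" using w c by simp
  have half1: "E1 A (on1 (L2 c w) (E1 A t)) = on1 (L2 c w) (E1 A t)"
  proof -
    have "on1 (L2 c w) (E1 A t) = T1 A (on1 (L2 c w) (R1 t))"
      using T1_L2[OF w c, of "R1 t"] t by simp
    then show ?thesis using L t by simp
  qed
  have half2: "E1 A (on1 (L2 c w) t) = E1 A (on1 (L2 c w) (E1 A t))"
  proof (rule E1_eqI)
    fix q r assume q: "q .: A" and r: "r .: A"
    show "T2 A (q \<diamondop> r) \<star> on1 (L2 c w) t = T2 A (q \<diamondop> r) \<star> on1 (L2 c w) (E1 A t)"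
    proof (rule sep2[OF A_module A_module])
      fix f assume f: "f \<in> dual A"
      \<comment> \<open>The factor that the slice \<open>f\<close> of the second leg contributes.\<close>
      define Q where "Q y z = q \<cdot> s2 f (T1 A (z \<diamondop> y))" for y z
      have Q: "islin K A A (Q y)" if "y .: A" for y unfolding Q_def using f q that by simp
      have Q': "islin K A A (\<lambda>y. Q y z)" if "z .: A" for z unfolding Q_def using f q that by simp
      \<comment> \<open>The slice of the left side as a function of \<open>c \<otimes> r\<close> and of the second argument.\<close>
      define \<Phi> where "\<Phi> v = tensor_lift K A A A (\<lambda>x y. s1 w (DL x (on2 (Q y) v)))" for v
      have b: "bilin K A A A (\<lambda>x y. s1 w (DL x (on2 (Q y) v)))" if v: "v .: AA" for v
      proof (rule bilinI)
        show "islin K A A (\<lambda>y. s1 w (DL x (on2 (Q y) v)))" if x: "x .: A" for x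
          using w x by (intro islin_s1 islin_DL islin_map_param2) (use v Q Q' in simp_all)
        show "islin K A A (\<lambda>x. s1 w (DL x (on2 (Q y) v)))" if y: "y .: A" for y
          using w y v Q by simp
      qed
      have \<Phi>_lin: "islin K AA A (\<Phi> v)" if "v .: AA" for v
        unfolding \<Phi>_def using tensor_lift_islin[OF _ _ _ b[OF that]] by simp
      have \<Phi>_lin': "islin K AA A (\<lambda>v. \<Phi> v u)" if u: "u .: AA" for u
        unfolding \<Phi>_def by (rule islin_tensor_lift_param) (use u b Q w in simp_all)
      have \<Phi>_pure: "\<Phi> v (x \<diamondop> y) = s1 w (DL x (on2 (Q y) v))" if "v .: AA" "x .: A" "y .: A" for v x y
        unfolding \<Phi>_def using that b by simp
      have Q_T2: "Q y z = s2 f (rm2 y (T2 A (q \<diamondop> z)))" if "y .: A" "z .: A" for y z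
        using that q f by (simp add: Q_def flip: T1_T2)
      have fy: "islin K A (scalar_space K) (\<lambda>x. f (x \<cdot> y))" if "y .: A" for y using f that by (auto intro: islin_comp)
      have QE: "E2 A (on2 (Q y) v) = on2 (Q y) (E2 A v)" if y: "y .: A" and v: "v .: AA" for y v
      proof (rule AA_eqI[where Z=AA, OF _ _ _ v])
        fix d z assume dz: "d .: A" "z .: A"
        have "Q y x = s2 (\<lambda>x. f (x \<cdot> y)) (T2 A (q \<diamondop> x))" if "x .: A" for x using Q_T2[OF y that] y q that f by simp
        moreover from this have "on2 (\<lambda>c. s2 (\<lambda>x. f (x \<cdot> y)) (T2 A (q \<diamondop> c))) (E2 A (d \<diamondop> z)) = on2 (Q y) (E2 A (d \<diamondop> z))"
          by (intro mcong) (use fy[OF y] q dz in simp_all)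
        ultimately show "E2 A (on2 (Q y) (d \<diamondop> z)) = on2 (Q y) (E2 A (d \<diamondop> z))"
          using E2_T2_lcol[of "\<lambda>x. f (x \<cdot> y)" q z d] fy[OF y] Q[OF y] q dz by simp
      qed (use Q[OF y] in simp_all)
      have a: "s2 f (T2 A (q \<diamondop> r) \<star> on1 (L2 c w) u) = \<Phi> (c \<diamondop> r) u" if u: "u .: AA" for u
      proof (rule AA_eqI[where Z=A, OF _ _ _ u])
        fix x y assume xy: "x .: A" "y .: A"
        have "s2 f (T2 A (q \<diamondop> r) \<star> on1 (L2 c w) (x \<diamondop> y)) = s2 f (rm1 (L2 c w x) (rm2 y (T2 A (q \<diamondop> r))))" (is "?lhs = _")
          using xy q r c w L f by simp
        also have "... = Q y r \<cdot> L2 c w x" using xy q r c w f fy by (simp add: Q_T2)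
        also have "... = \<Phi> (c \<diamondop> r) (x \<diamondop> y)" (is "_ = ?rhs") using xy c r w Q islin_in[OF Q] by (simp add: \<Phi>_pure)
        finally show "?lhs = ?rhs" .
      qed (use f q r L c \<Phi>_lin in simp_all)
      \<comment> \<open>\<open>\<Phi>\<close> absorbs \<open>E2\<close> in its first argument.  On a value \<open>T2 (p \<otimes> s)\<close> it depends on \<open>u\<close> only through \<open>D s u\<close>, so
        there it absorbs \<open>E1\<close> in the second argument.\<close>
      have b': "\<Phi> (E2 A v) u = \<Phi> v u" if v: "v .: AA" and u: "u .: AA" for u v
      proof (rule AA_eqI[where Z=A, OF _ _ _ u])
        fix x y assume xy: "x .: A" "y .: A"
        show "\<Phi> (E2 A v) (x \<diamondop> y) = \<Phi> v (x \<diamondop> y)"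
          using xy v Q[OF xy(2)] by (simp add: \<Phi>_pure QE[symmetric] w)
      qed (use v \<Phi>_lin in simp_all)
      have c': "\<Phi> (T2 A (p \<diamondop> s)) u = q \<cdot> s2 f (on1 (L2 p w) (D s u))" if p: "p .: A" and s: "s .: A" and u: "u .: AA" for p s u
      proof (rule AA_eqI[where Z=A, OF _ _ _ u])
        fix x y assume xy: "x .: A" "y .: A"
        let ?R = "\<lambda>z. s2 f (T1 A (z \<diamondop> y))"
        have R: "islin K A A ?R" using f xy by simp
        have lp: "islin K A A (\<lambda>z. L2 p w (z \<cdot> x))" using w p xy by simp
        have "q \<cdot> s2 f (on1 (L2 p w) (D s (x \<diamondop> y))) = q \<cdot> L2 p w (?R s \<cdot> x)"
          using xy s p w f q lp by simp
        also have "L2 p w (?R s \<cdot> x) = s1 w (DL x (on2 ?R (T2 A (p \<diamondop> s))))"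
          using T2_lcol[where w=f and c=p and x=s and b=y] xy s p f w by (simp add: T2_mult)
        also have "q \<cdot> ... = s1 w (lm2 q (DL x (on2 ?R (T2 A (p \<diamondop> s)))))"
          using q w xy s p R f by simp
        also have "lm2 q (DL x (on2 ?R v)) = DL x (on2 (Q y) v)" if v: "v .: AA" for v
        proof (rule AA_eqI[where Z=AA, OF _ _ _ v])
          fix d z assume dz: "d .: A" "z .: A"
          show "lm2 q (DL x (on2 ?R (d \<diamondop> z))) = DL x (on2 (Q y) (d \<diamondop> z))"
            using dz xy q f R Q[OF xy(2)] islin_in[OF Q[OF xy(2)]]
            by (simp add: Q_def) (rule mcong, simp_all add: m_ass)
        qed (use xy q R Q in simp_all)
        finally show "\<Phi> (T2 A (p \<diamondop> s)) (x \<diamondop> y) = q \<cdot> s2 f (on1 (L2 p w) (D s (x \<diamondop> y)))"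
          using p s xy by (simp add: \<Phi>_pure)
      qed (use p s q f w \<Phi>_lin in simp_all)
      have d: "\<Phi> (T2 A v) (E1 A t) = \<Phi> (T2 A v) t" if v: "v .: AA" for v
        by (rule AA_eqI[where Z=A, OF _ _ _ v])
           (use t c' in "simp_all add: islin_comp[OF \<Phi>_lin']")
      have "\<Phi> (c \<diamondop> r) (E1 A t) = \<Phi> (T2 A (R2 (c \<diamondop> r))) (E1 A t)" using b' c r t by simp
      also have "... = \<Phi> (T2 A (R2 (c \<diamondop> r))) t" by (rule d) (simp add: c r)
      also have "... = \<Phi> (c \<diamondop> r) t" using b' c r t by simp
      finally show "s2 f (T2 A (q \<diamondop> r) \<star> on1 (L2 c w) t) = s2 f (T2 A (q \<diamondop> r) \<star> on1 (L2 c w) (E1 A t))"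
        using a t by simp
    qed (use q r t L c in simp_all)
  qed (use t L in simp_all)
  show ?thesis using half1 half2 by simp
qed

section \<open>Properties of \<open>R1\<close>\<close>

text \<open>\<open>R1 = R1 T1 R1\<close> and \<open>E1 = T1 R1\<close>, so \<open>R1\<close> inherits every symmetry that \<open>T1\<close>, \<open>E1\<close> and \<open>R1 T1\<close> have.\<close>

lemma R1_commutes:
  assumes C: "islin K AA AA C" and T: "!!t. t .: AA ==> T1 A (C t) = C (T1 A t)" and E: "!!t. t .: AA ==> E1 A (C t) = C (E1 A t)"
    and G: "!!a b c. a .: A ==> b .: A ==> c .: A ==> R1 (T1 A (C (a \<diamondop> (b \<cdot> c)))) = C (R1 (T1 A (a \<diamondop> (b \<cdot> c))))"
    and t: "t .: AA"
  shows "R1 (C t) = C (R1 t)"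
proof -
  note Cin = islin_in[OF C]
  have G': "R1 (T1 A (C u)) = C (R1 (T1 A u))" if u: "u .: AA" for u
  proof (rule AA_eqI[where Z=AA, OF _ _ _ u])
    fix a x assume a: "a .: A" and x: "x .: A"
    show "R1 (T1 A (C (a \<diamondop> x))) = C (R1 (T1 A (a \<diamondop> x)))" using x
    proof (induction rule: A_induct)
      case (add x y)
      have i: "islin K A AA (\<lambda>x. R1 (T1 A (C (a \<diamondop> x))))" "islin K A AA (\<lambda>x. C (R1 (T1 A (a \<diamondop> x))))" using a by (simp_all add: islin_comp[OF C])
      show ?case using add by (simp add: islin_add[OF i(1)] islin_add[OF i(2)])
    qed (use G a in simp)
  qed (simp_all add: islin_comp[OF C])
  have "R1 (C t) = R1 (E1 A (C t))" using Cin t by simp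
  also have "... = R1 (C (T1 A (R1 t)))" using E t by simp
  also have "... = R1 (T1 A (C (R1 t)))" using T t by simp
  also have "... = C (R1 (T1 A (R1 t)))" using G' t by simp
  also have "... = C (R1 t)" using t by simp
  finally show ?thesis .
qed

lemma R1_L2:
  assumes w: "w \<in> dual A" and d: "d .: A" and t: "t .: AA"
  shows "R1 (on1 (L2 d w) t) = on1 (L2 d w) (R1 t)"
proof (rule R1_commutes[OF _ T1_L2[OF w d] E1_L2[OF w d] _ t])
  fix a b c assume abc: "a .: A" "b .: A" "c .: A"
  have L: "islin K A A (L2 d w)" using w d by simp
  let ?t = "tensor_flip K A A (T4 A (c \<diamondop> b))"
  have "R1 (T1 A (on1 (L2 d w) (a \<diamondop> (b \<cdot> c)))) = on1 (\<lambda>x. s2 eps (T1 A (L2 d w a \<diamondop> x))) ?t" (is "?lhs = _")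
    using abc w d L by (simp add: R1_T1_mult)
  also have "... = on1 (\<lambda>x. L2 d w (s2 eps (T1 A (a \<diamondop> x)))) ?t"
  proof (rule mcong)
    fix x assume x: "x .: A"
    have "s2 eps (T1 A (L2 d w a \<diamondop> x)) = s2 eps (on1 (L2 d w) (T1 A (a \<diamondop> x)))" (is "?lhs = _") using T1_rcol[OF _ w d abc(1) x] by simp
    also have "... = L2 d w (s2 eps (T1 A (a \<diamondop> x)))" (is "_ = ?rhs") using L abc x by simp
    finally show "?lhs = ?rhs" .
  qed (use abc w d in simp_all)
  also have "... = on1 (L2 d w) (R1 (T1 A (a \<diamondop> (b \<cdot> c))))" (is "_ = ?rhs") using abc L by (simp add: R1_T1_mult)
  finally show "?lhs = ?rhs" .
qed (use w d in simp_all)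

lemma T4_right:
  assumes a: "a .: A" and b: "b .: A" and c: "c .: A"
  shows "T4 A ((a \<cdot> c) \<diamondop> b) = rm1 c (T4 A (a \<diamondop> b))"
proof (rule cL1)
  fix d assume d: "d .: A"
  have "lm1 d (T4 A ((a \<cdot> c) \<diamondop> b)) = rm1 (a \<cdot> c) (T2 A (d \<diamondop> b))" (is "?lhs = _") using a b c d by (simp add: ax)
  also have "... = rm1 c (rm1 a (T2 A (d \<diamondop> b)))" using a b c d by simp (rule mcong, simp_all add: m_ass)
  also have "... = rm1 c (lm1 d (T4 A (a \<diamondop> b)))" using a b d by (simp only: ax)
  also have "... = lm1 d (rm1 c (T4 A (a \<diamondop> b)))" (is "_ = ?rhs") using a b c d by simp (rule mcong, simp_all add: m_ass)
  finally show "?lhs = ?rhs" .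
qed (use a b c in simp_all)

lemma T1_right': 
  assumes c: "c .: A" and t: "t .: AA"
  shows "T1 A (rm2 c t) = rm2 c (T1 A t)"
  by (rule AA_eqI[where Z=AA, OF _ _ _ t]) (use c in "simp_all add: T1_right")

lemma flip_map: 
  assumes "islin K A A f" "islin K A A g" and t: "t .: AA"
  shows "tensor_flip K A A (map_A f g t) = map_A g f (tensor_flip K A A t)"
  by (rule AA_eqI[where Z=AA, OF _ _ _ t]) (simp_all add: assms islin_flip islin_in[OF assms(1)] islin_in[OF assms(2)])

lemma R1_right:
  assumes d: "d .: A" and t: "t .: AA"
  shows "R1 (rm2 d t) = rm2 d (R1 t)"
proof (rule R1_commutes[OF _ T1_right'[OF d] E1_R(2)[OF d] _ t])
  fix a b c assume abc: "a .: A" "b .: A" "c .: A"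
  then show "R1 (T1 A (rm2 d (a \<diamondop> (b \<cdot> c)))) = rm2 d (R1 (T1 A (a \<diamondop> (b \<cdot> c))))"
    using d by (simp add: m_ass R1_T1_mult T4_right flip_map)
qed (use d in simp_all)

text \<open>\<open>S b a\<close> is \<open>S(b) a\<close>, the left component of the multiplier \<open>S(b)\<close>.\<close>

definition S :: "'a => 'a => 'a" where "S b a = s1 eps (R1 (b \<diamondop> a))"

lemma S_antipode: "a .: A ==> fst (antipode R1 R2 b) a = S b a"
  by (simp add: antipode_def S_def slice_eq)

lemma islin_S1 [simp]: "a .: A ==> islin K X A f ==> islin K X A (\<lambda>x. S (f x) a)"
  and islin_S2 [simp]: "b .: A ==> islin K X A f ==> islin K X A (\<lambda>x. S b (f x))"
  by (simp_all add: S_def)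

lemma islin_S2' [simp]: "b .: A ==> islin K A A (S b)" using islin_S2[OF _ islin_id] .

lemma S_in [simp]: "a .: A ==> b .: A ==> S b a .: A"
  by (simp add: S_def)

lemma S_right: "a .: A ==> b .: A ==> c .: A ==> S b (a \<cdot> c) = S b a \<cdot> c"
  unfolding S_def using R1_right[of c "b \<diamondop> a"] by simp

lemma eps_L2: "w \<in> dual A ==> d .: A ==> p .: A ==> eps (L2 d w p) = w (d \<cdot> p)"
  using slice_swap[OF A_module A_module _ eps_dual, of w "T2 A (d \<diamondop> p)"] by simp

lemma dual_mult: "islin K A (scalar_space K) w ==> d .: A ==> islin K A (scalar_space K) (\<lambda>x. w (d \<cdot> x))"
  "islin K A (scalar_space K) w ==> d .: A ==> islin K A (scalar_space K) (\<lambda>x. w (x \<cdot> d))"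
  by (simp_all add: islin_comp[where g=w and W=A])

text \<open>
  This says \<open>R1 (a \<otimes> b) = a\<^sub>1 \<otimes> S(a\<^sub>2) b\<close>, with the first leg covered by \<open>d\<close>; it follows from \<open>R1_L2\<close> because
  the slices \<open>L2 d w\<close> followed by \<open>\<epsilon>\<close> are the functionals \<open>p \<mapsto> w (d p)\<close>.
\<close>

lemma R1_T2:
  assumes d: "d .: A" and a: "a .: A" and b: "b .: A"
  shows "on2 (\<lambda>x. S x b) (T2 A (d \<diamondop> a)) = lm1 d (R1 (a \<diamondop> b))"
proof (rule sep1[OF A_module A_module])
  fix w assume w: "w \<in> dual A"
  have L: "islin K A A (L2 d w)" using w d by simp
  have "s1 w (on2 (\<lambda>x. S x b) (T2 A (d \<diamondop> a))) = S (L2 d w a) b" using w d a b by simp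
  also have "... = s1 eps (on1 (L2 d w) (R1 (a \<diamondop> b)))"
    unfolding S_def using R1_L2[OF w d, of "a \<diamondop> b"] L a b by simp
  also have "... = s1 (\<lambda>p. eps (L2 d w p)) (R1 (a \<diamondop> b))" using L a b by simp
  also have "... = s1 (\<lambda>p. w (d \<cdot> p)) (R1 (a \<diamondop> b))" by (rule sl1_cong) (use w a b d L in "simp_all add: eps_L2")
  finally show "s1 w (on2 (\<lambda>x. S x b) (T2 A (d \<diamondop> a))) = s1 w (lm1 d (R1 (a \<diamondop> b)))"
    using w a b d by simp
qed (use a b d in simp_all)

section \<open>The map \<open>\<sqinter>\<^sup>L\<close>\<close>

text \<open>\<open>PL a b\<close> and \<open>PLr b a\<close> are the products \<open>\<sqinter>\<^sup>L(a) b\<close> and \<open>b \<sqinter>\<^sup>L(a)\<close>; \<open>PLb a b\<close> is the product of the barred variant of \<open>\<sqinter>\<^sup>L(a)\<close> with \<open>b\<close>.\<close>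

definition PL :: "'a => 'a => 'a" where "PL a b = s1 eps (E1 A (a \<diamondop> b))"
definition PLr :: "'a => 'a => 'a" where "PLr b a = s1 eps (T4 A (a \<diamondop> b))"
definition PLb :: "'a => 'a => 'a" where "PLb a b = s1 eps (T2 A (a \<diamondop> b))"

lemma islin_PL [simp]: "b .: A ==> islin K X A f ==> islin K X A (\<lambda>x. PL (f x) b)"
   "a .: A ==> islin K X A f ==> islin K X A (\<lambda>x. PL a (f x))"
   "b .: A ==> islin K X A f ==> islin K X A (\<lambda>x. PLr (f x) b)"
   "a .: A ==> islin K X A f ==> islin K X A (\<lambda>x. PLr a (f x))"
   "b .: A ==> islin K X A f ==> islin K X A (\<lambda>x. PLb (f x) b)"
   "a .: A ==> islin K X A f ==> islin K X A (\<lambda>x. PLb a (f x))"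
  by (simp_all add: PL_def PLr_def PLb_def)

lemma islin_PL' [simp]: "a .: A ==> islin K A A (PL a)" "a .: A ==> islin K A A (PLr a)" "a .: A ==> islin K A A (PLb a)"
  using islin_PL(2,4,6)[OF _ islin_id] by auto

lemma PL_in [simp]: "a .: A ==> b .: A ==> PL a b .: A" "a .: A ==> b .: A ==> PLr a b .: A"
   "a .: A ==> b .: A ==> PLb a b .: A"
  by (simp_all add: PL_def PLr_def PLb_def)

text \<open>In Sweedler notation \<open>a\<^sub>1 S(a\<^sub>2) b = \<sqinter>\<^sup>L(a) b\<close>.\<close>

lemma mu_R1: 
  assumes t: "t .: AA" shows "mu (R1 t) = s1 eps (E1 A t)"
  using ax(4)[of "R1 t"] t by simp

lemma PLr_D: 
  assumes a: "a .: A" and b: "b .: A" and c: "c .: A"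
  shows "PLr b a \<cdot> c = s1 eps (D b (a \<diamondop> c))"
proof -
  have "PLr b a \<cdot> c = s1 eps (rm2 c (T4 A (a \<diamondop> b)))" using a b c by (simp add: PLr_def)
  then show ?thesis using a b c by (simp add: T4_T1 del: s1_map)
qed

text \<open>\<open>b \<sqinter>\<^sup>L(a) c\<close> and its right counterpart both are \<open>(\<epsilon> \<otimes> A) (\<Delta>(b) (a \<otimes> c))\<close>; this makes \<open>\<sqinter>\<^sup>L(a)\<close> a multiplier.\<close>

lemma PL_D:
  assumes a: "a .: A" and b: "b .: A" and c: "c .: A"
  shows "b \<cdot> PL a c = s1 eps (D b (a \<diamondop> c))"
proof -
  have "b \<cdot> PL a c = s1 eps (lm2 b (E1 A (a \<diamondop> c)))" using a b c by (simp add: PL_def)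
  then show ?thesis using a b c by (simp add: ax(11) del: s1_map)
qed

lemma PL_mult: "a .: A ==> b .: A ==> c .: A ==> b \<cdot> PL a c = PLr b a \<cdot> c"
  by (simp add: PLr_D PL_D del: D_pure)

lemma PL_right: "a .: A ==> b .: A ==> c .: A ==> PL a (b \<cdot> c) = PL a b \<cdot> c"
  by (rule cancel_A) (simp_all add: PL_mult flip: m_ass)

lemma PLr_left: "a .: A ==> b .: A ==> c .: A ==> PLr (c \<cdot> b) a = c \<cdot> PLr b a"
  by (rule cancel_A') (simp_all add: m_ass flip: PL_mult)

lemma eps_PLr: "x .: A ==> y .: A ==> eps (PLr x y) = eps (x \<cdot> y)"
  using slice_swap[OF A_module A_module eps_dual eps_dual, of "T4 A (y \<diamondop> x)"] by (simp add: PLr_def)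

text \<open>Elements of \<open>L\<close> commute with \<open>\<Delta>\<close> on the first leg: \<open>\<Delta>(l x) = (l \<otimes> 1) \<Delta>(x)\<close>.\<close>

lemma T1_PL:
  assumes a: "a .: A" and t: "t .: AA"
  shows "T1 A (on1 (PL a) t) = on1 (PL a) (T1 A t)"
proof (rule AA_eqI[where Z=AA, OF _ _ _ t])
  fix x b assume h: "x .: A" "b .: A"
  have "T1 A (PL a x \<diamondop> b) = on1 (\<lambda>p. PL a p) (T1 A (x \<diamondop> b))"
    unfolding PL_def using T1_E1_rcol[where w=eps and c=a and x=x and b=b] a h by simp
  then show "T1 A (on1 (PL a) (x \<diamondop> b)) = on1 (PL a) (T1 A (x \<diamondop> b))" using a h by simp
qed (simp_all add: a)

lemma T4_lcol:
  assumes w: "w \<in> dual A" and c: "c .: A" and x: "x .: A" and b: "b .: A"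
  shows "T4 A (c \<diamondop> s2 w (T1 A (x \<diamondop> b))) = on2 (\<lambda>p. s2 w (T1 A (p \<diamondop> b))) (T4 A (c \<diamondop> x))"
proof (rule cL1)
  let ?R = "\<lambda>p. s2 w (T1 A (p \<diamondop> b))"
  have R: "islin K A A ?R" using w b by simp
  fix d assume d: "d .: A"
  have "lm1 d (T4 A (c \<diamondop> ?R x)) = rm1 c (T2 A (d \<diamondop> ?R x))" (is "?lhs = _") using w c x b d by (simp add: ax)
  also have "... = on2 ?R (rm1 c (T2 A (d \<diamondop> x)))"
    using T2_lcol[where w=w and c=d and x=x and b=b] w c x b d R by simp
  also have "... = on2 ?R (lm1 d (T4 A (c \<diamondop> x)))" using c x d by (simp only: ax)
  also have "... = lm1 d (on2 ?R (T4 A (c \<diamondop> x)))" (is "_ = ?rhs") using c x d R by simp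
  finally show "?lhs = ?rhs" .
qed (use w c x b in simp_all)

lemma T1_PLr:
  assumes a: "a .: A" and x: "x .: A" and b: "b .: A"
  shows "T1 A (PLr x a \<diamondop> b) = on1 (\<lambda>p. PLr p a) (T1 A (x \<diamondop> b))"
proof (rule sep2[OF A_module A_module])
  fix w assume w: "w \<in> dual A"
  have "s2 w (T1 A (PLr x a \<diamondop> b)) = s1 eps (on2 (\<lambda>p. s2 w (T1 A (p \<diamondop> b))) (T4 A (a \<diamondop> x)))"
    unfolding PLr_def using a x b w by simp
  also have "... = PLr (s2 w (T1 A (x \<diamondop> b))) a" unfolding PLr_def using a x b w by (simp only: T4_lcol)
  finally show "s2 w (T1 A (PLr x a \<diamondop> b)) = s2 w (on1 (\<lambda>p. PLr p a) (T1 A (x \<diamondop> b)))" using a x b w by simp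
qed (use a x b in simp_all)

text \<open>\<open>\<Delta>(r l) = \<Delta>(r) (l \<otimes> 1)\<close> for \<open>l = \<sqinter>\<^sup>L(c)\<close>, the right-handed form of \<open>T1_PL\<close>.\<close>

lemma D_PLr:
  assumes r: "r .: A" and c: "c .: A" and t: "t .: AA"
  shows "D (PLr r c) t = D r (on1 (PL c) t)"
proof (rule AA_eqI[where Z=AA, OF _ _ _ t])
  fix x y assume xy: "x .: A" "y .: A"
  show "D (PLr r c) (x \<diamondop> y) = D r (on1 (PL c) (x \<diamondop> y))"
    using r c xy by (simp add: T1_PLr) (rule mcong, simp_all add: PL_mult)
qed (use r c in simp_all)

text \<open>
  \<open>E\<close> commutes with \<open>l \<otimes> 1\<close> for \<open>l\<close> in \<open>L\<close>.  On the range of \<open>E1\<close> this is \<open>T1_PL\<close>; the rest is seen by multiplying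
  with values of \<open>T2\<close>, where \<open>l\<close> can be moved into \<open>\<Delta>\<close>.
\<close>

lemma E1_PL:
  assumes c: "c .: A" and t: "t .: AA"
  shows "E1 A (on1 (PL c) t) = on1 (PL c) (E1 A t)"
proof -
  have "on1 (PL c) (E1 A t) = T1 A (on1 (PL c) (R1 t))" using c t by (simp add: T1_PL)
  then have 1: "E1 A (on1 (PL c) (E1 A t)) = on1 (PL c) (E1 A t)" using c t by simp
  have "E1 A (on1 (PL c) t) = E1 A (on1 (PL c) (E1 A t))"
    by (rule E1_eqI) (use c t in "simp_all add: T2_star flip: D_PLr")
  with 1 show ?thesis by simp
qed

text \<open>\<open>\<sqinter>\<^sup>L(\<sqinter>\<^sup>L(c) a) = \<sqinter>\<^sup>L(c) \<sqinter>\<^sup>L(a)\<close>: the range of \<open>\<sqinter>\<^sup>L\<close> is a subalgebra of the multipliers.\<close>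

lemma PL_PL:
  assumes a: "a .: A" and b: "b .: A" and c: "c .: A"
  shows "PL (PL c a) b = PL c (PL a b)"
proof (rule cancel_A)
  fix x assume x: "x .: A"
  have "x \<cdot> PL (PL c a) b = s1 eps (D x (on1 (PL c) (a \<diamondop> b)))" (is "?lhs = _") using a b c x by (simp add: PL_D del: D_pure)
  also have "... = PLr x c \<cdot> PL a b" using a b c x by (simp add: PL_D del: D_pure map_pure flip: D_PLr)
  also have "... = x \<cdot> PL c (PL a b)" (is "_ = ?rhs") using a b c x by (simp add: PL_mult)
  finally show "?lhs = ?rhs" .
qed (use a b c in simp_all)

lemma PLr_PL: 
  assumes a: "a .: A" and z: "z .: A" and c: "c .: A"
  shows "PLr z (PL a c) = PLr (PLr z a) c"
proof (rule cancel_A')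
  fix d assume d: "d .: A"
  have "PLr z (PL a c) \<cdot> d = z \<cdot> PL a (PL c d)" (is "?lhs = _") using a z c d by (simp add: PL_PL flip: PL_mult)
  also have "... = PLr z a \<cdot> PL c d" using a z c d by (simp add: PL_mult)
  also have "... = PLr (PLr z a) c \<cdot> d" (is "_ = ?rhs") using a z c d by (simp add: PL_mult)
  finally show "?lhs = ?rhs" .
qed (use a z c in simp_all)

text \<open>\<open>b\<^sub>1 \<otimes> \<sqinter>\<^sup>L(b\<^sub>2) c = E (b \<otimes> c)\<close>, covered by \<open>d\<close>.\<close>

lemma T2_PL:
  assumes d: "d .: A" and b: "b .: A" and c: "c .: A"
  shows "on2 (\<lambda>x. PL x c) (T2 A (d \<diamondop> b)) = lm1 d (E1 A (b \<diamondop> c))"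
proof (rule sep1[OF A_module A_module])
  fix w assume w: "w \<in> dual A"
  have L: "islin K A A (L2 d w)" using w d by simp
  have "s1 w (on2 (\<lambda>x. PL x c) (T2 A (d \<diamondop> b))) = s1 eps (E1 A (on1 (L2 d w) (b \<diamondop> c)))" using w d b c by (simp add: PL_def)
  also have "... = s1 (\<lambda>p. eps (L2 d w p)) (E1 A (b \<diamondop> c))" unfolding E1_L2[OF w d pure_in[OF A_module A_module b c]] using L b c by simp
  also have "... = s1 (\<lambda>p. w (d \<cdot> p)) (E1 A (b \<diamondop> c))" by (rule sl1_cong) (use w b c d L in "simp_all add: eps_L2")
  finally show "s1 w (on2 (\<lambda>x. PL x c) (T2 A (d \<diamondop> b))) = s1 w (lm1 d (E1 A (b \<diamondop> c)))" using w b c d by simp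
qed (use b c d in simp_all)

lemma T4_PL:
  assumes d: "d .: A" and b: "b .: A" and c: "c .: A"
  shows "on2 (\<lambda>x. PL x c) (T4 A (d \<diamondop> b)) = E1 A ((b \<cdot> d) \<diamondop> c)"
proof (rule cL1)
  fix p assume p: "p .: A"
  have "lm1 p (on2 (\<lambda>x. PL x c) (T4 A (d \<diamondop> b))) = on2 (\<lambda>x. PL x c) (lm1 p (T4 A (d \<diamondop> b)))"
    using p b c d by simp
  also have "... = on2 (\<lambda>x. PL x c) (rm1 d (T2 A (p \<diamondop> b)))" using p b d by (simp only: ax)
  also have "... = rm1 d (on2 (\<lambda>x. PL x c) (T2 A (p \<diamondop> b)))" using p b c d by simp
  also have "... = rm1 d (lm1 p (E1 A (b \<diamondop> c)))" using p b c by (simp only: T2_PL)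
  also have "... = lm1 p (rm1 d (E1 A (b \<diamondop> c)))" using p b c d by simp (rule mcong, simp_all add: m_ass)
  also have "rm1 d (E1 A (b \<diamondop> c)) = E1 A ((b \<cdot> d) \<diamondop> c)" using b c d E1_R(1)[of d "b \<diamondop> c"] by simp
  finally show "lm1 p (on2 (\<lambda>x. PL x c) (T4 A (d \<diamondop> b))) = lm1 p (E1 A ((b \<cdot> d) \<diamondop> c))" .
qed (use b c d in simp_all)

text \<open>The same identity for right multiplication: \<open>(p \<otimes> q) E (c \<otimes> 1) = p c\<^sub>1 \<otimes> q \<sqinter>\<^sup>L(c\<^sub>2)\<close>.\<close>

lemma T2_PLr:
  assumes p: "p .: A" and q: "q .: A" and c: "c .: A"
  shows "on2 (\<lambda>x. PLr q x) (T2 A (p \<diamondop> c)) = rm1 c (E2 A (p \<diamondop> q))"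
proof (rule cR2)
  fix w assume w: "w .: A"
  have "rm2 w (on2 (\<lambda>x. PLr q x) (T2 A (p \<diamondop> c))) = lm2 q (on2 (\<lambda>x. PL x w) (T2 A (p \<diamondop> c)))"
    using p q c w by simp (rule mcong, simp_all add: PL_mult)
  also have "... = (p \<diamondop> q) \<star> E1 A (c \<diamondop> w)" using p q c w by (simp add: T2_PL del: map_map) simp
  also have "... = rm2 w (rm1 c (E2 A (p \<diamondop> q)))" using p q c w by (simp flip: E2_star del: star_pure1)
  finally show "rm2 w (on2 (\<lambda>x. PLr q x) (T2 A (p \<diamondop> c))) =
     rm2 w (rm1 c (E2 A (p \<diamondop> q)))" .
qed (use p q c in simp_all)

text \<open>The transpose of \<open>E1_PL\<close> along the product of \<open>A \<otimes> A\<close>.\<close>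

lemma E2_PLr:
  assumes a: "a .: A" and t: "t .: AA"
  shows "E2 A (on1 (\<lambda>u. PLr u a) t) = on1 (\<lambda>u. PLr u a) (E2 A t)"
proof (rule star_cancelR)
  have adj: "on1 (\<lambda>u. PLr u a) t \<star> s = t \<star> on1 (PL a) s" if t: "t .: AA" and s: "s .: AA" for s t
  proof (rule AA_eqI[where Z=AA, OF _ _ _ s])
    fix x y assume xy: "x .: A" "y .: A"
    show "on1 (\<lambda>u. PLr u a) t \<star> (x \<diamondop> y) = t \<star> on1 (PL a) (x \<diamondop> y)"
      using a t xy by simp (rule mcong, simp_all add: PL_mult)
  qed (use a t in simp_all)
  show "E2 A (on1 (\<lambda>u. PLr u a) t) \<star> u = on1 (\<lambda>u. PLr u a) (E2 A t) \<star> u" if u: "u .: AA" for u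
    using u a t by (simp add: E2_star adj E1_PL)
qed (use a t in simp_all)

text \<open>
  The axiom relating \<open>\<epsilon>\<close>, \<open>E2\<close> and \<open>T2\<close> moves \<open>\<Delta>\<close> to \<open>E\<close>, and \<open>E2\<close> and \<open>E1\<close> are exchanged by covering with \<open>y\<close>.  The left side
  depends on \<open>a\<close> only through \<open>\<sqinter>\<^sup>L(a)\<close>, and so does the right side; this is what makes \<open>dl\<close> well defined.
\<close>

lemma PLb_PLr:
  assumes a: "a .: A" and z: "z .: A" and c: "c .: A"
  shows "PLb (PLr z a) c = s1 (\<lambda>x. eps (z \<cdot> x)) (E1 A (a \<diamondop> c))"
proof (rule cancel_A)
  have ez: "islin K A (scalar_space K) (\<lambda>x. eps (z \<cdot> x))" using z by simp
  fix y assume y: "y .: A"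
  have "y \<cdot> PLb (PLr z a) c = s1 eps (lm2 y (T2 A (PLr z a \<diamondop> c)))" (is "?lhs = _") using a z c y by (simp add: PLb_def)
  also have "... = s1 eps (rm2 c (E2 A (PLr z a \<diamondop> y)))" using a z c y by (simp add: ax(12) del: s1_map)
  also have "E2 A (PLr z a \<diamondop> y) = on1 (\<lambda>u. PLr u a) (E2 A (z \<diamondop> y))" using E2_PLr[OF a, of "z \<diamondop> y"] a z y by simp
  also have "s1 eps (rm2 c ...) = s1 (\<lambda>u. eps (PLr u a)) (rm2 c (E2 A (z \<diamondop> y)))" using a z c y by simp
  also have "... = s1 (\<lambda>u. eps (u \<cdot> a)) (rm2 c (E2 A (z \<diamondop> y)))" by (rule sl1_cong) (use a z c y in "simp_all add: eps_PLr")
  also have "... = s1 eps (map_A (\<lambda>x. x \<cdot> a) (\<lambda>x. x \<cdot> c) (E2 A (z \<diamondop> y)))" using a z c y by simp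
  also have "... = s1 eps (map_A (\<lambda>x. z \<cdot> x) (\<lambda>x. y \<cdot> x) (E1 A (a \<diamondop> c)))" using a z c y by (simp only: ax(1))
  also have "... = y \<cdot> s1 (\<lambda>x. eps (z \<cdot> x)) (E1 A (a \<diamondop> c))" (is "_ = ?rhs") using a z c y by simp
  finally show "?lhs = ?rhs" .
qed (use a z c in simp_all)

text \<open>\<open>(z \<otimes> 1) \<Delta>(m b) = (z m \<otimes> 1) \<Delta>(b)\<close> for \<open>m\<close> in \<open>L\<close>.\<close>

lemma PLb_PL:
  assumes m: "m .: A" and z: "z .: A" and b: "b .: A"
  shows "PLb z (PL m b) = PLb (PLr z m) b"
proof -
  have "T2 A (z \<diamondop> PL m b) = T2 A (PLr z m \<diamondop> b)"
  proof (rule cR2)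
    fix w assume w: "w .: A"
    have "rm2 w (T2 A (z \<diamondop> PL m b)) = lm1 z (T1 A (on1 (PL m) (b \<diamondop> w)))" (is "?lhs = _") using m z b w by (simp add: T1_T2)
    also have "... = lm1 (PLr z m) (T1 A (b \<diamondop> w))" unfolding T1_PL[OF m pure_in[OF A_module A_module b w]]
      using m z b w by simp (rule mcong, simp_all add: PL_mult)
    also have "... = rm2 w (T2 A (PLr z m \<diamondop> b))" (is "_ = ?rhs") using m z b w by (simp add: T1_T2)
    finally show "?lhs = ?rhs" .
  qed (use m z b in simp_all)
  then show ?thesis by (simp add: PLb_def)
qed

text \<open>\<open>dl a u b\<close> is \<open>\<delta>(\<sqinter>\<^sup>L(a)) (u \<otimes> b)\<close> for the comultiplication \<open>\<delta>\<close> on \<open>L\<close> that is constructed below.\<close>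

definition dl :: "'a => 'a => 'a => ('k, 'a, 'a) tensor" where
  "dl a u b = on1 (\<lambda>y. PL y u) (E1 A (a \<diamondop> b))"

lemma dl_in [simp]: "a .: A ==> u .: A ==> b .: A ==> dl a u b .: AA"
  by (simp add: dl_def)

lemma PLb_bilin: "a .: A ==> b .: A ==> bilin K A A AA (\<lambda>z w. w \<diamondop> PLb (PLr z a) b)"
  by (intro bilinI) simp_all

text \<open>
  \<open>x \<sqinter>\<^sup>L(y) u = (\<epsilon> \<otimes> A) (\<Delta>(x) (y \<otimes> u))\<close> slices the first leg of \<open>E\<close> by functionals \<open>\<epsilon> (z -)\<close>, and
  \<open>PLb_PLr\<close> computes these slices.  Consequently \<open>dl a u b\<close> depends on \<open>a\<close> and \<open>b\<close> only through the
  products \<open>PLb (PLr z a) b\<close>.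
\<close>

lemma dl_formula:
  assumes a: "a .: A" and u: "u .: A" and b: "b .: A" and x: "x .: A"
  shows "lm1 x (dl a u b) = tensor_lift K A A AA (\<lambda>z w. w \<diamondop> PLb (PLr z a) b) (T1 A (x \<diamondop> u))"
proof -
  have l: "islin K A (scalar_space K) (\<lambda>z. eps (z \<cdot> y))" if "y .: A" for y using that by simp
  have l': "islin K A A (\<lambda>y. s1 (\<lambda>z. eps (z \<cdot> y)) t)" if t: "t .: AA" for t
  proof (rule iffD1[OF islin_cong])
    show "islin K A A (\<lambda>y. s1 eps (rm1 y t))"
      by (rule islin_s1[OF A_module A_module eps_dual islin_map_param1]) (use t in simp_all)
  qed (use t in simp_all)
  have "lm1 x (dl a u b) = on1 (\<lambda>y. x \<cdot> PL y u) (E1 A (a \<diamondop> b))" using a u b x by (simp add: dl_def)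
  also have "... = on1 (\<lambda>y. s1 (\<lambda>z. eps (z \<cdot> y)) (T1 A (x \<diamondop> u))) (E1 A (a \<diamondop> b))"
    by (rule mcong) (use a u b x in "simp_all add: PL_D")
  also have "... = tensor_lift K A A AA (\<lambda>z w. w \<diamondop> PLb (PLr z a) b) (T1 A (x \<diamondop> u))"
  proof (rule AA_eqI[where Z=AA and t="T1 A (x \<diamondop> u)" and f="\<lambda>t. on1 (\<lambda>y. s1 (\<lambda>z. eps (z \<cdot> y)) t) (E1 A (a \<diamondop> b))"])
    show "islin K AA AA (\<lambda>t. on1 (\<lambda>y. s1 (\<lambda>z. eps (z \<cdot> y)) t) (E1 A (a \<diamondop> b)))"
      by (rule islin_map_param1) (use a b l' in simp_all)
    show "islin K AA AA (tensor_lift K A A AA (\<lambda>z w. w \<diamondop> PLb (PLr z a) b))" using a b by (intro tensor_lift_islin PLb_bilin) simp_all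
    fix z w assume zw: "z .: A" "w .: A"
    have ez: "islin K A (scalar_space K) (\<lambda>x. eps (z \<cdot> x))" using zw by simp
    note sc = islin_scaled[OF A_module zw(2) ez]
    have "on1 (\<lambda>y. s1 (\<lambda>z. eps (z \<cdot> y)) (z \<diamondop> w)) (E1 A (a \<diamondop> b)) = on1 (\<lambda>y. eps (z \<cdot> y) \<odot>\<^bsub>A\<^esub> w) (E1 A (a \<diamondop> b))" (is "?lhs = _")
      by (rule mcong) (use a b zw l' in simp_all)
    also have "... = w \<diamondop> s1 (\<lambda>y. eps (z \<cdot> y)) (E1 A (a \<diamondop> b))"
    proof (rule AA_eqI[where Z=AA and t="E1 A (a \<diamondop> b)" and f="on1 (\<lambda>y. eps (z \<cdot> y) \<odot>\<^bsub>A\<^esub> w)" and g="\<lambda>s. w \<diamondop> s1 (\<lambda>y. eps (z \<cdot> y)) s"])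
      fix p q assume pq: "p .: A" "q .: A"
      have e: "eps (z \<cdot> p) .: K" using islin_in[OF ez] pq by simp
      show "on1 (\<lambda>y. eps (z \<cdot> y) \<odot>\<^bsub>A\<^esub> w) (p \<diamondop> q) = w \<diamondop> s1 (\<lambda>y. eps (z \<cdot> y)) (p \<diamondop> q)"
        using zw pq sc ez e
        by (simp add: islin_smult[OF islin_pure1[OF A_module A_module _ islin_id]] islin_smult[OF islin_pure2[OF A_module A_module _ islin_id]])
    qed (use a b zw ez sc in simp_all)
    also have "... = tensor_lift K A A AA (\<lambda>z w. w \<diamondop> PLb (PLr z a) b) (z \<diamondop> w)" (is "_ = ?rhs") using a b zw by (simp add: PLb_PLr PLb_bilin)
    finally show "?lhs = ?rhs" .
  qed (use x u in simp_all)
  finally show ?thesis .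
qed

lemma tensor_lift_cong:
  assumes "module K V" "module K W" "module K Z" "bilin K V W Z b" "t .: (V ** W)"
    "!!v w. v .: V ==> w .: W ==> b v w = b' v w"
  shows "tensor_lift K V W Z b t = tensor_lift K V W Z b' t"
  using tensor_lift_unique[OF assms(1-3) tensor_lift_islin[OF assms(1-4)] assms(5), of b'] assms by simp

lemma dl_cong:
  assumes a: "a .: A" "a' .: A" and b: "b .: A" "b' .: A" and u: "u .: A"
    and eq: "!!z. z .: A ==> PLb (PLr z a) b = PLb (PLr z a') b'"
  shows "dl a u b = dl a' u b'"
proof (rule cL1)
  fix x assume x: "x .: A"
  show "lm1 x (dl a u b) = lm1 x (dl a' u b')"
    unfolding dl_formula[OF a(1) u b(1) x] dl_formula[OF a(2) u b(2) x]
    by (rule tensor_lift_cong) (use a b u x eq PLb_bilin in simp_all)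
qed (use a b u in simp_all)

lemma PL_determines_PLr:
  assumes a: "a .: A" "a' .: A" and eq: "!!b. b .: A ==> PL a b = PL a' b" and z: "z .: A"
  shows "PLr z a = PLr z a'"
  by (rule cancel_A') (use assms in "simp_all flip: PL_mult")

text \<open>\<open>\<delta>\<close> is well defined on \<open>L\<close>.\<close>

lemma dl_dep:
  assumes a: "a .: A" "a' .: A" and eq: "!!b. b .: A ==> PL a b = PL a' b" and u: "u .: A" and b: "b .: A"
  shows "dl a u b = dl a' u b"
  by (rule dl_cong[OF a b b u]) (simp add: PL_determines_PLr[OF a eq])

text \<open>\<open>\<delta> (l m) = \<delta>(l) (1 \<otimes> m)\<close>, and in the next lemma \<open>\<delta> (m l) = (m \<otimes> 1) \<delta>(l)\<close>.\<close>

lemma dl_right: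
  assumes a: "a .: A" and c: "c .: A" and u: "u .: A" and b: "b .: A"
  shows "dl (PL a c) u b = dl a u (PL c b)"
  by (rule dl_cong) (use assms in "simp_all add: PLr_PL PLb_PL")

lemma dl_left:
  assumes a: "a .: A" and c: "c .: A" and u: "u .: A" and b: "b .: A"
  shows "dl (PL c a) u b = on1 (PL c) (dl a u b)"
proof -
  have "dl (PL c a) u b = on1 (\<lambda>y. PL y u) (on1 (PL c) (E1 A (a \<diamondop> b)))"
    unfolding dl_def using E1_PL[OF c, of "a \<diamondop> b"] a b c by simp
  also have "... = on1 (PL c) (dl a u b)" unfolding dl_def using a b c u by simp (rule mcong, simp_all add: PL_PL)
  finally show ?thesis .
qed

text \<open>Slices of the first leg turn \<open>E (x \<otimes> y)\<close> into products \<open>\<sqinter>\<^sup>L(x') y\<close>, for which the claim is \<open>PL_PL\<close>.\<close>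

lemma E1_PL2:
  assumes x: "x .: A" and y: "y .: A" and b: "b .: A"
  shows "on2 (\<lambda>x. PL x b) (E1 A (x \<diamondop> y)) = E1 A (x \<diamondop> PL y b)"
proof (rule cL1)
  fix d assume d: "d .: A"
  show "lm1 d (on2 (\<lambda>x. PL x b) (E1 A (x \<diamondop> y))) = lm1 d (E1 A (x \<diamondop> PL y b))"
  proof (rule sep1[OF A_module A_module])
    fix w assume w: "w \<in> dual A"
    have e: "s1 w (lm1 d (E1 A (x \<diamondop> c))) = PL (L2 d w x) c" if c: "c .: A" for c
      unfolding T2_PL[OF d x c, symmetric] using c d x w by simp
    have "s1 w (lm1 d (on2 (\<lambda>x. PL x b) (E1 A (x \<diamondop> y)))) = PL (s1 w (lm1 d (E1 A (x \<diamondop> y)))) b"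
      using d w x y b by simp
    also have "... = s1 w (lm1 d (E1 A (x \<diamondop> PL y b)))"
      using e[of y] e[of "PL y b"] d w x y b by (simp add: PL_PL del: s1_map)
    finally show "s1 w (lm1 d (on2 (\<lambda>x. PL x b) (E1 A (x \<diamondop> y)))) =
        s1 w (lm1 d (E1 A (x \<diamondop> PL y b)))" .
  qed (use d x y b in simp_all)
qed (use x y b in simp_all)

lemma PL_bilin: "bilin K A A A PL"
  by (intro bilinI) simp_all

lemma lift_PL: "t .: AA ==> tensor_lift K A A A PL t = s1 eps (E1 A t)"
  by (rule tensor_lift_unique) (simp_all add: PL_def)

text \<open>\<open>\<sqinter>\<^sup>L(a\<^sub>1) a\<^sub>2 b = a b\<close>.  As \<open>A\<close> is idempotent, the elements \<open>\<sqinter>\<^sup>L(x) y\<close> therefore span \<open>A\<close>.\<close>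

lemma lift_PL_T1: "a .: A ==> b .: A ==> tensor_lift K A A A PL (T1 A (a \<diamondop> b)) = a \<cdot> b"
  by (simp add: lift_PL)

lemma lift_PL_E1: "a .: A ==> b .: A ==> tensor_lift K A A A PL (E1 A (a \<diamondop> b)) = PL a b"
  by (simp add: lift_PL ax(2) PL_def)

section \<open>The map \<open>\<sqinter>\<^sup>R\<close>\<close>

text \<open>\<open>PR x y\<close> is \<open>\<sqinter>\<^sup>R(x) y = y\<^sub>1 \<epsilon>(x y\<^sub>2)\<close>.\<close>

definition PR :: "'a => 'a => 'a" where "PR x y = s2 eps (T3 A (y \<diamondop> x))"

lemma islin_PR [simp]: "b .: A ==> islin K X A f ==> islin K X A (\<lambda>x. PR (f x) b)"
   "a .: A ==> islin K X A f ==> islin K X A (\<lambda>x. PR a (f x))"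
  by (simp_all add: PR_def)

lemma islin_PR' [simp]: "a .: A ==> islin K A A (PR a)"
  using islin_PR(2)[OF _ islin_id] by auto

lemma PR_in [simp]: "a .: A ==> b .: A ==> PR a b .: A"
  by (simp add: PR_def)

lemma PR_bilin: "bilin K A A A PR"
  by (intro bilinI) simp_all

lemma PR_left: 
  assumes d: "d .: A" and x: "x .: A" and y: "y .: A"
  shows "d \<cdot> PR x y = s2 (\<lambda>q. eps (x \<cdot> q)) (T2 A (d \<diamondop> y))"
proof -
  have "d \<cdot> PR x y = s2 eps (lm1 d (T3 A (y \<diamondop> x)))" using d x y by (simp add: PR_def)
  also have "... = s2 eps (lm2 x (T2 A (d \<diamondop> y)))" using d x y by (simp only: T2_T3)
  finally show ?thesis using d x y by simp
qed

lemma eps_PR: "x .: A ==> y .: A ==> eps (PR x y) = eps (x \<cdot> y)"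
  using slice_swap[OF A_module A_module eps_dual eps_dual, of "T3 A (y \<diamondop> x)"] by (simp add: PR_def)

text \<open>\<open>\<epsilon> (x -)\<close> does not distinguish \<open>s \<Delta>(c)\<close> from \<open>s E (c \<otimes> 1)\<close> on the second leg, and \<open>s = (d \<otimes> 1) \<Delta>(y)\<close> absorbs \<open>E\<close>.\<close>

lemma PR_right:
  assumes x: "x .: A" and y: "y .: A" and c: "c .: A"
  shows "PR x (y \<cdot> c) = PR x y \<cdot> c"
proof (rule cancel_A)
  fix d assume d: "d .: A"
  let ?e = "\<lambda>q. eps (x \<cdot> q)"
  have e: "islin K A (scalar_space K) ?e" using x by simp
  have *: "s2 ?e (DL c s) = s2 ?e (rm1 c (E2 A s))" if s: "s .: AA" for s
  proof (rule AA_eqI[where Z=A, OF _ _ _ s])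
    fix p q assume pq: "p .: A" "q .: A"
    have "s2 ?e (DL c (p \<diamondop> q)) = s2 (\<lambda>r. eps (x \<cdot> (q \<cdot> r))) (T2 A (p \<diamondop> c))" (is "?lhs = _") using pq c x e by simp
    also have "... = s2 (\<lambda>r. ?e (PLr q r)) (T2 A (p \<diamondop> c))"
    proof (rule sl2_cong)
      fix r assume r: "r .: A"
      have "eps (x \<cdot> (q \<cdot> r)) = eps (PLr (x \<cdot> q) r)" using x pq r by (simp add: eps_PLr m_ass)
      then show "eps (x \<cdot> (q \<cdot> r)) = eps (x \<cdot> PLr q r)" using x pq r by (simp add: PLr_left)
    qed (use x pq c in simp_all)
    also have "... = s2 ?e (on2 (\<lambda>r. PLr q r) (T2 A (p \<diamondop> c)))" using pq c e x by simp
    also have "... = s2 ?e (rm1 c (E2 A (p \<diamondop> q)))" (is "_ = ?rhs") using pq c by (simp only: T2_PLr)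
    finally show "?lhs = ?rhs" .
  qed (use c e in simp_all)
  have "d \<cdot> PR x (y \<cdot> c) = s2 ?e (DL c (T2 A (d \<diamondop> y)))" (is "?lhs = _") using d x y c by (simp add: PR_left T2_mult)
  also have "... = s2 ?e (rm1 c (T2 A (d \<diamondop> y)))" using d y by (simp add: *)
  also have "... = d \<cdot> (PR x y \<cdot> c)" (is "_ = ?rhs") using d x y c e by (simp add: PR_left flip: m_ass)
  finally show "?lhs = ?rhs" .
qed (use x y c in simp_all)

text \<open>\<open>\<sqinter>\<^sup>R(x) y\<close> enters \<open>\<sqinter>\<^sup>R\<close> only through the functional \<open>\<epsilon> (\<sqinter>\<^sup>R(x) y q) = \<epsilon> (x y q)\<close>.\<close>

lemma PR_PR:
  assumes x: "x .: A" and y: "y .: A" and z: "z .: A"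
  shows "PR (PR x y) z = PR (x \<cdot> y) z"
proof (rule cancel_A)
  fix d assume d: "d .: A"
  have "eps (PR x y \<cdot> q) = eps (x \<cdot> y \<cdot> q)" if q: "q .: A" for q
  proof -
    have "eps (PR x y \<cdot> q) = eps (PR x (y \<cdot> q))" using x y q by (simp add: PR_right)
    also have "... = eps (x \<cdot> (y \<cdot> q))" using x y q by (simp add: eps_PR)
    finally show ?thesis using x y q by (simp add: m_ass)
  qed
  then show "d \<cdot> PR (PR x y) z = d \<cdot> PR (x \<cdot> y) z" using d x y z by (simp add: PR_left, intro sl2_cong) simp_all
qed (use x y z in simp_all)

text \<open>In Sweedler notation \<open>S(a\<^sub>1) a\<^sub>2 x = \<sqinter>\<^sup>R(a) x\<close>, read off from the explicit form of \<open>R1 T1\<close>.\<close>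

lemma eps_R1_T1_pure:
  assumes a: "a .: A" and x: "x .: A"
  shows "s1 eps (R1 (T1 A (a \<diamondop> x))) = PR a x"
  using x
proof (induction rule: A_induct)
  case (mult b c)
  let ?t = "T4 A (c \<diamondop> b)"
  have t: "tensor_flip K A A ?t .: AA" using mult by simp
  have "s1 eps (R1 (T1 A (a \<diamondop> (b \<cdot> c)))) = s1 (\<lambda>x. eps (s2 eps (T1 A (a \<diamondop> x)))) (tensor_flip K A A ?t)"
    using a mult t by (simp add: R1_T1_mult)
  also have "... = s1 (\<lambda>x. eps (a \<cdot> x)) (tensor_flip K A A ?t)"
  proof (rule sl1_cong)
    show "eps (s2 eps (T1 A (a \<diamondop> x))) = eps (a \<cdot> x)" if "x .: A" for x
      using slice_swap[OF A_module A_module eps_dual eps_dual, of "T1 A (a \<diamondop> x)"] that a by simp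
  qed (use a t in simp_all)
  also have "... = s2 (\<lambda>x. eps (a \<cdot> x)) ?t"
    using sl2_flip[OF A_module A_module, of "\<lambda>x. eps (a \<cdot> x)" "tensor_flip K A A ?t"] a mult by simp
  also have "... = s2 eps (lm2 a ?t)" using a mult by simp
  also have "... = s2 eps (rm1 c (T3 A (b \<diamondop> a)))" using a mult by (simp only: T3_T4)
  also have "... = PR a (b \<cdot> c)" using a mult by (simp add: PR_right) (simp add: PR_def)
  finally show ?case .
next
  case (add x y)
  have i: "islin K A A (\<lambda>x. s1 eps (R1 (T1 A (a \<diamondop> x))))" using a by simp
  show ?case using add a by (simp add: islin_add[OF i] islin_add[OF islin_PR'])
qed

lemma eps_R1_T1:
  assumes t: "t .: AA" shows "s1 eps (R1 (T1 A t)) = tensor_lift K A A A PR t"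
  by (rule AA_eqI[where Z=A, OF _ _ _ t]) (simp_all add: eps_R1_T1_pure PR_bilin islin_tensor_lift)

lemma lift_PR_in [simp]: "t .: AA ==> tensor_lift K A A A PR t .: A"
  by (simp add: tensor_lift_in PR_bilin)

text \<open>A map that commutes with \<open>\<Delta>\<close> on the first leg does so however \<open>\<Delta>\<close> is covered.\<close>

lemma T3_rcol:
  assumes L: "islin K A A L" and r: "!!x b. x .: A ==> b .: A ==> T1 A (L x \<diamondop> b) = on1 L (T1 A (x \<diamondop> b))"
    and x: "x .: A" and b: "b .: A"
  shows "T3 A (L x \<diamondop> b) = on1 L (T3 A (x \<diamondop> b))"
proof (rule cR2)
  note Lx = islin_in[OF L]
  fix e assume e: "e .: A"
  have "rm2 e (T3 A (L x \<diamondop> b)) = lm2 b (T1 A (L x \<diamondop> e))" (is "?lhs = _") using Lx x b e by (simp add: ax)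
  also have "... = on1 L (lm2 b (T1 A (x \<diamondop> e)))" using L x b e by (simp add: r)
  also have "... = on1 L (rm2 e (T3 A (x \<diamondop> b)))" using x b e by (simp only: ax)
  also have "... = rm2 e (on1 L (T3 A (x \<diamondop> b)))" (is "_ = ?rhs") using L x b e by simp
  finally show "?lhs = ?rhs" .
qed (use L x b islin_in[OF L] in simp_all)

lemma T2_PR:
  assumes d: "d .: A" and x: "x .: A" and y: "y .: A"
  shows "T2 A (d \<diamondop> PR x y) = on2 (PR x) (T2 A (d \<diamondop> y))"
proof (rule sep1[OF A_module A_module])
  fix w assume w: "w \<in> dual A"
  have L: "islin K A A (L2 d w)" using w d by simp
  have "T3 A (L2 d w y \<diamondop> x) = on1 (L2 d w) (T3 A (y \<diamondop> x))"
    by (rule T3_rcol[OF L _ y x]) (use T1_rcol[where w=w and c=d] w d in simp)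
  then have "PR x (L2 d w y) = L2 d w (PR x y)" unfolding PR_def using L x y by simp
  then show "s1 w (T2 A (d \<diamondop> PR x y)) = s1 w (on2 (PR x) (T2 A (d \<diamondop> y)))" using w d x y by simp
qed (use d x y in simp_all)

lemma E1_PR:
  assumes b: "b .: A" and x: "x .: A" and c: "c .: A"
  shows "E1 A (b \<diamondop> PR x c) = on2 (PR x) (E1 A (b \<diamondop> c))"
proof (rule sep1[OF A_module A_module])
  fix w assume w: "w \<in> dual A"
  let ?L = "\<lambda>p. s1 w (E1 A (b \<diamondop> p))"
  have L: "islin K A A ?L" using w b by simp
  have "T3 A (?L c \<diamondop> x) = on1 ?L (T3 A (c \<diamondop> x))"
    by (rule T3_rcol[OF L _ c x]) (use T1_E1_rcol[where w=w and c=b] w b in simp)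
  then have "PR x (?L c) = ?L (PR x c)" unfolding PR_def using L x c by simp
  then show "s1 w (E1 A (b \<diamondop> PR x c)) = s1 w (on2 (PR x) (E1 A (b \<diamondop> c)))" using w b x c by simp
qed (use b x c in simp_all)

text \<open>\<open>\<Delta>(\<sqinter>\<^sup>R(x) y) = (1 \<otimes> \<sqinter>\<^sup>R(x)) \<Delta>(y)\<close>: on the range of \<open>\<sqinter>\<^sup>R\<close> the comultiplication is seen by the second leg.\<close>

lemma T1_PR:
  assumes x: "x .: A" and t: "t .: AA"
  shows "T1 A (on1 (PR x) t) = on2 (PR x) (T1 A t)"
proof (rule AA_eqI[where Z=AA, OF _ _ _ t])
  fix b c assume b: "b .: A" and c: "c .: A"
  have "T1 A (PR x b \<diamondop> c) = on2 (PR x) (T1 A (b \<diamondop> c))"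
  proof (rule cL1)
    fix d assume d: "d .: A"
    have "lm1 d (T1 A (PR x b \<diamondop> c)) = on2 (\<lambda>q. PR x q \<cdot> c) (T2 A (d \<diamondop> b))" (is "?lhs = _")
      using d x b c by (simp add: T1_T2 T2_PR)
    also have "... = on2 (PR x) (rm2 c (T2 A (d \<diamondop> b)))"
      using d x b c by simp (rule mcong, simp_all add: PR_right)
    also have "... = on2 (PR x) (lm1 d (T1 A (b \<diamondop> c)))" using d b c by (simp only: T1_T2)
    also have "... = lm1 d (on2 (PR x) (T1 A (b \<diamondop> c)))" (is "_ = ?rhs") using d x b c by simp
    finally show "?lhs = ?rhs" .
  qed (use x b c in simp_all)
  then show "T1 A (on1 (PR x) (b \<diamondop> c)) = on2 (PR x) (T1 A (b \<diamondop> c))" using x b c by simp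
qed (use x in simp_all)

section \<open>The antipode\<close>

text \<open>By \<open>T1_PR\<close>, \<open>T1\<close> carries \<open>(\<sqinter>\<^sup>R(x) \<otimes> A) R1 (b \<otimes> z)\<close> to \<open>E (b \<otimes> \<sqinter>\<^sup>R(x) z)\<close>.  Apply \<open>(\<epsilon> \<otimes> A) R1\<close>.\<close>

lemma S_PR:
  assumes b: "b .: A" and x: "x .: A" and z: "z .: A"
  shows "S b (PR x z) = tensor_lift K A A A PR (on1 (PR x) (R1 (b \<diamondop> z)))"
proof -
  have "R1 (T1 A (on1 (PR x) (R1 (b \<diamondop> z)))) = R1 (E1 A (b \<diamondop> PR x z))"
    using b x z by (simp add: T1_PR E1_PR del: R1_E1)
  then show ?thesis using b x z by (simp add: S_def flip: eps_R1_T1)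
qed

lemma lift_PR_R1: "t .: AA ==> tensor_lift K A A A PR (R1 t) = s1 eps (R1 t)"
  by (simp flip: eps_R1_T1)

lemma lift_PR_map:
  assumes x: "x .: A" and t: "t .: AA"
  shows "tensor_lift K A A A PR (on1 (PR x) t) = tensor_lift K A A A PR (lm1 x t)"
  by (rule AA_eqI[where Z=A, OF _ _ _ t]) (use x in "simp_all add: PR_bilin islin_tensor_lift PR_PR")

lemma D_T1:
  assumes p: "p .: A" and t: "t .: AA"
  shows "D p (T1 A t) = T1 A (lm1 p t)"
  by (rule AA_eqI[where Z=AA, OF _ _ _ t]) (use p in "simp_all add: T1_mult")

text \<open>
  Write \<open>R1 (a \<otimes> c) = p \<otimes> q\<close> as a sum.  Then \<open>E (a b \<otimes> c) = E (a \<otimes> c) (b \<otimes> 1) = \<Delta>(p) (b \<otimes> q) = \<Delta>(p) E (b \<otimes> q)\<close>, which is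
  \<open>T1\<close> of \<open>(p \<otimes> 1) R1 (b \<otimes> q)\<close>.  Applying \<open>(\<epsilon> \<otimes> A) R1\<close> turns this into \<open>S(b) \<sqinter>\<^sup>R(p) q\<close>, and the sum of the
  \<open>\<sqinter>\<^sup>R(p) q\<close> is \<open>S(a) c\<close>.
\<close>

lemma S_mult:
  assumes a: "a .: A" and b: "b .: A" and c: "c .: A"
  shows "S (a \<cdot> b) c = S b (S a c)"
proof -
  \<comment> \<open>\<open>E (b \<otimes> q)\<close> multiplied by \<open>\<Delta>(p)\<close> from the left.\<close>
  let ?h = "\<lambda>p q. T1 A (lm1 p (R1 (b \<diamondop> q)))"
  have hb: "bilin K A A AA ?h" by (intro bilinI islin_ops islin_map_param1) (use b in simp_all)
  have "E1 A (a \<cdot> b \<diamondop> c) = rm1 b (T1 A (R1 (a \<diamondop> c)))" using E1_R(1)[OF b, of "a \<diamondop> c"] a b c by simp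
  also have "... = tensor_lift K A A AA ?h (R1 (a \<diamondop> c))"
  proof (rule AA_eqI[where Z=AA and t="R1 (a \<diamondop> c)"])
    fix p q assume pq: "p .: A" "q .: A"
    have "rm1 b (T1 A (p \<diamondop> q)) = D p (T1 A (R1 (b \<diamondop> q)))" using pq b by simp
    then show "rm1 b (T1 A (p \<diamondop> q)) = tensor_lift K A A AA ?h (p \<diamondop> q)" using pq b hb by (simp add: D_T1 del: T1_R1)
  qed (use a b c hb in "simp_all add: islin_tensor_lift")
  finally have E: "E1 A (a \<cdot> b \<diamondop> c) = tensor_lift K A A AA ?h (R1 (a \<diamondop> c))" .
  have "S (a \<cdot> b) c = s1 eps (R1 (E1 A (a \<cdot> b \<diamondop> c)))" using a b c by (simp add: S_def)
  also have "... = S b (tensor_lift K A A A PR (R1 (a \<diamondop> c)))" unfolding E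
  proof (rule AA_eqI[where Z=A and t="R1 (a \<diamondop> c)" and f="\<lambda>t. s1 eps (R1 (tensor_lift K A A AA ?h t))" and g="\<lambda>t. S b (tensor_lift K A A A PR t)"])
    fix p q assume pq: "p .: A" "q .: A"
    have "s1 eps (R1 (tensor_lift K A A AA ?h (p \<diamondop> q))) = tensor_lift K A A A PR (lm1 p (R1 (b \<diamondop> q)))"
      using pq b hb by (simp add: eps_R1_T1)
    also have "... = S b (PR p q)" using pq b by (simp add: S_PR lift_PR_map)
    finally show "s1 eps (R1 (tensor_lift K A A AA ?h (p \<diamondop> q))) = S b (tensor_lift K A A A PR (p \<diamondop> q))" using pq PR_bilin by simp
  qed (use a b c hb PR_bilin in "simp_all add: islin_tensor_lift")
  also have "... = S b (S a c)" using a c by (simp add: lift_PR_R1) (simp add: S_def)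
  finally show ?thesis .
qed

text \<open>Anti-multiplicativity in the form \<open>R1 (d \<otimes> S(b) a) = d\<^sub>1 \<otimes> S(b d\<^sub>2) a\<close>.\<close>

lemma R1_T3:
  assumes d: "d .: A" and b: "b .: A" and a: "a .: A"
  shows "R1 (d \<diamondop> S b a) = on2 (\<lambda>x. S x a) (T3 A (d \<diamondop> b))"
proof (rule cL1)
  fix c assume c: "c .: A"
  have "lm1 c (R1 (d \<diamondop> S b a)) = on2 (\<lambda>x. S x (S b a)) (T2 A (c \<diamondop> d))" (is "?lhs = _") using a b c d by (simp add: R1_T2)
  also have "... = on2 (\<lambda>x. S x a) (lm2 b (T2 A (c \<diamondop> d)))" using a b c d by simp (rule mcong, simp_all add: S_mult)
  also have "... = on2 (\<lambda>x. S x a) (lm1 c (T3 A (d \<diamondop> b)))" using b c d by (simp only: T2_T3)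
  also have "... = lm1 c (on2 (\<lambda>x. S x a) (T3 A (d \<diamondop> b)))" (is "_ = ?rhs") using a b c d by simp
  finally show "?lhs = ?rhs" .
qed (use a b d in simp_all)

lemma PL_S:
  assumes d: "d .: A" and b: "b .: A" and a: "a .: A"
  shows "PL d (S b a) = mu (on2 (\<lambda>x. S x a) (T3 A (d \<diamondop> b)))"
  using mu_R1[of "d \<diamondop> S b a"] assms by (simp add: R1_T3 PL_def)

text \<open>If all \<open>S(d)\<close> kill \<open>y\<close>, then so does \<open>R1\<close>, hence \<open>E1 = T1 R1\<close>, hence \<open>\<Delta>(a)\<close>, and \<open>\<epsilon>\<close> turns \<open>\<Delta>(a) (1 \<otimes> y)\<close> into \<open>a y\<close>.\<close>

lemma S_sep:
  assumes y: "y .: A" and z: "!!d. d .: A ==> S d y = zero A"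
  shows "y = zero A"
proof (rule nd_l[OF y])
  have R: "R1 (d \<diamondop> y) = zero AA" if d: "d .: A" for d
  proof (rule cL1)
    fix c assume c: "c .: A"
    have "lm1 c (R1 (d \<diamondop> y)) = on2 (\<lambda>x. S x y) (T2 A (c \<diamondop> d))" (is "?lhs = _") using c d y by (simp add: R1_T2)
    also have "... = on2 (\<lambda>x. (zero A)) (T2 A (c \<diamondop> d))" by (rule mcong) (use c d y z in simp_all)
    also have "... = zero AA"
      by (rule AA_eqI[where Z=AA and t="T2 A (c \<diamondop> d)" and g="\<lambda>_. (zero AA)"]) (use c d in "simp_all add: islin_zero_map pure_zero2")
    also have "... = lm1 c (zero AA)" (is "_ = ?rhs")
      by (rule islin_zero[symmetric, of AA AA]) (use c in simp_all)
    finally show "?lhs = ?rhs" .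
  qed (use d y in simp_all)
  have E: "E1 A (d \<diamondop> y) = zero AA" if d: "d .: A" for d
    using T1_R1[of "d \<diamondop> y"] R[OF d] d y islin_zero[of AA AA "T1 A"] by simp
  fix a assume a: "a .: A"
  have "T1 A (a \<diamondop> y) = zero AA"
  proof (rule cR1)
    fix d assume d: "d .: A"
    have "rm1 d (T1 A (a \<diamondop> y)) = D a (E1 A (d \<diamondop> y))" (is "?lhs = _") using a d y by simp
    also have "... = rm1 d (zero AA)" (is "_ = ?rhs")
      unfolding E[OF d] using islin_zero[of AA AA "D a"] islin_zero[of AA AA "rm1 d"] a d by simp
    finally show "?lhs = ?rhs" .
  qed (use a y in simp_all)
  then show "a \<cdot> y = zero A" using s1_eps_T1[OF a y] islin_zero[of AA A "s1 eps"] by simp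
qed

lemma S_bilin: "bilin K A A A S"
  by (intro bilinI) simp_all

text \<open>
  \<open>\<sqinter>\<^sup>R(a\<^sub>1) x \<otimes> a\<^sub>2 b = (1 \<otimes> a) E (x \<otimes> b)\<close>, the analogue of \<open>T2_PL\<close> for \<open>\<sqinter>\<^sup>R\<close>.  Both sides are
  \<open>x\<^sub>1 \<epsilon>(a\<^sub>1 x\<^sub>2) \<otimes> a\<^sub>2 b\<close>.
\<close>

lemma PR_dl:
  assumes a: "a .: A" and b: "b .: A" and x: "x .: A"
  shows "tensor_lift K A A AA (\<lambda>p q. PR p x \<diamondop> q) (T1 A (a \<diamondop> b)) = lm2 a (E1 A (x \<diamondop> b))"
proof (rule cL1)
  have bl: "bilin K A A AA (\<lambda>p q. PR p x \<diamondop> q)" by (intro bilinI) (use x in simp_all)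
  then show "tensor_lift K A A AA (\<lambda>p q. PR p x \<diamondop> q) (T1 A (a \<diamondop> b)) .: AA" using a b by (simp add: tensor_lift_in)
  fix d assume d: "d .: A"
  have l': "islin K A A (\<lambda>y. s1 (\<lambda>z. eps (z \<cdot> y)) t)" if t: "t .: AA" for t
  proof (rule iffD1[OF islin_cong])
    show "islin K A A (\<lambda>y. s1 eps (rm1 y t))"
      by (rule islin_s1[OF A_module A_module eps_dual islin_map_param1]) (use t in simp_all)
  qed (use t in simp_all)
  have "lm1 d (tensor_lift K A A AA (\<lambda>p q. PR p x \<diamondop> q) t) = on2 (\<lambda>w. s1 (\<lambda>p. eps (p \<cdot> w)) t) (T2 A (d \<diamondop> x))"
    if t: "t .: AA" for t
  proof (rule AA_eqI[where Z=AA and t=t and g="\<lambda>t. on2 (\<lambda>w. s1 (\<lambda>p. eps (p \<cdot> w)) t) (T2 A (d \<diamondop> x))"])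
    show "islin K AA AA (\<lambda>t. on2 (\<lambda>w. s1 (\<lambda>p. eps (p \<cdot> w)) t) (T2 A (d \<diamondop> x)))"
      by (rule islin_map_param2) (use d x l' in simp_all)
    show "islin K AA AA (\<lambda>t. lm1 d (tensor_lift K A A AA (\<lambda>p q. PR p x \<diamondop> q) t))"
      using d bl by (simp add: islin_tensor_lift)
    fix p q assume pq: "p .: A" "q .: A"
    let ?e = "\<lambda>w. eps (p \<cdot> w)"
    have ep: "islin K A (scalar_space K) ?e" using pq by simp
    have "on2 (\<lambda>w. s1 (\<lambda>p. eps (p \<cdot> w)) (p \<diamondop> q)) (T2 A (d \<diamondop> x)) = on2 (\<lambda>w. ?e w \<odot>\<^bsub>A\<^esub> q) (T2 A (d \<diamondop> x))"
      by (rule mcong) (use d x pq l' in simp_all)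
    also have "... = s2 ?e (T2 A (d \<diamondop> x)) \<diamondop> q"
    proof (rule AA_eqI[where Z=AA and t="T2 A (d \<diamondop> x)" and g="\<lambda>s. s2 ?e s \<diamondop> q"])
      fix u w assume uw: "u .: A" "w .: A"
      show "on2 (\<lambda>w. ?e w \<odot>\<^bsub>A\<^esub> q) (u \<diamondop> w) = s2 ?e (u \<diamondop> w) \<diamondop> q"
        using uw pq ep islin_in[OF ep uw(2)] islin_scaled[OF A_module pq(2) ep]
        by (simp add: islin_smult[OF islin_pure1[OF A_module A_module _ islin_id]] islin_smult[OF islin_pure2[OF A_module A_module _ islin_id]])
    qed (use d x pq ep islin_scaled[OF A_module pq(2) ep] in simp_all)
    also have "... = lm1 d (tensor_lift K A A AA (\<lambda>p q. PR p x \<diamondop> q) (p \<diamondop> q))" using bl pq d x by (simp add: PR_left)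
    finally show "lm1 d (tensor_lift K A A AA (\<lambda>p q. PR p x \<diamondop> q) (p \<diamondop> q)) =
       on2 (\<lambda>w. s1 (\<lambda>p. eps (p \<cdot> w)) (p \<diamondop> q)) (T2 A (d \<diamondop> x))" by simp
  qed (rule t)
  then have "lm1 d (tensor_lift K A A AA (\<lambda>p q. PR p x \<diamondop> q) (T1 A (a \<diamondop> b))) =
     on2 (\<lambda>w. s1 (\<lambda>p. eps (p \<cdot> w)) (T1 A (a \<diamondop> b))) (T2 A (d \<diamondop> x))" using a b by simp
  also have "... = on2 (\<lambda>w. a \<cdot> PL w b) (T2 A (d \<diamondop> x))" by (rule mcong) (use a b d x l' in "simp_all add: PL_D")
  also have "... = lm2 a (on2 (\<lambda>w. PL w b) (T2 A (d \<diamondop> x)))" using a b d x by simp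
  also have "... = lm2 a (lm1 d (E1 A (x \<diamondop> b)))" using b d x by (simp only: T2_PL)
  also have "... = lm1 d (lm2 a (E1 A (x \<diamondop> b)))" using a b d x by simp
  finally show "lm1 d (tensor_lift K A A AA (\<lambda>p q. PR p x \<diamondop> q) (T1 A (a \<diamondop> b))) =
     lm1 d (lm2 a (E1 A (x \<diamondop> b)))" .
qed (use a b x in simp_all)

text \<open>
  \<open>\<sqinter>\<^sup>R(b) a = S(b\<^sub>1) b\<^sub>2 a\<close> lies in the span.  By \<open>PR_dl\<close> so do the slices of \<open>(1 \<otimes> a) E (x \<otimes> b)\<close>, hence all right
  slices of the range of \<open>E1\<close>, which contains the range of \<open>T1\<close>; right fullness says that the right slices of \<open>T1\<close> span \<open>A\<close>.
\<close>

lemma S_span: "carrier A = lspan K A {S b a | a b. a .: A \<and> b .: A}" (is "_ = ?U")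
proof
  have sub: "submodule ?U K A" by (rule submodule_lspan) auto
  note UD = submoduleD[OF A_module sub]
  show "?U \<subseteq> carrier A" by (rule UD)
  have R: "s1 eps (R1 t) \<in> ?U" if t: "t .: AA" for t
    using A_module A_module t
  proof (induction rule: tensor_induct)
    case (pure b a)
    then show ?case unfolding S_def[symmetric] by (intro lspanI) blast
  next
    case (add s t)
    have i: "islin K AA A (\<lambda>t. s1 eps (R1 t))" by simp
    show ?case using UD(3)[OF add(3,4)] by (simp add: islin_add[OF i add(1,2)])
  qed
  have PRU: "PR b a \<in> ?U" if "a .: A" "b .: A" for a b
    using R[of "T1 A (b \<diamondop> a)"] that by (simp add: eps_R1_T1_pure)
  have E: "s2 w (E1 A (x \<diamondop> b)) \<in> ?U" if x: "x .: A" and b: "b .: A" and w: "w \<in> dual A" for x b w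
  proof (rule slice_in_submodule[OF A_module A_module sub _ _ _ _ w, where \<Phi>="{(\<lambda>y. w (a \<cdot> y)) | a w. a .: A \<and> w \<in> dual A}"])
    show "{(\<lambda>y. w (a \<cdot> y)) | a w. a .: A \<and> w \<in> dual A} \<subseteq> dual A" by (auto intro: dual_mult)
    show "y = zero A" if y: "y .: A" "!!f. f \<in> {(\<lambda>y. w (a \<cdot> y)) | a w. a .: A \<and> w \<in> dual A} ==> f y = \<zero>" for y
    proof (rule nd_l[OF y(1)])
      fix a assume a: "a .: A"
      show "a \<cdot> y = zero A"
      proof (rule ccontr)
        assume n: "a \<cdot> y \<noteq> (zero A)"
        have z: "submodule {(zero A)} K A" by (intro submoduleI') auto
        obtain f where f: "f \<in> dual A" "f (a \<cdot> y) = \<one>"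
          by (rule functional_ex[OF A_module z, of "a \<cdot> y"]) (use a y n in auto)
        have "f (a \<cdot> y) = \<zero>" using y(2)[of "\<lambda>y. f (a \<cdot> y)"] a f(1) by blast
        with f(2) show False using field_K by (simp add: field_def domain_def domain_axioms_def)
      qed
    qed
    fix f assume "f \<in> {(\<lambda>y. w (a \<cdot> y)) | a w. a .: A \<and> w \<in> dual A}"
    then obtain a g where g: "f = (\<lambda>y. g (a \<cdot> y))" "a .: A" "g \<in> dual A" by blast
    have bl: "bilin K A A AA (\<lambda>p q. PR p x \<diamondop> q)" by (intro bilinI) (use x in simp_all)
    have "s2 g (tensor_lift K A A AA (\<lambda>p q. PR p x \<diamondop> q) t) \<in> ?U" if t: "t .: AA" for t
      using A_module A_module t
    proof (induction rule: tensor_induct)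
      case (pure p q)
      then show ?case using g bl x UD(4)[OF dual_in[OF g(3)] PRU] by simp
    next
      case (add s t)
      have i: "islin K AA A (\<lambda>t. s2 g (tensor_lift K A A AA (\<lambda>p q. PR p x \<diamondop> q) t))" using g bl by (simp add: islin_tensor_lift)
      show ?case using UD(3)[OF add(3,4)] by (simp add: islin_add[OF i add(1,2)])
    qed
    from this[of "T1 A (a \<diamondop> b)"] show "s2 f (E1 A (x \<diamondop> b)) \<in> ?U" using g b x by (simp add: PR_dl)
  qed (use x b in simp)
  have E': "s2 w (E1 A t) \<in> ?U" if t: "t .: AA" and w: "w \<in> dual A" for t w
    using A_module A_module t
  proof (induction rule: tensor_induct)
    case (pure p q) then show ?case using E w by simp
  next
    case (add s t)
    have i: "islin K AA A (\<lambda>t. s2 w (E1 A t))" using w by simp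
    show ?case using UD(3)[OF add(3,4)] by (simp add: islin_add[OF i add(1,2)])
  qed
  have "carrier A = lspan K A {s2 w (T1 A (a \<diamondop> b)) | w a b. w \<in> functionals \<and> a .: A \<and> b .: A}"
    using right_full by (simp add: right_full_def slice_eq)
  also have "... \<subseteq> ?U"
  proof (rule lspan_subset[OF sub])
    show "{s2 w (T1 A (a \<diamondop> b)) | w a b. w \<in> functionals \<and> a .: A \<and> b .: A} \<subseteq> ?U"
    proof
      fix x assume "x \<in> {s2 w (T1 A (a \<diamondop> b)) | w a b. w \<in> functionals \<and> a .: A \<and> b .: A}"
      then obtain w a b where *: "x = s2 w (T1 A (a \<diamondop> b))" "w \<in> functionals" "a .: A" "b .: A" by blast
      have "s2 w (E1 A (T1 A (a \<diamondop> b))) \<in> ?U" by (rule E') (use * lin_islin[of w] in simp_all)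
      then show "x \<in> ?U" using * by simp
    qed
  qed
  finally show "carrier A \<subseteq> ?U" .
qed

lemma S_induct [consumes 1, case_names S add]:
  assumes "x .: A" "!!a b. a .: A ==> b .: A ==> P (S b a)"
    "!!x y. x .: A ==> y .: A ==> P x ==> P y ==> P (x \<oplus>\<^bsub>A\<^esub> y)"
  shows "P x"
proof -
  have *: "P (S b a) \<and> (\<forall>c\<in>carrier K. P (c \<odot>\<^bsub>A\<^esub> S b a))" if "a .: A" "b .: A" for a b
  proof -
    have i: "islin K A A (S b)" using that by simp
    show ?thesis using assms(2) that by (simp flip: islin_smult[OF i])
  qed
  have sub: "{S b a | a b. a .: A \<and> b .: A} \<subseteq> carrier A" by auto
  have "x \<in> lspan K A {S b a | a b. a .: A \<and> b .: A}" using assms(1) S_span by simp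
  with A_module sub have "P x \<and> (\<forall>c\<in>carrier K. P (c \<odot>\<^bsub>A\<^esub> x))"
  proof (induction rule: lspan_induct)
    case (gen x) then show ?case using * by blast
  next
    case zero
    have "S (zero A) (zero A) = zero A" by (rule islin_zero) simp_all
    then have "P (zero A)" using assms(2)[of "(zero A)" "(zero A)"] by simp
    then show ?case by simp
  next
    case (add x y) then show ?case by (simp add: assms(3) m_smult_r_distr)
  next
    case (smult c x) then show ?case by (simp flip: m_smult_assoc)
  qed
  then show ?thesis by blast
qed

text \<open>
  The second leg of \<open>\<delta>(l)\<close> can be pulled through the antipode: \<open>\<delta>(l) (S(d) a \<otimes> b)\<close> with the second leg covered by
  \<open>e\<close> is \<open>l S(d') a \<otimes> e' b\<close> with \<open>d' \<otimes> e' = (d \<otimes> e) E\<close>.  Apply a coinvariant \<open>f\<close> to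
  the first leg: the result depends on \<open>f\<close> and \<open>l\<close> only through \<open>f l\<close>, which is what makes \<open>V\<^sup>c\<close> firm.
\<close>

lemma dl_S:
  assumes c: "c .: A" and d: "d .: A" and a: "a .: A" and e: "e .: A" and b: "b .: A"
  shows "lm2 e (dl c (S d a) b) = map_A (\<lambda>x. PL c (S x a)) (\<lambda>x. x \<cdot> b) (E2 A (d \<diamondop> e))"
proof (rule sep2[OF A_module A_module])
  fix f assume f: "f \<in> dual A"
  let ?f = "\<lambda>x. f (e \<cdot> x)" and ?g = "\<lambda>x. f (x \<cdot> b)"
  have fd: "islin K A (scalar_space K) ?f" "islin K A (scalar_space K) ?g" using f e b dual_mult by auto
  let ?R = "\<lambda>x. s2 ?f (E1 A (x \<diamondop> b))"
  have R: "islin K A A ?R" using fd b by simp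
  \<comment> \<open>\<open>d ?R(x) = d'' x\<close>: the slice of \<open>E\<close> moves from one factor to the other.\<close>
  define d'' where "d'' = s2 ?g (E2 A (d \<diamondop> e))"
  have d'': "d'' .: A" using fd d e by (simp add: d''_def)
  have dR: "d \<cdot> ?R x = d'' \<cdot> x" if x: "x .: A" for x
  proof -
    have "d \<cdot> ?R x = s2 f (map_A (\<lambda>x. d \<cdot> x) (\<lambda>x. e \<cdot> x) (E1 A (x \<diamondop> b)))" using f d e x b by simp
    also have "... = s2 f (map_A (\<lambda>u. u \<cdot> x) (\<lambda>u. u \<cdot> b) (E2 A (d \<diamondop> e)))" using d e x b by (simp only: ax(1))
    finally show ?thesis using f d e x b by (simp add: d''_def)
  qed
  have lc: "T2 A (p \<diamondop> ?R c) = on2 ?R (T2 A (p \<diamondop> c))" if p: "p .: A" for p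
  proof (rule sep1[OF A_module A_module])
    fix w assume w: "w \<in> dual A"
    have "s1 w (T2 A (p \<diamondop> ?R c)) = s2 ?f (on1 (L2 p w) (E1 A (c \<diamondop> b)))" using w p fd c b by simp
    also have "... = ?R (L2 p w c)" using E1_L2[OF w p, of "c \<diamondop> b"] w p c b by simp
    finally show "s1 w (T2 A (p \<diamondop> ?R c)) = s1 w (on2 ?R (T2 A (p \<diamondop> c)))" using w p c R by simp
  qed (use p c b fd R in simp_all)
  have T3: "T3 A (?R c \<diamondop> d) = T3 A (c \<diamondop> d'')"
  proof (rule cL1)
    fix p assume p: "p .: A"
    have "lm1 p (T3 A (?R c \<diamondop> d)) = lm2 d (T2 A (p \<diamondop> ?R c))" (is "?lhs = _") using p d c b fd by (simp add: T2_T3)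
    also have "... = on2 (\<lambda>x. d \<cdot> ?R x) (T2 A (p \<diamondop> c))" using p d c R by (simp add: lc)
    also have "... = lm2 d'' (T2 A (p \<diamondop> c))" by (rule mcong) (use p d c R dR in simp_all)
    also have "... = lm1 p (T3 A (c \<diamondop> d''))" (is "_ = ?rhs") using p c d'' by (simp add: T2_T3)
    finally show "?lhs = ?rhs" .
  qed (use c d d'' b fd in simp_all)
  have "s2 f (lm2 e (dl c (S d a) b)) = PL (?R c) (S d a)" (is "?lhs = _") unfolding dl_def using f e c b d a fd by simp
  also have "... = PL c (S d'' a)" using T3 c d d'' a b fd by (simp add: PL_S)
  also have "... = s2 f (map_A (\<lambda>x. PL c (S x a)) (\<lambda>x. x \<cdot> b) (E2 A (d \<diamondop> e)))" (is "_ = ?rhs") unfolding d''_def using f e c b d a fd by simp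
  finally show "?lhs = ?rhs" .
qed (use assms in simp_all)

lemma scaled_bilin1: "w \<in> dual A ==> bilin K A A A (\<lambda>y z. w y \<odot>\<^bsub>A\<^esub> z)"
  and scaled_bilin2: "w \<in> dual A ==> bilin K A A A (\<lambda>y z. w z \<odot>\<^bsub>A\<^esub> y)"
  by (intro bilinI islin_scaled islin_smult_map islin_id; simp add: dual_in islin_in)+

end

section \<open>Hopf modules\<close>

locale hopf_mod = hopf_wmb K A R1 R2
  for K :: "'k ring" (structure) and A :: "('k, 'a) wmb" and R1 R2 +
  fixes V :: "('k, 'v, 'a) hopf_module"
  assumes HV: "hopf_module V"
begin

abbreviation "VA \<equiv> (V ** A)"
abbreviation "PV \<equiv> pure_tensor K V A"
abbreviation "mapV \<equiv> tensor_map K V A V A"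
abbreviation "onA f \<equiv> mapV idm f"
abbreviation "lmV a \<equiv> onA (\<lambda>x. a \<cdot> x)"
abbreviation "rmV a \<equiv> onA (\<lambda>x. x \<cdot> a)"

lemma V_module [simp]: "module K V" 
  and ract_bilin: "bilin K V A V (ract V)"
  and ract_assoc: "v .: V ==> a .: A ==> b .: A ==> ract V (ract V v a) b = ract V v (a \<cdot> b)"
  and ract_nondeg: "v .: V ==> (!!a. a .: A ==> ract V v a = zero V) ==> v = zero V"
  and action_surj: "action V ` carrier VA = carrier V"
  and V_comodule: "right_comodule V" and V_full: "full_comodule V"
  and V_hopf: "t .: (VA ** A) ==> lam V (tA VA V (action V) t) =
        tA VA V (action V) (legs13 K V A V A A (lam V) (legs23 K A A A A V (T1 A) t))"
  using HV by (auto simp: hopf_module_def right_module_def bilinear_map_iff)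

lemma VA_module [simp]: "module K VA" by simp

lemma lam_islin [simp]: "islin K VA VA (lam V)" and rho_islin [simp]: "islin K VA VA (rho V)"
  and lam_rho: "v .: V ==> a .: A ==> b .: A ==>
        lmV a (lam V (PV v b)) = rmV b (rho V (PV v a))"
  and V_E1: "t .: (VA ** A) ==>
        legs12 K V A V A A (lam V) (legs13 K V A V A A (lam V) (legs23 K A A A A V (E1 A) t)) =
        legs12 K V A V A A (lam V) (legs13 K V A V A A (lam V) t)"
  and V_T1: "t .: (VA ** A) ==>
        legs12 K V A V A A (lam V) (legs13 K V A V A A (lam V) (legs23 K A A A A V (T1 A) t)) =
        legs23 K A A A A V (T1 A) (legs12 K V A V A A (lam V) t)"
  using V_comodule by (auto simp: right_comodule_def lin_iff)

lemma islin_lam [simp]: "islin K X VA f ==> islin K X VA (\<lambda>x. lam V (f x))" "islin K X VA f ==> islin K X VA (\<lambda>x. rho V (f x))"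
  by (rule islin_comp[OF lam_islin] islin_comp[OF rho_islin]; assumption)+

lemma lam_in [simp]: "t .: VA ==> lam V t .: VA" "t .: VA ==> rho V t .: VA"
  using islin_in[OF lam_islin] islin_in[OF rho_islin] by auto

lemma islin_ract1 [simp]: "a .: A ==> islin K X V f ==> islin K X V (\<lambda>x. ract V (f x) a)"
  and islin_ract2 [simp]: "v .: V ==> islin K X A g ==> islin K X V (\<lambda>x. ract V v (g x))"
  and ract_in [simp]: "v .: V ==> a .: A ==> ract V v a .: V"
proof -
  show "a .: A ==> islin K X V f ==> islin K X V (\<lambda>x. ract V (f x) a)"
    using ract_bilin islin_comp[of V V "\<lambda>v. ract V v a" X f] by (simp add: bilin_def)
  show "v .: V ==> islin K X A g ==> islin K X V (\<lambda>x. ract V v (g x))"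
    using ract_bilin islin_comp[of A V "\<lambda>a. ract V v a" X g] by (simp add: bilin_def)
  show "v .: V ==> a .: A ==> ract V v a .: V"
    using ract_bilin islin_in[of K A V "ract V v" a] by (simp add: bilin_def)
qed

lemma action_pure [simp]: "v .: V ==> a .: A ==> action V (PV v a) = ract V v a"
  by (simp add: action_def ract_bilin)

lemma islin_action [simp]: "islin K X VA f ==> islin K X V (\<lambda>x. action V (f x))"
  unfolding action_def by (rule islin_tensor_lift) (simp_all add: ract_bilin)

lemma islin_action' [simp]: "islin K VA V (action V)" using islin_action[OF islin_id] .

lemma action_in [simp]: "t .: VA ==> action V t .: V" by (rule islin_in[OF islin_action'])

lemmas VA_eqI = tensor_eqI[OF V_module A_module]

lemma V_induct_act [consumes 1, case_names act add]:
  assumes "v .: V" "!!v a. v .: V ==> a .: A ==> P (ract V v a)"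
    "!!u v. u .: V ==> v .: V ==> P u ==> P v ==> P (u \<oplus>\<^bsub>V\<^esub> v)"
  shows "P v"
proof -
  obtain t where t: "t .: VA" "v = action V t" using assms(1) action_surj by (metis imageE)
  have "P (action V t)" using V_module A_module t(1)
    by (induction rule: tensor_induct) (simp_all add: assms islin_add[OF islin_action'])
  then show ?thesis using t by simp
qed

text \<open>
  The slice \<open>(V \<otimes> w) \<lambda> (v \<otimes> q)\<close>.  The maps \<open>th w q\<close> separate the points of \<open>V\<close> (\<open>th_sep\<close>) and their values span \<open>V\<close>
  by fullness, so they play the role of the coaction \<open>v \<mapsto> v\<^sub>0 \<otimes> v\<^sub>1\<close>.
\<close>

definition th :: "('a => 'k) => 'a => 'v => 'v" where "th w q v = sl2 V A w (lam V (PV v q))"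

lemma islin_th [simp]: "w \<in> dual A ==> q .: A ==> islin K X V f ==> islin K X V (\<lambda>x. th w q (f x))"
  "w \<in> dual A ==> v .: V ==> islin K X A g ==> islin K X V (\<lambda>x. th w (g x) v)"
  by (simp_all add: th_def)

lemma islin_th' [simp]: "w \<in> dual A ==> q .: A ==> islin K V V (th w q)" using islin_th(1)[OF _ _ islin_id] .

lemma th_in [simp]: "w \<in> dual A ==> q .: A ==> v .: V ==> th w q v .: V"
  by (simp add: th_def)

lemma V_induct_full [consumes 1, case_names full add]:
  assumes v: "v .: V" and full: "!!w a v. w \<in> dual A ==> a .: A ==> v .: V ==> P (th w a v)"
    and add: "!!u v. u .: V ==> v .: V ==> P u ==> P v ==> P (u \<oplus>\<^bsub>V\<^esub> v)"
  shows "P v"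
proof -
  let ?G = "{slice2 V w (lam V (PV v a)) | w v a. w \<in> functionals \<and> v .: V \<and> a .: A}"
  have *: "P x \<and> (\<forall>c\<in>carrier K. P (c \<odot>\<^bsub>V\<^esub> x)) \<and> x .: V" if x: "x \<in> ?G" for x
  proof -
    obtain w u a where g: "x = slice2 V w (lam V (PV u a))" "w \<in> functionals" "u .: V" "a .: A" using x by blast
    have w: "w \<in> dual A" using lin_islin[OF g(2)] by simp
    have e: "x = th w a u" using g by (simp add: th_def slice_eq)
    show ?thesis using full[OF w g(4)] g(3,4) w unfolding e by (simp flip: islin_smult[OF islin_th'[OF w g(4)]])
  qed
  have sub: "?G \<subseteq> carrier V" using * by blast
  have "v \<in> lspan K V ?G" using v V_full by (simp add: full_comodule_def)
  with V_module sub have "P v \<and> (\<forall>c\<in>carrier K. P (c \<odot>\<^bsub>V\<^esub> v))"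
  proof (induction rule: lspan_induct)
    case (gen x) then show ?case using * by blast
  next
    case zero
    have "th (counit A) (zero A) (zero V) = zero V" by (rule islin_zero) simp_all
    then have "P (zero V)" using full[of "counit A" "(zero A)" "(zero V)"] by simp
    then show ?case by simp
  next
    case (add x y) then show ?case by (simp add: assms(3) m_smult_r_distr)
  next
    case (smult c x) then show ?case by (simp flip: m_smult_assoc)
  qed
  then show ?thesis by blast
qed

text \<open>As for \<open>T1\<close>: the second leg of \<open>\<lambda>\<close> is right linear, since \<open>\<rho>\<close> covers it from the left.\<close>

lemma lam_right: 
  assumes v: "v .: V" and a: "a .: A" and b: "b .: A"
  shows "lam V (PV v (a \<cdot> b)) = rmV b (lam V (PV v a))"
proof (rule cancelL2[OF V_module])
  fix c assume c: "c .: A"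
  have "lmV c (lam V (PV v (a \<cdot> b))) = rmV (a \<cdot> b) (rho V (PV v c))" (is "?lhs = _") using v a b c by (simp add: lam_rho)
  also have "... = rmV b (rmV a (rho V (PV v c)))"
    using v a b c by simp (rule map_cong, simp_all add: m_ass)
  also have "... = rmV b (lmV c (lam V (PV v a)))" using v a c by (simp only: lam_rho)
  also have "... = lmV c (rmV b (lam V (PV v a)))" (is "_ = ?rhs")
    using v a b c by simp (rule map_cong, simp_all add: m_ass)
  finally show "?lhs = ?rhs" .
qed (use v a b in simp_all)

section \<open>The comodule axioms, contracted with a bilinear map\<close>

text \<open>The tensor \<open>v \<otimes> t\<close>, bracketed to the left.\<close>

abbreviation "emb v \<equiv> tA A VA (\<lambda>p. PV v p)"

text \<open>
  With \<open>t = p \<otimes> q\<close> this is \<open>v\<^sub>0 \<otimes> \<beta> (v\<^sub>1 p, v\<^sub>2 q)\<close>.  Contracting the last two legs with an arbitrary bilinear map turns the two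
  comodule axioms, which live in a threefold tensor product, into identities in \<open>V \<otimes> A\<close>.
\<close>

definition Lam :: "('a => 'a => 'a) => 'v => ('k, 'a, 'a) tensor => ('k, 'v, 'a) tensor" where
  "Lam \<beta> v t = tensor_lift K VA A VA (\<lambda>x z. onA (\<lambda>y. \<beta> y z) x)
     (legs12 K V A V A A (lam V) (legs13 K V A V A A (lam V) (emb v t)))"

lemma con_bilin: assumes \<beta>: "bilin K A A A \<beta>" shows "bilin K VA A VA (\<lambda>x z. onA (\<lambda>y. \<beta> y z) x)"
proof -
  have l: "islin K A A (\<lambda>y. \<beta> y z)" "islin K A A (\<beta> z)" if "z .: A" for z using \<beta> that by (simp_all add: bilin_def)
  show ?thesis by (intro bilinI islin_map islin_map_param2) (simp_all add: l)
qed

lemma legs_lin [simp]: "islin K X (VA ** A) f ==> islin K X (VA ** A) (\<lambda>x. legs12 K V A V A A (lam V) (f x))"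
  "islin K X (VA ** A) f ==> islin K X (VA ** A) (\<lambda>x. legs13 K V A V A A (lam V) (f x))"
  by (rule islin_legs12 islin_legs13; simp)+

lemma islin_emb [simp]: "v .: V ==> islin K X AA f ==> islin K X (VA ** A) (\<lambda>x. emb v (f x))"
  "t .: AA ==> islin K V (VA ** A) (\<lambda>v. emb v t)"
  by (simp, intro islin_map_param1, simp_all)

lemma islin_Lam: assumes \<beta>: "bilin K A A A \<beta>"
  shows "v .: V ==> islin K X AA f ==> islin K X VA (\<lambda>x. Lam \<beta> v (f x))"
  unfolding Lam_def by (rule islin_tensor_lift) (simp_all add: con_bilin[OF \<beta>])

lemma Lam_pure:
  assumes \<beta>: "bilin K A A A \<beta>" and v: "v .: V" and p: "p .: A" and q: "q .: A"
  shows "Lam \<beta> v (p \<diamondop> q) = tensor_lift K V A VA (\<lambda>v' a. onA (\<lambda>y. \<beta> y a) (lam V (PV v' p))) (lam V (PV v q))"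
proof -
  note cb = con_bilin[OF \<beta>]
  have "legs12 K V A V A A (lam V) (legs13 K V A V A A (lam V) (emb v (p \<diamondop> q))) =
     tA V VA (\<lambda>v'. lam V (PV v' p)) (lam V (PV v q))"
    using v p q by (simp add: legs13_pure) (simp add: legs12_def)
  then have "Lam \<beta> v (p \<diamondop> q) = tensor_lift K VA A VA (\<lambda>x z. onA (\<lambda>y. \<beta> y z) x) (tA V VA (\<lambda>v'. lam V (PV v' p)) (lam V (PV v q)))"
    by (simp add: Lam_def)
  also have "... = tensor_lift K V A VA (\<lambda>v' a. onA (\<lambda>y. \<beta> y a) (lam V (PV v' p))) (lam V (PV v q))"
    by (rule tensor_lift_unique[symmetric]) (use v p q cb in "simp_all add: islin_tensor_lift")
  finally show ?thesis .
qed

lemma Lam_E1: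
  assumes \<beta>: "bilin K A A A \<beta>" and v: "v .: V" and t: "t .: AA"
  shows "Lam \<beta> v (E1 A t) = Lam \<beta> v t"
proof (rule AA_eqI[where Z=VA and f="\<lambda>t. Lam \<beta> v (E1 A t)" and g="\<lambda>t. Lam \<beta> v t", OF _ _ _ t])
  fix p q assume pq: "p .: A" "q .: A"
  have "emb v (E1 A (p \<diamondop> q)) = legs23 K A A A A V (E1 A) (pure_tensor K VA A (PV v p) q)" using v pq by (simp add: legs23_pure)
  then show "Lam \<beta> v (E1 A (p \<diamondop> q)) = Lam \<beta> v (p \<diamondop> q)" using V_E1[of "pure_tensor K VA A (PV v p) q"] v pq by (simp add: Lam_def)
qed (use v \<beta> in "simp_all add: islin_Lam")

text \<open>Coassociativity of the coaction.\<close>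

lemma Lam_T1:
  assumes \<beta>: "bilin K A A A \<beta>" and v: "v .: V" and p: "p .: A" and q: "q .: A"
  shows "Lam \<beta> v (T1 A (p \<diamondop> q)) = onA (\<lambda>y. tensor_lift K A A A \<beta> (T1 A (y \<diamondop> q))) (lam V (PV v p))"
proof -
  note cb = con_bilin[OF \<beta>]
  let ?\<Phi> = "tensor_lift K VA A VA (\<lambda>x z. onA (\<lambda>y. \<beta> y z) x)"
  have l: "islin K A A (\<lambda>y. tensor_lift K A A A \<beta> (T1 A (y \<diamondop> q)))" using q \<beta> by (simp add: islin_tensor_lift)
  have l': "islin K A A (\<lambda>y. \<beta> y z)" "z' .: A ==> \<beta> z z' .: A" if "z .: A" for z z'
    using \<beta> that by (auto simp: bilin_def intro: islin_in)
  have "emb v (T1 A (p \<diamondop> q)) = legs23 K A A A A V (T1 A) (pure_tensor K VA A (PV v p) q)" using v p q by (simp add: legs23_pure)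
  then have "Lam \<beta> v (T1 A (p \<diamondop> q)) = ?\<Phi> (legs23 K A A A A V (T1 A) (pure_tensor K VA A (lam V (PV v p)) q))"
    using V_T1[of "pure_tensor K VA A (PV v p) q"] v p q by (simp add: Lam_def legs12_pure)
  also have "... = onA (\<lambda>y. tensor_lift K A A A \<beta> (T1 A (y \<diamondop> q))) (lam V (PV v p))"
  proof (rule VA_eqI[where Z=VA and t="lam V (PV v p)" and f="\<lambda>x. ?\<Phi> (legs23 K A A A A V (T1 A) (pure_tensor K VA A x q))" and
        g="\<lambda>x. onA (\<lambda>y. tensor_lift K A A A \<beta> (T1 A (y \<diamondop> q))) x"])
    fix u a assume u: "u .: V" and a: "a .: A"
    have "?\<Phi> (emb u t) = PV u (tensor_lift K A A A \<beta> t)" if t: "t .: AA" for t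
      by (rule AA_eqI[where Z=VA, OF _ _ _ t]) (use u cb \<beta> l' in "simp_all add: islin_tensor_lift")
    then show "?\<Phi> (legs23 K A A A A V (T1 A) (pure_tensor K VA A (PV u a) q)) = onA (\<lambda>y. tensor_lift K A A A \<beta> (T1 A (y \<diamondop> q))) (PV u a)"
      using u a q l by (simp add: legs23_pure)
  next
    show "islin K VA VA (\<lambda>x. ?\<Phi> (legs23 K A A A A V (T1 A) (pure_tensor K VA A x q)))"
      using q cb by (intro islin_tensor_lift islin_legs23) simp_all
  qed (use v p q l in simp_all)
  finally show ?thesis .
qed

lemma map_scaled1:
  assumes w: "w \<in> dual A" and a: "a .: A" and t: "t .: VA"
  shows "onA (\<lambda>y. w y \<odot>\<^bsub>A\<^esub> a) t = PV (sl2 V A w t) a"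
proof -
  have w': "islin K A (scalar_space K) w" using w by simp
  show ?thesis
  proof (rule VA_eqI[where Z=VA, OF _ _ _ t])
    fix u y assume u: "u .: V" and y: "y .: A"
    show "onA (\<lambda>y. w y \<odot>\<^bsub>A\<^esub> a) (PV u y) = PV (sl2 V A w (PV u y)) a"
      using u y a w' islin_in[OF w' y] islin_scaled[OF A_module a w']
      by (simp add: islin_smult[OF islin_pure1[OF V_module A_module _ islin_id]] islin_smult[OF islin_pure2[OF V_module A_module _ islin_id]])
  qed (use a w' islin_scaled[OF A_module a w'] in simp_all)
qed

lemma map_scaled2:
  assumes c: "c .: K" and t: "t .: VA"
  shows "onA (\<lambda>y. c \<odot>\<^bsub>A\<^esub> y) t = c \<odot>\<^bsub>VA\<^esub> t"
proof -
  have l: "islin K A A (\<lambda>y. c \<odot>\<^bsub>A\<^esub> y)" using c by (simp add: islin_smult_map)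
  show ?thesis
    by (rule VA_eqI[where Z=VA, OF _ _ _ t])
       (use c l in "simp_all add: islin_smult_map islin_smult[OF islin_pure2[OF V_module A_module _ islin_id]]")
qed

text \<open>The contractions that slice the second or the third leg by \<open>w\<close>.\<close>

abbreviation "mid w \<equiv> \<lambda>y z. w y \<odot>\<^bsub>A\<^esub> z"
abbreviation "third w \<equiv> \<lambda>y z. w z \<odot>\<^bsub>A\<^esub> y"

lemma Lam_mid:
  assumes w: "w \<in> dual A" and v: "v .: V" and p: "p .: A" and q: "q .: A"
  shows "Lam (mid w) v (p \<diamondop> q) = mapV (th w p) idm (lam V (PV v q))"
  unfolding Lam_pure[OF scaled_bilin1[OF w] v p q]
  by (rule tensor_lift_unique) (use w v p q in "simp_all add: map_scaled1[unfolded mem_Collect_eq] th_def")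

lemma Lam_third:
  assumes w: "w \<in> dual A" and v: "v .: V" and p: "p .: A" and q: "q .: A"
  shows "Lam (third w) v (p \<diamondop> q) = lam V (PV (th w q v) p)"
  unfolding Lam_pure[OF scaled_bilin2[OF w] v p q] th_def
proof (rule tensor_lift_unique)
  fix u a assume u: "u .: V" and a: "a .: A"
  have l: "islin K V VA (\<lambda>u. lam V (PV u p))" using p by simp
  have "w a .: K" using w a by (simp add: dual_in islin_in)
  then show "onA (\<lambda>y. w a \<odot>\<^bsub>A\<^esub> y) (lam V (PV u p)) = lam V (PV (sl2 V A w (PV u a)) p)"
    using u a w p by (simp add: map_scaled2 islin_smult[OF l])
qed (use w v p q in simp_all)

text \<open>
  \<open>(V \<otimes> \<epsilon>) \<lambda> (- \<otimes> z)\<close> turns the slice at \<open>c\<close> into the slice at \<open>\<sqinter>\<^sup>L(z) c\<close>.  In the coassociativity axiom, \<open>z \<otimes> c\<close> may be replaced by \<open>E (z \<otimes> c) = T1 (R1 (z \<otimes> c))\<close>,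
  and \<open>\<mu> R1 (z \<otimes> c) = \<sqinter>\<^sup>L(z) c\<close>.
\<close>

lemma th_PL:
  assumes w: "w \<in> dual A" and v: "v .: V" and z: "z .: A" and c: "c .: A"
  shows "th eps z (th w c v) = th w (PL z c) v"
proof -
  note b2 = scaled_bilin2[OF w]
  have *: "sl2 V A eps (Lam (third w) v (T1 A s)) = th w (mu s) v" if s: "s .: AA" for s
  proof (rule AA_eqI[where Z=V, OF _ _ _ s])
    fix p q assume p: "p .: A" and q: "q .: A"
    have "sl2 V A eps (Lam (third w) v (T1 A (p \<diamondop> q))) = sl2 V A (\<lambda>y. eps (s2 w (T1 A (y \<diamondop> q)))) (lam V (PV v p))"
      unfolding Lam_T1[OF b2 v p q] sl2_def[symmetric] using w v p q by (simp add: sl2_map)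
    also have "... = sl2 V A (\<lambda>y. w (y \<cdot> q)) (lam V (PV v p))"
      by (rule sl2_cong) (use w v p q in "simp_all add: slice_swap[OF A_module A_module eps_dual, unfolded mem_Collect_eq]")
    also have "... = th w (p \<cdot> q) v" unfolding th_def using w v p q by (simp add: lam_right sl2_map)
    finally show "sl2 V A eps (Lam (third w) v (T1 A (p \<diamondop> q))) = th w (mu (p \<diamondop> q)) v" using p q by (simp add: mu_pure)
  qed (use w v b2 in "simp_all add: islin_Lam")
  have "th eps z (th w c v) = sl2 V A eps (Lam (third w) v (T1 A (R1 (z \<diamondop> c))))"
    using w v z c by (simp add: Lam_E1[OF b2] Lam_third th_def[of eps])
  also have "... = th w (mu (R1 (z \<diamondop> c))) v" by (rule *) (simp add: z c)
  finally show ?thesis using z c mu_R1[of "z \<diamondop> c"] by (simp add: PL_def)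
qed

text \<open>By fullness, \<open>v\<close> may be taken as a slice; then \<open>th_PL\<close> applies, and \<open>\<sqinter>\<^sup>L(z)\<close> is determined by the functional \<open>a \<mapsto> \<epsilon> (a z)\<close>.\<close>

lemma eps_determines:
  assumes z: "z .: A" "z' .: A" and v: "v .: V" and eq: "!!a. a .: A ==> eps (a \<cdot> z) = eps (a \<cdot> z')"
  shows "th eps z v = th eps z' v"
  using v
proof (induction rule: V_induct_full)
  case (full w c u)
  have "PL z c = PL z' c"
  proof (rule cancel_A)
    fix b assume b: "b .: A"
    have "b \<cdot> PL z c = s1 (\<lambda>x. eps (x \<cdot> z)) (T1 A (b \<diamondop> c))" using b z full by (simp add: PL_D)
    also have "... = s1 (\<lambda>x. eps (x \<cdot> z')) (T1 A (b \<diamondop> c))" by (rule sl1_cong) (use b z full eq in simp_all)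
    also have "... = b \<cdot> PL z' c" using b z full by (simp add: PL_D)
    finally show "b \<cdot> PL z c = b \<cdot> PL z' c" .
  qed (use z full in simp_all)
  then show ?case using full z by (simp add: th_PL[unfolded mem_Collect_eq])
next
  case (add u v)
  then show ?case using z by (simp add: islin_add[OF islin_th'])
qed

section \<open>The action and the coaction\<close>

text \<open>With \<open>t = p \<otimes> q\<close> this is \<open>v\<^sub>0 p \<otimes> v\<^sub>1 q\<close>; for \<open>t = T1 (a \<otimes> b)\<close> it is the coaction of \<open>v a\<close> (\<open>lam_act\<close>).\<close>

definition Bm :: "'v => ('k, 'a, 'a) tensor => ('k, 'v, 'a) tensor" where
  "Bm v t = tA VA V (action V) (legs13 K V A V A A (lam V) (emb v t))"

lemma islin_Bm [simp]: "v .: V ==> islin K X AA f ==> islin K X VA (\<lambda>x. Bm v (f x))"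
  "t .: AA ==> islin K V VA (\<lambda>v. Bm v t)"
  by (simp_all add: Bm_def)

lemma Bm_in [simp]: "v .: V ==> t .: AA ==> Bm v t .: VA"
  by (rule islin_in[OF islin_Bm(2)])

lemma Bm_pure [simp]: "v .: V ==> p .: A ==> q .: A ==> Bm v (p \<diamondop> q) = mapV (\<lambda>u. ract V u p) idm (lam V (PV v q))"
  unfolding Bm_def by (simp add: legs13_pure) (rule map_cong, simp_all)

lemma lam_act: "v .: V ==> a .: A ==> b .: A ==> lam V (PV (ract V v a) b) = Bm v (T1 A (a \<diamondop> b))"
  using V_hopf[of "pure_tensor K VA A (PV v a) b"] by (simp add: legs23_pure Bm_def)

text \<open>The action is surjective, so \<open>v = u d\<close>; then \<open>\<Delta>(d)\<close> stands to the left of \<open>E\<close> and absorbs it.\<close>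

lemma Bm_E1:
  assumes v: "v .: V" and t: "t .: AA"
  shows "Bm v (E1 A t) = Bm v t"
  using v
proof (induction rule: V_induct_act)
  case (act u d)
  have *: "Bm u (rm1 p s) = mapV (\<lambda>v. ract V v p) idm (Bm u s)" if s: "s .: AA" and p: "p .: A" for s p
    by (rule AA_eqI[where Z=VA, OF _ _ _ s]) (use p act in "simp_all, intro map_cong, simp_all add: ract_assoc")
  have "Bm (ract V u d) t = Bm u (D d t)" if t: "t .: AA" for t
    by (rule AA_eqI[where Z=VA, OF _ _ _ t]) (use act * in "simp_all add: lam_act")
  then show ?case using t act by (simp add: D_E1)
next
  case (add u v)
  then show ?case using t by (simp add: islin_add[OF islin_Bm(2)])
qed

section \<open>The morphism attached to an element of a Hopf module\<close>

text \<open>It suffices to take \<open>x = S(b) a\<close>, where \<open>\<rho>\<close> provides the element, by anti-multiplicativity of the antipode.\<close>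

lemma RV_ex:
  assumes v: "v .: V" and x: "x .: A"
  shows "\<exists>y\<in>carrier VA. \<forall>d\<in>carrier A. onA (S d) y = onA (\<lambda>z. S z x) (lam V (PV v d))"
  using x
proof (induction rule: S_induct)
  case (S a b)
  show ?case
  proof (rule bexI[where x="onA (\<lambda>z. S z a) (rho V (PV v b))"], rule ballI)
    fix d assume d: "d .: A"
    have "onA (S d) (onA (\<lambda>z. S z a) (rho V (PV v b))) = onA (\<lambda>z. S z a) (rmV d (rho V (PV v b)))" (is "?lhs = _")
      using d v S by simp (rule map_cong, simp_all add: S_mult)
    also have "... = onA (\<lambda>z. S z a) (lmV b (lam V (PV v d)))" using d v S by (simp only: lam_rho)
    also have "... = onA (\<lambda>z. S z (S b a)) (lam V (PV v d))" (is "_ = ?rhs") using d v S by simp (rule map_cong, simp_all add: S_mult)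
    finally show "?lhs = ?rhs" .
  qed (use v S in simp)
next
  case (add x x')
  then obtain y y' where y: "y .: VA" "y' .: VA"
    "!!d. d .: A ==> onA (S d) y = onA (\<lambda>z. S z x) (lam V (PV v d))"
    "!!d. d .: A ==> onA (S d) y' = onA (\<lambda>z. S z x') (lam V (PV v d))" by blast
  show ?case
  proof (rule bexI[where x="y \<oplus>\<^bsub>VA\<^esub> y'"], rule ballI)
    fix d assume d: "d .: A"
    have i: "islin K VA VA (onA (S d))" using islin_map[OF V_module A_module V_module A_module islin_id islin_S2'[OF d] islin_id] .
    have j: "islin K A VA (\<lambda>x. onA (\<lambda>z. S z x) (lam V (PV v d)))" by (rule islin_map_param2) (use d v in simp_all)
    show "onA (S d) (y \<oplus>\<^bsub>VA\<^esub> y') = onA (\<lambda>z. S z (x \<oplus>\<^bsub>A\<^esub> x')) (lam V (PV v d))"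
      using y d add by (simp add: islin_add[OF i] islin_add[OF j])
  qed (use y in simp)
qed

lemma S_sep2:
  assumes "y .: VA" "y' .: VA" "!!d. d .: A ==> onA (S d) y = onA (S d) y'"
  shows "y = y'"
  by (rule sep_map2[where I="carrier A" and W'="\<lambda>_. A" and f=S, OF V_module A_module _ _ _ assms(1,2)])
     (simp_all add: S_sep assms(3))

text \<open>
  The element \<open>v\<^sub>0 \<otimes> S(v\<^sub>1) x\<close> of \<open>V \<otimes> A\<close>.  As \<open>v\<^sub>0 \<otimes> v\<^sub>1\<close> is not itself an element of \<open>V \<otimes> A\<close>, it is described by its
  products with the \<open>S(d)\<close> on the second leg; these separate points by \<open>S_sep2\<close>.
\<close>

definition RV :: "'v => 'a => ('k, 'v, 'a) tensor" where
  "RV v x = (THE y. y .: VA \<and> (\<forall>d\<in>carrier A. onA (S d) y = onA (\<lambda>z. S z x) (lam V (PV v d))))"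

lemma RV: 
  assumes v: "v .: V" and x: "x .: A"
  shows RV_in [simp]: "RV v x .: VA"
    and S_RV: "d .: A ==> onA (S d) (RV v x) = onA (\<lambda>z. S z x) (lam V (PV v d))"
proof -
  obtain y where y: "y .: VA" "!!d. d .: A ==> onA (S d) y = onA (\<lambda>z. S z x) (lam V (PV v d))"
    using RV_ex[OF v x] by blast
  have e: "RV v x = y" unfolding RV_def
  proof (rule the_equality)
    fix y' assume y': "y' .: VA \<and> (\<forall>d\<in>carrier A. onA (S d) y' = onA (\<lambda>z. S z x) (lam V (PV v d)))"
    show "y' = y" by (rule S_sep2) (use y y' in simp_all)
  qed (use y in simp)
  show "RV v x .: VA" using e y by simp
  show "d .: A ==> onA (S d) (RV v x) = onA (\<lambda>z. S z x) (lam V (PV v d))" using e y by simp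
qed

lemma RV_eqI:
  assumes "v .: V" "x .: A" "y .: VA"
    "!!d. d .: A ==> onA (S d) y = onA (\<lambda>z. S z x) (lam V (PV v d))"
  shows "RV v x = y"
  by (rule S_sep2) (use assms in "simp_all add: S_RV")

lemma islin_mapS: "d .: A ==> islin K VA VA (onA (S d))"
  using islin_map[OF V_module A_module V_module A_module islin_id islin_S2' islin_id] .

lemma islin_RV2': assumes v: "v .: V" shows "islin K A VA (RV v)"
proof (rule islinI)
  have j: "islin K A VA (\<lambda>x. onA (\<lambda>z. S z x) (lam V (PV v d)))" if "d .: A" for d
    by (rule islin_map_param2) (use that v in simp_all)
  show "RV v (x \<oplus>\<^bsub>A\<^esub> y) = RV v x \<oplus>\<^bsub>VA\<^esub> RV v y" if "x .: A" "y .: A" for x y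
    by (rule RV_eqI) (use that v in "simp_all add: islin_add[OF j] islin_add[OF islin_mapS] S_RV")
  show "RV v (c \<odot>\<^bsub>A\<^esub> x) = c \<odot>\<^bsub>VA\<^esub> RV v x" if "c .: K" "x .: A" for c x
    by (rule RV_eqI) (use that v in "simp_all add: islin_smult[OF j] islin_smult[OF islin_mapS] S_RV")
qed (use v in simp)

lemma islin_RV1': assumes x: "x .: A" shows "islin K V VA (\<lambda>v. RV v x)"
proof (rule islinI)
  have j: "islin K V VA (\<lambda>v. onA (\<lambda>z. S z x) (lam V (PV v d)))" if "d .: A" for d
    using that x by simp
  show "RV (u \<oplus>\<^bsub>V\<^esub> v) x = RV u x \<oplus>\<^bsub>VA\<^esub> RV v x" if "u .: V" "v .: V" for u v
    by (rule RV_eqI) (use that x in "simp_all add: islin_add[OF j] islin_add[OF islin_mapS] S_RV")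
  show "RV (c \<odot>\<^bsub>V\<^esub> v) x = c \<odot>\<^bsub>VA\<^esub> RV v x" if "c .: K" "v .: V" for c v
    by (rule RV_eqI) (use that x in "simp_all add: islin_smult[OF j] islin_smult[OF islin_mapS] S_RV")
qed (use x in simp)

lemma islin_RV [simp]: "x .: A ==> islin K X V f ==> islin K X VA (\<lambda>u. RV (f u) x)"
  "v .: V ==> islin K X A g ==> islin K X VA (\<lambda>u. RV v (g u))"
  by (rule islin_comp[OF islin_RV1'] islin_comp[OF islin_RV2']; assumption)+

lemma RV_bilin: "bilin K V A VA RV"
  by (intro bilinI islin_RV1' islin_RV2')

lemma RV_S:
  assumes v: "v .: V" and b: "b .: A" and a: "a .: A"
  shows "RV v (S b a) = onA (\<lambda>z. S z a) (rho V (PV v b))"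
proof (rule RV_eqI)
  fix d assume d: "d .: A"
  have "onA (S d) (onA (\<lambda>z. S z a) (rho V (PV v b))) = onA (\<lambda>z. S z a) (rmV d (rho V (PV v b)))" (is "?lhs = _")
    using d v a b by simp (rule map_cong, simp_all add: S_mult)
  also have "... = onA (\<lambda>z. S z a) (lmV b (lam V (PV v d)))" using d v b by (simp only: lam_rho)
  also have "... = onA (\<lambda>z. S z (S b a)) (lam V (PV v d))" (is "_ = ?rhs") using d v a b by simp (rule map_cong, simp_all add: S_mult)
  finally show "?lhs = ?rhs" .
qed (use v a b in simp_all)

lemma RV_right:
  assumes v: "v .: V" and x: "x .: A" and c: "c .: A"
  shows "RV v (x \<cdot> c) = rmV c (RV v x)"
proof (rule RV_eqI)
  fix d assume d: "d .: A"
  have "onA (S d) (rmV c (RV v x)) = rmV c (onA (S d) (RV v x))" (is "?lhs = _")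
    using d v x c by simp (rule map_cong, simp_all add: S_right)
  also have "... = onA (\<lambda>z. S z (x \<cdot> c)) (lam V (PV v d))" (is "_ = ?rhs")
    using d v x c by (simp add: S_RV) (rule map_cong, simp_all add: S_right)
  finally show "?lhs = ?rhs" .
qed (use v x c in simp_all)

text \<open>\<open>f\<^sub>v(x) = v\<^sub>0 S(v\<^sub>1) x\<close>.\<close>

definition fv :: "'v => 'a => 'v" where "fv v x = action V (RV v x)"

lemma islin_fv [simp]: "x .: A ==> islin K X V f ==> islin K X V (\<lambda>u. fv (f u) x)"
  "v .: V ==> islin K X A g ==> islin K X V (\<lambda>u. fv v (g u))"
  by (simp_all add: fv_def)

lemma islin_fv' [simp]: "v .: V ==> islin K A V (fv v)" using islin_fv(2)[OF _ islin_id] .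

lemma fv_in [simp]: "v .: V ==> x .: A ==> fv v x .: V"
  by (simp add: fv_def)

lemma fv_bilin: "bilin K V A V fv"
  by (intro bilinI) simp_all

lemma action_map:
  assumes f: "islin K A A f" and t: "t .: VA"
  shows "action V (onA f t) = tensor_lift K V A V (\<lambda>v x. ract V v (f x)) t"
  by (rule tensor_lift_unique[symmetric]) (use f t islin_in[OF f] in simp_all)

lemma fv_S: "v .: V ==> b .: A ==> a .: A ==> fv v (S b a) = tensor_lift K V A V (\<lambda>v' b'. ract V v' (S b' a)) (rho V (PV v b))"
  unfolding fv_def by (simp add: RV_S action_map)

lemma fv_right:
  assumes v: "v .: V" and x: "x .: A" and c: "c .: A"
  shows "fv v (x \<cdot> c) = ract V (fv v x) c"
proof -
  have "action V (rmV c t) = ract V (action V t) c" if t: "t .: VA" for t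
    by (rule VA_eqI[where Z=V, OF _ _ _ t]) (use c in "simp_all add: ract_assoc")
  then show ?thesis using v x c by (simp add: fv_def RV_right)
qed

end

context hopf_wmb begin

text \<open>Both sides are \<open>\<epsilon> (x t\<^sub>2) w (t\<^sub>1 c)\<close>.\<close>

lemma eps_T4_PR:
  assumes w: "w \<in> dual A" and x: "x .: A" and t: "t .: A" and c: "c .: A"
  shows "eps (x \<cdot> s1 w (T4 A (c \<diamondop> t))) = w (PR x (t \<cdot> c))"
proof -
  have e: "islin K A (scalar_space K) (\<lambda>y. eps (x \<cdot> y))" using x by simp
  have "PR x (t \<cdot> c) = s2 eps (rm1 c (T3 A (t \<diamondop> x)))" using x t c by (simp add: PR_right) (simp add: PR_def)
  also have "... = s2 eps (lm2 x (T4 A (c \<diamondop> t)))" using x t c by (simp only: T3_T4)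
  also have "... = s2 (\<lambda>y. eps (x \<cdot> y)) (T4 A (c \<diamondop> t))" using x t c by simp
  finally show ?thesis using slice_swap[OF A_module A_module _ e, of w "T4 A (c \<diamondop> t)"] w t c by simp
qed

text \<open>\<open>R1 (s \<otimes> x) = s\<^sub>1 \<otimes> S(s\<^sub>2) x\<close>, with the second leg covered by \<open>S(e)\<close> instead of the first leg by an element of \<open>A\<close>.\<close>

lemma S_R1:
  assumes s: "s .: A" and x: "x .: A" and e: "e .: A"
  shows "on2 (S e) (R1 (s \<diamondop> x)) = on2 (\<lambda>z. S z x) (T1 A (s \<diamondop> e))"
proof (rule cL1)
  fix c assume c: "c .: A"
  have "lm1 c (on2 (S e) (R1 (s \<diamondop> x))) = on2 (S e) (lm1 c (R1 (s \<diamondop> x)))" (is "?lhs = _")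
    using s x e c by simp
  also have "... = on2 (S e) (on2 (\<lambda>z. S z x) (T2 A (c \<diamondop> s)))" using s x c by (simp only: R1_T2)
  also have "... = on2 (\<lambda>z. S z x) (rm2 e (T2 A (c \<diamondop> s)))"
    using s x e c by simp (rule mcong, simp_all add: S_mult)
  also have "... = on2 (\<lambda>z. S z x) (lm1 c (T1 A (s \<diamondop> e)))" using s e c by (simp only: T1_T2)
  also have "... = lm1 c (on2 (\<lambda>z. S z x) (T1 A (s \<diamondop> e)))" (is "_ = ?rhs") using s x e c by simp
  finally show "?lhs = ?rhs" .
qed (use s x e in simp_all)

end

context hopf_mod begin

text \<open>With \<open>t = p \<otimes> q\<close> this is \<open>v\<^sub>0 \<epsilon>(v\<^sub>1 q) \<otimes> p\<close>.\<close>

definition gam :: "'v => ('k, 'a, 'a) tensor => ('k, 'v, 'a) tensor" where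
  "gam v t = tensor_flip K A V (tensor_map K A A A V idm (\<lambda>s. th eps s v) t)"

lemma islin_gam [simp]: "v .: V ==> islin K X AA f ==> islin K X VA (\<lambda>x. gam v (f x))"
  unfolding gam_def by (intro islin_flip) simp_all

lemma gam_in [simp]: "v .: V ==> t .: AA ==> gam v t .: VA"
  by (rule islin_in[OF islin_gam[OF _ islin_id]])

text \<open>\<open>S(y\<^sub>1) y\<^sub>2 q = \<sqinter>\<^sup>R(y) q\<close>.\<close>

lemma lift_S_T1: "y .: A ==> q .: A ==> tensor_lift K A A A S (T1 A (y \<diamondop> q)) = PR y q"
proof -
  assume a: "y .: A" "q .: A"
  have "tensor_lift K A A A S (T1 A (y \<diamondop> q)) = s1 eps (R1 (T1 A (y \<diamondop> q)))"
    by (rule tensor_lift_unique) (use a in "simp_all add: S_def")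
  then show ?thesis using a by (simp add: eps_R1_T1_pure)
qed

text \<open>
  In Sweedler notation \<open>v\<^sub>0 \<otimes> S(v\<^sub>1) v\<^sub>2 b c\<close> equals \<open>v\<^sub>0 \<epsilon>(v\<^sub>1 b\<^sub>2) \<otimes> b\<^sub>1 c\<close>.  After covering by \<open>S(d)\<close>, coassociativity of the
  coaction applies with \<open>\<beta> = S\<close>, once \<open>d \<otimes> b c\<close> has been replaced by \<open>T1 R1 (d \<otimes> b c)\<close>.  Sliced, both sides have the
  form \<open>(V \<otimes> \<epsilon>) \<lambda> (v \<otimes> z)\<close>, with different \<open>z\<close>; these \<open>z\<close> induce the same functional \<open>\<epsilon> (a z)\<close>, so that \<open>eps_determines\<close> concludes.
\<close>

lemma RV_lam:
  assumes v: "v .: V" and b: "b .: A" and c: "c .: A"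
  shows "tensor_lift K V A VA RV (lam V (PV v (b \<cdot> c))) = gam v (T4 A (c \<diamondop> b))"
proof (rule S_sep2)
  fix d assume d: "d .: A"
  show "onA (S d) (tensor_lift K V A VA RV (lam V (PV v (b \<cdot> c)))) = onA (S d) (gam v (T4 A (c \<diamondop> b)))"
  proof (rule sep2[OF V_module A_module])
    fix w assume w: "w \<in> dual A"
    let ?N = "\<lambda>q. s1 w (T4 A (c \<diamondop> q))"
    have N: "islin K A A ?N" using w c by simp
    have Nb: "bilin K A A A (\<lambda>p q. p \<cdot> ?N q)" by (intro bilinI) (use w c in simp_all)
    define z where "z = tensor_lift K A A A (\<lambda>p q. p \<cdot> ?N q) (R1 (d \<diamondop> b))"
    define z' where "z' = s1 (\<lambda>y. w (S d y)) (T4 A (c \<diamondop> b))"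
    have w': "(\<lambda>y. w (S d y)) \<in> dual A" using w d by (simp add: islin_comp[where g=w and W=A])
    have z: "z .: A" "z' .: A" using d b c w' Nb by (simp_all add: z_def z'_def tensor_lift_in)
    have "tensor_lift K V A VA RV (lam V (PV v (b \<cdot> c))) .: VA" using v b c RV_bilin by (simp add: tensor_lift_in)
    have "onA (S d) (tensor_lift K V A VA RV s) = tensor_lift K V A VA (\<lambda>v' a. onA (\<lambda>y. S y a) (lam V (PV v' d))) s" if s: "s .: VA" for s
      by (rule tensor_lift_unique[symmetric]) (use s d RV_bilin in "simp_all add: S_RV islin_tensor_lift")
    then have "onA (S d) (tensor_lift K V A VA RV (lam V (PV v (b \<cdot> c)))) = Lam S v (d \<diamondop> (b \<cdot> c))"
      using v d b c by (simp add: Lam_pure[OF S_bilin])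
    also have "... = Lam S v (T1 A (R1 (d \<diamondop> (b \<cdot> c))))" using v d b c by (simp add: Lam_E1[OF S_bilin])
    also have "R1 (d \<diamondop> (b \<cdot> c)) = rm2 c (R1 (d \<diamondop> b))" using R1_right[of c "d \<diamondop> b"] d b c by simp
    finally have 1: "onA (S d) (tensor_lift K V A VA RV (lam V (PV v (b \<cdot> c)))) = Lam S v (T1 A (rm2 c (R1 (d \<diamondop> b))))" .
    have "sl2 V A w (Lam S v (T1 A (rm2 c s))) = th eps (tensor_lift K A A A (\<lambda>p q. p \<cdot> ?N q) s) v" if s: "s .: AA" for s
    proof (rule AA_eqI[where Z=V and f="\<lambda>s. sl2 V A w (Lam S v (T1 A (rm2 c s)))" and
          g="\<lambda>s. th eps (tensor_lift K A A A (\<lambda>p q. p \<cdot> ?N q) s) v", OF _ _ _ s])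
      fix p q assume pq: "p .: A" "q .: A"
      have l: "islin K A A (\<lambda>y. tensor_lift K A A A S (T1 A (y \<diamondop> (q \<cdot> c))))" using pq c S_bilin by (simp add: islin_tensor_lift)
      have "sl2 V A w (Lam S v (T1 A (rm2 c (p \<diamondop> q)))) =
          sl2 V A (\<lambda>y. w (tensor_lift K A A A S (T1 A (y \<diamondop> (q \<cdot> c))))) (lam V (PV v p))"
        using v pq c w l by (simp add: Lam_T1[OF S_bilin] sl2_map)
      also have "... = sl2 V A (\<lambda>y. eps (y \<cdot> ?N q)) (lam V (PV v p))"
        by (rule sl2_cong) (use v pq c w l in "simp_all add: lift_S_T1 eps_T4_PR islin_comp[where g=w and W=A]")
      also have "... = th eps (p \<cdot> ?N q) v" unfolding th_def using v pq c w by (simp add: lam_right sl2_map)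
      finally show "sl2 V A w (Lam S v (T1 A (rm2 c (p \<diamondop> q)))) = th eps (tensor_lift K A A A (\<lambda>p q. p \<cdot> ?N q) (p \<diamondop> q)) v"
        using pq Nb by simp
    qed (use v w c Nb in "simp_all add: islin_Lam[OF S_bilin] islin_tensor_lift")
    from this[of "R1 (d \<diamondop> b)"] have "sl2 V A w (onA (S d) (tensor_lift K V A VA RV (lam V (PV v (b \<cdot> c))))) = th eps z v"
      using d b by (simp add: 1 z_def)
    also have "... = th eps z' v"
    proof (rule eps_determines[OF z v])
      fix a assume a: "a .: A"
      have "eps (a \<cdot> tensor_lift K A A A (\<lambda>p q. p \<cdot> ?N q) s) = w (tensor_lift K A A A PR (map_A (\<lambda>u. a \<cdot> u) (\<lambda>u. u \<cdot> c) s))" if s: "s .: AA" for s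
        by (rule AA_eqI[where Z="scalar_space K", OF _ _ _ s])
          (use a c w Nb PR_bilin in "simp_all add: islin_tensor_lift islin_comp[where g=w and W=A] eps_T4_PR flip: m_ass")
      from this[of "R1 (d \<diamondop> b)"] have "eps (a \<cdot> z) = w (tensor_lift K A A A PR (lm1 a (rm2 c (R1 (d \<diamondop> b)))))"
        using a b c d by (simp add: z_def)
      also have "rm2 c (R1 (d \<diamondop> b)) = R1 (d \<diamondop> (b \<cdot> c))" using R1_right[of c "d \<diamondop> b"] d b c by simp
      also have "w (tensor_lift K A A A PR (lm1 a (R1 (d \<diamondop> (b \<cdot> c))))) = w (S d (PR a (b \<cdot> c)))"
        using a b c d by (simp add: S_PR lift_PR_map)
      also have "... = eps (a \<cdot> z')" using eps_T4_PR[OF w' a b c] by (simp add: z'_def)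
      finally show "eps (a \<cdot> z) = eps (a \<cdot> z')" .
    qed
    also have "... = sl2 V A w (onA (S d) (gam v (T4 A (c \<diamondop> b))))"
      using v b c d w w' by (simp add: gam_def z'_def sl2_map sl2_flip sl1_map)
    finally show "sl2 V A w (onA (S d) (tensor_lift K V A VA RV (lam V (PV v (b \<cdot> c))))) = sl2 V A w (onA (S d) (gam v (T4 A (c \<diamondop> b))))" .
  qed (use v b c d RV_bilin in "simp_all add: tensor_lift_in")
qed (use v b c RV_bilin in "simp_all add: tensor_lift_in")

text \<open>
  For a slice \<open>v\<close> of the coaction, \<open>th_PL\<close> turns the counit into \<open>\<sqinter>\<^sup>L\<close>, and \<open>T4_PL\<close> collects the legs of \<open>\<Delta>(b)\<close> into
  \<open>E (b c \<otimes> e)\<close>; the Hopf module absorbs \<open>E\<close> by \<open>Bm_E1\<close>.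
\<close>

lemma action_gam:
  assumes v: "v .: V" and b: "b .: A" and c: "c .: A"
  shows "action V (gam v (T4 A (c \<diamondop> b))) = ract V v (b \<cdot> c)"
  using v
proof (induction rule: V_induct_full)
  case (full w e u)
  let ?T = "T4 A (c \<diamondop> b)"
  have w: "islin K A (scalar_space K) w" using full by simp
  have "gam (th w e u) ?T = tensor_flip K A V (tensor_map K A A A V idm (\<lambda>t. th w (PL t e) u) ?T)"
    unfolding gam_def by (rule arg_cong[where f="tensor_flip K A V"], rule map_cong) (use full b c in "simp_all add: th_PL[unfolded mem_Collect_eq]")
  also have "action V (tensor_flip K A V (tensor_map K A A A V idm (\<lambda>t. th w (PL t e) u) s)) = sl2 V A w (Bm u (on2 (\<lambda>t. PL t e) s))"
    if s: "s .: AA" for s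
  proof (rule AA_eqI[where Z=V and f="\<lambda>s. action V (tensor_flip K A V (tensor_map K A A A V idm (\<lambda>t. th w (PL t e) u) s))" and
      g="\<lambda>s. sl2 V A w (Bm u (on2 (\<lambda>t. PL t e) s))", OF _ _ _ s])
    fix p q assume pq: "p .: A" "q .: A"
    show "action V (tensor_flip K A V (tensor_map K A A A V idm (\<lambda>t. th w (PL t e) u) (p \<diamondop> q))) = sl2 V A w (Bm u (on2 (\<lambda>t. PL t e) (p \<diamondop> q)))"
      using pq full w by (simp add: sl2_map th_def)
  qed (use full w in "simp_all add: islin_flip")
  finally have "action V (gam (th w e u) ?T) = sl2 V A w (Bm u (E1 A ((b \<cdot> c) \<diamondop> e)))" using b c full by (simp add: T4_PL)
  also have "... = ract V (th w e u) (b \<cdot> c)" using b c full w by (simp add: Bm_E1 sl2_map th_def)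
  finally show ?case .
next
  case (add u v)
  have i: "islin K V V (\<lambda>v. action V (gam v (T4 A (c \<diamondop> b))))" unfolding gam_def
    by (intro islin_action islin_flip islin_map_param2) (use b c in simp_all)
  have j: "islin K V V (\<lambda>v. ract V v (b \<cdot> c))" using b c by simp
  show ?case using add by (simp add: islin_add[OF i] islin_add[OF j])
qed

lemma fv_lam_pure:
  assumes v: "v .: V" and a: "a .: A"
  shows "tensor_lift K V A V fv (lam V (PV v a)) = ract V v a"
  using a
proof (induction rule: A_induct)
  case (mult b c)
  have "tensor_lift K V A V fv (lam V (PV v (b \<cdot> c))) = action V (tensor_lift K V A VA RV (lam V (PV v (b \<cdot> c))))"
    by (rule tensor_lift_unique) (use v mult RV_bilin in "simp_all add: fv_def islin_tensor_lift")
  then show ?case using v mult by (simp add: RV_lam action_gam)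
next
  case (add x y)
  have i: "islin K A V (\<lambda>x. tensor_lift K V A V fv (lam V (PV v x)))" using v fv_bilin by (simp add: islin_tensor_lift)
  have j: "islin K A V (\<lambda>x. ract V v x)" using v by simp
  show ?case using add v by (simp add: islin_add[OF i] islin_add[OF j])
qed

text \<open>\<open>f\<close>, indexed by \<open>v\<^sub>0\<close> and applied to \<open>v\<^sub>1 a\<close>, is \<open>v\<^sub>0 S(v\<^sub>1) v\<^sub>2 a\<close>, which is \<open>v a\<close>.  It follows that the values of the \<open>f\<^sub>v\<close> span \<open>V\<close>.\<close>

lemma fv_lam:
  assumes t: "t .: VA" shows "tensor_lift K V A V fv (lam V t) = action V t"
  by (rule VA_eqI[where Z=V, OF _ _ _ t]) (use fv_bilin in "simp_all add: fv_lam_pure islin_tensor_lift")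

text \<open>If all slices of \<open>\<lambda> (u \<otimes> a)\<close> vanish, then so does \<open>u a\<close>, which can be recovered from \<open>\<lambda> (u \<otimes> a)\<close> by \<open>fv_lam\<close>.\<close>

lemma th_sep:
  assumes u: "u .: V" and z: "!!w s. w \<in> dual A ==> s .: A ==> th w s u = zero V"
  shows "u = zero V"
proof (rule ract_nondeg[OF u])
  fix a assume a: "a .: A"
  have "lam V (PV u a) = zero VA"
    by (rule sep2_zero[OF V_module A_module]) (use u a z in "simp_all flip: th_def")
  then show "ract V u a = zero V"
    using fv_lam_pure[OF u a] islin_zero[OF _ _ tensor_lift_islin[OF V_module A_module V_module fv_bilin]] by simp
qed

end

context hopf_wmb begin

lemma s1_lift: "w \<in> dual A ==> tensor_lift K A A A (\<lambda>y z. w y \<odot>\<^bsub>A\<^esub> z) = s1 w"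
  and s2_lift: "w \<in> dual A ==> tensor_lift K A A A (\<lambda>y z. w z \<odot>\<^bsub>A\<^esub> y) = s2 w"
  by (simp_all add: sl1_def sl2_def)

end

context hopf_mod begin

text \<open>\<open>(\<lambda> \<otimes> A) (v \<otimes> t)\<close>, bracketed as an element of \<open>V \<otimes> (A \<otimes> A)\<close>.\<close>

definition coact :: "'v => ('k, 'a, 'a) tensor => ('k, 'v, ('k, 'a, 'a) tensor) tensor" where
  "coact v t = tensor_assoc K V A A (legs12 K V A V A A (lam V) (emb v t))"

abbreviation "mapVAA \<equiv> tensor_map K V AA V A"

lemma islin_assoc' [simp]: "islin K X (VA ** A) f ==> islin K X (V ** AA) (\<lambda>x. tensor_assoc K V A A (f x))"
  by (rule islin_comp[OF islin_assoc]) simp_all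

lemma islin_coact [simp]: "v .: V ==> islin K X AA f ==> islin K X (V ** AA) (\<lambda>x. coact v (f x))"
  "t .: AA ==> islin K V (V ** AA) (\<lambda>v. coact v t)"
  by (simp_all add: coact_def)

lemma coact_in [simp]: "v .: V ==> t .: AA ==> coact v t .: (V ** AA)"
  by (rule islin_in[OF islin_coact(2)])

lemma coact_pure: 
  assumes v: "v .: V" and p: "p .: A" and q: "q .: A"
  shows "coact v (p \<diamondop> q) = tensor_map K V A V AA idm (\<lambda>y. y \<diamondop> q) (lam V (PV v p))"
proof -
  have *: "tensor_assoc K V A A (pure_tensor K VA A t q) = tensor_map K V A V AA idm (\<lambda>y. y \<diamondop> q) t" if t: "t .: VA" for t
    by (rule VA_eqI[where Z="V ** AA", OF _ _ _ t]) (use q in "simp_all add: assoc_pure")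
  show ?thesis using v p q by (simp add: coact_def legs12_pure *)
qed

lemma coact_bilin: "s .: A ==> bilin K V A (V ** AA) (\<lambda>v x. coact v (R1 (s \<diamondop> x)))"
  by (intro bilinI) simp_all

text \<open>
  Both sides are \<open>v\<^sub>0 \<otimes> v\<^sub>1 s\<^sub>1 \<otimes> S(v\<^sub>2 s\<^sub>2) x\<close>.  The maps \<open>t \<mapsto> S(e) ((w \<otimes> A) t)\<close> separate the points of \<open>A \<otimes> A\<close>; after applying
  them, \<open>R1\<close> becomes \<open>T1\<close> by \<open>S_R1\<close>, and coassociativity of the coaction applies.
\<close>

lemma lam_R1:
  assumes v: "v .: V" and x: "x .: A" and s: "s .: A"
  shows "tensor_map K V A V AA idm (\<lambda>s. R1 (s \<diamondop> x)) (lam V (PV v s)) = tensor_lift K V A (V ** AA) (\<lambda>v x. coact v (R1 (s \<diamondop> x))) (RV v x)"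
proof (rule sep_map2[where I="dual A \<times> carrier A" and W'="\<lambda>_. A" and f="\<lambda>(w, e) t. S e (s1 w t)", OF V_module AA_module])
  show "tensor_map K V A V AA idm (\<lambda>s. R1 (s \<diamondop> x)) (lam V (PV v s)) .: (V ** AA)" using v x s by simp
  show "tensor_lift K V A (V ** AA) (\<lambda>v x. coact v (R1 (s \<diamondop> x))) (RV v x) .: (V ** AA)"
    using v x s coact_bilin by (simp add: tensor_lift_in)
next
  fix t assume t: "t .: AA" and z: "!!i. i \<in> dual A \<times> carrier A ==> (case i of (w, e) => \<lambda>t. S e (s1 w t)) t = zero A"
  show "t = zero AA"
  proof (rule sep1_zero[OF A_module A_module t])
    fix w assume w: "w \<in> dual A"
    show "s1 w t = zero A" by (rule S_sep) (use w t z[of "(w, _)"] in simp_all)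
  qed
next
  fix i assume "i \<in> dual A \<times> carrier A"
  then obtain w e where i: "i = (w, e)" and w: "w \<in> dual A" and e: "e .: A" by blast
  let ?f = "\<lambda>t. S e (s1 w t)"
  have wl: "islin K A (scalar_space K) w" using w by simp
  have tb: "bilin K A A VA (\<lambda>p q. PV (th w p v') q)" if "v' .: V" for v' by (intro bilinI) (use that w in simp_all)
  have tb2: "bilin K A A VA (\<lambda>p q. PV (th w p v') (S q x'))" if "v' .: V" "x' .: A" for v' x' by (intro bilinI) (use that w in simp_all)
  have tb3: "bilin K V A VA (\<lambda>v' x'. tensor_lift K A A VA (\<lambda>p q. PV (th w p v') (S q x')) u)" if u: "u .: AA" for u
    by (intro bilinI; rule islin_tensor_lift_param) (use u tb2 w in simp_all)
  have "mapVAA idm ?f (tensor_map K V A V AA idm (\<lambda>s. R1 (s \<diamondop> x)) (lam V (PV v s))) = onA (\<lambda>s. ?f (R1 (s \<diamondop> x))) (lam V (PV v s))"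
    using v x s w e by simp
  also have "... = onA (\<lambda>s. S (s1 w (T1 A (s \<diamondop> e))) x) (lam V (PV v s))"
  proof (rule map_cong)
    fix s assume s: "s .: A"
    have "?f (R1 (s \<diamondop> x)) = s1 w (on2 (S e) (R1 (s \<diamondop> x)))" (is "?lhs = _") using s x w e by simp
    also have "... = S (s1 w (T1 A (s \<diamondop> e))) x" (is "_ = ?rhs") using s x w e by (simp add: S_R1)
    finally show "?lhs = ?rhs" .
  qed (use v x s w e in simp_all)
  also have "... = onA (\<lambda>z. S z x) (Lam (mid w) v (T1 A (s \<diamondop> e)))"
    using v x s w e by (simp add: Lam_T1[OF scaled_bilin1] s1_lift)
  also have "... = tensor_lift K V A VA (\<lambda>v' x'. tensor_lift K A A VA (\<lambda>p q. PV (th w p v') (S q x')) (T1 A (s \<diamondop> e))) (RV v x)"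
  proof (rule AA_eqI[where Z=VA and t="T1 A (s \<diamondop> e)" and f="\<lambda>u. onA (\<lambda>z. S z x) (Lam (mid w) v u)" and
     g="\<lambda>u. tensor_lift K V A VA (\<lambda>v' x'. tensor_lift K A A VA (\<lambda>p q. PV (th w p v') (S q x')) u) (RV v x)"])
    fix p q assume pq: "p .: A" "q .: A"
    have "tensor_lift K V A VA (\<lambda>v' x'. tensor_lift K A A VA (\<lambda>p q. PV (th w p v') (S q x')) (p \<diamondop> q)) (RV v x) = mapV (th w p) (S q) (RV v x)"
      by (rule tensor_lift_unique) (use pq w tb2 v x in simp_all)
    also have "... = mapV (th w p) idm (onA (S q) (RV v x))" using pq w v x by simp
    also have "... = mapV (th w p) idm (onA (\<lambda>z. S z x) (lam V (PV v q)))" using pq v x by (simp only: S_RV)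
    also have "... = onA (\<lambda>z. S z x) (Lam (mid w) v (p \<diamondop> q))" using pq v x w by (simp add: Lam_mid)
    finally show "onA (\<lambda>z. S z x) (Lam (mid w) v (p \<diamondop> q)) =
       tensor_lift K V A VA (\<lambda>v' x'. tensor_lift K A A VA (\<lambda>p q. PV (th w p v') (S q x')) (p \<diamondop> q)) (RV v x)" by simp
  next
    show "islin K AA VA (\<lambda>u. tensor_lift K V A VA (\<lambda>v' x'. tensor_lift K A A VA (\<lambda>p q. PV (th w p v') (S q x')) u) (RV v x))"
      by (rule islin_tensor_lift_param) (use v x tb2 tb3 in "simp_all add: islin_tensor_lift")
  qed (use v x w s e in "simp_all add: islin_Lam[OF scaled_bilin1]")
  also have "... = mapVAA idm ?f (tensor_lift K V A (V ** AA) (\<lambda>v x. coact v (R1 (s \<diamondop> x))) (RV v x))"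
  proof (rule tensor_lift_unique)
    fix v' x' assume vx: "v' .: V" "x' .: A"
    have 1: "mapVAA idm ?f (coact v' t) = tensor_lift K A A VA (\<lambda>p q. PV (th w p v') q) (on2 (S e) t)" if t: "t .: AA" for t
    proof (rule AA_eqI[where Z=VA, OF _ _ _ t])
      fix p q assume pq: "p .: A" "q .: A"
      have "mapVAA idm ?f (coact v' (p \<diamondop> q)) = onA (\<lambda>y. S e (w y \<odot>\<^bsub>A\<^esub> q)) (lam V (PV v' p))"
        unfolding coact_pure[OF vx(1) pq]
        by (subst map_map) (use vx pq w e in "simp_all, intro map_cong, simp_all")
      also have "... = onA (\<lambda>y. w y \<odot>\<^bsub>A\<^esub> S e q) (lam V (PV v' p))"
        by (rule map_cong) (use vx pq w wl e dual_in[OF w] in "simp_all add: islin_scaled islin_smult[OF islin_S2']")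
      also have "... = PV (th w p v') (S e q)" using vx pq w e by (simp add: map_scaled1[unfolded mem_Collect_eq] th_def)
      finally show "mapVAA idm ?f (coact v' (p \<diamondop> q)) = tensor_lift K A A VA (\<lambda>p q. PV (th w p v') q) (on2 (S e) (p \<diamondop> q))"
        using pq e vx tb by simp
    qed (use vx e w tb in "simp_all add: islin_tensor_lift")
    have 2: "tensor_lift K A A VA (\<lambda>p q. PV (th w p v') q) (on2 (\<lambda>z. S z x') t) = tensor_lift K A A VA (\<lambda>p q. PV (th w p v') (S q x')) t" if t: "t .: AA" for t
      by (rule AA_eqI[where Z=VA, OF _ _ _ t]) (use vx tb tb2 in "simp_all add: islin_tensor_lift")
    show "tensor_lift K A A VA (\<lambda>p q. PV (th w p v') (S q x')) (T1 A (s \<diamondop> e)) =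
       mapVAA idm ?f (tensor_lift K V A (V ** AA) (\<lambda>v x. coact v (R1 (s \<diamondop> x))) (PV v' x'))"
      using vx s e coact_bilin[OF s] by (simp add: 1 S_R1 2)
  qed (use v x s e w coact_bilin in "simp_all add: islin_tensor_lift")
  finally show "mapVAA idm ((case i of (w, e) => \<lambda>t. S e (s1 w t))) (tensor_map K V A V AA idm (\<lambda>s. R1 (s \<diamondop> x)) (lam V (PV v s))) =
    mapVAA idm ((case i of (w, e) => \<lambda>t. S e (s1 w t))) (tensor_lift K V A (V ** AA) (\<lambda>v x. coact v (R1 (s \<diamondop> x))) (RV v x))"
    unfolding i by simp
qed auto

text \<open>
  Apply \<open>(w \<otimes> A) T1\<close> to \<open>lam_R1\<close>: the factors \<open>T1 R1\<close> combine to \<open>E1\<close>.  The antipode has disappeared from the right side, which is why the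
  coaction on \<open>RV v x\<close> becomes computable.
\<close>

lemma th_lam_RV:
  assumes v: "v .: V" and x: "x .: A" and s: "s .: A" and w: "w \<in> dual A"
  shows "mapV (th w s) idm (lam V (RV v x)) = onA (\<lambda>a. s1 w (E1 A (a \<diamondop> x))) (lam V (PV v s))"
proof -
  let ?\<Omega> = "\<lambda>t. s1 w (T1 A t)"
  have \<Omega>: "islin K AA A ?\<Omega>" using w by simp
  have 1: "mapVAA idm ?\<Omega> (coact v' t) = Lam (mid w) v' (T1 A t)" if v': "v' .: V" and t: "t .: AA" for v' t
  proof (rule AA_eqI[where Z=VA and f="\<lambda>t. mapVAA idm ?\<Omega> (coact v' t)" and g="\<lambda>t. Lam (mid w) v' (T1 A t)", OF _ _ _ t])
    fix p q assume pq: "p .: A" "q .: A"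
    show "mapVAA idm ?\<Omega> (coact v' (p \<diamondop> q)) = Lam (mid w) v' (T1 A (p \<diamondop> q))"
      using v' pq w \<Omega> by (simp add: coact_pure Lam_T1[OF scaled_bilin1] s1_lift)
  qed (use v' w \<Omega> in "simp_all add: islin_Lam[OF scaled_bilin1]")
  have "mapV (th w s) idm (lam V y) = mapVAA idm ?\<Omega> (tensor_lift K V A (V ** AA) (\<lambda>v x. coact v (R1 (s \<diamondop> x))) y)"
    if y: "y .: VA" for y
  proof (rule VA_eqI[where Z=VA, OF _ _ _ y])
    fix v' x' assume vx: "v' .: V" "x' .: A"
    show "mapV (th w s) idm (lam V (PV v' x')) = mapVAA idm ?\<Omega> (tensor_lift K V A (V ** AA) (\<lambda>v x. coact v (R1 (s \<diamondop> x))) (PV v' x'))"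
      using vx s w coact_bilin[OF s] by (simp add: 1 Lam_E1[OF scaled_bilin1] Lam_mid)
  qed (use s w \<Omega> coact_bilin[OF s] in "simp_all add: islin_tensor_lift")
  then have "mapV (th w s) idm (lam V (RV v x)) = mapVAA idm ?\<Omega> (tensor_map K V A V AA idm (\<lambda>s. R1 (s \<diamondop> x)) (lam V (PV v s)))"
    using v x s by (simp add: lam_R1)
  also have "... = onA (\<lambda>a. s1 w (T1 A (R1 (a \<diamondop> x)))) (lam V (PV v s))" by (rule map_map) (use v x s w in simp_all)
  also have "... = onA (\<lambda>a. s1 w (E1 A (a \<diamondop> x))) (lam V (PV v s))" by (rule map_cong) (use v x s w in simp_all)
  finally show ?thesis .
qed

text \<open>Right slices of \<open>\<Delta>\<close> commute with the left slices of \<open>E\<close> that occur in \<open>th_lam_RV\<close>, by the compatibility of \<open>E1\<close> and \<open>T1\<close>.\<close>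

lemma lam_RV_slice:
  assumes v: "v .: V" and x: "x .: A" and e: "e .: A" and f: "f \<in> dual A"
  shows "onA (\<lambda>y. s2 f (T1 A (y \<diamondop> e))) (lam V (RV v x)) = lam V (RV v (s2 f (T1 A (x \<diamondop> e))))"
proof (rule sep_map1[where I="dual A \<times> carrier A" and V'="\<lambda>_. V" and f="\<lambda>(w, s). th w s", OF V_module A_module])
  show "v = zero V" if "v .: V" "!!i. i \<in> dual A \<times> carrier A ==> (case i of (w, s) => th w s) v = zero V" for v
    by (rule th_sep[OF that(1)]) (use that(2)[of "(_, _)"] in simp)
  fix i assume "i \<in> dual A \<times> carrier A"
  then obtain w s where i: "i = (w, s)" and w: "w \<in> dual A" and s: "s .: A" by blast
  let ?r = "\<lambda>y. s2 f (T1 A (y \<diamondop> e))"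
  have r: "islin K A A ?r" using e f by simp
  have "mapV (th w s) idm (onA ?r (lam V (RV v x))) = onA ?r (mapV (th w s) idm (lam V (RV v x)))"
    using v x r w s by simp
  also have "... = onA (\<lambda>a. ?r (s1 w (E1 A (a \<diamondop> x)))) (lam V (PV v s))" using v x r w s by (simp add: th_lam_RV[unfolded mem_Collect_eq])
  also have "... = onA (\<lambda>a. s1 w (E1 A (a \<diamondop> ?r x))) (lam V (PV v s))"
  proof (rule map_cong)
    fix a assume a: "a .: A"
    have l: "islin K A A (\<lambda>p. s1 w (E1 A (a \<diamondop> p)))" using a w by simp
    have "?r (s1 w (E1 A (a \<diamondop> x))) = s2 f (on1 (\<lambda>p. s1 w (E1 A (a \<diamondop> p))) (T1 A (x \<diamondop> e)))"
      using T1_E1_rcol[where w=w and c=a and x=x and b=e] w a x e by simp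
    then show "?r (s1 w (E1 A (a \<diamondop> x))) = s1 w (E1 A (a \<diamondop> ?r x))" using l f x e by simp
  qed (use v x s w r e f in simp_all)
  also have "... = mapV (th w s) idm (lam V (RV v (?r x)))" using v x w s e f by (simp add: th_lam_RV[unfolded mem_Collect_eq])
  finally show "tA V V (case i of (w, s) => th w s) (onA ?r (lam V (RV v x))) =
     tA V V (case i of (w, s) => th w s) (lam V (RV v (?r x)))" unfolding i by simp
qed (use v x e f in auto)

text \<open>
  The coaction of \<open>v' x'\<close> is \<open>v'\<^sub>0 x'\<^sub>1 \<otimes> v'\<^sub>1 x'\<^sub>2\<close>; rewriting the action by \<open>fv_lam\<close> and using coassociativity moves the slice to the
  argument, where \<open>lam_RV_slice\<close> applies.
\<close>

lemma th_fv:
  assumes v: "v .: V" and x: "x .: A" and e: "e .: A" and f: "f \<in> dual A"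
  shows "th f e (fv v x) = fv v (s2 f (T1 A (x \<diamondop> e)))"
proof -
  let ?r = "\<lambda>y. s2 f (T1 A (y \<diamondop> e))"
  let ?g = "tensor_lift K V A V fv"
  have r: "islin K A A ?r" using e f by simp
  note g = islin_tensor_lift[OF V_module A_module V_module fv_bilin]
  have 1: "sl2 V A f (Bm v' t) = ?g (Lam (third f) v' t)" if t: "t .: AA" and v': "v' .: V" for t v'
    by (rule AA_eqI[where Z=V and f="\<lambda>t. sl2 V A f (Bm v' t)" and g="\<lambda>t. ?g (Lam (third f) v' t)", OF _ _ _ t])
       (use v' f in "simp_all add: g islin_Lam[OF scaled_bilin2] sl2_map Lam_third fv_lam_pure flip: th_def")
  have "th f e (action V y) = ?g (onA ?r (lam V y))" if y: "y .: VA" for y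
  proof (rule VA_eqI[where Z=V, OF _ _ _ y])
    fix v' x' assume vx: "v' .: V" "x' .: A"
    show "th f e (action V (PV v' x')) = ?g (onA ?r (lam V (PV v' x')))"
      using vx e f by (simp add: th_def lam_act 1 Lam_T1[OF scaled_bilin2] s2_lift)
  qed (use e f r in "simp_all add: g")
  then have "th f e (fv v x) = ?g (onA ?r (lam V (RV v x)))" using v x by (simp add: fv_def)
  also have "... = action V (RV v (?r x))" using v x e f by (simp add: lam_RV_slice fv_lam)
  finally show ?thesis by (simp add: fv_def)
qed

text \<open>Slice by slice this is \<open>th_fv\<close>.\<close>

lemma lam_fv:
  assumes v: "v .: V" and t: "t .: AA"
  shows "lam V (tA A V (fv v) t) = tA A V (fv v) (T1 A t)"
proof (rule AA_eqI[where Z=VA, OF _ _ _ t])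
  fix x e assume xe: "x .: A" "e .: A"
  have "lam V (PV (fv v x) e) = tA A V (fv v) (T1 A (x \<diamondop> e))"
    by (rule sep2[OF V_module A_module]) (use v xe th_fv[OF v xe] in "simp_all add: sl2_map flip: th_def")
  then show "lam V (tA A V (fv v) (x \<diamondop> e)) = tA A V (fv v) (T1 A (x \<diamondop> e))" using v xe by simp
qed (use v in simp_all)

end

section \<open>Vector spaces with the same underlying data\<close>

text \<open>
  Tensor products and linear maps depend only on these data, but a Hopf module and its underlying space are records
  of different types.
\<close>

definition same_space :: "('k, 'v, 'x) module_scheme => ('k, 'v, 'y) module_scheme => bool" where
  "same_space V V' \<longleftrightarrow> carrier V = carrier V' \<and> add V = add V' \<and> smult V = smult V' \<and> zero V = zero V'"

lemma same_refl [simp]: "same_space V V" by (simp add: same_space_def)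

lemma tensor_rels_same: "same_space V V' ==> same_space W W' ==> tensor_rels K V W = tensor_rels K V' W'"
  by (simp add: tensor_rels_def same_space_def)

lemma tensor_space_same: "same_space V V' ==> same_space W W' ==> tensor_space K V W = tensor_space K V' W'"
  and pure_tensor_same: "same_space V V' ==> same_space W W' ==> pure_tensor K V W = pure_tensor K V' W'"
  using tensor_rels_same[of V V' W W' K] 
  by (auto simp: tensor_space_def pure_tensor_def tensor_ker_def same_space_def intro!: ext)

lemma lin_same: "same_space V V' ==> same_space W W' ==> lin K V W = lin K V' W'"
  by (simp add: lin_def same_space_def)

lemma islin_same: "same_space V V' ==> same_space W W' ==> islin K V W f = islin K V' W' f"
  by (simp add: islin_def same_space_def)

lemma tensor_lift_same: 
  assumes V: "same_space V V'" and W: "same_space W W'" and Z: "same_space Z Z'"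
  shows "tensor_lift K V W Z b = tensor_lift K V' W' Z' b"
proof -
  have "carrier V = carrier V'" "carrier W = carrier W'" using V W by (simp_all add: same_space_def)
  then show ?thesis unfolding tensor_lift_def tensor_space_same[OF V W, of K] pure_tensor_same[OF V W, of K]
    using lin_same[OF same_refl Z, of K "tensor_space K V' W'"] by simp
qed

lemma tensor_map_same:
  assumes V: "same_space V V'" and W: "same_space W W'" and Y: "same_space Y Y'" and Z: "same_space Z Z'"
  shows "tensor_map K V W Y Z f g = tensor_map K V' W' Y' Z' f g"
  unfolding tensor_map_def tensor_space_same[OF Y Z, of K] pure_tensor_same[OF Y Z, of K]
  by (rule tensor_lift_same[OF V W same_refl])

context over_field begin

text \<open>The vector space axioms hold for \<open>L\<close> and \<open>V\<^sup>c\<close>, which consist of functions, because they are images of \<open>A\<close> and \<open>V\<close>.\<close>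

lemma module_surj:
  assumes V: "module K V" and c: "carrier L = q ` carrier V" and z: "(zero L) = q (zero V)"
    and a: "!!x y. x .: V ==> y .: V ==> q x \<oplus>\<^bsub>L\<^esub> q y = q (x \<oplus>\<^bsub>V\<^esub> y)"
    and s: "!!k x. k .: K ==> x .: V ==> k \<odot>\<^bsub>L\<^esub> q x = q (k \<odot>\<^bsub>V\<^esub> x)"
  shows "module K L" and "islin K V L q"
proof -
  show "module K L"
  proof (rule moduleI[OF cring_K])
    show "abelian_group L"
    proof (rule abelian_groupI)
      fix x assume "x .: L"
      then obtain v where v: "v .: V" "x = q v" using c by blast
      then show "\<exists>y\<in>carrier L. y \<oplus>\<^bsub>L\<^esub> x = zero L" using V c by (intro bexI[of _ "q (\<ominus>\<^bsub>V\<^esub> v)"]) (simp_all add: a z)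
    qed (use V in "auto simp: c a z m_assoc m_comm m_lcomm")
  qed (use V in "auto simp: c a s m_smult_l_distr m_smult_r_distr m_smult_assoc")
  show "islin K V L q" by (rule islinI) (use c a s in auto)
qed

lemma module_same: "same_space V V' ==> module K V ==> module K V'"
  by (rule module_surj(1)[where V=V and q="\<lambda>x. x"]) (simp_all add: same_space_def)

end

section \<open>Morphisms of Hopf modules\<close>

context hopf_wmb begin

lemma regular_same: "same_space regular_hopf_module A"
  by (simp add: same_space_def regular_hopf_module_def)

lemma hopf_hom_regular:
  "f \<in> hopf_hom regular_hopf_module V \<longleftrightarrow> f \<in> lin K A V \<and> (\<forall>a\<in>carrier A. \<forall>b\<in>carrier A. f (a \<cdot> b) = ract V (f a) b) \<and>
     (\<forall>t\<in>carrier AA. lam V (tA A V f t) = tA A V f (T1 A t))"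
  unfolding hopf_hom_def rmodule_hom_def comodule_hom_def
  unfolding tensor_map_same[OF regular_same same_refl same_refl same_refl] tensor_space_same[OF regular_same same_refl] lin_same[OF regular_same same_refl]
  by (auto simp: regular_hopf_module_def)

lemma hopf_hom_iff:
  "f \<in> hopf_hom V W \<longleftrightarrow> f \<in> lin K V W \<and> (\<forall>v\<in>carrier V. \<forall>a\<in>carrier A. f (ract V v a) = ract W (f v) a) \<and>
     (\<forall>t\<in>carrier (V ** A). lam W (tA V W f t) = tA V W f (lam V t))"
  by (auto simp: hopf_hom_def rmodule_hom_def comodule_hom_def)

lemma hopf_mod_intro: "hopf_module V ==> hopf_mod K A R1 R2 V"
  by unfold_locales

end

context hopf_mod begin

text \<open>\<open>f\<^sub>v\<close> has the property that characterizes \<open>\<varpi>(v)\<close>, and such a morphism is unique by \<open>S_span\<close>.\<close>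

lemma varpi_eq:
  assumes v: "v .: V" shows "varpi V v = restrict (fv v) (carrier A)"
  unfolding varpi_def
proof (rule the_equality)
  have f: "islin K A V (restrict (fv v) (carrier A))" using iffD1[OF islin_cong[of A "fv v"] islin_fv'[OF v]] by simp
  have m: "tA A V (restrict (fv v) (carrier A)) t = tA A V (fv v) t" if "t .: AA" for t
    by (rule map_cong) (use f that in simp_all)
  show "restrict (fv v) (carrier A) \<in> hopf_hom regular_hopf_module V \<and>
    (\<forall>a\<in>carrier A. \<forall>b\<in>carrier A. restrict (fv v) (carrier A) (fst (antipode R1 R2 b) a) =
        tensor_lift K V A V (\<lambda>v' b'. ract V v' (fst (antipode R1 R2 b') a)) (rho V (PV v b)))"
  proof (intro conjI ballI)
    show "restrict (fv v) (carrier A) \<in> hopf_hom regular_hopf_module V"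
      using v f by (simp add: hopf_hom_regular restrict_lin fv_right m lam_fv)
    fix a b assume "a .: A" "b .: A"
    then show "restrict (fv v) (carrier A) (fst (antipode R1 R2 b) a) =
        tensor_lift K V A V (\<lambda>v' b'. ract V v' (fst (antipode R1 R2 b') a)) (rho V (PV v b))"
      using v by (simp add: S_antipode fv_S)
  qed
  fix g assume g: "g \<in> hopf_hom regular_hopf_module V \<and> (\<forall>a\<in>carrier A. \<forall>b\<in>carrier A. g (fst (antipode R1 R2 b) a) =
        tensor_lift K V A V (\<lambda>v' b'. ract V v' (fst (antipode R1 R2 b') a)) (rho V (PV v b)))"
  then have gl: "g \<in> lin K A V" by (simp add: hopf_hom_regular)
  note gl' = lin_islin[OF gl]
  show "g = restrict (fv v) (carrier A)"
  proof (rule lin_eqI[OF gl restrict_lin[OF A_module islin_fv'[OF v]]])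
    fix x assume "x .: A"
    then have "g x = fv v x"
    proof (induction rule: S_induct)
      case (S a b)
      then show ?case using g v by (simp add: S_antipode fv_S)
    next
      case (add x y)
      then show ?case using v by (simp add: islin_add[OF gl'] islin_add[OF islin_fv'])
    qed
    then show "g x = restrict (fv v) (carrier A) x" using \<open>x .: A\<close> by simp
  qed
qed

lemma varpi_app [simp]: "v .: V ==> x .: A ==> varpi V v x = fv v x"
  by (simp add: varpi_eq)

lemma varpi_hom:
  assumes v: "v .: V" shows "varpi V v \<in> hopf_hom regular_hopf_module V"
proof -
  have f: "islin K A V (restrict (fv v) (carrier A))" using iffD1[OF islin_cong[of A "fv v"] islin_fv'[OF v]] by simp
  have m: "tA A V (restrict (fv v) (carrier A)) t = tA A V (fv v) t" if "t .: AA" for t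
    by (rule map_cong) (use f that in simp_all)
  show ?thesis unfolding varpi_eq[OF v] using v f by (simp add: hopf_hom_regular restrict_lin fv_right m lam_fv)
qed

text \<open>
  A Hopf morphism carries \<open>R1 (a \<otimes> x)\<close> to \<open>RV (f a) x\<close>, by the characterization of the latter and \<open>S_R1\<close>; and
  \<open>\<mu> R1 (a \<otimes> x) = \<sqinter>\<^sup>L(a) x\<close>.
\<close>

lemma fv_hom:
  assumes f: "f \<in> hopf_hom regular_hopf_module V" and a: "a .: A" and x: "x .: A"
  shows "fv (f a) x = f (PL a x)"
proof -
  have l: "islin K A V f" using f by (auto simp: hopf_hom_regular intro: lin_islin)
  note fin = islin_in[OF l]
  have fm: "f (a \<cdot> b) = ract V (f a) b" if "a .: A" "b .: A" for a b using f that by (simp add: hopf_hom_regular)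
  have fl: "lam V (tA A V f t) = tA A V f (T1 A t)" if "t .: AA" for t
    using f that by (simp add: hopf_hom_regular)
  have "RV (f a) x = tA A V f (R1 (a \<diamondop> x))"
  proof (rule RV_eqI)
    fix d assume d: "d .: A"
    have "onA (S d) (tA A V f (R1 (a \<diamondop> x))) = tA A V f (on2 (S d) (R1 (a \<diamondop> x)))" (is "?lhs = _")
      using a x d l by simp
    also have "... = tA A V f (on2 (\<lambda>z. S z x) (T1 A (a \<diamondop> d)))" using a x d by (simp only: S_R1)
    also have "... = onA (\<lambda>z. S z x) (tA A V f (T1 A (a \<diamondop> d)))" using a x d l by simp
    also have "... = onA (\<lambda>z. S z x) (lam V (PV (f a) d))" (is "_ = ?rhs") using fl[of "a \<diamondop> d"] a d l by simp
    finally show "?lhs = ?rhs" .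
  qed (use a x l fin in simp_all)
  moreover have "action V (tA A V f t) = f (mu t)" if t: "t .: AA" for t
    by (rule AA_eqI[where Z=V, OF _ _ _ t]) (use l fin fm in "simp_all add: islin_comp[OF l]")
  ultimately show ?thesis using a x by (simp add: fv_def mu_R1 PL_def)
qed

end

context hopf_wmb begin

text \<open>A Hopf morphism commutes with action and coaction, hence carries \<open>RV v x\<close> to \<open>RV (f v) x\<close>.\<close>

lemma fv_natural:
  assumes V: "hopf_module V" and W: "hopf_module W" and f: "f \<in> hopf_hom V W" and v: "v .: V" and x: "x .: A"
  shows "hopf_mod.fv K A R1 W (f v) x = f (hopf_mod.fv K A R1 V v x)"
proof -
  interpret V: hopf_mod K A R1 R2 V using V by (rule hopf_mod_intro)
  interpret W: hopf_mod K A R1 R2 W using W by (rule hopf_mod_intro)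
  have l: "islin K V W f" using f by (auto simp: hopf_hom_iff intro: lin_islin)
  note fin = islin_in[OF l]
  have fm: "f (ract V v a) = ract W (f v) a" if "v .: V" "a .: A" for v a using f that by (simp add: hopf_hom_iff)
  have fl: "lam W (tA V W f t) = tA V W f (lam V t)" if "t .: V.VA" for t
    using f that by (simp add: hopf_hom_iff)
  have "W.RV (f v) x = tA V W f (V.RV v x)"
  proof (rule W.RV_eqI)
    fix d assume d: "d .: A"
    have "W.mapV idm (S d) (tA V W f (V.RV v x)) = tA V W f (V.mapV idm (S d) (V.RV v x))" (is "?lhs = _")
      using v x d l by simp
    also have "... = tA V W f (V.mapV idm (\<lambda>z. S z x) (lam V (V.PV v d)))" using v x d by (simp only: V.S_RV)
    also have "... = W.mapV idm (\<lambda>z. S z x) (tA V W f (lam V (V.PV v d)))" using v x d l by simp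
    also have "... = W.mapV idm (\<lambda>z. S z x) (lam W (W.PV (f v) d))" (is "_ = ?rhs") using fl[of "V.PV v d"] v d l by simp
    finally show "?lhs = ?rhs" .
  qed (use v x l fin in simp_all)
  moreover have "action W (tA V W f t) = f (action V t)" if t: "t .: V.VA" for t
    by (rule V.VA_eqI[where Z=W, OF _ _ _ t]) (use l fin fm in "simp_all add: islin_comp[OF l]")
  ultimately show ?thesis using v x by (simp add: V.fv_def W.fv_def)
qed

section \<open>The base algebra\<close>

abbreviation "L \<equiv> base_L"

lemma sqL_simps [simp]: "b .: A ==> fst (sqL a) b = PL a b" "b .: A ==> snd (sqL a) b = PLr b a"
  by (simp_all add: sqL_def PL_def PLr_def slice_eq)

text \<open>Multipliers are pairs of extensional maps; this is the pair \<open>\<sqinter>\<^sup>L(a)\<close>.\<close>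

lemma sqL_alt: "sqL a = (\<lambda>b\<in>carrier A. PL a b, \<lambda>b\<in>carrier A. PLr b a)"
  by (auto simp: sqL_def PL_def PLr_def slice_eq)

lemma L_carrier: "carrier L = sqL ` carrier A" by (simp add: base_L_def)

lemma sqL_in [simp]: "a .: A ==> sqL a .: L" by (simp add: L_carrier)

lemma sqL_eq: "a .: A ==> a' .: A ==> sqL a = sqL a' \<longleftrightarrow> (\<forall>b\<in>carrier A. PL a b = PL a' b)"
  using PL_determines_PLr[of a a'] by (auto simp: sqL_alt fun_eq_iff restrict_def) 

lemma L_lin: "module K L" "islin K A L sqL"
proof -
  have z: "(zero L) = sqL (zero A)"
  proof -
    have "PL (zero A) b = zero A" "PLr b (zero A) = zero A" if b: "b .: A" for b
    proof -
      have "islin K A A (\<lambda>a. PL a b)" "islin K A A (\<lambda>a. PLr b a)" using b by simp_all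
      then show "PL (zero A) b = zero A" "PLr b (zero A) = zero A" by (auto dest: islin_zero[OF A_module A_module])
    qed
    then show ?thesis by (auto simp: base_L_def multiplier_algebra_def sqL_alt)
  qed
  have lin: "islin K A A (\<lambda>a. PL a b)" "islin K A A (\<lambda>a. PLr b a)" if "b .: A" for b using that by simp_all
  have a: "sqL a \<oplus>\<^bsub>L\<^esub> sqL a' = sqL (a \<oplus>\<^bsub>A\<^esub> a')" if "a .: A" "a' .: A" for a a'
    using that by (auto simp: base_L_def multiplier_algebra_def sqL_alt islin_add[OF lin(1)] islin_add[OF lin(2)])
  have s: "k \<odot>\<^bsub>L\<^esub> sqL a = sqL (k \<odot>\<^bsub>A\<^esub> a)" if "k .: K" "a .: A" for k a
    using that by (auto simp: base_L_def multiplier_algebra_def sqL_alt islin_smult[OF lin(1)] islin_smult[OF lin(2)])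
  show "module K L" "islin K A L sqL" by (rule module_surj[OF A_module L_carrier z a s]; simp)+
qed

lemmas L_module [simp] = L_lin(1)

lemma islin_sqL [simp]: "islin K X A f ==> islin K X L (\<lambda>x. sqL (f x))" "islin K A L sqL"
  using islin_comp[OF L_lin(2)] L_lin(2) by auto

lemma L_mult: "c .: A ==> a .: A ==> sqL c \<otimes>\<^bsub>L\<^esub> sqL a = sqL (PL c a)"
  by (auto simp: base_L_def multiplier_algebra_def sqL_alt compose_def PL_PL PLr_PL)

lemma fst_L_in [simp]: "l .: L ==> b .: A ==> fst l b .: A"
  by (auto simp: L_carrier)

lemma L_mult_in [simp]: "l .: L ==> m .: L ==> l \<otimes>\<^bsub>L\<^esub> m .: L"
  by (auto simp: L_carrier L_mult)

lemma fst_L_mult: "l .: L ==> m .: L ==> b .: A ==> fst (l \<otimes>\<^bsub>L\<^esub> m) b = fst l (fst m b)"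
  by (auto simp: L_carrier L_mult PL_PL)

lemma fst_L_right: "l .: L ==> b .: A ==> c .: A ==> fst l (b \<cdot> c) = fst l b \<cdot> c"
  by (auto simp: L_carrier PL_right)

lemma L_eqI:
  assumes "l .: L" "m .: L" "!!b. b .: A ==> fst l b = fst m b" shows "l = m"
  using assms by (auto simp: L_carrier sqL_eq)

lemma islin_fst2 [simp]: "l .: L ==> islin K X A f ==> islin K X A (\<lambda>x. fst l (f x))"
proof -
  assume l: "l .: L" and f: "islin K X A f"
  obtain a where a: "a .: A" "l = sqL a" using l by (auto simp: L_carrier)
  have "islin K A A (fst l)" by (rule iffD1[OF islin_cong, of A "PL a"]) (use a in simp_all)
  from islin_comp[OF this f] show ?thesis .
qed

lemma islin_fst1 [simp]: "b .: A ==> islin K X L f ==> islin K X A (\<lambda>x. fst (f x) b)"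
proof -
  assume b: "b .: A" and f: "islin K X L f"
  have lin: "islin K A A (\<lambda>a. PL a b)" using b by simp
  have "islin K L A (\<lambda>l. fst l b)"
  proof (rule islinI)
    fix l m assume "l .: L" "m .: L"
    then obtain a a' where a: "a .: A" "l = sqL a" "a' .: A" "m = sqL a'" by (auto simp: L_carrier)
    then show "fst (l \<oplus>\<^bsub>L\<^esub> m) b = fst l b \<oplus>\<^bsub>A\<^esub> fst m b"
      using b by (simp add: islin_add[OF lin] flip: islin_add[OF L_lin(2)])
  next
    fix k l assume "k .: K" "l .: L"
    then obtain a where a: "k .: K" "a .: A" "l = sqL a" by (auto simp: L_carrier)
    then show "fst (k \<odot>\<^bsub>L\<^esub> l) b = k \<odot>\<^bsub>A\<^esub> fst l b"
      using b by (simp add: islin_smult[OF lin] flip: islin_smult[OF L_lin(2)])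
  qed (use b in simp)
  from islin_comp[OF this f] show ?thesis .
qed

lemma fst_bilin: "bilin K L A A fst"
proof (intro bilinI)
  show "islin K A A (fst l)" if "l .: L" for l using islin_fst2[OF that islin_id] .
qed simp

lemma L_mult_bilin: "bilin K L L L (mult L)"
proof (intro bilinI; rule islinI)
  have L_eqI': "l = m" if "l .: L" "m .: L" "!!b. b .: A ==> fst l b = fst m b" for l m using L_eqI that .
  note f1 = islin_fst1[OF _ islin_id] and f2 = islin_fst2[OF _ islin_id]
  note s = islin_add[OF f1] islin_smult[OF f1] islin_add[OF f2] islin_smult[OF f2] fst_L_mult
  show "u \<otimes>\<^bsub>L\<^esub> (x \<oplus>\<^bsub>L\<^esub> y) = u \<otimes>\<^bsub>L\<^esub> x \<oplus>\<^bsub>L\<^esub> u \<otimes>\<^bsub>L\<^esub> y" if "u .: L" "x .: L" "y .: L" for u x y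
    by (rule L_eqI) (use that in "simp_all add: s")
  show "u \<otimes>\<^bsub>L\<^esub> (c \<odot>\<^bsub>L\<^esub> x) = c \<odot>\<^bsub>L\<^esub> (u \<otimes>\<^bsub>L\<^esub> x)" if "u .: L" "x .: L" "c .: K" for u x c
    by (rule L_eqI) (use that in "simp_all add: s")
  show "(x \<oplus>\<^bsub>L\<^esub> y) \<otimes>\<^bsub>L\<^esub> u = x \<otimes>\<^bsub>L\<^esub> u \<oplus>\<^bsub>L\<^esub> y \<otimes>\<^bsub>L\<^esub> u" if "u .: L" "x .: L" "y .: L" for u x y
    by (rule L_eqI) (use that in "simp_all add: s")
  show "(c \<odot>\<^bsub>L\<^esub> x) \<otimes>\<^bsub>L\<^esub> u = c \<odot>\<^bsub>L\<^esub> (x \<otimes>\<^bsub>L\<^esub> u)" if "u .: L" "x .: L" "c .: K" for u x c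
    by (rule L_eqI) (use that in "simp_all add: s")
qed simp_all

end

section \<open>Balanced tensor products\<close>

text \<open>
  The tensor product over \<open>L\<close> of two bilinear actions, with its universal property.  It is used with \<open>A\<close> and with \<open>L\<close> itself
  on the right.
\<close>

locale balanced = over_field K for K :: "'k ring" (structure) +
  fixes L :: "('k, 'l, 'x) module_scheme" and P :: "('k, 'p, 'l, 'y) rmodule_scheme"
    and N :: "('k, 'n, 'z) module_scheme" and lact :: "'l => 'n => 'n"
  assumes L: "module K L" and P: "module K P" and N: "module K N"
    and ract: "bilin K P L P (ract P)" and lact: "bilin K L N N lact"
begin

abbreviation "PN \<equiv> (P ** N)"
abbreviation "B \<equiv> bal_space K L P N lact"
abbreviation "bt \<equiv> bal_tensor K L P N lact"

lemma acts_in [simp]: "p .: P ==> l .: L ==> rmodule.ract P p l .: P"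
  "l .: L ==> n .: N ==> lact l n .: N"
  using ract lact by (auto simp: bilin_def dest: islin_in)

lemma PN_module: "module K PN" using P N by simp

lemma ker_sub: "submodule (bal_ker K L P N lact) K PN"
  unfolding bal_ker_def by (rule submodule_lspan) (use P N in auto)

lemma B_module: "module K B"
  unfolding bal_space_def by (rule module_quot[OF PN_module ker_sub])

definition proj where "proj t = bal_ker K L P N lact +>\<^bsub>PN\<^esub> t"

lemma islin_proj: "islin K PN B proj"
  using islin_coset[OF PN_module ker_sub] unfolding bal_space_def proj_def by simp

lemma proj_pure: "proj (pure_tensor K P N p n) = bt p n"
  by (simp add: proj_def bal_tensor_def)

lemma bt_bilin: "bilin K P N B bt"
  unfolding proj_pure[symmetric]
  by (intro bilinI islin_comp[OF islin_proj] islin_pure1 islin_pure2 islin_id P N)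

lemma bt_in: "p .: P ==> n .: N ==> bt p n .: B"
  using bt_bilin by (auto simp: bilin_def dest: islin_in)

lemma islin_bt1: "n .: N ==> islin K X P f ==> islin K X B (\<lambda>x. bt (f x) n)"
  using bt_bilin islin_comp[of P B "\<lambda>p. bt p n" X f] by (simp add: bilin_def)

lemma islin_bt2: "p .: P ==> islin K X N f ==> islin K X B (\<lambda>x. bt p (f x))"
  using bt_bilin islin_comp[of N B "bt p" X f] by (simp add: bilin_def)

lemma bt_balanced:
  assumes p: "p .: P" and l: "l .: L" and n: "n .: N"
  shows "bt (rmodule.ract P p l) n = bt p (lact l n)"
proof -
  have "pure_tensor K P N (rmodule.ract P p l) n \<ominus>\<^bsub>PN\<^esub> pure_tensor K P N p (lact l n) \<in> bal_ker K L P N lact"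
    unfolding bal_ker_def by (rule lspanI) (use assms in blast)
  then show ?thesis unfolding bal_tensor_def
    by (subst coset_eq_iff[OF PN_module ker_sub]) (use assms P N in simp_all)
qed

lemma proj_surj: "x .: B ==> \<exists>t\<in>carrier PN. x = proj t"
  by (simp add: bal_space_def quot_carrier proj_def)

lemma bal_induct [consumes 1, case_names bt add]:
  assumes x: "x .: B" and "!!p n. p .: P ==> n .: N ==> Q (bt p n)"
    "!!x y. x .: B ==> y .: B ==> Q x ==> Q y ==> Q (x \<oplus>\<^bsub>B\<^esub> y)"
  shows "Q x"
proof -
  obtain t where t: "t .: PN" "x = proj t" using proj_surj[OF x] by blast
  have "Q (proj t)" using P N t(1)
  proof (induction rule: tensor_induct)
    case (pure v w) then show ?case using assms(2) by (simp add: proj_pure)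
  next
    case (add s t) then show ?case using assms(3) islin_in[OF islin_proj] by (simp add: islin_add[OF islin_proj])
  qed
  then show ?thesis using t by simp
qed

lemma bal_eqI:
  assumes "islin K B Z f" "islin K B Z g" "!!p n. p .: P ==> n .: N ==> f (bt p n) = g (bt p n)" "x .: B"
  shows "f x = g x"
  using assms(4) by (induction rule: bal_induct) (simp_all add: assms(3) islin_add[OF assms(1)] islin_add[OF assms(2)])

lemma bal_lift:
  assumes Z: "module K Z" and b: "bilin K P N Z b"
    and bal: "!!p l n. p .: P ==> l .: L ==> n .: N ==> b (rmodule.ract P p l) n = b p (lact l n)"
  shows bal_lift_lin: "bal_lift K L P N lact Z b \<in> lin K B Z"
    and bal_lift_bt: "p .: P ==> n .: N ==> bal_lift K L P N lact Z b (bt p n) = b p n"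
proof -
  let ?f = "tensor_lift K P N Z b"
  note f = tensor_lift_islin[OF P N Z b]
  have "bal_ker K L P N lact \<subseteq> {x \<in> carrier PN. ?f x = (zero Z)}"
    unfolding bal_ker_def
  proof (rule lspan_subset[OF submodule_kernel[OF PN_module Z f]], safe)
    fix p l n assume *: "p .: P" "l .: L" "n .: N"
    let ?x = "pure_tensor K P N (rmodule.ract P p l) n" and ?y = "pure_tensor K P N p (lact l n)"
    have xy: "?x .: PN" "?y .: PN" using * P N by simp_all
    show "?x \<ominus>\<^bsub>PN\<^esub> ?y .: PN" using xy PN_module by simp
    have "?f ?x = ?f ?y" using * P N Z b by (simp add: bal)
    then show "?f (?x \<ominus>\<^bsub>PN\<^esub> ?y) = zero Z" using islin_in[OF f xy(2)] Z by (simp add: islin_sub[OF PN_module Z f xy] m_sub_eq_zero)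
  qed
  then have ker: "?f u = zero Z" if "u \<in> bal_ker K L P N lact" for u using that by blast
  have "\<exists>g. islin K B Z g \<and> (\<forall>t\<in>carrier PN. g (proj t) = ?f t)"
    unfolding bal_space_def proj_def by (rule quot_lift[OF PN_module ker_sub Z f ker]) (assumption | blast)+
  then obtain g where g: "islin K B Z g" "!!t. t .: PN ==> g (proj t) = ?f t" by blast
  have gp: "g (bt p n) = b p n" if "p .: P" "n .: N" for p n
    using g(2)[of "pure_tensor K P N p n"] that P N Z b by (simp add: proj_pure)
  have eq: "bal_lift K L P N lact Z b = restrict g (carrier B)" unfolding bal_lift_def
  proof (rule the_lin[OF B_module g(1)])
    fix h x assume h: "islin K B Z h" "\<forall>p\<in>carrier P. \<forall>n\<in>carrier N. h (bt p n) = b p n" and x: "x .: B"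
    show "h x = g x" by (rule bal_eqI[OF h(1) g(1) _ x]) (use h gp in simp)
  qed (simp add: gp bt_in)
  show "bal_lift K L P N lact Z b \<in> lin K B Z" unfolding eq by (rule restrict_lin[OF B_module g(1)])
  show "p .: P ==> n .: N ==> bal_lift K L P N lact Z b (bt p n) = b p n" unfolding eq by (simp add: gp bt_in)
qed

lemmas bal_lift_islin = lin_islin[OF bal_lift_lin]

end

context hopf_wmb begin

section \<open>The separability structure of the base algebra\<close>

text \<open>\<open>ev u b\<close> evaluates an element of \<open>L \<otimes> L\<close> at \<open>u \<otimes> b\<close>; these evaluations separate the points by \<open>LL_sep\<close>.\<close>

abbreviation "LL \<equiv> (L ** L)"
abbreviation "ev u b \<equiv> tensor_map K L L A A (\<lambda>l. fst l u) (\<lambda>l. fst l b)"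

lemma L_sep: "l .: L ==> (!!b. b .: A ==> fst l b = zero A) ==> l = zero L"
  by (rule L_eqI) (simp_all add: islin_zero[OF _ _ islin_fst1[OF _ islin_id]])

lemma LW_sep:
  assumes "module K W" "s .: (L ** W)" "t .: (L ** W)"
    "!!u. u .: A ==> tensor_map K L W A W (\<lambda>l. fst l u) idm s = tensor_map K L W A W (\<lambda>l. fst l u) idm t"
  shows "s = t"
  by (rule sep_map1[where I="carrier A" and V'="\<lambda>_. A" and f="\<lambda>u l. fst l u", OF L_module assms(1) _ _ _ assms(2,3)])
     (simp_all add: L_sep assms(4))

lemma WL_sep:
  assumes "module K W" "s .: (W ** L)" "t .: (W ** L)"
    "!!u. u .: A ==> tensor_map K W L W A idm (\<lambda>l. fst l u) s = tensor_map K W L W A idm (\<lambda>l. fst l u) t"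
  shows "s = t"
  by (rule sep_map2[where I="carrier A" and W'="\<lambda>_. A" and f="\<lambda>u l. fst l u", OF assms(1) L_module _ _ _ assms(2,3)])
     (simp_all add: L_sep assms(4))

lemma LL_sep:
  assumes "s .: LL" "t .: LL" "!!u b. u .: A ==> b .: A ==> ev u b s = ev u b t"
  shows "s = t"
proof (rule LW_sep[OF L_module assms(1,2)])
  fix u assume u: "u .: A"
  show "tensor_map K L L A L (\<lambda>l. fst l u) idm s = tensor_map K L L A L (\<lambda>l. fst l u) idm t"
    by (rule WL_sep[OF A_module]) (use u assms in simp_all)
qed

text \<open>
  Since the \<open>\<sqinter>\<^sup>L(x) y\<close> span \<open>A\<close>, it suffices to treat \<open>a = \<sqinter>\<^sup>L(x) y\<close>, where the element is \<open>(\<sqinter>\<^sup>L \<otimes> \<sqinter>\<^sup>L) E (x \<otimes> y)\<close>.  The last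
  conjunct says that multiplication sends it back to \<open>\<sqinter>\<^sup>L(a)\<close>.
\<close>

lemma dl_ex:
  assumes a: "a .: A"
  shows "\<exists>z\<in>carrier LL. (\<forall>u\<in>carrier A. \<forall>b\<in>carrier A. ev u b z = dl a u b) \<and> (\<forall>b\<in>carrier A. tensor_lift K L A A fst (tensor_map K L L L A idm (\<lambda>l. fst l b) z) = PL a b)"
    (is "\<exists>z\<in>_. ?A a z \<and> ?B a z")
  using a
proof (induction rule: A_induct)
  case (mult a b)
  let ?P = "\<lambda>t. \<exists>z\<in>carrier LL. ?A (tensor_lift K A A A PL t) z \<and> ?B (tensor_lift K A A A PL t) z"
  note B = PL_bilin fst_bilin
  have "?P t" if t: "t .: AA" for t using A_module A_module t
  proof (induction rule: tensor_induct)
    case (pure x y)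
    let ?z = "tensor_map K A A L L sqL sqL (E1 A (x \<diamondop> y))"
    have 1: "ev u b ?z = dl (PL x y) u b" if u: "u .: A" and b: "b .: A" for u b
    proof -
      have "ev u b ?z = map_A (\<lambda>l. fst (sqL l) u) (\<lambda>l. fst (sqL l) b) (E1 A (x \<diamondop> y))" using pure u b by simp
      also have "... = map_A (\<lambda>x. PL x u) (\<lambda>x. PL x b) (E1 A (x \<diamondop> y))" by (rule mcong) (use pure u b in simp_all)
      also have "... = on1 (\<lambda>x. PL x u) (on2 (\<lambda>x. PL x b) (E1 A (x \<diamondop> y)))" using pure u b by simp
      also have "... = dl x u (PL y b)" using pure u b by (simp only: E1_PL2 dl_def)
      also have "... = dl (PL x y) u b" using pure u b by (simp add: dl_right)
      finally show ?thesis .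
    qed
    have 2: "tensor_lift K L A A fst (tensor_map K L L L A idm (\<lambda>l. fst l b) ?z) = PL (PL x y) b" if b: "b .: A" for b
    proof -
      have "tensor_lift K L A A fst (tensor_map K L L L A idm (\<lambda>l. fst l b) ?z) = tensor_lift K L A A fst (tensor_map K A A L A sqL (\<lambda>l. fst (sqL l) b) (E1 A (x \<diamondop> y)))"
        using pure b by simp
      also have "tensor_map K A A L A sqL (\<lambda>l. fst (sqL l) b) (E1 A (x \<diamondop> y)) = tA A L sqL (on2 (\<lambda>x. PL x b) (E1 A (x \<diamondop> y)))"
        using pure b by simp
      also have "... = tA A L sqL (E1 A (x \<diamondop> PL y b))" using pure b by (simp only: E1_PL2)
      also have "tensor_lift K L A A fst (tA A L sqL t) = tensor_lift K A A A PL t" if t: "t .: AA" for t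
        by (rule tensor_lift_unique[symmetric]) (use t B in "simp_all add: islin_tensor_lift")
      finally show ?thesis using pure b by (simp add: lift_PL_E1 PL_PL)
    qed
    show ?case by (rule bexI[where x="?z"]) (use 1 2 pure B in simp_all)
  next
    case (add s t)
    then obtain y z where y: "y .: LL" "?A (tensor_lift K A A A PL s) y \<and> ?B (tensor_lift K A A A PL s) y"
      and z: "z .: LL" "?A (tensor_lift K A A A PL t) z \<and> ?B (tensor_lift K A A A PL t) z" by blast
    have i: "islin K LL AA (ev u b)" if "u .: A" "b .: A" for u b
      using islin_map[OF L_module L_module A_module A_module islin_fst1[OF that(1) islin_id] islin_fst1[OF that(2) islin_id] islin_id] .
    have i2: "islin K LL A (\<lambda>z. tensor_lift K L A A fst (tensor_map K L L L A idm (\<lambda>l. fst l b) z))" if "b .: A" for b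
      using that fst_bilin by (simp add: islin_tensor_lift)
    have j: "islin K AA A (tensor_lift K A A A PL)" using tensor_lift_islin[OF A_module A_module A_module PL_bilin] .
    have k: "islin K A AA (\<lambda>a. dl a u b)" if "u .: A" "b .: A" for u b using that by (simp add: dl_def)
    have k': "islin K A A (\<lambda>a. PL a b)" if "b .: A" for b using that by simp
    show ?case
      by (rule bexI[where x="y \<oplus>\<^bsub>LL\<^esub> z"])
         (use add y z islin_in[OF j] in "simp_all add: islin_add[OF j] islin_add[OF k] islin_add[OF k'] islin_add[OF i] islin_add[OF i2]")
  qed
  from this[of "T1 A (a \<diamondop> b)"] show ?case using mult by (simp add: lift_PL_T1)
next
  case (add x x')
  then obtain y z where y: "y .: LL" "?A x y \<and> ?B x y" and z: "z .: LL" "?A x' z \<and> ?B x' z" by blast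
  have i: "islin K LL AA (ev u b)" if "u .: A" "b .: A" for u b
    using islin_map[OF L_module L_module A_module A_module islin_fst1[OF that(1) islin_id] islin_fst1[OF that(2) islin_id] islin_id] .
  have i2: "islin K LL A (\<lambda>z. tensor_lift K L A A fst (tensor_map K L L L A idm (\<lambda>l. fst l b) z))" if "b .: A" for b
    using that fst_bilin by (simp add: islin_tensor_lift)
  have k: "islin K A AA (\<lambda>a. dl a u b)" if "u .: A" "b .: A" for u b using that by (simp add: dl_def)
  have k': "islin K A A (\<lambda>a. PL a b)" if "b .: A" for b using that by simp
  show ?case
    by (rule bexI[where x="y \<oplus>\<^bsub>LL\<^esub> z"])
       (use add y z in "simp_all add: islin_add[OF k] islin_add[OF k'] islin_add[OF i] islin_add[OF i2]")
qed

text \<open>The map \<open>\<delta>\<close>; by \<open>dl_dep\<close> the choice of \<open>a\<close> does not matter.\<close>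

definition del :: "'a multiplier => ('k, 'a multiplier, 'a multiplier) tensor" where
  "del l = (THE z. z .: LL \<and> (\<forall>a\<in>carrier A. l = sqL a \<longrightarrow> (\<forall>u\<in>carrier A. \<forall>b\<in>carrier A. ev u b z = dl a u b)))"

lemma del:
  assumes a: "a .: A"
  shows del_sqL_in: "del (sqL a) .: LL"
    and ev_del: "u .: A ==> b .: A ==> ev u b (del (sqL a)) = dl a u b"
    and fst_del': "b .: A ==> tensor_lift K L A A fst (tensor_map K L L L A idm (\<lambda>l. fst l b) (del (sqL a))) = PL a b"
proof -
  obtain z where z: "z .: LL" "!!u b. u .: A ==> b .: A ==> ev u b z = dl a u b"
    "!!b. b .: A ==> tensor_lift K L A A fst (tensor_map K L L L A idm (\<lambda>l. fst l b) z) = PL a b" using dl_ex[OF a] by blast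
  have "del (sqL a) = z" unfolding del_def
  proof (rule the_equality)
    show "z .: LL \<and> (\<forall>a'\<in>carrier A. sqL a = sqL a' \<longrightarrow> (\<forall>u\<in>carrier A. \<forall>b\<in>carrier A. ev u b z = dl a' u b))"
    proof (intro conjI ballI impI)
      fix a' u b assume "a' .: A" "sqL a = sqL a'" "u .: A" "b .: A"
      then show "ev u b z = dl a' u b" using z(2)[of u b] dl_dep[OF a, of a' u b] a by (simp add: sqL_eq)
    qed (rule z)
    fix y assume "y .: LL \<and> (\<forall>a'\<in>carrier A. sqL a = sqL a' \<longrightarrow> (\<forall>u\<in>carrier A. \<forall>b\<in>carrier A. ev u b y = dl a' u b))"
    then show "y = z" by (intro LL_sep) (use z a in simp_all)
  qed
  with z show "del (sqL a) .: LL" "u .: A ==> b .: A ==> ev u b (del (sqL a)) = dl a u b"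
    "b .: A ==> tensor_lift K L A A fst (tensor_map K L L L A idm (\<lambda>l. fst l b) (del (sqL a))) = PL a b" by simp_all
qed

lemma del_in [simp]: "l .: L ==> del l .: LL"
  by (auto simp: L_carrier del_sqL_in)

lemma islin_ev: "u .: A ==> b .: A ==> islin K LL AA (ev u b)"
  using islin_map[OF L_module L_module A_module A_module islin_fst1[OF _ islin_id] islin_fst1[OF _ islin_id] islin_id] .

lemma islin_del': "islin K L LL del"
proof (rule islinI)
  have k: "islin K A AA (\<lambda>a. dl a u b)" if "u .: A" "b .: A" for u b using that by (simp add: dl_def)
  fix l m assume "l .: L" "m .: L"
  then obtain a a' where a: "a .: A" "l = sqL a" "a' .: A" "m = sqL a'" by (auto simp: L_carrier)
  show "del (l \<oplus>\<^bsub>L\<^esub> m) = del l \<oplus>\<^bsub>LL\<^esub> del m"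
    by (rule LL_sep) (use a in "simp_all add: del_sqL_in ev_del islin_add[OF k] islin_add[OF islin_ev] flip: islin_add[OF L_lin(2)]")
next
  have k: "islin K A AA (\<lambda>a. dl a u b)" if "u .: A" "b .: A" for u b using that by (simp add: dl_def)
  fix c l assume c: "c .: K" and "l .: L"
  then obtain a where a: "a .: A" "l = sqL a" by (auto simp: L_carrier)
  show "del (c \<odot>\<^bsub>L\<^esub> l) = c \<odot>\<^bsub>LL\<^esub> del l"
    by (rule LL_sep) (use a c in "simp_all add: del_sqL_in ev_del islin_smult[OF k] islin_smult[OF islin_ev] flip: islin_smult[OF L_lin(2)]")
qed simp

lemma islin_del [simp]: "islin K X L f ==> islin K X LL (\<lambda>x. del (f x))"
  by (rule islin_comp[OF islin_del'])

lemma islin_Lmult [simp]: "l .: L ==> islin K X L f ==> islin K X L (\<lambda>x. l \<otimes>\<^bsub>L\<^esub> f x)"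
  "l .: L ==> islin K X L f ==> islin K X L (\<lambda>x. f x \<otimes>\<^bsub>L\<^esub> l)"
  using L_mult_bilin islin_comp[of L L "mult L l" X f] islin_comp[of L L "\<lambda>x. x \<otimes>\<^bsub>L\<^esub> l" X f] by (simp_all add: bilin_def)

lemma del_left:
  assumes l: "l .: L" and m: "m .: L"
  shows "del (m \<otimes>\<^bsub>L\<^esub> l) = tensor_map K L L L L (\<lambda>x. m \<otimes>\<^bsub>L\<^esub> x) idm (del l)"
proof -
  obtain a c where a: "a .: A" "l = sqL a" "c .: A" "m = sqL c" using l m by (auto simp: L_carrier)
  show ?thesis
  proof (rule LL_sep)
    fix u b assume ub: "u .: A" "b .: A"
    have "ev u b (tensor_map K L L L L (\<lambda>x. m \<otimes>\<^bsub>L\<^esub> x) idm (del l)) = on1 (fst m) (ev u b (del l))"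
      using l m ub by simp (rule map_cong, simp_all add: fst_L_mult)
    also have "... = on1 (PL c) (dl a u b)" using a ub by (simp add: ev_del, intro mcong) simp_all
    also have "... = ev u b (del (m \<otimes>\<^bsub>L\<^esub> l))" using a ub by (simp add: L_mult ev_del dl_left)
    finally show "ev u b (del (m \<otimes>\<^bsub>L\<^esub> l)) = ev u b (tensor_map K L L L L (\<lambda>x. m \<otimes>\<^bsub>L\<^esub> x) idm (del l))" by simp
  qed (use l m in simp_all)
qed

lemma mult_del:
  assumes l: "l .: L"
  shows "tensor_lift K L L L (mult L) (del l) = l"
proof -
  obtain a where a: "a .: A" "l = sqL a" using l by (auto simp: L_carrier)
  show ?thesis
  proof (rule L_eqI)
    fix b assume b: "b .: A"
    have "fst (tensor_lift K L L L (mult L) z) b = tensor_lift K L A A fst (tensor_map K L L L A idm (\<lambda>l. fst l b) z)" if z: "z .: LL" for z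
      by (rule tensor_eqI[where Z=A, OF L_module L_module _ _ _ z])
         (use b L_mult_bilin fst_bilin in "simp_all add: islin_tensor_lift fst_L_mult")
    then show "fst (tensor_lift K L L L (mult L) (del l)) b = fst l b" using a b by (simp add: del_sqL_in fst_del')
  qed (use l L_mult_bilin in "simp_all add: tensor_lift_in")
qed

end

context over_field begin

lemma islin_inv:
  assumes V: "module K V" and f: "islin K V W f" and b: "bij_betw f (carrier V) (carrier W)"
  shows "islin K W V (inv_into (carrier V) f)"
proof (rule islinI)
  have inj: "inj_on f (carrier V)" and im: "f ` carrier V = carrier W" using b by (auto simp: bij_betw_def)
  note e = inv_into_f_f[OF inj]
  show "inv_into (carrier V) f x .: V" if "x .: W" for x using that im by (simp add: inv_into_into)
  fix x y assume "x .: W" "y .: W"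
  then obtain u v where u: "u .: V" "v .: V" "x = f u" "y = f v" unfolding im[symmetric] by blast
  then show "inv_into (carrier V) f (x \<oplus>\<^bsub>W\<^esub> y) = inv_into (carrier V) f x \<oplus>\<^bsub>V\<^esub> inv_into (carrier V) f y"
    using V by (simp add: e flip: islin_add[OF f])
next
  have inj: "inj_on f (carrier V)" and im: "f ` carrier V = carrier W" using b by (auto simp: bij_betw_def)
  note e = inv_into_f_f[OF inj]
  fix c x assume c: "c .: K" "x .: W"
  then obtain u where u: "u .: V" "x = f u" unfolding im[symmetric] by blast
  then show "inv_into (carrier V) f (c \<odot>\<^bsub>W\<^esub> x) = c \<odot>\<^bsub>V\<^esub> inv_into (carrier V) f x"
    using V c by (simp add: e flip: islin_smult[OF f])
qed

end

context balanced begin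

lemma islin_bal_lift_param:
  assumes Z: "module K Z" and X: "module K X" and x: "x .: B"
    and b: "!!y. y .: X ==> bilin K P N Z (b y)"
    and bal: "!!y p l n. y .: X ==> p .: P ==> l .: L ==> n .: N ==> b y (rmodule.ract P p l) n = b y p (lact l n)"
    and i: "!!p n. p .: P ==> n .: N ==> islin K X Z (\<lambda>y. b y p n)"
  shows "islin K X Z (\<lambda>y. bal_lift K L P N lact Z (b y) x)"
  using x
proof (induction rule: bal_induct)
  case (bt p n)
  show ?case by (rule iffD1[OF islin_cong i[OF bt]]) (use X bt in "simp_all add: bal_lift_bt[OF Z b bal]")
next
  case (add s t)
  show ?case
    by (rule iffD1[OF islin_cong islin_add_map[OF Z add(3,4)]])
       (use X add in "simp_all add: islin_add[OF bal_lift_islin[OF Z b bal]]")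
qed

end

context hopf_wmb begin

lemma del_right:
  assumes l: "l .: L" and m: "m .: L"
  shows "del (l \<otimes>\<^bsub>L\<^esub> m) = tensor_map K L L L L idm (\<lambda>x. x \<otimes>\<^bsub>L\<^esub> m) (del l)"
proof -
  obtain a c where a: "a .: A" "l = sqL a" "c .: A" "m = sqL c" using l m by (auto simp: L_carrier)
  show ?thesis
  proof (rule LL_sep)
    fix u b assume ub: "u .: A" "b .: A"
    have "ev u b (tensor_map K L L L L idm (\<lambda>x. x \<otimes>\<^bsub>L\<^esub> m) (del l)) = ev u (fst m b) (del l)"
      using l m ub by simp (rule map_cong, simp_all add: fst_L_mult)
    also have "... = ev u b (del (l \<otimes>\<^bsub>L\<^esub> m))" using a ub by (simp add: L_mult ev_del dl_right)
    finally show "ev u b (del (l \<otimes>\<^bsub>L\<^esub> m)) = ev u b (tensor_map K L L L L idm (\<lambda>x. x \<otimes>\<^bsub>L\<^esub> m) (del l))" by simp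
  qed (use l m in simp_all)
qed

text \<open>\<open>T1\<close> and \<open>T3\<close> are left \<open>L\<close>-linear in the first leg, so that they descend to \<open>P \<otimes>\<^sub>L A\<close>.\<close>

lemma T1_L: 
  assumes l: "l .: L" and t: "t .: AA"
  shows "T1 A (on1 (fst l) t) = on1 (fst l) (T1 A t)"
proof -
  obtain c where c: "c .: A" "l = sqL c" using l by (auto simp: L_carrier)
  have *: "on1 (fst l) t = on1 (PL c) t" if "t .: AA" for t
    using that c l by (intro mcong) simp_all
  show ?thesis using t c(1) by (simp add: * T1_PL)
qed

lemma T3_L: 
  assumes l: "l .: L" and t: "t .: AA"
  shows "T3 A (on1 (fst l) t) = on1 (fst l) (T3 A t)"
proof (rule AA_eqI[where Z=AA, OF _ _ _ t])
  have fl: "islin K A A (fst l)" using islin_fst2[OF l islin_id] .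
  fix x b assume xb: "x .: A" "b .: A"
  have "T1 A (fst l x \<diamondop> b) = on1 (fst l) (T1 A (x \<diamondop> b))" if "x .: A" "b .: A" for x b
    using T1_L[OF l, of "x \<diamondop> b"] that fl by simp
  from T3_rcol[OF fl this xb] have "T3 A (fst l x \<diamondop> b) = on1 (fst l) (T3 A (x \<diamondop> b))" .
  then show "T3 A (on1 (fst l) (x \<diamondop> b)) = on1 (fst l) (T3 A (x \<diamondop> b))" using xb fl by simp
qed (use islin_fst2[OF l islin_id] in simp_all)

section \<open>The regular comodule\<close>

text \<open>\<open>embA a t\<close> is \<open>a \<otimes> t\<close>, bracketed to the left; \<open>mulA c\<close> multiplies the first of three legs by \<open>c\<close>.\<close>

abbreviation "embA a \<equiv> tA A AA (\<lambda>p. a \<diamondop> p)"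
abbreviation "mulA c \<equiv> tA AA AA (lm1 c)"

lemma islin_map_A': "islin K A A f ==> islin K A A g ==> islin K AA AA (map_A f g)"
  using islin_map[OF A_module A_module A_module A_module _ _ islin_id] .

lemma mulA_cancel:
  assumes "s .: AAA" "t .: AAA" "!!c. c .: A ==> mulA c s = mulA c t"
  shows "s = t"
proof (rule sep_map1[where I="carrier A" and V'="\<lambda>_. AA" and f="\<lambda>c. lm1 c", OF AA_module A_module _ _ _ assms(1,2)])
  fix v assume v: "v .: AA" "!!c. c .: A ==> lm1 c v = zero AA"
  show "v = zero AA"
  proof (rule cL1)
    fix c assume c: "c .: A"
    show "lm1 c v = lm1 c (zero AA)"
      using v c islin_zero[OF _ _ islin_map_A'[of "\<lambda>x. c \<cdot> x" "\<lambda>x. x"]] by simp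
  qed (use v in simp_all)
qed (use assms(3) in "simp_all add: islin_map_A'")

text \<open>With \<open>t = p \<otimes> q\<close> this is \<open>a\<^sub>1 p \<otimes> a\<^sub>2 q\<close> in three legs, \<open>\<Delta>\<close> applied twice: the iterated coaction of \<open>A\<close> on itself.\<close>

definition regLam :: "'a => ('k, 'a, 'a) tensor => ('k, ('k, 'a, 'a) tensor, 'a) tensor" where
  "regLam a t = A12 (T1 A) (A13 (T1 A) (embA a t))"

lemma islin_A_legs: "islin K AA AA X ==> islin K Y AAA f ==> islin K Y AAA (\<lambda>x. A12 X (f x))"
  "islin K AA AA X ==> islin K Y AAA f ==> islin K Y AAA (\<lambda>x. A13 X (f x))"
  "islin K AA AA X ==> islin K Y AAA f ==> islin K Y AAA (\<lambda>x. A23 X (f x))"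
  by (rule islin_legs12 islin_legs13 islin_legs23; simp)+

lemma islin_regLam [simp]: "a .: A ==> islin K X AA f ==> islin K X AAA (\<lambda>x. regLam a (f x))"
  by (simp add: regLam_def islin_A_legs)

lemma regLam_in [simp]: "a .: A ==> t .: AA ==> regLam a t .: AAA"
  by (rule islin_in[OF islin_regLam[OF _ islin_id]])

lemma islin_assoc_inv' [simp]: "islin K X (A ** AA) f ==> islin K X AAA (\<lambda>x. tensor_assoc_inv K A A A (f x))"
  by (rule islin_comp[OF islin_assoc_inv]) simp_all

lemma islin_D1 [simp]: "t .: AA ==> islin K A AA (\<lambda>x. D x t)"
proof -
  have "bilin K A A AA (\<lambda>p q. rm1 p (T1 A (x \<diamondop> q)))" if "x .: A" for x
    by (intro bilinI islin_map_param1) (use that in simp_all)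
  then show "t .: AA ==> islin K A AA (\<lambda>x. D x t)" unfolding D_def
    by (intro islin_tensor_lift_param) simp_all
qed

text \<open>
  Coassociativity in the form \<open>(c \<otimes> 1) \<Delta>(a) = m \<otimes> x\<close>, a sum, gives \<open>m \<otimes> \<Delta>(x) t\<close>: the iterated coaction ends with a left
  multiplication by \<open>\<Delta>\<close>.
\<close>

lemma mulA_regLam:
  assumes c: "c .: A" and a: "a .: A" and t: "t .: AA"
  shows "mulA c (regLam a t) = tensor_assoc_inv K A A A (tensor_map K A A A AA idm (\<lambda>x. D x t) (T2 A (c \<diamondop> a)))"
proof (rule AA_eqI[where Z=AAA, OF _ _ _ t])
  fix p q assume p: "p .: A" and q: "q .: A"
  let ?m = "tA AA AA (rm2 p)"
  note mA = islin_map_A'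
  have "regLam a (p \<diamondop> q) = tA A AA (\<lambda>x. T1 A (x \<diamondop> p)) (T1 A (a \<diamondop> q))"
    using a p q by (simp add: regLam_def A13_PAA A12_map)
  then have "mulA c (regLam a (p \<diamondop> q)) = tA A AA (\<lambda>x. lm1 c (T1 A (x \<diamondop> p))) (T1 A (a \<diamondop> q))"
    using a p q c mA by simp
  also have "... = tA A AA (\<lambda>x. rm2 p (T2 A (c \<diamondop> x))) (T1 A (a \<diamondop> q))"
    by (rule map_cong) (use a p q c in "simp_all add: T1_T2")
  also have "... = ?m (A12 (T2 A) (A23 (T1 A) (pure_tensor K AA A (c \<diamondop> a) q)))" using a p q c mA by (simp add: A23_PAA A12_map)
  also have "... = ?m (A23 (T1 A) (pure_tensor K AA A (T2 A (c \<diamondop> a)) q))" using a q c by (simp add: ax A12_PAA)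
  also have "?m (A23 (T1 A) (pure_tensor K AA A y q)) = tensor_assoc_inv K A A A (tensor_map K A A A AA idm (\<lambda>x. D x (p \<diamondop> q)) y)" if y: "y .: AA" for y
  proof (rule AA_eqI[where Z=AAA and f="\<lambda>y. ?m (A23 (T1 A) (pure_tensor K AA A y q))" and g="\<lambda>y. tensor_assoc_inv K A A A (tensor_map K A A A AA idm (\<lambda>x. D x (p \<diamondop> q)) y)", OF _ _ _ y])
    fix m x assume mx: "m .: A" "x .: A"
    have Dl: "islin K A AA (\<lambda>x. D x (p \<diamondop> q))" using p q by (intro islin_D1) simp
    have "?m (A23 (T1 A) (pure_tensor K AA A (m \<diamondop> x) q)) = tA A AA (\<lambda>z. m \<diamondop> (z \<cdot> p)) (T1 A (x \<diamondop> q))" (is "?lhs = _")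
      using mx p q mA by (simp add: A23_PAA) (rule map_cong, simp_all)
    also have "... = embA m (D x (p \<diamondop> q))" using mx p q by simp
    also have "... = tensor_assoc_inv K A A A (tensor_map K A A A AA idm (\<lambda>x. D x (p \<diamondop> q)) (m \<diamondop> x))" (is "_ = ?rhs")
      using mx p q Dl by (simp add: assoc_inv_pure_right del: D_pure)
    finally show "?lhs = ?rhs" .
  qed (use p q mA islin_D1[of "p \<diamondop> q"] in "simp_all add: islin_A_legs del: D_pure")
  finally show "mulA c (regLam a (p \<diamondop> q)) = tensor_assoc_inv K A A A (tensor_map K A A A AA idm (\<lambda>x. D x (p \<diamondop> q)) (T2 A (c \<diamondop> a)))"
    using a c by simp
next
  show "islin K AA AAA (\<lambda>t. tensor_assoc_inv K A A A (tensor_map K A A A AA idm (\<lambda>x. D x t) (T2 A (c \<diamondop> a))))"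
    by (intro islin_assoc_inv' islin_map_param2) (use a c in simp_all)
qed (use a c islin_map_A'[of "\<lambda>x. c \<cdot> x" "\<lambda>x. x"] in simp_all)

text \<open>\<open>\<Delta>(x) E = \<Delta>(x)\<close>, by \<open>mulA_regLam\<close>.\<close>

lemma regular_E1:
  assumes t: "t .: AAA"
  shows "A12 (T1 A) (A13 (T1 A) (A23 (E1 A) t)) = A12 (T1 A) (A13 (T1 A) t)"
proof (rule tensor3_eqI[OF A_module A_module A_module _ _ _ t, where Z=AAA])
  fix a p q assume apq: "a .: A" "p .: A" "q .: A"
  have "regLam a (E1 A (p \<diamondop> q)) = regLam a (p \<diamondop> q)"
    by (rule mulA_cancel) (use apq in \<open>simp_all add: mulA_regLam, intro arg_cong[where f="tensor_assoc_inv K A A A"] map_cong, simp_all\<close>)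
  then show "A12 (T1 A) (A13 (T1 A) (A23 (E1 A) (pure_tensor K AA A (a \<diamondop> p) q))) = A12 (T1 A) (A13 (T1 A) (pure_tensor K AA A (a \<diamondop> p) q))"
    using apq by (simp add: regLam_def A23_PAA)
qed (simp_all add: islin_A_legs)

text \<open>\<open>\<Delta>(x) \<Delta>(p) = \<Delta>(x p)\<close>, by \<open>mulA_regLam\<close>.\<close>

lemma regular_T1:
  assumes t: "t .: AAA"
  shows "A12 (T1 A) (A13 (T1 A) (A23 (T1 A) t)) = A23 (T1 A) (A12 (T1 A) t)"
proof (rule tensor3_eqI[OF A_module A_module A_module _ _ _ t, where Z=AAA])
  fix a p q assume apq: "a .: A" "p .: A" "q .: A"
  note mA = islin_map_A'
  have "regLam a (T1 A (p \<diamondop> q)) = A23 (T1 A) (pure_tensor K AA A (T1 A (a \<diamondop> p)) q)"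
  proof (rule mulA_cancel)
    show "A23 (T1 A) (pure_tensor K AA A (T1 A (a \<diamondop> p)) q) .: AAA"
      by (rule islin_in[OF islin_A_legs(3)[OF _ islin_id]]) (use apq in simp_all)
    fix c assume c: "c .: A"
    have 1: "mulA c (A23 (T1 A) (pure_tensor K AA A y q)) = A23 (T1 A) (pure_tensor K AA A (lm1 c y) q)" if y: "y .: AA" for y
    proof (rule AA_eqI[where Z=AAA and f="\<lambda>y. mulA c (A23 (T1 A) (pure_tensor K AA A y q))", OF _ _ _ y])
      fix m x assume mx: "m .: A" "x .: A"
      show "mulA c (A23 (T1 A) (pure_tensor K AA A (m \<diamondop> x) q)) = A23 (T1 A) (pure_tensor K AA A (lm1 c (m \<diamondop> x)) q)"
        using mx apq c mA by (simp add: A23_PAA) (rule map_cong, simp_all)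
    qed (use apq c mA in "simp_all add: islin_A_legs")
    have 2: "tensor_assoc_inv K A A A (tensor_map K A A A AA idm (\<lambda>x. D x (T1 A (p \<diamondop> q))) y) = A23 (T1 A) (pure_tensor K AA A (rm2 p y) q)"
      if y: "y .: AA" for y
    proof (rule AA_eqI[where Z=AAA and f="\<lambda>y. tensor_assoc_inv K A A A (tensor_map K A A A AA idm (\<lambda>x. D x (T1 A (p \<diamondop> q))) y)" and
          g="\<lambda>y. A23 (T1 A) (pure_tensor K AA A (rm2 p y) q)", OF _ _ _ y])
      fix m x assume mx: "m .: A" "x .: A"
      have Dl: "islin K A AA (\<lambda>x. D x (T1 A (p \<diamondop> q)))" using apq by (intro islin_D1) simp
      show "tensor_assoc_inv K A A A (tensor_map K A A A AA idm (\<lambda>x. D x (T1 A (p \<diamondop> q))) (m \<diamondop> x)) = A23 (T1 A) (pure_tensor K AA A (rm2 p (m \<diamondop> x)) q)"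
        using mx apq Dl by (simp add: assoc_inv_pure_right D_T1 A23_PAA)
    qed (use apq islin_D1[of "T1 A (p \<diamondop> q)"] in "simp_all add: islin_A_legs")
    show "mulA c (regLam a (T1 A (p \<diamondop> q))) = mulA c (A23 (T1 A) (pure_tensor K AA A (T1 A (a \<diamondop> p)) q))"
      using apq c by (simp add: mulA_regLam 1 2 T1_T2)
  qed (use apq in simp_all)
  then show "A12 (T1 A) (A13 (T1 A) (A23 (T1 A) (pure_tensor K AA A (a \<diamondop> p) q))) = A23 (T1 A) (A12 (T1 A) (pure_tensor K AA A (a \<diamondop> p) q))"
    using apq by (simp add: regLam_def A23_PAA A12_PAA)
qed (simp_all add: islin_A_legs)

end

section \<open>Firm modules\<close>

locale firm_mod = hopf_wmb K A R1 R2
  for K :: "'k ring" (structure) and A :: "('k, 'a) wmb" and R1 R2 +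
  fixes P :: "('k, 'p, 'a multiplier) rmodule"
  assumes FP: "firm_module K base_L P"
begin

lemma P_module [simp]: "module K P"
  and P_bilin: "bilin K P L P (ract P)"
  and P_assoc: "p .: P ==> l .: L ==> m .: L ==> ract P (ract P p l) m = ract P p (l \<otimes>\<^bsub>L\<^esub> m)"
  and P_bij: "bij_betw (bal_lift K L P L (mult L) P (ract P)) (carrier (bal_space K L P L (mult L))) (carrier P)"
  using FP by (auto simp: firm_module_def right_module_def bilinear_map_iff)

sublocale BA: balanced K base_L P A fst
  by (intro balanced.intro balanced_axioms.intro over_field_axioms) (simp_all add: P_bilin fst_bilin)

sublocale BL: balanced K base_L P base_L "mult base_L"
  by (intro balanced.intro balanced_axioms.intro over_field_axioms) (simp_all add: P_bilin L_mult_bilin)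

lemmas BA_module [simp] = BA.B_module

lemma islin_P1 [simp]: "l .: L ==> islin K X P f ==> islin K X P (\<lambda>x. ract P (f x) l)"
  and islin_P2 [simp]: "p .: P ==> islin K X L g ==> islin K X P (\<lambda>x. ract P p (g x))"
proof -
  show "l .: L ==> islin K X P f ==> islin K X P (\<lambda>x. ract P (f x) l)"
    using P_bilin islin_comp[of P P "\<lambda>v. ract P v l" X f] by (simp add: bilin_def)
  show "p .: P ==> islin K X L g ==> islin K X P (\<lambda>x. ract P p (g x))"
    using P_bilin islin_comp[of L P "\<lambda>l. ract P p l" X g] by (simp add: bilin_def)
qed

lemma islin_P2' [simp]: "p .: P ==> islin K L P (ract P p)" using islin_P2[OF _ islin_id] .

abbreviation "rl \<equiv> bal_lift K L P L (mult L) P (ract P)"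

lemma rl_lin: "islin K BL.B P rl" and rl_bt: "p .: P ==> l .: L ==> rl (BL.bt p l) = ract P p l"
  by (rule BL.bal_lift_islin BL.bal_lift_bt; simp add: P_bilin P_assoc)+

text \<open>Firmness makes the action of \<open>L\<close> surjective.\<close>

lemma P_induct [consumes 1, case_names act add]:
  assumes p: "p .: P" and "!!p l. p .: P ==> l .: L ==> Q (ract P p l)"
    "!!p q. p .: P ==> q .: P ==> Q p ==> Q q ==> Q (p \<oplus>\<^bsub>P\<^esub> q)"
  shows "Q p"
proof -
  obtain x where x: "x .: BL.B" "p = rl x" using p P_bij by (auto simp: bij_betw_def)
  have "Q (rl x)" using x(1)
  proof (induction rule: BL.bal_induct)
    case (bt p n) then show ?case using assms(2) by (simp add: rl_bt)
  next
    case (add x y) then show ?case using assms(3) islin_in[OF rl_lin] by (simp add: islin_add[OF rl_lin])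
  qed
  then show ?thesis using x by simp
qed

abbreviation "PxL \<equiv> (P ** L)"
abbreviation "PxA \<equiv> (P ** A)"
abbreviation "pdel p l \<equiv> tensor_map K L L P L (\<lambda>x. ract P p x) idm (del l)"

text \<open>The map \<open>P \<rightarrow> P \<otimes> L\<close> with \<open>p l \<mapsto> p \<delta>(l)\<close>.  It is defined on \<open>P \<otimes>\<^sub>L L\<close> by left linearity of \<open>\<delta>\<close>, and transported to \<open>P\<close> by firmness.\<close>

definition dP :: "'p => ('k, 'p, 'a multiplier) tensor" where
  "dP p = bal_lift K L P L (mult L) PxL pdel (inv_into (carrier BL.B) rl p)"

lemma pdel_bilin: "bilin K P L PxL pdel"
  by (intro bilinI islin_map_param1) simp_all

lemma pdel_bal: "p .: P ==> l .: L ==> m .: L ==> pdel (ract P p l) m = pdel p (l \<otimes>\<^bsub>L\<^esub> m)"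
  by (simp add: del_left) (rule map_cong, simp_all add: P_assoc)

lemma islin_dP': "islin K P PxL dP"
  unfolding dP_def
  by (intro islin_comp[OF BL.bal_lift_islin islin_inv[OF BL.B_module rl_lin P_bij]]) (simp_all add: pdel_bilin pdel_bal)

lemma islin_dP [simp]: "islin K X P f ==> islin K X PxL (\<lambda>x. dP (f x))"
  by (rule islin_comp[OF islin_dP'])

lemma dP_in [simp]: "p .: P ==> dP p .: PxL" by (rule islin_in[OF islin_dP'])

lemma dP_act:
  assumes p: "p .: P" and l: "l .: L" shows "dP (ract P p l) = pdel p l"
proof -
  have "inv_into (carrier BL.B) rl (ract P p l) = BL.bt p l"
    using inv_into_f_f[of rl "carrier BL.B" "BL.bt p l"] P_bij p l by (simp add: bij_betw_def rl_bt BL.bt_in)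
  then show ?thesis using p l BL.bal_lift_bt[OF _ pdel_bilin pdel_bal p l] by (simp add: dP_def)
qed

lemma dP_right:
  assumes p: "p .: P" and m: "m .: L"
  shows "dP (ract P p m) = tensor_map K P L P L idm (\<lambda>x. x \<otimes>\<^bsub>L\<^esub> m) (dP p)"
  using p
proof (induction rule: P_induct)
  case (act p l)
  then show ?case using m by (simp add: P_assoc dP_act del_right)
next
  case (add p q)
  have i: "islin K P PxL (\<lambda>p. dP (ract P p m))" "islin K P PxL (\<lambda>p. tensor_map K P L P L idm (\<lambda>x. x \<otimes>\<^bsub>L\<^esub> m) (dP p))" using m by simp_all
  show ?case using add by (simp add: islin_add[OF i(1)] islin_add[OF i(2)])
qed

lemma mult_dP:
  assumes p: "p .: P" shows "tensor_lift K P L P (ract P) (dP p) = p"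
  using p
proof (induction rule: P_induct)
  case (act p l)
  have "tensor_lift K P L P (ract P) (tensor_map K L L P L (\<lambda>x. ract P p x) idm z) = ract P p (tensor_lift K L L L (mult L) z)" if z: "z .: LL" for z
    by (rule tensor_eqI[where Z=P, OF L_module L_module _ _ _ z])
       (use act in "simp_all add: islin_tensor_lift P_bilin L_mult_bilin P_assoc islin_in[OF islin_P2']")
  then show ?case using act by (simp add: dP_act mult_del)
next
  case (add p q)
  have i: "islin K P P (\<lambda>p. tensor_lift K P L P (ract P) (dP p))" by (simp add: islin_tensor_lift P_bilin)
  show ?case using add by (simp add: islin_add[OF i])
qed

abbreviation "sec0 p a \<equiv> tensor_map K P L P A idm (\<lambda>l. fst l a) (dP p)"

text \<open>\<open>p \<otimes>\<^sub>L a \<mapsto> p\<^sub>0 \<otimes> p\<^sub>1 a\<close> for \<open>dP p = p\<^sub>0 \<otimes> p\<^sub>1\<close>; well defined by right linearity of \<open>\<delta>\<close>.\<close>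

definition sec :: "('k, 'p, 'a) tensor set => ('k, 'p, 'a) tensor" where
  "sec = bal_lift K L P A fst PxA sec0"

lemma sec0_bilin: "bilin K P A PxA sec0"
  by (intro bilinI islin_map_param2) simp_all

lemma sec0_bal: "p .: P ==> l .: L ==> a .: A ==> sec0 (ract P p l) a = sec0 p (fst l a)"
  by (simp add: dP_right) (rule map_cong, simp_all add: fst_L_mult)

lemma sec_lin: "islin K BA.B PxA sec" and sec_bt: "p .: P ==> a .: A ==> sec (BA.bt p a) = sec0 p a"
  unfolding sec_def by (rule BA.bal_lift_islin BA.bal_lift_bt; simp add: sec0_bilin sec0_bal)+

text \<open>\<open>p l\<^sub>1 \<otimes>\<^sub>L l\<^sub>2 a = p \<otimes>\<^sub>L l\<^sub>1 l\<^sub>2 a\<close>, and multiplication undoes \<open>\<delta>\<close>.\<close>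

lemma proj_sec:
  assumes x: "x .: BA.B" shows "BA.proj (sec x) = x"
proof (rule BA.bal_eqI[OF _ islin_id _ x, where f="\<lambda>x. BA.proj (sec x)"])
  show "islin K BA.B BA.B (\<lambda>x. BA.proj (sec x))" by (rule islin_comp[OF BA.islin_proj sec_lin])
  fix p a assume p: "p .: P" and a: "a .: A"
  have i: "islin K P BA.B (\<lambda>p. BA.proj (sec (BA.bt p a)))"
    by (rule islin_comp[OF BA.islin_proj islin_comp[OF sec_lin BA.islin_bt1[OF a islin_id]]])
  show "BA.proj (sec (BA.bt p a)) = BA.bt p a" using p
  proof (induction rule: P_induct)
    case (act p l)
    obtain c where c: "c .: A" "l = sqL c" using act by (auto simp: L_carrier)
    have 1: "BA.proj (tA L P (ract P p) z) = BA.bt p (tensor_lift K L A A fst z)" if z: "z .: (L ** A)" for z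
      by (rule tensor_eqI[where Z=BA.B, OF L_module A_module _ _ _ z])
         (use act in "simp_all add: islin_comp[OF BA.islin_proj] BA.islin_bt2 islin_tensor_lift fst_bilin BA.proj_pure BA.bt_balanced islin_in[OF islin_P2']")
    have "sec (BA.bt (ract P p l) a) = tA L P (ract P p) (tensor_map K L L L A idm (\<lambda>l. fst l a) (del l))"
      using act a by (simp add: sec_bt dP_act)
    then have "BA.proj (sec (BA.bt (ract P p l) a)) = BA.proj (tA L P (ract P p) (tensor_map K L L L A idm (\<lambda>l. fst l a) (del l)))"
      by (simp only:)
    also have "... = BA.bt p (tensor_lift K L A A fst (tensor_map K L L L A idm (\<lambda>l. fst l a) (del l)))"
      by (rule 1) (use act a in simp)
    also have "... = BA.bt p (fst l a)" using c a by (simp add: fst_del')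
    also have "... = BA.bt (ract P p l) a" using act a by (simp add: BA.bt_balanced)
    finally show ?case .
  next
    case (add p q)
    show ?case unfolding islin_add[OF i add(1,2)] add(3,4) by (rule islin_add[OF BA.islin_bt1[OF a islin_id] add(1,2), symmetric])
  qed
qed

text \<open>
  If \<open>p \<otimes>\<^sub>L a = 0\<close> for all \<open>a\<close>, then the section shows that the second leg of \<open>dP p\<close> is killed by all evaluations, so
  \<open>dP p = 0\<close>; and multiplication recovers \<open>p\<close>.
\<close>

lemma bt_sep:
  assumes p: "p .: P" and z: "!!a. a .: A ==> BA.bt p a = zero BA.B"
  shows "p = zero P"
proof -
  have PxL: "module K PxL" and PxA: "module K PxA" by simp_all
  have "dP p = zero PxL"
  proof (rule WL_sep[OF P_module])
    fix u assume u: "u .: A"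
    have i: "islin K PxL PxA (tensor_map K P L P A idm (\<lambda>l. fst l u))"
      using islin_map[OF P_module L_module P_module A_module islin_id islin_fst1[OF u islin_id] islin_id] .
    have "tensor_map K P L P A idm (\<lambda>l. fst l u) (dP p) = sec (BA.bt p u)" (is "?lhs = _") using p u by (simp add: sec_bt)
    also have "... = zero PxA" using z[OF u] islin_zero[OF BA_module PxA sec_lin] by simp
    also have "... = tensor_map K P L P A idm (\<lambda>l. fst l u) (zero PxL)" (is "_ = ?rhs") using islin_zero[OF PxL PxA i] by simp
    finally show "?lhs = ?rhs" .
  qed (use p in simp_all)
  then have "tensor_lift K P L P (ract P) (dP p) = zero P"
    using islin_zero[OF PxL P_module tensor_lift_islin[OF P_module L_module P_module P_bilin]] by simp
  then show ?thesis using p by (simp add: mult_dP)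
qed

section \<open>The Hopf module \<open>P \<otimes>\<^sub>L A\<close>\<close>

abbreviation "Q \<equiv> tensor_L_obj P"
abbreviation "QA \<equiv> (Q ** A)"
text \<open>\<open>em p t\<close> is \<open>p \<otimes>\<^sub>L t\<close> in \<open>(P \<otimes>\<^sub>L A) \<otimes> A\<close>.\<close>

abbreviation "em p \<equiv> tA A Q (BA.bt p)"

lemma Q_same: "same_space Q BA.B" "same_space BA.B Q"
  by (simp_all add: same_space_def tensor_L_obj_def Let_def)

lemma Q_carrier: "carrier Q = carrier BA.B" using Q_same by (simp add: same_space_def)

lemma Q_module [simp]: "module K Q" by (rule module_same[OF Q_same(2) BA_module])

lemma islin_bt_Q1 [simp]: "a .: A ==> islin K X P f ==> islin K X Q (\<lambda>x. BA.bt (f x) a)"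
  and islin_bt_Q2 [simp]: "p .: P ==> islin K X A g ==> islin K X Q (\<lambda>x. BA.bt p (g x))"
  using BA.islin_bt1[of a X f] BA.islin_bt2[of p X g] islin_same[OF same_refl Q_same(1), of K X] by auto

lemma islin_bt_Q2' [simp]: "p .: P ==> islin K A Q (BA.bt p)" using islin_bt_Q2[OF _ islin_id] .

lemma bt_Q_in [simp]: "p .: P ==> a .: A ==> BA.bt p a .: Q"
  by (simp add: Q_carrier BA.bt_in)

lemma Q_eqI:
  assumes "islin K Q Z f" "islin K Q Z g" "!!p n. p .: P ==> n .: A ==> f (BA.bt p n) = g (BA.bt p n)" "x .: Q"
  shows "f x = g x"
  using BA.bal_eqI[of Z f g x] assms islin_same[OF Q_same(1) same_refl, of K Z] by (simp add: Q_carrier)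

lemma Q_induct [consumes 1, case_names bt add]:
  assumes x: "x .: Q" and "!!p n. p .: P ==> n .: A ==> R (BA.bt p n)"
    "!!x y. x .: Q ==> y .: Q ==> R x ==> R y ==> R (x \<oplus>\<^bsub>Q\<^esub> y)"
  shows "R x"
proof -
  have eq: "add BA.B = add Q" using Q_same by (simp add: same_space_def)
  have "x .: BA.B" using x by (simp add: Q_carrier)
  then show ?thesis
  proof (induction rule: BA.bal_induct)
    case (bt p n) then show ?case by (rule assms(2))
  next
    case (add x y) then show ?case unfolding eq by (intro assms(3)) (simp_all add: Q_carrier)
  qed
qed

lemma islin_em [simp]: "p .: P ==> islin K X AA f ==> islin K X QA (\<lambda>x. em p (f x))"
  "t .: AA ==> islin K P QA (\<lambda>p. em p t)"
  by (simp, intro islin_map_param1, simp_all)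

lemma em_in [simp]: "p .: P ==> t .: AA ==> em p t .: QA"
  by (rule islin_in[OF islin_em(2)])

lemma em_bal:
  assumes p: "p .: P" and l: "l .: L" and t: "t .: AA"
  shows "em (ract P p l) t = em p (on1 (fst l) t)"
  using islin_fst2[OF l islin_id] p l t by simp (rule map_cong, simp_all add: BA.bt_balanced)

text \<open>Well defined because \<open>T\<close> is left \<open>L\<close>-linear in its first leg.\<close>

lemma map2:
  assumes T: "islin K AA AA T" and TL: "!!l t. l .: L ==> t .: AA ==> T (on1 (fst l) t) = on1 (fst l) (T t)"
  shows map2_lin: "tensor_L_map2 P T \<in> lin K QA QA"
    and map2_pure: "p .: P ==> a .: A ==> b .: A ==>
      tensor_L_map2 P T (pure_tensor K Q A (BA.bt p a) b) = em p (T (a \<diamondop> b))"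
proof -
  have Ti: "islin K X AA (\<lambda>x. T (f x))" if "islin K X AA f" for X :: "('k, 'a, 'xx) module_scheme" and f using islin_comp[OF T that] .
  have Tin: "T t .: AA" if "t .: AA" for t using islin_in[OF T that] .
  have bb: "bilin K P A QA (\<lambda>p a. em p (T (a \<diamondop> b)))" if "b .: A" for b
    by (intro bilinI) (use that in "simp_all add: Ti Tin")
  have bal: "em (ract P p l) (T (a \<diamondop> b)) = em p (T (fst l a \<diamondop> b))" if "p .: P" "l .: L" "a .: A" "b .: A" for p l a b
    using that TL[of l "a \<diamondop> b"] islin_fst2[OF that(2) islin_id] by (simp add: em_bal Tin del: map_map)
  let ?h = "\<lambda>x b. bal_lift K L P A fst QA (\<lambda>p a. em p (T (a \<diamondop> b))) x"
  have QAm: "module K QA" by simp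
  have h1: "islin K Q QA (\<lambda>x. ?h x b)" if "b .: A" for b
    using BA.bal_lift_islin[OF QAm bb bal] that islin_same[OF Q_same(1) same_refl, of K QA] by simp
  have h2: "islin K A QA (?h x)" if "x .: Q" for x
    by (rule BA.islin_bal_lift_param) (use that bb bal in "simp_all add: Q_carrier Ti")
  have hb: "bilin K Q A QA ?h" by (intro bilinI h1 h2)
  define f where "f = tensor_lift K Q A QA ?h"
  have f: "islin K QA QA f" unfolding f_def by (rule tensor_lift_islin[OF Q_module A_module QAm hb])
  have fp: "f (pure_tensor K Q A (BA.bt p a) b) = em p (T (a \<diamondop> b))" if "p .: P" "a .: A" "b .: A" for p a b
    using that hb BA.bal_lift_bt[OF QAm bb bal] by (simp add: f_def)
  have eq: "tensor_L_map2 P T = restrict f (carrier QA)" unfolding tensor_L_map2_def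
    unfolding tensor_space_same[OF Q_same(2) same_refl, of K A] pure_tensor_same[OF Q_same(2) same_refl, of K A]
     tensor_map_same[OF same_refl same_refl Q_same(2) same_refl, of K A A A]
  proof (rule the_lin[OF QAm f])
    fix g t assume g: "islin K QA QA g" "\<forall>p\<in>carrier P. \<forall>a\<in>carrier A. \<forall>b\<in>carrier A. g (pure_tensor K Q A (BA.bt p a) b) = em p (T (a \<diamondop> b))"
      and t: "t .: QA"
    show "g t = f t"
    proof (rule tensor_eqI[OF Q_module A_module g(1) f _ t])
      fix x b assume x: "x .: Q" and b: "b .: A"
      show "g (pure_tensor K Q A x b) = f (pure_tensor K Q A x b)"
        by (rule Q_eqI[where Z=QA, OF _ _ _ x]) (use b g(2) fp in "simp_all add: islin_comp[OF g(1)] islin_comp[OF f]")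
    qed
  qed (simp add: fp)
  show "tensor_L_map2 P T \<in> lin K QA QA" unfolding eq by (rule restrict_lin[OF QAm f])
  show "p .: P ==> a .: A ==> b .: A ==>
      tensor_L_map2 P T (pure_tensor K Q A (BA.bt p a) b) = em p (T (a \<diamondop> b))" unfolding eq by (simp add: fp)
qed

lemma lam_Q: "lam Q = tensor_L_map2 P (T1 A)" and rho_Q: "rho Q = tensor_L_map2 P (T3 A)"
  by (simp_all add: tensor_L_obj_def Let_def)

lemma lam_Q_lin: "lam Q \<in> lin K QA QA" "rho Q \<in> lin K QA QA"
  unfolding lam_Q rho_Q by (rule map2_lin; simp add: T1_L T3_L)+

lemmas lam_Q_islin [simp] = lam_Q_lin[THEN lin_islin]

lemma islin_lam_Q [simp]: "islin K X QA f ==> islin K X QA (\<lambda>x. lam Q (f x))" "islin K X QA f ==> islin K X QA (\<lambda>x. rho Q (f x))"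
  by (rule islin_comp[OF lam_Q_islin(1)] islin_comp[OF lam_Q_islin(2)]; assumption)+

lemma lam_Q_pure: "p .: P ==> a .: A ==> b .: A ==> lam Q (pure_tensor K Q A (BA.bt p a) b) = em p (T1 A (a \<diamondop> b))"
  and rho_Q_pure: "p .: P ==> a .: A ==> b .: A ==> rho Q (pure_tensor K Q A (BA.bt p a) b) = em p (T3 A (a \<diamondop> b))"
  unfolding lam_Q rho_Q by (rule map2_pure; simp add: T1_L T3_L)+

lemma lam_Q_em: "p .: P ==> t .: AA ==> lam Q (em p t) = em p (T1 A t)"
  by (rule AA_eqI[where Z=QA and f="\<lambda>t. lam Q (em p t)" and g="\<lambda>t. em p (T1 A t)"]) (simp_all add: lam_Q_pure)

lemma islin_Q: "islin K Q Z f \<longleftrightarrow> islin K BA.B Z f" "islin K Z Q g \<longleftrightarrow> islin K Z BA.B g"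
  by (rule islin_same[OF Q_same(1) same_refl] islin_same[OF same_refl Q_same(1)])+

lemma ract_Q:
  assumes b: "b .: A"
  shows ract_Q_lin: "islin K Q Q (\<lambda>x. ract Q x b)"
    and ract_Q_bt: "p .: P ==> a .: A ==> ract Q (BA.bt p a) b = BA.bt p (a \<cdot> b)"
proof -
  have eq: "ract Q x b = bal_lift K L P A fst BA.B (\<lambda>p a. BA.bt p (a \<cdot> b)) x" for x by (simp add: tensor_L_obj_def Let_def)
  have bb: "bilin K P A BA.B (\<lambda>p a. BA.bt p (a \<cdot> b))" by (intro bilinI BA.islin_bt1 BA.islin_bt2) (use b in simp_all)
  have bal: "BA.bt (ract P p l) (n \<cdot> b) = BA.bt p (fst l n \<cdot> b)" if "p .: P" "l .: L" "n .: A" for p l n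
    using that b by (simp add: BA.bt_balanced fst_L_right)
  show "islin K Q Q (\<lambda>x. ract Q x b)" unfolding eq islin_Q by (rule BA.bal_lift_islin[OF BA_module bb bal])
  show "p .: P ==> a .: A ==> ract Q (BA.bt p a) b = BA.bt p (a \<cdot> b)" unfolding eq by (rule BA.bal_lift_bt[OF BA_module bb bal])
qed

lemma islin_ract_Q1 [simp]: "b .: A ==> islin K X Q f ==> islin K X Q (\<lambda>x. ract Q (f x) b)"
  by (rule islin_comp[OF ract_Q_lin])

lemma islin_ract_Q2: assumes x: "x .: Q" shows "islin K A Q (ract Q x)"
  using x
proof (induction rule: Q_induct)
  case (bt p n)
  show ?case by (rule iffD1[OF islin_cong, of A "\<lambda>b. BA.bt p (n \<cdot> b)"]) (use bt in "simp_all add: ract_Q_bt")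
next
  case (add x y)
  show ?case by (rule iffD1[OF islin_cong islin_add_map[OF Q_module add(3,4)]]) (use add in "simp_all add: islin_add[OF ract_Q_lin]")
qed

lemma ract_Q_bilin: "bilin K Q A Q (ract Q)"
  by (intro bilinI islin_ract_Q2 ract_Q_lin)

lemma action_Q_pure: "x .: Q ==> a .: A ==> action Q (pure_tensor K Q A x a) = ract Q x a"
  by (simp add: action_def ract_Q_bilin)

lemma islin_action_Q [simp]: "islin K X QA f ==> islin K X Q (\<lambda>x. action Q (f x))"
  unfolding action_def by (rule islin_tensor_lift) (simp_all add: ract_Q_bilin)

lemma islin_action_Q' [simp]: "islin K QA Q (action Q)" using islin_action_Q[OF islin_id] .

lemma action_Q_em: "p .: P ==> t .: AA ==> action Q (em p t) = BA.bt p (mu t)"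
  by (rule AA_eqI[where Z=Q and f="\<lambda>t. action Q (em p t)" and g="\<lambda>t. BA.bt p (mu t)"]) (simp_all add: action_Q_pure ract_Q_bt)

lemma sec_ract:
  assumes x: "x .: Q" and b: "b .: A"
  shows "sec (ract Q x b) = tensor_map K P A P A idm (\<lambda>a. a \<cdot> b) (sec x)"
proof -
  have s: "islin K Q PxA sec" using sec_lin by (simp add: islin_Q)
  show ?thesis
  proof (rule Q_eqI[where Z=PxA, OF _ _ _ x])
    fix p a assume pa: "p .: P" "a .: A"
    show "sec (ract Q (BA.bt p a) b) = tensor_map K P A P A idm (\<lambda>a. a \<cdot> b) (sec (BA.bt p a))"
      using pa b by (simp add: ract_Q_bt sec_bt) (rule map_cong, simp_all add: fst_L_right)
  qed (use b s in "simp_all add: islin_comp[OF s] ract_Q_lin")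
qed

text \<open>\<open>P \<otimes>\<^sub>L A\<close> embeds, \<open>A\<close>-linearly, into \<open>P \<otimes> A\<close>, where non-degeneracy is inherited from \<open>A\<close>.\<close>

lemma Q_nondeg:
  assumes x: "x .: Q" and z: "!!a. a .: A ==> ract Q x a = zero Q"
  shows "x = zero Q"
proof -
  have s: "islin K Q PxA sec" using sec_lin by (simp add: islin_Q)
  have PxA: "module K PxA" by simp
  have "sec x = sec (zero Q)"
  proof (rule cancelR2[OF P_module])
    fix a assume a: "a .: A"
    show "tensor_map K P A P A idm (\<lambda>x. x \<cdot> a) (sec x) = tensor_map K P A P A idm (\<lambda>x. x \<cdot> a) (sec (zero Q))"
      using x a z islin_zero[OF Q_module Q_module ract_Q_lin[OF a]] by (simp flip: sec_ract)
  qed (use islin_in[OF s] x in simp_all)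
  then have "BA.proj (sec x) = BA.proj (sec (zero Q))" by simp
  then show ?thesis using x Q_module[THEN m_zero] by (simp add: proj_sec Q_carrier)
qed

text \<open>
  \<open>emm p\<close> attaches \<open>p\<close> to the first of three legs.  By the next lemmas it intertwines the structure maps of
  \<open>P \<otimes>\<^sub>L A\<close> with those of \<open>A\<close>, so that the Hopf module axioms reduce to those of the regular Hopf module.
\<close>

abbreviation "emm p \<equiv> tA AA QA (em p)"

lemma islin_em' [simp]: "p .: P ==> islin K AA QA (em p)" using islin_em(1)[OF _ islin_id] .

lemma Q3_eqI:
  assumes f: "islin K (QA ** A) Z f" and g: "islin K (QA ** A) Z g"
    and eq: "!!p s. p .: P ==> s .: AAA ==> f (emm p s) = g (emm p s)" and t: "t .: (QA ** A)"
  shows "f t = g t"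
proof (rule tensor3_eqI[OF Q_module A_module A_module f g _ t])
  fix x b c assume x: "x .: Q" and b: "b .: A" and c: "c .: A"
  have i: "islin K Q (QA ** A) (\<lambda>x. pure_tensor K QA A (pure_tensor K Q A x b) c)" using b c by simp
  show "f (pure_tensor K QA A (pure_tensor K Q A x b) c) = g (pure_tensor K QA A (pure_tensor K Q A x b) c)"
  proof (rule Q_eqI[OF islin_comp[OF f i] islin_comp[OF g i] _ x])
    fix p a assume "p .: P" "a .: A"
    then show "f (pure_tensor K QA A (pure_tensor K Q A (BA.bt p a) b) c) = g (pure_tensor K QA A (pure_tensor K Q A (BA.bt p a) b) c)"
      using eq[of p "pure_tensor K AA A (a \<diamondop> b) c"] b c by simp
  qed
qed

lemma islin_Q_legs: "islin K Y (QA ** A) f ==> islin K Y (QA ** A) (\<lambda>x. legs12 K Q A Q A A (lam Q) (f x))"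
  "islin K Y (QA ** A) f ==> islin K Y (QA ** A) (\<lambda>x. legs13 K Q A Q A A (lam Q) (f x))"
  "islin K AA AA X ==> islin K Y (QA ** A) f ==> islin K Y (QA ** A) (\<lambda>x. legs23 K A A A A Q X (f x))"
  by (rule islin_legs12 islin_legs13 islin_legs23; simp)+

lemma legs12_emm:
  assumes p: "p .: P" and s: "s .: AAA"
  shows "legs12 K Q A Q A A (lam Q) (emm p s) = emm p (A12 (T1 A) s)"
  unfolding legs12_def using p s by simp (rule map_cong, simp_all add: lam_Q_em)

lemma legs23_emm:
  assumes X: "islin K AA AA X" and p: "p .: P" and s: "s .: AAA"
  shows "legs23 K A A A A Q X (emm p s) = emm p (A23 X s)"
proof (rule tensor3_eqI[OF A_module A_module A_module _ _ _ s, where Z="QA ** A"])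
  fix a b c assume abc: "a .: A" "b .: A" "c .: A"
  show "legs23 K A A A A Q X (emm p (pure_tensor K AA A (a \<diamondop> b) c)) = emm p (A23 X (pure_tensor K AA A (a \<diamondop> b) c))"
    using abc p X islin_in[OF X] by (simp add: legs23_pure A23_PAA) (rule map_cong, simp_all)
qed (use X p in "simp_all add: islin_Q_legs islin_A_legs")

lemma legs13_emm:
  assumes p: "p .: P" and s: "s .: AAA"
  shows "legs13 K Q A Q A A (lam Q) (emm p s) = emm p (A13 (T1 A) s)"
proof (rule tensor3_eqI[OF A_module A_module A_module _ _ _ s, where Z="QA ** A"])
  fix a b c assume abc: "a .: A" "b .: A" "c .: A"
  show "legs13 K Q A Q A A (lam Q) (emm p (pure_tensor K AA A (a \<diamondop> b) c)) = emm p (A13 (T1 A) (pure_tensor K AA A (a \<diamondop> b) c))"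
    using abc p by (simp add: legs13_pure lam_Q_pure A13_PAA) (rule map_cong, simp_all)
qed (use p in "simp_all add: islin_Q_legs islin_A_legs")

lemma A_legs_in: "islin K AA AA X ==> s .: AAA ==> A12 X s .: AAA" "islin K AA AA X ==> s .: AAA ==> A13 X s .: AAA"
  "islin K AA AA X ==> s .: AAA ==> A23 X s .: AAA"
  by (rule islin_in[OF islin_A_legs(1)[OF _ islin_id]] islin_in[OF islin_A_legs(2)[OF _ islin_id]] islin_in[OF islin_A_legs(3)[OF _ islin_id]]; assumption)+

lemma Q_comodule: "right_comodule Q"
  unfolding right_comodule_def
proof (intro conjI ballI)
  fix x a b assume x: "x .: Q" and a: "a .: A" and b: "b .: A"
  show "tensor_map K Q A Q A idm (\<lambda>x. a \<cdot> x) (lam Q (pure_tensor K Q A x b)) = tensor_map K Q A Q A idm (\<lambda>x. x \<cdot> b) (rho Q (pure_tensor K Q A x a))"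
  proof (rule Q_eqI[where Z=QA, OF _ _ _ x])
    fix p c assume p: "p .: P" and c: "c .: A"
    have "tensor_map K Q A Q A idm (\<lambda>x. a \<cdot> x) (lam Q (pure_tensor K Q A (BA.bt p c) b)) = em p (lm2 a (T1 A (c \<diamondop> b)))"
      using p c a b by (simp add: lam_Q_pure)
    also have "... = em p (rm2 b (T3 A (c \<diamondop> a)))" using a b c by (simp only: ax)
    also have "... = tensor_map K Q A Q A idm (\<lambda>x. x \<cdot> b) (rho Q (pure_tensor K Q A (BA.bt p c) a))" using p c a b by (simp add: rho_Q_pure)
    finally show "tensor_map K Q A Q A idm (\<lambda>x. a \<cdot> x) (lam Q (pure_tensor K Q A (BA.bt p c) b)) =
      tensor_map K Q A Q A idm (\<lambda>x. x \<cdot> b) (rho Q (pure_tensor K Q A (BA.bt p c) a))" .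
  qed (use a b in simp_all)
next
  fix t assume t: "t .: (QA ** A)"
  show "legs12 K Q A Q A A (lam Q) (legs13 K Q A Q A A (lam Q) (legs23 K A A A A Q (E1 A) t)) = legs12 K Q A Q A A (lam Q) (legs13 K Q A Q A A (lam Q) t)"
    by (rule Q3_eqI[where Z="QA ** A", OF _ _ _ t])
       (simp_all add: islin_Q_legs legs12_emm legs13_emm legs23_emm A_legs_in regular_E1)
  show "legs12 K Q A Q A A (lam Q) (legs13 K Q A Q A A (lam Q) (legs23 K A A A A Q (T1 A) t)) = legs23 K A A A A Q (T1 A) (legs12 K Q A Q A A (lam Q) t)"
    by (rule Q3_eqI[where Z="QA ** A", OF _ _ _ t])
       (simp_all add: islin_Q_legs legs12_emm legs13_emm legs23_emm A_legs_in regular_T1)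
qed (simp_all add: lam_Q_lin)

text \<open>The slices of the coaction on \<open>p \<otimes>\<^sub>L a\<close> are \<open>p \<otimes>\<^sub>L\<close> the slices of \<open>T1\<close>, which span \<open>A\<close> by right fullness.\<close>

lemma Q_full: "full_comodule Q"
proof -
  let ?G = "{slice2 Q w (lam Q (pure_tensor K Q A v a)) | w v a. w \<in> functionals \<and> v .: Q \<and> a .: A}"
  have G: "?G \<subseteq> carrier Q"
  proof
    fix x assume "x \<in> ?G"
    then obtain w v a where x: "x = slice2 Q w (lam Q (pure_tensor K Q A v a))" "w \<in> functionals" "v .: Q" "a .: A" by blast
    show "x .: Q" unfolding x(1) slice_eq by (rule sl2_in) (use x lin_islin[OF x(2)] islin_in[OF lam_Q_islin(1)] in simp_all)
  qed
  have sub: "submodule (lspan K Q ?G) K Q" by (rule submodule_lspan[OF Q_module G])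
  have bt: "BA.bt p x \<in> lspan K Q ?G" if p: "p .: P" and x: "x .: A" for p x
  proof -
    have S: "submodule {x \<in> carrier A. BA.bt p x \<in> lspan K Q ?G} K A" by (rule submodule_preimage[OF A_module Q_module _ sub]) (use p in simp)
    have "lspan K A {slice2 A w (T1 A (a \<diamondop> b)) | w a b. w \<in> functionals \<and> a .: A \<and> b .: A} \<subseteq> {x \<in> carrier A. BA.bt p x \<in> lspan K Q ?G}"
    proof (rule lspan_subset[OF S], rule subsetI)
      fix y assume "y \<in> {slice2 A w (T1 A (a \<diamondop> b)) | w a b. w \<in> functionals \<and> a .: A \<and> b .: A}"
      then obtain w a b where y: "y = slice2 A w (T1 A (a \<diamondop> b))" "w \<in> functionals" "a .: A" "b .: A" by blast
      have w: "islin K A (scalar_space K) w" using y(2) by (rule lin_islin)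
      have "BA.bt p y = slice2 Q w (lam Q (pure_tensor K Q A (BA.bt p a) b))" using y w p by (simp add: slice_eq lam_Q_pure sl2_map)
      then have "BA.bt p y \<in> lspan K Q ?G" using y p by (intro lspanI) (use bt_Q_in[OF p y(3)] in blast)
      moreover have "y .: A" using y w by (simp add: slice_eq)
      ultimately show "y \<in> {x \<in> carrier A. BA.bt p x \<in> lspan K Q ?G}" by blast
    qed
    then show ?thesis using x right_full unfolding right_full_def by blast
  qed
  have "x \<in> lspan K Q ?G" if "x .: Q" for x using that
  proof (induction rule: Q_induct)
    case (bt p n) then show ?case by (rule \<open>!!x p. p .: P ==> x .: A ==> BA.bt p x \<in> lspan K Q ?G\<close>)
  next
    case (add x y) then show ?case by (intro submoduleD(3)[OF Q_module sub])
  qed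
  then show ?thesis unfolding full_comodule_def using submoduleD(1)[OF Q_module sub] by blast
qed

lemma Q_hopf: "hopf_module Q"
  unfolding hopf_module_def
proof (intro conjI ballI impI)
  show "right_module K A Q" unfolding right_module_def bilinear_map_iff
  proof (intro conjI ballI)
    fix x a b assume x: "x .: Q" and a: "a .: A" and b: "b .: A"
    show "ract Q (ract Q x a) b = ract Q x (a \<cdot> b)"
      by (rule Q_eqI[where Z=Q, OF _ _ _ x]) (use a b in "simp_all add: ract_Q_bt m_ass")
  qed (simp_all add: ract_Q_bilin)
  fix x assume x: "x .: Q" "\<forall>a\<in>carrier A. ract Q x a = zero Q"
  show "x = zero Q" by (rule Q_nondeg) (use x in simp_all)
next
  have QAm: "module K QA" by simp
  have "x \<in> action Q ` carrier QA" if "x .: Q" for x using that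
  proof (induction rule: Q_induct)
    case (bt p n)
    have "n \<in> mu ` carrier AA" using mu_surj bt by simp
    then obtain t where t: "t .: AA" "n = mu t" by blast
    show ?case by (rule image_eqI[of _ _ "em p t"]) (use t bt in "simp_all add: action_Q_em")
  next
    case (add x y)
    then obtain s t where st: "s .: QA" "t .: QA" "x = action Q s" "y = action Q t" by blast
    show ?case by (rule image_eqI[of _ _ "s \<oplus>\<^bsub>QA\<^esub> t"]) (use st in "simp_all add: islin_add[OF islin_action_Q'] QAm")
  qed
  then show "action Q ` carrier QA = carrier Q" using islin_in[OF islin_action_Q'] by blast
next
  fix t assume t: "t .: (QA ** A)"
  let ?a = "tA QA Q (action Q)"
  show "lam Q (?a t) = ?a (legs13 K Q A Q A A (lam Q) (legs23 K A A A A Q (T1 A) t))"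
  proof (rule Q3_eqI[where Z=QA, OF _ _ _ t])
    fix p s assume p: "p .: P" and s: "s .: AAA"
    have 1: "?a (emm p s) = em p (mu_A s)" if "s .: AAA" for s
      using p that by simp (rule map_cong, simp_all add: action_Q_em)
    have m: "mu_A s .: AA" using s by simp
    show "lam Q (?a (emm p s)) = ?a (legs13 K Q A Q A A (lam Q) (legs23 K A A A A Q (T1 A) (emm p s)))"
      using p s m by (simp add: legs13_emm legs23_emm 1 A_legs_in lam_Q_em ax(6) del: map_map)
  qed (simp_all add: islin_Q_legs)
qed (simp_all add: Q_comodule Q_full)

end

context hopf_mod begin

section \<open>The module of coinvariants\<close>

abbreviation "C \<equiv> coinv_obj V"

text \<open>By \<open>fv_lam\<close>, the values of the maps \<open>f\<^sub>v\<close> span \<open>V\<close>.\<close>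

lemma V_induct_fv [consumes 1, case_names fv add]:
  assumes v: "v .: V" and fv: "!!v x. v .: V ==> x .: A ==> Q (fv v x)"
    and add: "!!u v. u .: V ==> v .: V ==> Q u ==> Q v ==> Q (u \<oplus>\<^bsub>V\<^esub> v)"
  shows "Q v"
  using v
proof (induction rule: V_induct_act)
  case (act v a)
  note l = tensor_lift_islin[OF V_module A_module V_module fv_bilin]
  have "Q (tensor_lift K V A V fv t)" if t: "t .: VA" for t using V_module A_module t
  proof (induction rule: tensor_induct)
    case (pure v x) then show ?case using fv by (simp add: fv_bilin)
  next
    case (add s t) then show ?case using assms(3) islin_in[OF l] by (simp add: islin_add[OF l])
  qed
  from this[of "lam V (PV v a)"] show ?case using act by (simp add: fv_lam_pure)
qed (rule add)

lemma C_simps: "carrier C = varpi V ` carrier V" "(zero C) = (\<lambda>a\<in>carrier A. (zero V))"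
  "f \<oplus>\<^bsub>C\<^esub> g = (\<lambda>a\<in>carrier A. f a \<oplus>\<^bsub>V\<^esub> g a)" "c \<odot>\<^bsub>C\<^esub> f = (\<lambda>a\<in>carrier A. c \<odot>\<^bsub>V\<^esub> f a)"
  "ract C f l = (\<lambda>a\<in>carrier A. f (fst l a))"
  by (simp_all add: coinv_obj_def)

lemma varpi_add: "u .: V ==> v .: V ==> varpi V u \<oplus>\<^bsub>C\<^esub> varpi V v = varpi V (u \<oplus>\<^bsub>V\<^esub> v)"
  and varpi_smult: "c .: K ==> v .: V ==> c \<odot>\<^bsub>C\<^esub> varpi V v = varpi V (c \<odot>\<^bsub>V\<^esub> v)"
  and varpi_zero: "(zero C) = varpi V (zero V)"
proof -
  have i: "islin K V V (\<lambda>v. fv v x)" if "x .: A" for x using that by simp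
  show "u .: V ==> v .: V ==> varpi V u \<oplus>\<^bsub>C\<^esub> varpi V v = varpi V (u \<oplus>\<^bsub>V\<^esub> v)"
    by (auto simp: C_simps varpi_eq islin_add[OF i])
  show "c .: K ==> v .: V ==> c \<odot>\<^bsub>C\<^esub> varpi V v = varpi V (c \<odot>\<^bsub>V\<^esub> v)"
    by (auto simp: C_simps varpi_eq islin_smult[OF i])
  show "(zero C) = varpi V (zero V)"
    by (auto simp: C_simps varpi_eq islin_zero[OF V_module V_module i])
qed

lemma C_module [simp]: "module K C" and islin_varpi': "islin K V C (varpi V)"
  by (rule module_surj[OF V_module C_simps(1) varpi_zero varpi_add varpi_smult]; assumption)+

lemma islin_varpi [simp]: "islin K X V f ==> islin K X C (\<lambda>x. varpi V (f x))"
  by (rule islin_comp[OF islin_varpi'])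

lemma varpi_in [simp]: "v .: V ==> varpi V v .: C" by (simp add: C_simps)

lemma C_hom: "f .: C ==> f \<in> hopf_hom regular_hopf_module V"
  using varpi_hom by (auto simp: C_simps)

lemma C_lin [simp]: "f .: C ==> islin K A V f"
  using C_hom by (auto simp: hopf_hom_regular intro: lin_islin)

lemma islin_C2 [simp]: "f .: C ==> islin K X A g ==> islin K X V (\<lambda>x. f (g x))"
  by (rule islin_comp[OF C_lin])

lemma C_app_in [simp]: "f .: C ==> a .: A ==> f a .: V"
  by (rule islin_in[OF C_lin])

lemma islin_C1 [simp]: "a .: A ==> islin K X C g ==> islin K X V (\<lambda>x. g x a)"
proof -
  assume a: "a .: A" and g: "islin K X C g"
  have "islin K C V (\<lambda>f. f a)" by (rule islinI) (use a in "simp_all add: C_simps(3,4)")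
  from islin_comp[OF this g] show ?thesis .
qed

lemma islin_C1' [simp]: "a .: A ==> islin K C V (\<lambda>f. f a)" by (rule islin_C1[OF _ islin_id])

lemma C_eqI: "f .: C ==> g .: C ==> (!!a. a .: A ==> f a = g a) ==> f = g"
  using C_hom by (auto simp: hopf_hom_regular intro: lin_eqI)

lemma C_app_mult: "f .: C ==> a .: A ==> b .: A ==> f (a \<cdot> b) = ract V (f a) b"
  using C_hom by (simp add: hopf_hom_regular)

text \<open>This is \<open>fv_hom\<close>; in particular \<open>V\<^sup>c\<close> is closed under the action of \<open>L\<close>.\<close>

lemma ract_C_sqL: "f .: C ==> c .: A ==> ract C f (sqL c) = varpi V (f c)"
  by (auto simp: C_simps(5) varpi_eq fv_hom[OF C_hom])

lemma ract_C_in [simp]: "f .: C ==> l .: L ==> ract C f l .: C"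
  by (auto simp: L_carrier ract_C_sqL)

lemma ract_C_app [simp]: "a .: A ==> ract C f l a = f (fst l a)"
  by (simp add: C_simps(5))

lemma ract_C_bilin: "bilin K C L C (ract C)"
proof (intro bilinI; rule islinI)
  note f1 = islin_fst1[OF _ islin_id] and c1 = islin_C1[OF _ islin_id]
  note s = islin_add[OF f1] islin_smult[OF f1] islin_add[OF C_lin] islin_smult[OF C_lin] islin_add[OF c1] islin_smult[OF c1]
  show "ract C f (l \<oplus>\<^bsub>L\<^esub> m) = ract C f l \<oplus>\<^bsub>C\<^esub> ract C f m" if "f .: C" "l .: L" "m .: L" for f l m
    by (rule C_eqI) (use that in "simp_all add: s")
  show "ract C f (c \<odot>\<^bsub>L\<^esub> l) = c \<odot>\<^bsub>C\<^esub> ract C f l" if "f .: C" "l .: L" "c .: K" for f l c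
    by (rule C_eqI) (use that in "simp_all add: s")
  show "ract C (f \<oplus>\<^bsub>C\<^esub> g) l = ract C f l \<oplus>\<^bsub>C\<^esub> ract C g l" if "f .: C" "g .: C" "l .: L" for f g l
    by (rule C_eqI) (use that in "simp_all add: s")
  show "ract C (c \<odot>\<^bsub>C\<^esub> f) l = c \<odot>\<^bsub>C\<^esub> ract C f l" if "f .: C" "l .: L" "c .: K" for f l c
    by (rule C_eqI) (use that in "simp_all add: s")
qed simp_all

lemma C_right_module: "right_module K L C"
  unfolding right_module_def bilinear_map_iff
proof (intro conjI ballI)
  fix f l m assume "f .: C" "l .: L" "m .: L"
  then show "ract C (ract C f l) m = ract C f (l \<otimes>\<^bsub>L\<^esub> m)" by (intro C_eqI) (simp_all add: fst_L_mult)
qed (simp_all add: ract_C_bilin)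

lemma islin_ract_C [simp]: "l .: L ==> islin K X C h ==> islin K X C (\<lambda>x. ract C (h x) l)"
   "f .: C ==> islin K X L g ==> islin K X C (\<lambda>x. ract C f (g x))"
  using ract_C_bilin islin_comp[of C C "\<lambda>p. ract C p l" X h] islin_comp[of L C "ract C f" X g] by (simp_all add: bilin_def)

lemma islin_ract_C' [simp]: "f .: C ==> islin K L C (ract C f)" using islin_ract_C(2)[OF _ islin_id] .

abbreviation "CL \<equiv> (C ** L)"

lemma C_S_sep: "g .: C ==> (!!d a. d .: A ==> a .: A ==> g (S d a) = zero V) ==> g = zero C"
proof (rule C_eqI)
  assume g: "g .: C" and z: "!!d a. d .: A ==> a .: A ==> g (S d a) = zero V"
  show "g a = zero C a" if a: "a .: A" for a
  proof -
    have "g a = zero V" using a by (induction rule: S_induct) (simp_all add: z g islin_add[OF C_lin])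
    then show ?thesis using a by (simp add: C_simps(2))
  qed
qed simp_all

text \<open>The test maps on \<open>V\<^sup>c \<otimes> L\<close> that fit the formula \<open>dl_S\<close>.\<close>

abbreviation "tst d a e b \<equiv> tensor_map K C L V A (\<lambda>g. g (S d a)) (\<lambda>m. e \<cdot> fst m b)"

lemma CL_sep:
  assumes s: "s .: CL" and t: "t .: CL"
    and eq: "!!d a e b. d .: A ==> a .: A ==> e .: A ==> b .: A ==> tst d a e b s = tst d a e b t"
  shows "s = t"
proof (rule WL_sep[OF C_module s t])
  fix b assume b: "b .: A"
  let ?m = "tensor_map K C L C A idm (\<lambda>l. fst l b)"
  show "?m s = ?m t"
  proof (rule cancelL2[OF C_module])
    fix e assume e: "e .: A"
    let ?e = "tensor_map K C A C A idm (\<lambda>x. e \<cdot> x)"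
    show "?e (?m s) = ?e (?m t)"
    proof (rule sep_map1[where I="carrier A \<times> carrier A" and V'="\<lambda>_. V" and f="\<lambda>(d, a) g. g (S d a)", OF C_module A_module])
      fix g assume "g .: C" "!!i. i \<in> carrier A \<times> carrier A ==> (case i of (d, a) => \<lambda>g. g (S d a)) g = zero V"
      then show "g = zero C" by (intro C_S_sep) (simp, metis SigmaI case_prod_conv)
    next
      fix i assume "i \<in> carrier A \<times> carrier A"
      then obtain d a where i: "i = (d, a)" "d .: A" "a .: A" by blast
      show "tA C V (case i of (d, a) => \<lambda>g. g (S d a)) (?e (?m s)) = tA C V (case i of (d, a) => \<lambda>g. g (S d a)) (?e (?m t))"
        using i b e s t eq[of d a e b] by simp
    qed (use s t b e in auto)
  qed (use s t b in simp_all)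
qed

sublocale BC: balanced K base_L C base_L "mult base_L"
  by (intro balanced.intro balanced_axioms.intro over_field_axioms) (simp_all add: ract_C_bilin L_mult_bilin)

abbreviation "rlC \<equiv> bal_lift K L C L (mult L) C (ract C)"

lemma rlC_lin: "islin K BC.B C rlC" and rlC_bt: "p .: C ==> l .: L ==> rlC (BC.bt p l) = ract C p l"
proof -
  have a: "ract C (ract C p l) m = ract C p (l \<otimes>\<^bsub>L\<^esub> m)" if "p .: C" "l .: L" "m .: L" for p l m
    using C_right_module that by (simp add: right_module_def)
  show "islin K BC.B C rlC" "p .: C ==> l .: L ==> rlC (BC.bt p l) = ract C p l"
    by (rule BC.bal_lift_islin BC.bal_lift_bt; simp add: ract_C_bilin a)+
qed

abbreviation "cdel f l \<equiv> tensor_map K L L C L (ract C f) idm (del l)"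

lemma cdel_bilin: "bilin K C L CL cdel"
  by (intro bilinI islin_map_param1) simp_all

text \<open>By \<open>dl_S\<close>, the test maps send \<open>f \<delta>(l)\<close> to \<open>(f l) (S(d') a) \<otimes> e' b\<close> with \<open>d' \<otimes> e' = (d \<otimes> e) E\<close>.  This depends on \<open>f \<otimes> l\<close> only through \<open>f l\<close>.\<close>

lemma cdel_zero:
  assumes t: "t .: CL" and z: "tensor_lift K C L C (ract C) t = zero C"
  shows "tensor_lift K C L CL cdel t = zero CL"
proof (rule CL_sep)
  fix d a e b assume A: "d .: A" "a .: A" "e .: A" "b .: A"
  let ?g = "\<lambda>g. tensor_map K A A V A (\<lambda>x. g (S x a)) (\<lambda>x. x \<cdot> b) (E2 A (d \<diamondop> e))"
  have VA: "module K VA" "module K CL" by simp_all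
  have CS: "islin K A V (\<lambda>x. g (S x a))" if "g .: C" for g by (rule islin_C2[OF that]) (use A in simp)
  have g: "islin K C VA ?g" by (rule islin_map_param1) (use A CS in simp_all)
  have tl: "islin K CL VA (tst d a e b)"
    using islin_map[OF C_module L_module V_module A_module islin_C1[OF _ islin_id] islin_mult1[OF _ islin_fst1[OF _ islin_id]] islin_id] A by simp
  have "tst d a e b (tensor_lift K C L CL cdel t) = ?g (tensor_lift K C L C (ract C) t)" (is "?lhs = _")
  proof (rule tensor_eqI[where Z=VA, OF C_module L_module _ _ _ t])
    fix f l assume f: "f .: C" and l: "l .: L"
    obtain c where c: "c .: A" "l = sqL c" using l by (auto simp: L_carrier)
    have fl: "islin K L V (\<lambda>m. f (fst m (S d a)))" by (rule islin_C2[OF f]) (use A in simp)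
    have "tst d a e b (cdel f l) = tensor_map K L L V A (\<lambda>m. ract C f m (S d a)) (\<lambda>m. e \<cdot> fst m b) (del l)" using f l A by simp
    also have "... = tensor_map K L L V A (\<lambda>m. f (fst m (S d a))) (\<lambda>m. e \<cdot> fst m b) (del l)"
      by (rule map_cong) (use f l A fl in simp_all)
    also have "... = tA A V f (lm2 e (ev (S d a) b (del l)))" using f l A by simp
    also have "... = tA A V f (map_A (\<lambda>x. PL c (S x a)) (\<lambda>x. x \<cdot> b) (E2 A (d \<diamondop> e)))" using c A by (simp only: ev_del S_in dl_S)
    also have "... = tensor_map K A A V A (\<lambda>x. f (PL c (S x a))) (\<lambda>x. x \<cdot> b) (E2 A (d \<diamondop> e))" using f c A by simp
    also have "... = ?g (ract C f l)" by (rule map_cong) (use f c A islin_C2[OF f, of A "\<lambda>x. PL c (S x a)"] in simp_all)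
    finally show "tst d a e b (tensor_lift K C L CL cdel (pure_tensor K C L f l)) = ?g (tensor_lift K C L C (ract C) (pure_tensor K C L f l))"
      using f l cdel_bilin ract_C_bilin by simp
  qed (use cdel_bilin ract_C_bilin in "simp_all add: islin_tensor_lift islin_comp[OF tl] islin_comp[OF g]")
  also have "... = zero VA" unfolding z by (rule islin_zero[OF C_module VA(1) g])
  also have "... = tst d a e b (zero CL)" (is "_ = ?rhs") by (rule islin_zero[OF VA(2,1) tl, symmetric])
  finally show "?lhs = ?rhs" .
qed (use t cdel_bilin in "simp_all add: tensor_lift_in")

text \<open>\<open>f l\<^sub>1 \<otimes>\<^sub>L l\<^sub>2 = f \<otimes>\<^sub>L l\<^sub>1 l\<^sub>2 = f \<otimes>\<^sub>L l\<close>.\<close>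

lemma proj_cdel:
  assumes t: "t .: CL" shows "BC.proj (tensor_lift K C L CL cdel t) = BC.proj t"
proof (rule tensor_eqI[where Z=BC.B, OF C_module L_module _ _ _ t])
  fix f l assume f: "f .: C" and l: "l .: L"
  have "BC.proj (tensor_map K L L C L (ract C f) idm z) = BC.bt f (tensor_lift K L L L (mult L) z)" if z: "z .: LL" for z
    by (rule tensor_eqI[where Z=BC.B, OF L_module L_module _ _ _ z])
       (use f in "simp_all add: islin_comp[OF BC.islin_proj] BC.islin_bt2 islin_tensor_lift L_mult_bilin BC.proj_pure BC.bt_balanced")
  then show "BC.proj (tensor_lift K C L CL cdel (pure_tensor K C L f l)) = BC.proj (pure_tensor K C L f l)"
    using f l cdel_bilin by (simp add: mult_del BC.proj_pure)
qed (use cdel_bilin in "simp_all add: islin_comp[OF BC.islin_proj] BC.islin_proj islin_tensor_lift")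

text \<open>Lift to \<open>V\<^sup>c \<otimes> L\<close>: by \<open>cdel_zero\<close> the element \<open>\<Sum> f\<^sub>i \<delta>(l\<^sub>i)\<close> vanishes, and it has the same image in \<open>V\<^sup>c \<otimes>\<^sub>L L\<close>.\<close>

lemma rlC_inj:
  assumes x: "x .: BC.B" and z: "rlC x = zero C" shows "x = zero BC.B"
proof -
  obtain t where t: "t .: CL" "x = BC.proj t" using BC.proj_surj[OF x] by blast
  have "rlC (BC.proj t) = tensor_lift K C L C (ract C) t"
    by (rule tensor_lift_unique[symmetric])
       (use t in "simp_all add: islin_comp[OF rlC_lin BC.islin_proj] BC.proj_pure rlC_bt")
  then have "tensor_lift K C L C (ract C) t = zero C" using z t by simp
  from cdel_zero[OF t(1) this] have "BC.proj t = BC.proj (zero CL)" using proj_cdel[OF t(1)] by simp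
  then show ?thesis using t islin_zero[OF BC.PN_module BC.B_module BC.islin_proj] by simp
qed

text \<open>Surjectivity: \<open>\<varpi>(f\<^sub>v(x)) = \<varpi>(v) \<sqinter>\<^sup>L(x)\<close>, and the values \<open>f\<^sub>v(x)\<close> span \<open>V\<close>.\<close>

lemma C_firm: "firm_module K L C"
  unfolding firm_module_def
proof (intro conjI bij_betw_imageI C_right_module)
  show "inj_on rlC (carrier BC.B)"
  proof (rule inj_onI)
    fix x y assume xy: "x .: BC.B" "y .: BC.B" "rlC x = rlC y"
    note in' = islin_in[OF rlC_lin]
    have "rlC (x \<ominus>\<^bsub>BC.B\<^esub> y) = rlC x \<ominus>\<^bsub>C\<^esub> rlC y" by (rule islin_sub[OF BC.B_module C_module rlC_lin xy(1,2)])
    also have "... = zero C" using m_sub_eq_zero[OF C_module in'[OF xy(1)] in'[OF xy(2)]] xy(3) by simp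
    finally have "x \<ominus>\<^bsub>BC.B\<^esub> y = zero BC.B" using rlC_inj[of "x \<ominus>\<^bsub>BC.B\<^esub> y"] xy BC.B_module by simp
    then show "x = y" by (rule eq_from_sub[OF BC.B_module xy(1,2)])
  qed
  show "rlC ` carrier BC.B = carrier C"
  proof
    show "rlC ` carrier BC.B \<subseteq> carrier C" using islin_in[OF rlC_lin] by blast
    have "varpi V v \<in> rlC ` carrier BC.B" if "v .: V" for v using that
    proof (induction rule: V_induct_fv)
      case (fv v x)
      have "varpi V (fv v x) = rlC (BC.bt (varpi V v) (sqL x))" using fv ract_C_sqL[of "varpi V v" x] by (simp add: rlC_bt)
      then show ?case using fv by (intro image_eqI[of _ _ "BC.bt (varpi V v) (sqL x)"]) (simp_all add: BC.bt_in)
    next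
      case (add u v)
      then obtain x y where xy: "x .: BC.B" "y .: BC.B" "varpi V u = rlC x" "varpi V v = rlC y" by blast
      show ?case by (rule image_eqI[of _ _ "x \<oplus>\<^bsub>BC.B\<^esub> y"]) (use add xy BC.B_module in "simp_all add: islin_add[OF rlC_lin] islin_add[OF islin_varpi']")
    qed
    then show "carrier C \<subseteq> rlC ` carrier BC.B" by (auto simp: C_simps(1))
  qed
qed

end

context hopf_wmb begin

section \<open>Bijective morphisms are isomorphisms\<close>

lemma inj_from_kernel:
  assumes V: "module K V" and W: "module K W" and f: "islin K V W f"
    and z: "!!x. x .: V ==> f x = zero W ==> x = zero V"
  shows "inj_on f (carrier V)"
proof (rule inj_onI)
  fix x y assume xy: "x .: V" "y .: V" "f x = f y"
  have "f (x \<ominus>\<^bsub>V\<^esub> y) = f x \<ominus>\<^bsub>W\<^esub> f y" by (rule islin_sub[OF V W f xy(1,2)])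
  also have "... = zero W" using m_sub_eq_zero[OF W islin_in[OF f xy(1)] islin_in[OF f xy(2)]] xy(3) by simp
  finally have "x \<ominus>\<^bsub>V\<^esub> y = zero V" using z xy V by simp
  then show "x = y" by (rule eq_from_sub[OF V xy(1,2)])
qed

lemma firm_isoI:
  assumes V: "module K V" and W: "module K W" and f: "f \<in> rmodule_hom K L V W" and b: "bij_betw f (carrier V) (carrier W)"
    and act: "!!p l. p .: V ==> l .: L ==> ract V p l .: V"
  shows "f \<in> firm_iso V W"
proof -
  have l: "islin K V W f" using f by (auto simp: rmodule_hom_def intro: lin_islin)
  have inj: "inj_on f (carrier V)" and im: "f ` carrier V = carrier W" using b by (auto simp: bij_betw_def)
  let ?h = "inv_into (carrier V) f"
  let ?g = "restrict ?h (carrier W)"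
  have h: "?h (f v) = v" if "v .: V" for v using inv_into_f_f[OF inj that] .
  have "?g \<in> rmodule_hom K L W V" unfolding rmodule_hom_def
  proof (intro CollectI conjI ballI)
    show "?g \<in> lin K W V" by (rule restrict_lin[OF W islin_inv[OF V l b]])
    fix w m assume "w .: W" and m: "m .: L"
    then obtain v where v: "v .: V" "w = f v" unfolding im[symmetric] by blast
    have "ract W w m = f (ract V v m)" using f v m by (simp add: rmodule_hom_def)
    then show "?g (ract W w m) = ract V (?g w) m" using v m act islin_in[OF l] by (simp add: h)
  qed
  moreover have "?g (f p) = p" if "p .: V" for p using that islin_in[OF l] by (simp add: h)
  moreover have "f (?g q) = q" if "q .: W" for q using that im f_inv_into_f[of q f "carrier V"] by simp
  ultimately show ?thesis using f unfolding firm_iso_def by blast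
qed

lemma hopf_isoI:
  assumes HV: "hopf_module V" and HW: "hopf_module W" and f: "f \<in> hopf_hom V W" and b: "bij_betw f (carrier V) (carrier W)"
  shows "f \<in> hopf_iso V W"
proof -
  interpret V: hopf_mod K A R1 R2 V using HV by (rule hopf_mod_intro)
  interpret W: hopf_mod K A R1 R2 W using HW by (rule hopf_mod_intro)
  have l: "islin K V W f" using f by (auto simp: hopf_hom_iff intro: lin_islin)
  have inj: "inj_on f (carrier V)" and im: "f ` carrier V = carrier W" using b by (auto simp: bij_betw_def)
  let ?h = "inv_into (carrier V) f"
  let ?g = "restrict ?h (carrier W)"
  have h: "?h (f v) = v" if "v .: V" for v using inv_into_f_f[OF inj that] .
  have gf: "?g (f p) = p" if "p .: V" for p using that islin_in[OF l] by (simp add: h)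
  have fg: "f (?g q) = q" if "q .: W" for q using that im f_inv_into_f[of q f "carrier V"] by simp
  have gl: "?g \<in> lin K W V" by (rule restrict_lin[OF W.V_module islin_inv[OF V.V_module l b]])
  note gi = lin_islin[OF gl]
  have "?g \<in> hopf_hom W V" unfolding hopf_hom_iff
  proof (intro conjI ballI gl)
    fix w a assume "w .: W" and a: "a .: A"
    then obtain v where v: "v .: V" "w = f v" unfolding im[symmetric] by blast
    have "ract W w a = f (ract V v a)" using f v a by (simp add: hopf_hom_iff)
    then show "?g (ract W w a) = ract V (?g w) a" using v a by (simp only: gf V.ract_in)
  next
    fix t assume t: "t .: W.VA"
    let ?F = "tA V W f" and ?G = "tA W V ?g"
    have GF: "?G (?F s) = s" if s: "s .: V.VA" for s
      by (rule V.VA_eqI[where Z=V.VA, OF _ _ _ s]) (use l gi gf islin_in[OF l] in "simp_all del: restrict_apply")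
    have FG: "?F (?G s) = s" if s: "s .: W.VA" for s
      by (rule W.VA_eqI[where Z=W.VA, OF _ _ _ s]) (use l gi fg islin_in[OF gi] in "simp_all del: restrict_apply")
    have G: "?G t .: V.VA" using t gi by simp
    have "lam W t = lam W (?F (?G t))" using t by (simp only: FG)
    also have "... = ?F (lam V (?G t))" using f G by (simp add: hopf_hom_iff)
    finally have "?G (lam W t) = ?G (?F (lam V (?G t)))" by simp
    also have "... = lam V (?G t)" using G by (simp only: GF V.lam_in)
    finally show "lam V (?G t) = ?G (lam W t)" by (rule sym)
  qed
  then show ?thesis using f gf fg unfolding hopf_iso_def by blast
qed

end

section \<open>The unit\<close>

context firm_mod begin

lemma Q_hopf_mod: "hopf_mod K A R1 R2 Q"
  by (rule hopf_mod_intro[OF Q_hopf])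

definition eta :: "'p => 'a => ('k, 'p, 'a) tensor set" where
  "eta p = (\<lambda>a\<in>carrier A. BA.bt p a)"

lemma eta_hom:
  assumes p: "p .: P" shows "eta p \<in> hopf_hom regular_hopf_module Q"
proof -
  have l: "islin K A Q (eta p)" unfolding eta_def by (rule lin_islin[OF restrict_lin]) (use p in simp_all)
  have m: "tA A Q (eta p) t = em p t" if "t .: AA" for t
    by (rule map_cong) (use l that in "simp_all add: eta_def")
  have "eta p \<in> lin K A Q" unfolding eta_def by (rule restrict_lin) (use p in simp_all)
  then show ?thesis using p by (simp add: hopf_hom_regular m lam_Q_em) (simp add: eta_def ract_Q_bt)
qed

text \<open>\<open>fv_hom\<close>, applied to the morphism \<open>eta p\<close>, gives \<open>\<varpi>(p \<otimes>\<^sub>L c) = (a \<mapsto> p \<otimes>\<^sub>L \<sqinter>\<^sup>L(c) a)\<close>.\<close>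

lemma eta_sqL:
  assumes p: "p .: P" and c: "c .: A"
  shows "eta (ract P p (sqL c)) = varpi Q (BA.bt p c)"
proof -
  interpret H: hopf_mod K A R1 R2 Q by (rule Q_hopf_mod)
  have "BA.bt (ract P p (sqL c)) x = varpi Q (BA.bt p c) x" if x: "x .: A" for x
  proof -
    have "varpi Q (BA.bt p c) x = H.fv (eta p c) x" using p c x by (simp add: eta_def)
    also have "... = eta p (PL c x)" by (rule H.fv_hom[OF eta_hom[OF p] c x])
    also have "... = BA.bt (ract P p (sqL c)) x" using p c x by (simp add: eta_def BA.bt_balanced)
    finally show ?thesis by simp
  qed
  then show ?thesis using p c by (simp add: eta_def H.varpi_eq) (rule restrict_ext, simp)
qed

lemma islin_eta: "islin K P (coinv_obj Q) eta" and eta_ract: "p .: P ==> l .: L ==> eta (ract P p l) = ract (coinv_obj Q) (eta p) l"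
  and eta_image: "eta ` carrier P = carrier (coinv_obj Q)"
proof -
  interpret H: hopf_mod K A R1 R2 Q by (rule Q_hopf_mod)
  have b1: "islin K P Q (\<lambda>p. BA.bt p a)" if "a .: A" for a using that by simp
  have add: "eta (p \<oplus>\<^bsub>P\<^esub> q) = eta p \<oplus>\<^bsub>H.C\<^esub> eta q" if "p .: P" "q .: P" for p q
    using that unfolding eta_def H.C_simps by (intro restrict_ext) (simp add: islin_add[OF b1])
  have in1: "eta p .: H.C" if "p .: P" for p using that
  proof (induction rule: P_induct)
    case (act p l)
    then show ?case by (auto simp: L_carrier eta_sqL)
  qed (simp add: add)
  have in2: "varpi Q x \<in> eta ` carrier P" if "x .: Q" for x using that
  proof (induction rule: Q_induct)
    case (bt p n)
    then show ?case using eta_sqL[of p n] by (intro image_eqI[of _ _ "ract P p (sqL n)"]) simp_all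
  next
    case (add x y)
    then obtain p q where pq: "p .: P" "q .: P" "varpi Q x = eta p" "varpi Q y = eta q" by blast
    show ?case by (rule image_eqI[of _ _ "p \<oplus>\<^bsub>P\<^esub> q"])
      (use add pq \<open>!!p q. p .: P ==> q .: P ==> eta (p \<oplus>\<^bsub>P\<^esub> q) = eta p \<oplus>\<^bsub>H.C\<^esub> eta q\<close> in "simp_all add: islin_add[OF H.islin_varpi']")
  qed
  have smult: "eta (c \<odot>\<^bsub>P\<^esub> p) = c \<odot>\<^bsub>H.C\<^esub> eta p" if "c .: K" "p .: P" for c p
    using that unfolding eta_def H.C_simps by (intro restrict_ext) (simp add: islin_smult[OF b1])
  show "islin K P H.C eta" by (rule islinI) (use in1 add smult in simp_all)
  show "p .: P ==> l .: L ==> eta (ract P p l) = ract H.C (eta p) l"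
    unfolding eta_def H.C_simps by (rule restrict_ext) (simp add: BA.bt_balanced)
  show "eta ` carrier P = carrier H.C" using in1 in2 by (auto simp: H.C_simps(1))
qed

lemma eta_iso: "restrict eta (carrier P) \<in> firm_iso P (coinv_obj Q)"
proof -
  interpret H: hopf_mod K A R1 R2 Q by (rule Q_hopf_mod)
  show ?thesis
  proof (rule firm_isoI[OF P_module H.C_module])
    show "restrict eta (carrier P) \<in> rmodule_hom K L P H.C"
      unfolding rmodule_hom_def using eta_ract by (simp add: restrict_lin[OF P_module islin_eta] islin_in[OF islin_P1[OF _ islin_id]])
    have "inj_on eta (carrier P)"
    proof (rule inj_from_kernel[OF P_module H.C_module islin_eta])
      fix p assume p: "p .: P" and z: "eta p = zero H.C"
      show "p = zero P"
      proof (rule bt_sep[OF p])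
        fix a assume a: "a .: A"
        have "eta p a = zero Q" using a z by (simp add: H.C_simps(2))
        then show "BA.bt p a = zero BA.B" using a Q_same by (simp add: eta_def same_space_def)
      qed
    qed
    then show "bij_betw (restrict eta (carrier P)) (carrier P) (carrier H.C)"
      unfolding bij_betw_def using eta_image by (simp add: inj_on_restrict_eq)
  qed (simp add: islin_in[OF islin_P1[OF _ islin_id]])
qed

end

section \<open>The counit\<close>

context hopf_mod begin

lemma C_firm_mod: "firm_mod K A R1 R2 C"
  by unfold_locales (rule C_firm)

definition counit_map :: "('k, 'a => 'v, 'a) tensor set => 'v" where
  "counit_map = bal_lift K L C A fst V (\<lambda>f a. f a)"

lemma counit_props:
  shows counit_lin: "counit_map \<in> lin K (tensor_L_obj C) V"
    and counit_bt: "f .: C ==> a .: A ==> counit_map (tensor_L C f a) = f a"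
proof -
  interpret F: firm_mod K A R1 R2 C by (rule C_firm_mod)
  have b: "bilin K C A V (\<lambda>f a. f a)" by (intro bilinI) simp_all
  have bal: "ract C f l a = f (fst l a)" if "f .: C" "l .: L" "a .: A" for f l a using that by simp
  show "counit_map \<in> lin K F.Q V" unfolding counit_map_def lin_same[OF F.Q_same(1) same_refl]
    by (rule F.BA.bal_lift_lin[OF V_module b bal])
  show "f .: C ==> a .: A ==> counit_map (F.BA.bt f a) = f a" unfolding counit_map_def
    by (rule F.BA.bal_lift_bt[OF V_module b bal])
qed

lemma counit_iso_map: "counit_map \<in> hopf_iso (tensor_L_obj C) V"
proof -
  interpret F: firm_mod K A R1 R2 C by (rule C_firm_mod)
  let ?Q = "tensor_L_obj C"
  let ?bt = "tensor_L C"
  note cl = lin_islin[OF counit_lin]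
  have cli: "islin K X V (\<lambda>x. counit_map (g x))" if "islin K X ?Q g" for X :: "('k, 'x, 'xx) module_scheme" and g
    by (rule islin_comp[OF cl that])
  have act: "counit_map (ract ?Q x b) = ract V (counit_map x) b" if x: "x .: ?Q" and b: "b .: A" for x b
    by (rule F.Q_eqI[where Z=V, OF _ _ _ x])
       (use b in "simp_all add: islin_comp[OF cl] islin_comp[OF cl F.ract_Q_lin] cl F.ract_Q_bt counit_bt C_app_mult")
  have coact: "lam V (tA ?Q V counit_map t) = tA ?Q V counit_map (lam ?Q t)" if t: "t .: F.QA" for t
  proof (rule tensor_eqI[where Z=VA, OF F.Q_module A_module _ _ _ t])
    fix x b assume x: "x .: ?Q" and b: "b .: A"
    show "lam V (tA ?Q V counit_map (pure_tensor K ?Q A x b)) = tA ?Q V counit_map (lam ?Q (pure_tensor K ?Q A x b))"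
    proof (rule F.Q_eqI[where Z=VA, OF _ _ _ x])
      fix f a assume f: "f .: C" and a: "a .: A"
      have "tA ?Q V counit_map (lam ?Q (pure_tensor K ?Q A (?bt f a) b)) = tA A V (\<lambda>a. counit_map (?bt f a)) (T1 A (a \<diamondop> b))"
        using f a b cl by (simp add: F.lam_Q_pure)
      also have "... = tA A V f (T1 A (a \<diamondop> b))"
        by (rule map_cong) (use f a b cl in "simp_all add: counit_bt islin_comp[OF cl]")
      also have "... = lam V (tA A V f (a \<diamondop> b))" using C_hom[OF f] a b by (simp add: hopf_hom_regular)
      also have "... = lam V (tA ?Q V counit_map (pure_tensor K ?Q A (?bt f a) b))" using f a b cl by (simp add: counit_bt)
      finally show "lam V (tA ?Q V counit_map (pure_tensor K ?Q A (?bt f a) b)) =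
        tA ?Q V counit_map (lam ?Q (pure_tensor K ?Q A (?bt f a) b))" by simp
    qed (use b cl in simp_all)
  qed (use cl in simp_all)
  have hom: "counit_map \<in> hopf_hom ?Q V" using act coact counit_lin by (simp add: hopf_hom_iff)
  have inj: "inj_on counit_map (carrier ?Q)"
  proof (rule inj_from_kernel[OF F.Q_module V_module cl])
    fix x assume x: "x .: ?Q" and z: "counit_map x = zero V"
    have bb: "bilin K V A ?Q (\<lambda>v b. ?bt (varpi V v) b)" by (intro bilinI) simp_all
    \<comment> \<open>The map \<open>v \<otimes> b \<mapsto> \<varpi>(v\<^sub>0) \<otimes>\<^sub>L v\<^sub>1 b\<close>.  On \<open>v = f(a)\<close> it gives \<open>f \<otimes>\<^sub>L \<sqinter>\<^sup>L(a\<^sub>1) a\<^sub>2 b = f \<otimes>\<^sub>L a b\<close>.\<close>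
    let ?\<beta> = "\<lambda>v b. tensor_lift K V A ?Q (\<lambda>v b. ?bt (varpi V v) b) (lam V (PV v b))"
    have \<beta>: "islin K V ?Q (\<lambda>v. ?\<beta> v b)" if "b .: A" for b using that bb by (simp add: islin_tensor_lift)
    show "x = zero ?Q"
    proof (rule F.Q_nondeg[OF x])
      fix b assume b: "b .: A"
      have "ract ?Q x b = ?\<beta> (counit_map x) b"
      proof (rule F.Q_eqI[where Z="?Q", OF F.ract_Q_lin[OF b] islin_comp[OF \<beta>[OF b] cl] _ x])
        fix f a assume f: "f .: C" and a: "a .: A"
        have 1: "tensor_lift K V A ?Q (\<lambda>v b. ?bt (varpi V v) b) (tA A V f s) = ?bt f (tensor_lift K A A A PL s)" if s: "s .: AA" for s
        proof (rule AA_eqI[where Z="?Q", OF _ _ _ s])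
          fix u w assume uw: "u .: A" "w .: A"
          have "?bt (varpi V (f u)) w = ?bt f (PL u w)" using f uw by (simp add: F.BA.bt_balanced flip: ract_C_sqL)
          then show "tensor_lift K V A ?Q (\<lambda>v b. ?bt (varpi V v) b) (tA A V f (u \<diamondop> w)) = ?bt f (tensor_lift K A A A PL (u \<diamondop> w))"
            using f uw bb PL_bilin by simp
        qed (use f bb PL_bilin in "simp_all add: islin_tensor_lift")
        have "lam V (PV (f a) b) = tA A V f (T1 A (a \<diamondop> b))"
          using C_hom[OF f] f a b by (simp add: hopf_hom_regular) (metis C_lin A_module V_module islin_id map_pure pure_in)
        then show "ract ?Q (?bt f a) b = ?\<beta> (counit_map (?bt f a)) b"
          using f a b by (simp add: counit_bt 1 lift_PL_T1 F.ract_Q_bt)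
      qed
      then show "ract ?Q x b = zero ?Q" using z islin_zero[OF V_module F.Q_module \<beta>[OF b]] by simp
    qed
  qed
  have "v \<in> counit_map ` carrier ?Q" if "v .: V" for v using that
  proof (induction rule: V_induct_fv)
    case (fv v x)
    show ?case by (rule image_eqI[of _ _ "?bt (varpi V v) x"]) (use fv in "simp_all add: counit_bt")
  next
    case (add u v)
    then obtain x y where xy: "x .: ?Q" "y .: ?Q" "u = counit_map x" "v = counit_map y" by blast
    show ?case by (rule image_eqI[of _ _ "x \<oplus>\<^bsub>?Q\<^esub> y"]) (use xy in "simp_all add: islin_add[OF cl]")
  qed
  then have "bij_betw counit_map (carrier ?Q) (carrier V)"
    using inj islin_in[OF cl] by (auto simp: bij_betw_def)
  then show ?thesis by (rule hopf_isoI[OF F.Q_hopf HV hom])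
qed

end

context hopf_wmb begin

section \<open>The two categories\<close>

lemma restrict_compose_lin: "f \<in> lin K U V ==> g \<in> lin K V W ==> module K U ==> compose (carrier U) g f \<in> lin K U W"
  unfolding compose_def by (rule restrict_lin) (auto intro: islin_comp lin_islin)

lemma compose_app [simp]: "x .: U ==> compose (carrier U) g f x = g (f x)"
  by (simp add: compose_def)

lemma lin_comp_id: 
  assumes "f \<in> lin K U V" shows "compose (carrier U) f (\<lambda>x\<in>carrier U. x) = f" "compose (carrier U) (\<lambda>x\<in>carrier V. x) f = f"
proof -
  have "f \<in> extensional (carrier U)" "f \<in> carrier U \<rightarrow> carrier V" using assms islin_in[OF lin_islin[OF assms]] by (auto simp: lin_iff)
  then show "compose (carrier U) f (\<lambda>x\<in>carrier U. x) = f" "compose (carrier U) (\<lambda>x\<in>carrier V. x) f = f"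
    by (auto intro: compose_Id Id_compose)
qed

lemma lin_comp_assoc: 
  assumes "f \<in> lin K U V" shows "compose (carrier U) h (compose (carrier U) g f) = compose (carrier U) (compose (carrier V) h g) f"
  using assms by (intro ext) (auto simp: compose_def lin_def)

lemma firm_module_lin: "firm_module K L P ==> module K P"
  by (simp add: firm_module_def right_module_def)

lemma firm_ract_in: "firm_module K L P ==> p .: P ==> l .: L ==> ract P p l .: P"
  by (auto simp: firm_module_def right_module_def bilinear_map_def)

lemma rmodule_hom_comp: "firm_module K L P ==> f \<in> rmodule_hom K L P Q ==> g \<in> rmodule_hom K L Q R ==> compose (carrier P) g f \<in> rmodule_hom K L P R"
  unfolding rmodule_hom_def by (auto simp: firm_module_lin firm_ract_in intro!: restrict_compose_lin intro: islin_in[OF lin_islin])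

lemma hopf_hom_comp:
  fixes U :: "('k, 'u, 'a) hopf_module" and V :: "('k, 'v, 'a) hopf_module" and W :: "('k, 'w, 'a) hopf_module"
  assumes V: "hopf_module U" "hopf_module V" "hopf_module W" and f: "f \<in> hopf_hom U V" and g: "g \<in> hopf_hom V W"
  shows "compose (carrier U) g f \<in> hopf_hom U W"
proof -
  interpret U: hopf_mod K A R1 R2 U using V(1) by (rule hopf_mod_intro)
  interpret V: hopf_mod K A R1 R2 V using V(2) by (rule hopf_mod_intro)
  interpret W: hopf_mod K A R1 R2 W using V(3) by (rule hopf_mod_intro)
  have fl: "f \<in> lin K U V" and gl: "g \<in> lin K V W" using f g by (auto simp: hopf_hom_iff)
  note fi = lin_islin[OF fl] and gi = lin_islin[OF gl]
  have c: "compose (carrier U) g f \<in> lin K U W" using fl gl by (simp add: restrict_compose_lin)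
  have eq: "tA U W (compose (carrier U) g f) t = tA V W g (tA U V f t)" if t: "t .: U.VA" for t
  proof -
    have "tA U W (compose (carrier U) g f) t = tA U W (\<lambda>x. g (f x)) t"
      by (rule map_cong) (use t lin_islin[OF c] in simp_all)
    then show ?thesis using t fi gi by simp
  qed
  show ?thesis unfolding hopf_hom_iff
  proof (intro conjI ballI c)
    show "compose (carrier U) g f (ract U v a) = ract W (compose (carrier U) g f v) a" if "v .: U" "a .: A" for v a
      using that f g islin_in[OF fi] by (simp add: hopf_hom_iff)
    fix t assume t: "t .: U.VA"
    have ft: "tA U V f t .: V.VA" using t fi by simp
    show "lam W (tA U W (compose (carrier U) g f) t) = tA U W (compose (carrier U) g f) (lam U t)"
      using t ft f g by (simp add: eq hopf_hom_iff)
  qed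
qed

lemma hopf_hom_id:
  fixes V :: "('k, 'v, 'a) hopf_module"
  assumes V: "hopf_module V" shows "(\<lambda>v\<in>carrier V. v) \<in> hopf_hom V V"
proof -
  interpret V: hopf_mod K A R1 R2 V using V by (rule hopf_mod_intro)
  have l: "(\<lambda>v\<in>carrier V. v) \<in> lin K V V" by (rule restrict_lin) simp_all
  have eq: "tA V V (\<lambda>v\<in>carrier V. v) t = t" if t: "t .: V.VA" for t
  proof -
    have "tA V V (\<lambda>v\<in>carrier V. v) t = tA V V idm t"
      by (rule map_cong) (use t lin_islin[OF l] in simp_all)
    then show ?thesis using t by simp
  qed
  show ?thesis unfolding hopf_hom_iff by (simp add: l eq)
qed

lemma firm_category: "is_category (cat_firm :: (('k, 'p, 'a multiplier) rmodule, 'p => 'p) category)"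
proof -
  let ?C = "cat_firm :: (('k, 'p, 'a multiplier) rmodule, 'p => 'p) category"
  have l: "f \<in> rmodule_hom K L P Q ==> f \<in> lin K P Q" for f and P Q :: "('k, 'p, 'a multiplier) rmodule" by (simp add: rmodule_hom_def)
  have i: "(\<lambda>p\<in>carrier P. p) \<in> rmodule_hom K L P P" if P: "firm_module K L P" for P :: "('k, 'p, 'a multiplier) rmodule"
    using firm_ract_in[OF P] firm_module_lin[OF P] by (simp add: rmodule_hom_def restrict_lin)
  show ?thesis unfolding is_category_def cat_firm_def
    by (auto simp: i lin_comp_id[OF l] lin_comp_assoc[OF l] intro: rmodule_hom_comp)
qed

lemma hopf_category: "is_category (cat_hopf :: (('k, 'v, 'a) hopf_module, 'v => 'v) category)"
proof -
  have l: "f \<in> hopf_hom P Q ==> f \<in> lin K P Q" for f and P Q :: "('k, 'v, 'a) hopf_module" by (simp add: hopf_hom_iff)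
  show ?thesis unfolding is_category_def cat_hopf_def
    by (auto simp: lin_comp_id[OF l] lin_comp_assoc[OF l] intro: hopf_hom_comp hopf_hom_id)
qed

section \<open>The two functors\<close>

lemma tensor_L_mor:
  assumes FP: "firm_module K L P" and FQ: "firm_module K L Q" and f: "f \<in> rmodule_hom K L P Q"
  shows tensor_L_mor_hom: "tensor_L_mor P Q f \<in> hopf_hom (tensor_L_obj P) (tensor_L_obj Q)"
    and tensor_L_mor_bt: "p .: P ==> a .: A ==> tensor_L_mor P Q f (tensor_L P p a) = tensor_L Q (f p) a"
proof -
  interpret P: firm_mod K A R1 R2 P by unfold_locales (rule FP)
  interpret Q: firm_mod K A R1 R2 Q by unfold_locales (rule FQ)
  let ?F = "tensor_L_mor P Q f"
  have fi: "islin K P Q f" and fm: "!!p l. p .: P ==> l .: L ==> f (ract P p l) = ract Q (f p) l"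
    using f by (auto simp: rmodule_hom_def intro: lin_islin)
  note fin = islin_in[OF fi]
  have b: "bilin K P A Q.BA.B (\<lambda>p a. Q.BA.bt (f p) a)" by (intro bilinI Q.BA.islin_bt1 Q.BA.islin_bt2) (use fi fin in simp_all)
  have bal: "Q.BA.bt (f (ract P p l)) a = Q.BA.bt (f p) (fst l a)" if "p .: P" "l .: L" "a .: A" for p l a
    using that fin by (simp add: fm Q.BA.bt_balanced)
  have l: "?F \<in> lin K P.Q Q.Q" unfolding tensor_L_mor_def lin_same[OF P.Q_same(1) Q.Q_same(1)] by (rule P.BA.bal_lift_lin[OF Q.BA_module b bal])
  have bt: "?F (P.BA.bt p a) = Q.BA.bt (f p) a" if "p .: P" "a .: A" for p a
    unfolding tensor_L_mor_def by (rule P.BA.bal_lift_bt[OF Q.BA_module b bal that])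
  note li = lin_islin[OF l]
  show "p .: P ==> a .: A ==> ?F (P.BA.bt p a) = Q.BA.bt (f p) a" by (rule bt)
  show "?F \<in> hopf_hom P.Q Q.Q" unfolding hopf_hom_iff
  proof (intro conjI ballI l)
    fix x a assume x: "x .: P.Q" and a: "a .: A"
    show "?F (ract P.Q x a) = ract Q.Q (?F x) a"
      by (rule P.Q_eqI[where Z=Q.Q, OF _ _ _ x])
         (use a fin in "simp_all add: islin_comp[OF li P.ract_Q_lin] islin_comp[OF Q.ract_Q_lin li] P.ract_Q_bt Q.ract_Q_bt bt")
  next
    fix t assume t: "t .: P.QA"
    let ?M = "tA P.Q Q.Q ?F"
    show "lam Q.Q (?M t) = ?M (lam P.Q t)"
    proof (rule tensor_eqI[where Z=Q.QA, OF P.Q_module A_module _ _ _ t])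
      fix x b assume x: "x .: P.Q" and b: "b .: A"
      show "lam Q.Q (?M (pure_tensor K P.Q A x b)) = ?M (lam P.Q (pure_tensor K P.Q A x b))"
      proof (rule P.Q_eqI[where Z=Q.QA, OF _ _ _ x])
        fix p a assume p: "p .: P" and a: "a .: A"
        have "?M (lam P.Q (pure_tensor K P.Q A (P.BA.bt p a) b)) = tA A Q.Q (\<lambda>a. ?F (P.BA.bt p a)) (T1 A (a \<diamondop> b))"
          using p a b li by (simp add: P.lam_Q_pure)
        also have "... = Q.em (f p) (T1 A (a \<diamondop> b))" by (rule map_cong) (use p a b li in "simp_all add: bt islin_comp[OF li]")
        also have "... = lam Q.Q (?M (pure_tensor K P.Q A (P.BA.bt p a) b))" using p a b li fin by (simp add: bt Q.lam_Q_pure)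
        finally show "lam Q.Q (?M (pure_tensor K P.Q A (P.BA.bt p a) b)) = ?M (lam P.Q (pure_tensor K P.Q A (P.BA.bt p a) b))" by simp
      qed (use b li in simp_all)
    qed (use li in simp_all)
  qed
qed

text \<open>The elements \<open>p \<otimes>\<^sub>L a\<close> span, so morphisms out of \<open>P \<otimes>\<^sub>L A\<close> are determined by their values there.\<close>

lemma tensor_L_lin_eqI:
  assumes FP: "firm_module K L P" and f: "f \<in> lin K (tensor_L_obj P) Z" and g: "g \<in> lin K (tensor_L_obj P) Z"
    and eq: "!!p a. p .: P ==> a .: A ==> f (tensor_L P p a) = g (tensor_L P p a)"
  shows "f = g"
proof -
  interpret P: firm_mod K A R1 R2 P by unfold_locales (rule FP)
  show ?thesis by (rule lin_eqI[OF f g], rule P.Q_eqI[OF lin_islin[OF f] lin_islin[OF g] eq])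
qed

lemma tensor_L_functor: "is_functor (cat_firm :: (('k, 'p, 'a multiplier) rmodule, 'p => 'p) category) cat_hopf tensor_L_obj tensor_L_mor"
proof -
  have obj: "hopf_module (tensor_L_obj P)" if "firm_module K L P" for P :: "('k, 'p, 'a multiplier) rmodule"
  proof -
    interpret P: firm_mod K A R1 R2 P by unfold_locales (rule that)
    show ?thesis by (rule P.Q_hopf)
  qed
  have bt_in: "tensor_L P p a .: (tensor_L_obj P)" if "firm_module K L P" "p .: P" "a .: A" for P :: "('k, 'p, 'a multiplier) rmodule" and p a
  proof -
    interpret P: firm_mod K A R1 R2 P by unfold_locales (rule that(1))
    show ?thesis using that by simp
  qed
  have idr: "(\<lambda>p\<in>carrier P. p) \<in> rmodule_hom K L P P" if P: "firm_module K L P" for P :: "('k, 'p, 'a multiplier) rmodule"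
    using firm_ract_in[OF P] firm_module_lin[OF P] by (simp add: rmodule_hom_def restrict_lin)
  have l: "f \<in> hopf_hom V W ==> f \<in> lin K V W" for f and V W :: "('k, ('k, 'p, 'a) tensor set, 'a) hopf_module" by (simp add: hopf_hom_iff)
  have fin: "f p .: Q" if "f \<in> rmodule_hom K L P Q" "p .: P" for f p and P Q :: "('k, 'p, 'a multiplier) rmodule"
    using that by (auto simp: rmodule_hom_def intro: islin_in[OF lin_islin])
  have id: "tensor_L_mor P P (\<lambda>p\<in>carrier P. p) = (\<lambda>x\<in>carrier (tensor_L_obj P). x)" if P: "firm_module K L P" for P :: "('k, 'p, 'a multiplier) rmodule"
    by (rule tensor_L_lin_eqI[OF P l[OF tensor_L_mor_hom[OF P P idr[OF P]]] l[OF hopf_hom_id[OF obj[OF P]]]])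
       (use P in "simp add: tensor_L_mor_bt[OF P P idr[OF P]] bt_in")
  have comp: "tensor_L_mor P R (compose (carrier P) g f) = compose (carrier (tensor_L_obj P)) (tensor_L_mor Q R g) (tensor_L_mor P Q f)"
    if P: "firm_module K L P" and Q: "firm_module K L Q" and R: "firm_module K L R" and f: "f \<in> rmodule_hom K L P Q" and g: "g \<in> rmodule_hom K L Q R"
    for f g and P Q R :: "('k, 'p, 'a multiplier) rmodule"
    by (rule tensor_L_lin_eqI[OF P l[OF tensor_L_mor_hom[OF P R rmodule_hom_comp[OF P f g]]]
          l[OF hopf_hom_comp[OF obj[OF P] obj[OF Q] obj[OF R] tensor_L_mor_hom[OF P Q f] tensor_L_mor_hom[OF Q R g]]]])
       (simp add: tensor_L_mor_bt[OF P R rmodule_hom_comp[OF P f g]] tensor_L_mor_bt[OF P Q f] tensor_L_mor_bt[OF Q R g] bt_in[OF P] fin[OF f])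
  show ?thesis unfolding is_functor_def
    by (intro conjI firm_category hopf_category) (auto simp: cat_firm_def cat_hopf_def obj id comp tensor_L_mor_hom)
qed

text \<open>On \<open>\<varpi>(v)\<close> the composition with \<open>f\<close> is \<open>\<varpi>(f v)\<close>, by \<open>fv_natural\<close>; hence coinvariants are mapped to coinvariants.\<close>

lemma coinv_mor:
  assumes V: "hopf_module V" and W: "hopf_module W" and f: "f \<in> hopf_hom V W"
  shows coinv_mor_hom: "coinv_mor V W f \<in> rmodule_hom K L (coinv_obj V) (coinv_obj W)"
    and coinv_mor_app: "g .: (coinv_obj V) ==> coinv_mor V W f g = compose (carrier A) f g"
    and coinv_mor_varpi: "v .: V ==> coinv_mor V W f (varpi V v) = varpi W (f v)"
proof -
  interpret V: hopf_mod K A R1 R2 V using V by (rule hopf_mod_intro)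
  interpret W: hopf_mod K A R1 R2 W using W by (rule hopf_mod_intro)
  have fi: "islin K V W f" using f by (auto simp: hopf_hom_iff intro: lin_islin)
  note fin = islin_in[OF fi]
  let ?F = "coinv_mor V W f"
  show app: "?F g = compose (carrier A) f g" if "g .: V.C" for g using that by (simp add: coinv_mor_def)
  show vp: "?F (varpi V v) = varpi W (f v)" if v: "v .: V" for v
    using v fin by (simp add: app W.varpi_eq compose_def) (rule restrict_ext, simp add: fv_natural[OF V W f v])
  have in': "?F g .: W.C" if "g .: V.C" for g using that vp fin by (auto simp: V.C_simps(1))
  have app': "?F g a = f (g a)" if "g .: V.C" "a .: A" for g a using that by (simp add: app)
  have ops: "(g \<oplus>\<^bsub>V.C\<^esub> h) a = g a \<oplus>\<^bsub>V\<^esub> h a" "(c \<odot>\<^bsub>V.C\<^esub> g) a = c \<odot>\<^bsub>V\<^esub> g a" "(g' \<oplus>\<^bsub>W.C\<^esub> h') a = g' a \<oplus>\<^bsub>W\<^esub> h' a" "(c \<odot>\<^bsub>W.C\<^esub> g') a = c \<odot>\<^bsub>W\<^esub> g' a"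
    if "a .: A" for g h g' h' c a using that by (simp_all add: V.C_simps W.C_simps)
  have li: "islin K V.C W.C ?F"
  proof (rule islinI)
    show "?F g .: W.C" if "g .: V.C" for g using in' that .
    show "?F (g \<oplus>\<^bsub>V.C\<^esub> h) = ?F g \<oplus>\<^bsub>W.C\<^esub> ?F h" if "g .: V.C" "h .: V.C" for g h
      by (rule W.C_eqI) (use that in' in "simp_all add: app' ops islin_add[OF fi]")
    show "?F (c \<odot>\<^bsub>V.C\<^esub> g) = c \<odot>\<^bsub>W.C\<^esub> ?F g" if "c .: K" "g .: V.C" for c g
      by (rule W.C_eqI) (use that in' in "simp_all add: app' ops islin_smult[OF fi]")
  qed
  have "?F \<in> extensional (carrier V.C)" by (simp add: coinv_mor_def)
  then have l: "?F \<in> lin K V.C W.C" using li by (simp add: lin_iff)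
  show "?F \<in> rmodule_hom K L V.C W.C" unfolding rmodule_hom_def
  proof (intro CollectI conjI ballI l)
    show "?F (ract V.C g l) = ract W.C (?F g) l" if "g .: V.C" "l .: L" for g l
      by (rule W.C_eqI) (use that in' in "simp_all add: app'")
  qed
qed

lemma coinv_functor: "is_functor (cat_hopf :: (('k, 'v, 'a) hopf_module, 'v => 'v) category) cat_firm coinv_obj coinv_mor"
proof -
  have obj: "firm_module K L (coinv_obj V)" if "hopf_module V" for V :: "('k, 'v, 'a) hopf_module"
  proof -
    interpret V: hopf_mod K A R1 R2 V using that by (rule hopf_mod_intro)
    show ?thesis by (rule V.C_firm)
  qed
  have ext: "g \<in> extensional (carrier A) \<and> (\<forall>a\<in>carrier A. g a .: V)" if "hopf_module V" "g .: (coinv_obj V)" for g and V :: "('k, 'v, 'a) hopf_module"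
  proof -
    interpret V: hopf_mod K A R1 R2 V using that(1) by (rule hopf_mod_intro)
    show ?thesis using V.C_hom[OF that(2)] that(2) by (auto simp: hopf_hom_regular lin_iff)
  qed
  have l: "f \<in> rmodule_hom K L P Q ==> f \<in> lin K P Q" for f and P Q :: "('k, 'a => 'v, 'a multiplier) rmodule" by (simp add: rmodule_hom_def)
  have id: "coinv_mor V V (\<lambda>v\<in>carrier V. v) = (\<lambda>g\<in>carrier (coinv_obj V). g)" if V: "hopf_module V" for V :: "('k, 'v, 'a) hopf_module"
    unfolding coinv_mor_def
  proof (rule restrict_ext)
    fix g assume "g .: (coinv_obj V)"
    from ext[OF V this] show "compose (carrier A) (\<lambda>v\<in>carrier V. v) g = g" by (auto simp: compose_def extensional_def restrict_def fun_eq_iff)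
  qed
  have comp: "coinv_mor U W (compose (carrier U) g f) = compose (carrier (coinv_obj U)) (coinv_mor V W g) (coinv_mor U V f)"
    if U: "hopf_module U" and V: "hopf_module V" and W: "hopf_module W" and f: "f \<in> hopf_hom U V" and g: "g \<in> hopf_hom V W"
    for f g and U V W :: "('k, 'v, 'a) hopf_module"
  proof (rule lin_eqI[OF l[OF coinv_mor_hom[OF U W hopf_hom_comp[OF U V W f g]]]])
    show "compose (carrier (coinv_obj U)) (coinv_mor V W g) (coinv_mor U V f) \<in> lin K (coinv_obj U) (coinv_obj W)"
      by (rule restrict_compose_lin[OF l[OF coinv_mor_hom[OF U V f]] l[OF coinv_mor_hom[OF V W g]] firm_module_lin[OF obj[OF U]]])
    fix h assume h: "h .: (coinv_obj U)"
    have h': "coinv_mor U V f h .: (coinv_obj V)" by (rule islin_in[OF lin_islin[OF l[OF coinv_mor_hom[OF U V f]]] h])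
    show "coinv_mor U W (compose (carrier U) g f) h = compose (carrier (coinv_obj U)) (coinv_mor V W g) (coinv_mor U V f) h"
      using h h' ext[OF U h] by (simp add: coinv_mor_app[OF U W hopf_hom_comp[OF U V W f g]] coinv_mor_app[OF V W g] coinv_mor_app[OF U V f])
        (auto simp: compose_def restrict_def fun_eq_iff)
  qed
  show ?thesis unfolding is_functor_def
    by (intro conjI firm_category hopf_category) (auto simp: cat_firm_def cat_hopf_def obj id comp coinv_mor_hom)
qed

section \<open>The natural isomorphisms\<close>

lemma unit: "unit_iso (\<lambda>P. \<lambda>p\<in>carrier P. \<lambda>a\<in>carrier A. tensor_L P p a)"
  unfolding unit_iso_def
proof (intro conjI ballI)
  fix P :: "('k, 'p, 'a multiplier) rmodule" assume "P \<in> Obj cat_firm"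
  then have FP: "firm_module K L P" by (simp add: cat_firm_def)
  interpret P: firm_mod K A R1 R2 P by unfold_locales (rule FP)
  have "(\<lambda>p\<in>carrier P. \<lambda>a\<in>carrier A. tensor_L P p a) = restrict P.eta (carrier P)" by (simp add: P.eta_def[abs_def])
  then show "(\<lambda>p\<in>carrier P. \<lambda>a\<in>carrier A. tensor_L P p a) \<in> firm_iso P (coinv_obj (tensor_L_obj P))" using P.eta_iso by simp
  fix Q f p assume "Q \<in> Obj cat_firm" "f \<in> Hom cat_firm P Q" and p: "p .: P"
  then have FQ: "firm_module K L Q" and f: "f \<in> rmodule_hom K L P Q" by (simp_all add: cat_firm_def)
  interpret Q: firm_mod K A R1 R2 Q by unfold_locales (rule FQ)
  have fp: "f p .: Q" using f p by (auto simp: rmodule_hom_def intro: islin_in[OF lin_islin])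
  have e: "(\<lambda>a\<in>carrier A. tensor_L P p a) .: (coinv_obj P.Q)" using islin_in[OF P.islin_eta p] by (simp add: P.eta_def)
  have "coinv_mor P.Q Q.Q (tensor_L_mor P Q f) (\<lambda>a\<in>carrier A. tensor_L P p a) = compose (carrier A) (tensor_L_mor P Q f) (\<lambda>a\<in>carrier A. tensor_L P p a)"
    by (rule coinv_mor_app[OF P.Q_hopf Q.Q_hopf tensor_L_mor_hom[OF FP FQ f] e])
  also have "... = (\<lambda>a\<in>carrier A. tensor_L Q (f p) a)"
    unfolding compose_def by (rule restrict_ext) (simp add: tensor_L_mor_bt[OF FP FQ f p])
  finally show "coinv_mor P.Q Q.Q (tensor_L_mor P Q f) ((\<lambda>p\<in>carrier P. \<lambda>a\<in>carrier A. tensor_L P p a) p) = (\<lambda>p\<in>carrier Q. \<lambda>a\<in>carrier A. tensor_L Q p a) (f p)"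
    using p fp by simp
qed

lemma counit: "counit_iso (\<lambda>V. bal_lift K L (coinv_obj V) A fst V (\<lambda>f a. f a))"
  unfolding counit_iso_def
proof (intro conjI ballI)
  fix V :: "('k, 'v, 'a) hopf_module" assume "V \<in> Obj cat_hopf"
  then have HV: "hopf_module V" by (simp add: cat_hopf_def)
  interpret V: hopf_mod K A R1 R2 V using HV by (rule hopf_mod_intro)
  show "bal_lift K L V.C A fst V (\<lambda>f a. f a) \<in> hopf_iso (tensor_L_obj V.C) V" using V.counit_iso_map by (simp add: V.counit_map_def)
  fix W f x assume "W \<in> Obj cat_hopf" "f \<in> Hom cat_hopf V W" and x: "x .: (tensor_L_obj V.C)"
  then have HW: "hopf_module W" and f: "f \<in> hopf_hom V W" by (simp_all add: cat_hopf_def)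
  interpret W: hopf_mod K A R1 R2 W using HW by (rule hopf_mod_intro)
  interpret F: firm_mod K A R1 R2 V.C by (rule V.C_firm_mod)
  note cf = coinv_mor_hom[OF HV HW f]
  note tf = tensor_L_mor_hom[OF V.C_firm W.C_firm cf]
  have fi: "islin K V W f" using f by (auto simp: hopf_hom_iff intro: lin_islin)
  have ti: "islin K F.Q (tensor_L_obj W.C) (tensor_L_mor V.C W.C (coinv_mor V W f))" using tf by (auto simp: hopf_hom_iff intro: lin_islin)
  have "f (V.counit_map x) = W.counit_map (tensor_L_mor V.C W.C (coinv_mor V W f) x)"
  proof (rule F.Q_eqI[where Z=W, OF islin_comp[OF fi lin_islin[OF V.counit_lin]] islin_comp[OF lin_islin[OF W.counit_lin] ti] _ x])
    fix g a assume g: "g .: V.C" and a: "a .: A"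
    have "coinv_mor V W f \<in> lin K V.C W.C" using cf by (simp add: rmodule_hom_def)
    from islin_in[OF lin_islin[OF this] g] have "coinv_mor V W f g .: W.C" .
    then show "f (V.counit_map (F.BA.bt g a)) = W.counit_map (tensor_L_mor V.C W.C (coinv_mor V W f) (F.BA.bt g a))"
      using g a by (simp add: V.counit_bt W.counit_bt tensor_L_mor_bt[OF V.C_firm W.C_firm cf]) (simp add: coinv_mor_app[OF HV HW f])
  qed
  then show "f (bal_lift K L V.C A fst V (\<lambda>f a. f a) x) = bal_lift K L W.C A fst W (\<lambda>f a. f a) (tensor_L_mor V.C W.C (coinv_mor V W f) x)"
    by (simp add: V.counit_map_def W.counit_map_def)
qed

end

theorem theorem7p12:
  fixes K :: "'k ring" and A :: "('k, 'a) wmb"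
    and R1 R2 :: "('k, 'a, 'a) tensor \<Rightarrow> ('k, 'a, 'a) tensor"
  assumes "wmb_data.regular_wmb K A"
    and "wmb_data.left_full K A" and "wmb_data.right_full K A"
    and "wmb_data.antipode_witness K A R1 R2"
  shows "is_functor
           (wmb_data.cat_firm K A :: (('k, 'p, 'a multiplier) rmodule, 'p \<Rightarrow> 'p) category)
           (wmb_data.cat_hopf K A)
           (wmb_data.tensor_L_obj K A) (wmb_data.tensor_L_mor K A)
       \<and> is_functor
           (wmb_data.cat_hopf K A :: (('k, 'v, 'a) hopf_module, 'v \<Rightarrow> 'v) category)
           (wmb_data.cat_firm K A)
           (wmb_antipode_data.coinv_obj K A R1 R2) (wmb_antipode_data.coinv_mor K A R1 R2)
       \<and> (\<exists>\<eta> :: ('k, 'p, 'a multiplier) rmodule \<Rightarrow> 'p \<Rightarrow> 'a \<Rightarrow> ('k, 'p, 'a) tensor set.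
            wmb_antipode_data.unit_iso K A R1 R2 \<eta>)
       \<and> (\<exists>\<epsilon> :: ('k, 'v, 'a) hopf_module \<Rightarrow> ('k, 'a \<Rightarrow> 'v, 'a) tensor set \<Rightarrow> 'v.
            wmb_antipode_data.counit_iso K A R1 R2 \<epsilon>)"
proof -
  have "field K" using assms(1) by (simp add: wmb_data.regular_wmb_def wmb_data.idempotent_nondegenerate_algebra_def)
  then interpret hopf_wmb K A R1 R2
    using assms by (intro hopf_wmb.intro wmb.intro wmb_axioms.intro over_field.intro hopf_wmb_axioms.intro)
  show ?thesis using tensor_L_functor coinv_functor unit counit by blast
qed

end
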